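(* Let $f\in M_p$, $1<p<\infty$, $0<\alpha_i<\beta_i$, $\delta_i\in(0,\frac12)$, $i=1,2$. Then $$\omega_{\alpha_1,\alpha_2}(f,\delta_1,\delta_2)_{L_p(\mathbb{T}^2)}\asymp\delta_1^{\alpha_1}\delta_2^{\alpha_2}\Big\{\int_{\delta_1}^1\int_{\delta_2}^1\big[t_1^{-\alpha_1}t_2^{-\alpha_2}\omega_{\beta_1,\beta_2}(f,t_1,t_2)_{L_p(\mathbb{T}^2)}\big]^p\frac{dt_2}{t_2}\frac{dt_1}{t_1}\Big\}^{1/p}$$ (with $t_i\in(\delta_i,1)$).
   Context: $L_p(\mathbb{T}^2)$, $1<p<\infty$, is the space of measurable functions $f(x,y)$ that are $2\pi$-periodic in each variable with $\|f\|_{L_p(\mathbb{T}^2)}=\big(\int_0^{2\pi}\int_0^{2\pi}|f(x,y)|^p\,dx\,dy\big)^{1/p}<\infty$; $L_p^0(\mathbb{T}^2)$ is the set of $f\in L_p(\mathbb{T}^2)$ with $\int_0^{2\pi}f(x,y)\,dy=0$ for a.e. $x$ and $\int_0^{2\pi}f(x,y)\,dx=0$ for a.e. $y$. The class $M_p$, $1<p<\infty$, is the set of $f\in L_p^0(\mathbb{T}^2)$ whose Fourier series is $\sum_{\nu_1=1}^\infty\sum_{\nu_2=1}^\infty a_{\nu_1,\nu_2}\cos\nu_1x\cos\nu_2y$ with $a_{\nu_1,\nu_2}-a_{\nu_1+1,\nu_2}-a_{\nu_1,\nu_2+1}+a_{\nu_1+1,\nu_2+1}\ge0$ for all integers $\nu_1,\nu_2\ge1$.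 For $\alpha_1,\alpha_2>0$ the (fractional) differences are $\Delta_{h_1}^{\alpha_1}(f)=\sum_{\nu=0}^\infty(-1)^\nu\binom{\alpha_1}{\nu}f(x+(\alpha_1-\nu)h_1,y)$ and $\Delta_{h_2}^{\alpha_2}(f)=\sum_{\nu=0}^\infty(-1)^\nu\binom{\alpha_2}{\nu}f(x,y+(\alpha_2-\nu)h_2)$, where $\binom{\alpha}{0}=1$, $\binom{\alpha}{\nu}=\frac{\alpha(\alpha-1)\cdots(\alpha-\nu+1)}{\nu!}$ for $\nu\ge1$. The mixed modulus of smoothness is $\omega_{\alpha_1,\alpha_2}(f,\delta_1,\delta_2)_{L_p(\mathbb{T}^2)}=\sup_{|h_i|\le\delta_i,\,i=1,2}\|\Delta_{h_1}^{\alpha_1}(\Delta_{h_2}^{\alpha_2}(f))\|_{L_p(\mathbb{T}^2)}$. $A\asymp B$ means $C^{-1}B\le A\le CB$ with a constant $C>0$ independent of $f,\delta_1,\delta_2$ ($C$ may depend on $p,\alpha_i,\beta_i$). *)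

theory Defs
  imports "HOL-Analysis.Analysis"
begin

text \<open>A function on the torus is a function on the plane that is \<open>2\<pi>\<close>-periodic in each variable;
  one full period is the square below. Measurability is Lebesgue measurability, so all integrals of
  such functions are taken with respect to \<^const>\<open>lebesgue\<close> (and not \<^const>\<open>lborel\<close>).\<close>

definition period_square :: "(real \<times> real) set" where
  "period_square = {0..2 * pi} \<times> {0..2 * pi}"

definition periodic2 :: "(real \<times> real \<Rightarrow> real) \<Rightarrow> bool" where
  "periodic2 f \<longleftrightarrow> (\<forall>x y. f (x + 2 * pi, y) = f (x, y) \<and> f (x, y + 2 * pi) = f (x, y))"

definition Lp_T2 :: "real \<Rightarrow> (real \<times> real \<Rightarrow> real) set" where
  "Lp_T2 p = {f. f \<in> borel_measurable lebesgue \<and> periodic2 f \<and>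
     set_integrable lebesgue period_square (\<lambda>z. \<bar>f z\<bar> powr p)}"

definition Lp_norm :: "real \<Rightarrow> (real \<times> real \<Rightarrow> real) \<Rightarrow> real" where
  "Lp_norm p f = (LINT z:period_square|lebesgue. \<bar>f z\<bar> powr p) powr (1 / p)"

definition Lp0_T2 :: "real \<Rightarrow> (real \<times> real \<Rightarrow> real) set" where
  "Lp0_T2 p = {f \<in> Lp_T2 p.
     (AE x in lebesgue. (LINT y:{0..2 * pi}|lebesgue. f (x, y)) = 0) \<and>
     (AE y in lebesgue. (LINT x:{0..2 * pi}|lebesgue. f (x, y)) = 0)}"

text \<open>For \<open>u, v \<in> {cos, sin}\<close> this is the coefficient of \<open>u (m x) v (n y)\<close> in the real double
  trigonometric Fourier series of \<open>f\<close>; the factors 1 and 2 come from the mean of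
  \<open>u (m x)\<^sup>2\<close> over a period being 1 for \<open>u = cos, m = 0\<close> and 1/2 for \<open>m \<ge> 1\<close>.\<close>

definition trig_coeff ::
  "(real \<Rightarrow> real) \<Rightarrow> (real \<Rightarrow> real) \<Rightarrow> (real \<times> real \<Rightarrow> real) \<Rightarrow> nat \<Rightarrow> nat \<Rightarrow> real" where
  "trig_coeff u v f m n =
     (if m = 0 then 1 else 2) * (if n = 0 then 1 else 2) / (2 * pi)\<^sup>2 *
     (LINT (x, y):period_square|lebesgue. f (x, y) * u (real m * x) * v (real n * y))"

text \<open>The Fourier series of \<open>f\<close> is the formal series
  \<open>\<Sum>m\<ge>1. \<Sum>n\<ge>1. a m n * cos (m x) * cos (n y)\<close>; values of \<open>a\<close> at index 0 are irrelevant.\<close>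

definition has_cos_cos_fourier_series ::
  "(real \<times> real \<Rightarrow> real) \<Rightarrow> (nat \<Rightarrow> nat \<Rightarrow> real) \<Rightarrow> bool" where
  "has_cos_cos_fourier_series f a \<longleftrightarrow> (\<forall>m n.
     trig_coeff cos cos f m n = (if 1 \<le> m \<and> 1 \<le> n then a m n else 0) \<and>
     trig_coeff cos sin f m n = 0 \<and>
     trig_coeff sin cos f m n = 0 \<and>
     trig_coeff sin sin f m n = 0)"

definition M_class :: "real \<Rightarrow> (real \<times> real \<Rightarrow> real) set" where
  "M_class p = {f \<in> Lp0_T2 p. \<exists>a. has_cos_cos_fourier_series f a \<and>
     (\<forall>m\<ge>1. \<forall>n\<ge>1. a m n - a (m + 1) n - a m (n + 1) + a (m + 1) (n + 1) \<ge> 0)}"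

text \<open>The difference series are summed pointwise. For \<open>\<alpha> > 0\<close> the coefficients are absolutely
  summable, so for \<open>f\<close> in \<^term>\<open>Lp_T2 p\<close> the series converges absolutely almost everywhere and in
  the \<open>L\<^sub>p\<close> norm; on the exceptional null set the value of \<^const>\<open>suminf\<close> is immaterial.\<close>

definition frac_diff_1 :: "real \<Rightarrow> real \<Rightarrow> (real \<times> real \<Rightarrow> real) \<Rightarrow> real \<times> real \<Rightarrow> real" where
  "frac_diff_1 \<alpha> h f =
     (\<lambda>(x, y). \<Sum>\<nu>. (-1) ^ \<nu> * (\<alpha> gchoose \<nu>) * f (x + (\<alpha> - real \<nu>) * h, y))"

definition frac_diff_2 :: "real \<Rightarrow> real \<Rightarrow> (real \<times> real \<Rightarrow> real) \<Rightarrow> real \<times> real \<Rightarrow> real" where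
  "frac_diff_2 \<alpha> h f =
     (\<lambda>(x, y). \<Sum>\<nu>. (-1) ^ \<nu> * (\<alpha> gchoose \<nu>) * f (x, y + (\<alpha> - real \<nu>) * h))"

text \<open>For \<open>f\<close> in \<^term>\<open>Lp_T2 p\<close> the set of norms is bounded (by a multiple of the norm of \<open>f\<close>), so
  the supremum in the reals is the intended one.\<close>

definition mixed_modulus ::
  "real \<Rightarrow> real \<Rightarrow> real \<Rightarrow> (real \<times> real \<Rightarrow> real) \<Rightarrow> real \<Rightarrow> real \<Rightarrow> real" where
  "mixed_modulus p \<alpha>1 \<alpha>2 f \<delta>1 \<delta>2 =
     (SUP (h1, h2) \<in> {(h1, h2). \<bar>h1\<bar> \<le> \<delta>1 \<and> \<bar>h2\<bar> \<le> \<delta>2}.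
        Lp_norm p (frac_diff_1 \<alpha>1 h1 (frac_diff_2 \<alpha>2 h2 f)))"

end

theory Submission
  imports Defs
begin

text \<open>Both sides are comparable with one expression in the Fourier coefficients. Put
  \<open>c(\<alpha>, \<delta>, k) = min 1 (k \<delta>) powr \<alpha>\<close>. Then the \<open>p\<close>-th power of the modulus of orders \<open>\<alpha>1, \<alpha>2\<close> is
  comparable with \<open>\<Sum>k l. (k l) powr (p - 2) * (a k l * c(\<alpha>1, \<delta>1, k) * c(\<alpha>2, \<delta>2, l)) powr p\<close>.
  For the upper bound, \<open>f\<close> is the series of products of Dirichlet kernels whose weights are the
  nonnegative mixed differences of the coefficients. The fractional difference of the \<open>m\<close>-th
  Dirichlet kernel is bounded by weighted sums of translates of \<open>\<Sum>k\<le>m. c(\<alpha>, \<delta>, k) / (1 + k \<bar>sin (x / 2)\<bar>)\<close>, and positive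
  combinations of such kernels obey a Hardy--Littlewood inequality. For the lower bound, differences
  of \<open>f\<close> are paired with nonnegative combinations of phase-shifted blocks of cosines, whose norms in the conjugate
  exponent are controlled by the same inequality; since the coefficients are monotone, duality of
  sequence spaces gives the claim. Finally, as \<open>0 < \<alpha> < \<beta>\<close>, the integral of
  \<open>t powr (- \<alpha> p) * c(\<beta>, t, k) powr p / t\<close> over \<open>[\<delta>, 1]\<close> is comparable with
  \<open>\<delta> powr (- \<alpha> p) * c(\<alpha>, \<delta>, k) powr p\<close>.\<close>

section \<open>A Hardy--Littlewood inequality for damped kernels\<close>

text \<open>Norms are therefore estimated from above only, and only for positive combinations of
  \<open>ker\<close>, where Jensen's inequality works for every p > 1; lower bounds come from the
  same estimate for the conjugate exponent.

  No single step bounds all coefficients from below, since the multiplier vanishes where k h is a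
  multiple of 2 pi. Frequencies up to a multiple of 1 / \<delta> are tested with one small step, the
  others with an average over the steps up to \<delta>.

  The function is given only by its Fourier coefficients, so the series of Dirichlet kernels must
  first be shown to converge almost everywhere and to equal it. This needs the coefficient series to
  be finite, which follows from pairing the function itself with the test functions. All constants
  are fixed before the function is chosen.\<close>

lemma jensen_sum_powr_pos:
  fixes w y :: "'i \<Rightarrow> real"
  assumes "finite S" "p \<ge> 1" "\<And>i. i \<in> S \<Longrightarrow> w i \<ge> 0" "\<And>i. i \<in> S \<Longrightarrow> y i > 0"
  shows "(\<Sum>i\<in>S. w i * y i) powr p \<le> (\<Sum>i\<in>S. w i) powr (p - 1) * (\<Sum>i\<in>S. w i * y i powr p)"
proof (cases "(\<Sum>i\<in>S. w i) = 0")
  case True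
  then have "w i = 0" if "i \<in> S" for i
    using sum_nonneg_eq_0_iff[OF assms(1), of w] assms(3) that by auto
  then show ?thesis by simp
next
  case False
  define W where "W = (\<Sum>i\<in>S. w i)"
  have W: "W > 0" using False assms(3) sum_nonneg[of S w] unfolding W_def by fastforce
  have conv: "convex_on {0<..} (\<lambda>x. x powr p)"
    using powr_convex[OF assms(2)] by simp
  have "(\<Sum>i\<in>S. (w i / W) *\<^sub>R y i) powr p \<le> (\<Sum>i\<in>S. (w i / W) * (y i) powr p)"
  proof (rule convex_on_sum[OF assms(1) _ conv])
    show "S \<noteq> {}" using False by auto
    show "(\<Sum>i\<in>S. w i / W) = 1" using W unfolding W_def by (simp flip: sum_divide_distrib)
  qed (use assms W in \<open>auto intro: less_imp_le\<close>)
  also have "(\<Sum>i\<in>S. (w i / W) *\<^sub>R y i) = (\<Sum>i\<in>S. w i * y i) / W"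
    by (simp add: sum_divide_distrib)
  also have "(\<Sum>i\<in>S. (w i / W) * (y i) powr p) = (\<Sum>i\<in>S. w i * y i powr p) / W"
    by (simp add: sum_divide_distrib)
  also have "((\<Sum>i\<in>S. w i * y i) / W) powr p = (\<Sum>i\<in>S. w i * y i) powr p / W powr p"
    by (rule powr_divide)
  finally have "(\<Sum>i\<in>S. w i * y i) powr p \<le> (\<Sum>i\<in>S. w i * y i powr p) / W * W powr p"
    using W by (simp add: field_simps)
  also have "\<dots> = W powr (p-1) * (\<Sum>i\<in>S. w i * y i powr p)"
    using W by (simp add: powr_diff)
  finally show ?thesis unfolding W_def .
qed

text \<open>Convexity of \<open>powr\<close> is used on the open half-line, so terms with y i = 0
  are dropped first: they add nothing to either sum over y, and dropping them only shrinks the total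
  weight, whose exponent p - 1 is nonnegative.\<close>

lemma jensen_sum_powr:
  fixes w y :: "'i \<Rightarrow> real"
  assumes "finite S" "p \<ge> 1" "\<And>i. i \<in> S \<Longrightarrow> w i \<ge> 0" "\<And>i. i \<in> S \<Longrightarrow> y i \<ge> 0"
  shows "(\<Sum>i\<in>S. w i * y i) powr p \<le> (\<Sum>i\<in>S. w i) powr (p - 1) * (\<Sum>i\<in>S. w i * y i powr p)"
proof -
  define T where "T = {i\<in>S. y i > 0}"
  have T: "finite T" "T \<subseteq> S" using assms(1) by (auto simp: T_def)
  have z: "y i = 0" if "i \<in> S - T" for i using that assms(4)[of i] by (auto simp: T_def)
  have "(\<Sum>i\<in>S. w i * y i) = (\<Sum>i\<in>T. w i * y i)"
    by (rule sum.mono_neutral_right) (use assms T z in auto)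
  moreover have "(\<Sum>i\<in>S. w i * y i powr p) = (\<Sum>i\<in>T. w i * y i powr p)"
    by (rule sum.mono_neutral_right) (use assms T z in auto)
  moreover have "(\<Sum>i\<in>T. w i * y i) powr p \<le> (\<Sum>i\<in>T. w i) powr (p - 1) * (\<Sum>i\<in>T. w i * y i powr p)"
    by (rule jensen_sum_powr_pos) (use assms T in \<open>auto simp: T_def\<close>)
  moreover have "\<dots> \<le> (\<Sum>i\<in>S. w i) powr (p - 1) * (\<Sum>i\<in>T. w i * y i powr p)"
    using assms T by (intro mult_right_mono powr_mono2 sum_mono2 sum_nonneg) auto
  ultimately show ?thesis by simp
qed

text \<open>Mean value theorem, with a decreasing derivative exponent a - 1 < 0. Dividing by
  \<open>a\<close> lets one inequality serve both signs: a > 0 gives the telescoping bound for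
  initial sums, a < 0 the one for tails.\<close>

lemma powr_step_lower:
  fixes x a :: real
  assumes "1 < x" "a < 1" "a \<noteq> 0"
  shows "x powr (a - 1) \<le> (x powr a - (x - 1) powr a) / a"
proof -
  have "\<exists>z. z > x - 1 \<and> z < x \<and> x powr a - (x-1) powr a = (x - (x-1)) * (a * z powr (a-1))"
    by (rule MVT2) (use assms in \<open>auto intro!: derivative_eq_intros\<close>)
  then obtain z where z: "z > x - 1" "z < x" "x powr a - (x-1) powr a = a * z powr (a-1)" by auto
  have "x powr (a-1) \<le> z powr (a-1)"
    using z assms by (intro powr_mono2') auto
  with z assms show ?thesis by simp
qed

lemma sum_powr_le:
  fixes c :: real
  assumes "0 < c" "c < 1"
  shows "(\<Sum>k=1..n. real k powr (c - 1)) \<le> real n powr c / c"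
proof (induction n)
  case (Suc n)
  have "real (Suc n) powr (c-1) \<le> (real (Suc n) powr c - real n powr c) / c"
  proof (cases "n = 0")
    case False
    then show ?thesis using powr_step_lower[of "real (Suc n)" c] assms by simp
  qed (use assms in \<open>simp add: field_simps\<close>)
  with Suc show ?case by (simp add: diff_divide_distrib)
qed simp

lemma sum_powr_tail_le:
  fixes e :: real
  assumes "0 < e" "1 \<le> n"
  shows "(\<Sum>k=Suc n..m. real k powr (- e - 1)) \<le> real n powr (- e) / e"
proof -
  have "(\<Sum>k=Suc n..m. real k powr (- e - 1)) \<le> (real n powr (-e) - real m powr (-e)) / e" if "n \<le> m"
    using that
  proof (induction m rule: dec_induct)
    case (step m)
    have "real (Suc m) powr (-e-1) \<le> (real (Suc m) powr (-e) - real m powr (-e)) / (-e)"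
      using powr_step_lower[of "real (Suc m)" "-e"] assms step by simp
    moreover have "\<dots> = (real m powr (-e) - real (Suc m) powr (-e)) / e"
      using assms by (simp add: field_simps)
    ultimately show ?case using step by (simp add: diff_divide_distrib)
  qed simp
  moreover have "(real n powr (-e) - real m powr (-e)) / e \<le> real n powr (-e) / e"
    using assms by (intro divide_right_mono) auto
  ultimately show ?thesis using assms by (cases "n \<le> m") auto
qed

lemma sum_kernel_weight_le:
  fixes s e :: real
  assumes "0 < s" "s \<le> 1" "0 < e" "e < 1"
  shows "(\<Sum>k=1..m. real k powr (- e) / (1 + real k * s)) \<le> (1 / (1 - e) + 2 / e) * s powr (e - 1)"
proof -
  \<comment> \<open>The denominator 1 + k s changes its behaviour at k = 1 / s: up to
    \<open>n\<close> it is bounded below by 1, afterwards by k s. Both parts are then of order s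
    powr (e - 1).\<close>
  define n where "n = nat \<lfloor>1 / s\<rfloor>"
  have n1: "1 \<le> n" unfolding n_def using assms by (simp add: le_nat_floor)
  have n2: "real n \<le> 1 / s" unfolding n_def using assms by simp
  have "1 / s < real n + 1" unfolding n_def using assms by linarith
  then have n3: "1 / (2 * s) \<le> real n" using n1 by (simp add: field_simps)
  \<comment> \<open>If m < n the first block reaches beyond m, hence a covering and an inequality
    instead of a decomposition.\<close>
  have "(\<Sum>k=1..m. real k powr (- e) / (1 + real k * s))
     \<le> (\<Sum>k\<in>{1..n} \<union> {Suc n..m}. real k powr (- e) / (1 + real k * s))"
    using assms by (intro sum_mono2) auto
  also have "\<dots> = (\<Sum>k=1..n. real k powr (- e) / (1 + real k * s)) + (\<Sum>k=Suc n..m. real k powr (- e) / (1 + real k * s))"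
    by (rule sum.union_disjoint) auto
  also have "(\<Sum>k=1..n. real k powr (- e) / (1 + real k * s)) \<le> (\<Sum>k=1..n. real k powr ((1 - e) - 1))"
    using assms by (intro sum_mono) (auto intro!: divide_le_eq[THEN iffD2] simp: add_pos_nonneg mult_left_le_one_le add_strict_increasing2 distrib_left)
  also have "\<dots> \<le> real n powr (1 - e) / (1 - e)"
    by (rule sum_powr_le) (use assms in auto)
  also have "\<dots> \<le> (1 / s) powr (1 - e) / (1 - e)"
    using assms n2 by (intro divide_right_mono powr_mono2) auto
  also have "(1 / s) powr (1 - e) = s powr (e - 1)"
    using assms by (simp add: powr_divide powr_minus_divide[symmetric])
  also have "(\<Sum>k=Suc n..m. real k powr (- e) / (1 + real k * s)) \<le> (\<Sum>k=Suc n..m. real k powr (-e-1) / s)"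
  proof (intro sum_mono)
    fix k assume "k \<in> {Suc n..m}"
    then have k: "real k > 0" by simp
    have "real k powr (- e) / (1 + real k * s) \<le> real k powr (-e) / (real k * s)"
      using assms k by (intro divide_left_mono) (auto intro!: mult_pos_pos add_pos_pos)
    also have "\<dots> = real k powr (-e-1) / s" using k by (simp add: powr_diff)
    finally show "real k powr (- e) / (1 + real k * s) \<le> real k powr (-e-1) / s" .
  qed
  also have "\<dots> = (\<Sum>k=Suc n..m. real k powr (-e-1)) / s" by (simp add: sum_divide_distrib)
  also have "\<dots> \<le> (real n powr (-e) / e) / s"
    using assms n1 by (intro divide_right_mono sum_powr_tail_le) auto
  also have "real n powr (-e) \<le> (1 / (2 * s)) powr (-e)"
    using n3 assms by (intro powr_mono2') auto
  also have "(1 / (2 * s)) powr (-e) = 2 powr e * s powr e"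
    using assms by (simp add: powr_divide powr_minus_divide powr_mult)
  also have "2 powr e * s powr e \<le> 2 * s powr e"
    using assms powr_mono[of e 1 2] by (intro mult_right_mono) auto
  also have "2 * s powr e / e / s = 2 / e * s powr (e - 1)"
    using assms by (simp add: powr_diff)
  finally show ?thesis using assms by (simp add: algebra_simps divide_right_mono)
qed

section \<open>Integration over one period and the damped kernel\<close>

definition circ :: "real measure" where
  "circ = density lborel (\<lambda>x. indicator {0..2 * pi} x)"

text \<open>A smooth form of the classical Dirichlet kernel bound: k * ker k x is comparable with
  the minimum of k and 1 / \<bar>sin (x / 2)\<bar>. Unlike the Dirichlet kernel it is positive, and
  it is antitone in k.\<close>

definition ker :: "nat \<Rightarrow> real \<Rightarrow> real" where
  "ker k x = 1 / (1 + real k * \<bar>sin (x / 2)\<bar>)"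

lemma sets_circ [simp, measurable_cong]: "sets circ = sets borel"
  and space_circ [simp]: "space circ = UNIV"
  by (auto simp: circ_def)

lemma nn_integral_circ:
  assumes "f \<in> borel_measurable borel"
  shows "(\<integral>\<^sup>+x. f x \<partial>circ) = (\<integral>\<^sup>+x\<in>{0..2*pi}. f x \<partial>lborel)"
  unfolding circ_def using assms by (subst nn_integral_density) (auto simp: mult.commute)

lemma emeasure_circ: "emeasure circ (space circ) = ennreal (2 * pi)"
  unfolding circ_def by (subst emeasure_density) auto

interpretation circ: finite_measure circ
  by (rule finite_measureI) (simp only: emeasure_circ, simp)

interpretation circ2: pair_sigma_finite circ circ ..

lemma ker_pos: "0 < ker k x" and ker_le_1: "ker k x \<le> 1"
  by (simp_all add: ker_def add_pos_nonneg divide_le_eq_1)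

lemma ker_nonneg [simp]: "0 \<le> ker k x" using ker_pos[of k x] by simp

lemma ker_measurable [measurable]: "ker k \<in> borel_measurable borel"
  unfolding ker_def[abs_def] by measurable

text \<open>Jordan's inequality: the concave sine lies above its chord over this interval.\<close>

lemma sin_ge_two_pi:
  fixes t :: real
  assumes "0 \<le> t" "t \<le> pi / 2"
  shows "2 * t / pi \<le> sin t"
proof -
  have "convex_on {0..pi/2} (\<lambda>x. - sin x)"
    by (rule f''_ge0_imp_convex[where f' = "\<lambda>x. - cos x" and f'' = sin])
       (auto intro!: derivative_eq_intros sin_ge_zero)
  from convex_onD[OF this, of "2 * t / pi" 0 "pi/2"] assms show ?thesis
    by (simp add: divide_simps)
qed

lemma sum_ennreal_mult:
  assumes "\<And>k. k \<in> S \<Longrightarrow> 0 \<le> f k" "\<And>k. k \<in> S \<Longrightarrow> 0 \<le> g k"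
  shows "(\<Sum>k\<in>S. ennreal (f k) * ennreal (g k)) = ennreal (\<Sum>k\<in>S. f k * g k)"
  using assms by (subst sum_ennreal[symmetric]) (auto simp: ennreal_mult intro!: sum.cong)

lemma AE_circ_sin_half: "AE x in circ. sin (x / 2) \<noteq> 0"
proof -
  have "AE x in lborel. x \<in> {0..2 * pi} \<longrightarrow> sin (x / 2) \<noteq> 0"
    using AE_lborel_singleton[of 0] AE_lborel_singleton[of "2 * pi"]
  proof eventually_elim
    case (elim x)
    show ?case
    proof
      assume "x \<in> {0..2 * pi}"
      with elim have "0 < x / 2" "x / 2 < pi" by auto
      then show "sin (x / 2) \<noteq> 0" using sin_gt_zero[of "x / 2"] by auto
    qed
  qed
  then show ?thesis
    unfolding circ_def by (subst AE_density) (auto simp: indicator_def)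
qed

text \<open>By Jordan's inequality sin (x / 2) can be replaced by x / pi on the first half period.
  The kernel is bounded by 1 up to x = 1 / k and by pi / (k x) beyond; the integrals of x powr (- e)
  and of x powr (- e - 1) / k over these two ranges both scale like k powr (e - 1). The bounds 0 < e
  < 1 give convergence at infinity and at 0.\<close>

lemma nn_integral_ker_weight_le:
  fixes e :: real
  assumes "0 < e" "e < 1" "1 \<le> k"
  shows "(\<integral>\<^sup>+x. ennreal (ker k x * \<bar>sin (x / 2)\<bar> powr (- e)) \<partial>circ)
       \<le> ennreal (2 * (pi / (1 - e) + pi\<^sup>2 / e) * real k powr (e - 1))"
proof -
  define phi where "phi x = ennreal (pi * x powr (- e)) * indicator {0..1 / real k} x
      + ennreal (pi\<^sup>2 / real k * x powr (- e - 1)) * indicator {1 / real k..} x" for x :: real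
  have [measurable]: "phi \<in> borel_measurable borel" unfolding phi_def by measurable
  have half: "ennreal (ker k x * \<bar>sin (x / 2)\<bar> powr (- e)) \<le> phi x" if "0 < x" "x \<le> pi" for x
  proof -
    define s where "s = \<bar>sin (x / 2)\<bar>"
    have "2 * (x/2) / pi \<le> sin (x/2)" using that by (intro sin_ge_two_pi) auto
    then have s: "x / pi \<le> s" unfolding s_def by simp
    have xp: "0 < x / pi" using that by simp
    have sp: "0 < s" using s xp by linarith
    have "s powr (-e) \<le> (x / pi) powr (-e)" using s xp assms by (intro powr_mono2') auto
    also have "\<dots> = pi powr e * x powr (-e)" using that by (simp add: powr_divide powr_minus_divide)
    also have "\<dots> \<le> pi * x powr (-e)" using assms powr_mono[of e 1 pi] pi_ge_two
      by (intro mult_right_mono) auto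
    finally have 1: "s powr (-e) \<le> pi * x powr (-e)" .
    have k: "real k > 0" using assms by simp
    have 2: "ker k x \<le> pi / (real k * x)"
    proof -
      have "ker k x = 1 / (1 + real k * s)" by (simp add: ker_def s_def)
      also have "\<dots> \<le> 1 / (real k * s)" using k sp by (intro divide_left_mono) (auto intro!: mult_pos_pos add_pos_pos)
      also have "\<dots> \<le> 1 / (real k * (x / pi))" using k sp s xp
        by (intro divide_left_mono mult_left_mono mult_pos_pos) auto
      finally show ?thesis by simp
    qed
    show ?thesis
    proof (cases "x \<le> 1 / real k")
      case True
      have "ker k x * s powr (-e) \<le> 1 * (pi * x powr (-e))"
        using 1 ker_le_1[of k x] by (intro mult_mono) auto
      then show ?thesis using True that unfolding phi_def s_def
        by (auto intro!: order_trans[OF _ add_increasing2] ennreal_leI)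
    next
      case False
      have "ker k x * s powr (-e) \<le> (pi / (real k * x)) * (pi * x powr (-e))"
        using 1 2 that by (intro mult_mono) auto
      also have "\<dots> = pi\<^sup>2 / real k * x powr (-e-1)" using that by (simp add: powr_diff power2_eq_square)
      finally show ?thesis using False that unfolding phi_def s_def
        by (auto intro!: ennreal_leI)
    qed
  qed
  have k: "real k > 0" using assms by simp
  have int_phi: "(\<integral>\<^sup>+x. phi x \<partial>lborel) = ennreal ((pi / (1 - e) + pi\<^sup>2 / e) * real k powr (e - 1))"
  proof -
    have "((\<lambda>x. pi * x powr (-e)) has_integral (pi * ((1 / real k) powr (-e + 1) / (-e + 1)))) {0..1 / real k}"
      using assms by (intro has_integral_mult_right has_integral_powr_from_0) auto
    from nn_integral_has_integral_lebesgue'[OF _ this]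
    have 1: "(\<integral>\<^sup>+x. ennreal (pi * x powr (- e)) * indicator {0..1 / real k} x \<partial>lborel)
       = ennreal (pi * ((1 / real k) powr (-e + 1) / (-e + 1)))" by auto
    have "((\<lambda>x. pi\<^sup>2 / real k * x powr (-e-1)) has_integral (pi\<^sup>2 / real k * (-((1 / real k) powr ((-e-1) + 1)) / ((-e-1) + 1)))) {1 / real k..}"
      using assms k by (intro has_integral_mult_right has_integral_powr_to_inf) auto
    from nn_integral_has_integral_lebesgue'[OF _ this]
    have 2: "(\<integral>\<^sup>+x. ennreal (pi\<^sup>2 / real k * x powr (-e-1)) * indicator {1 / real k..} x \<partial>lborel)
       = ennreal (pi\<^sup>2 / real k * (-((1 / real k) powr ((-e-1) + 1)) / ((-e-1) + 1)))" by auto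
    have 3: "pi * ((1 / real k) powr (-e + 1) / (-e + 1)) = pi / (1 - e) * real k powr (e - 1)"
      using k by (simp add: powr_divide powr_minus_divide[symmetric])
    have 4: "pi\<^sup>2 / real k * (-((1 / real k) powr ((-e-1) + 1)) / ((-e-1) + 1)) = pi\<^sup>2 / e * real k powr (e - 1)"
      using k assms by (simp add: powr_divide powr_minus_divide powr_diff)
    have "(\<integral>\<^sup>+x. phi x \<partial>lborel) = ennreal (pi / (1 - e) * real k powr (e - 1)) + ennreal (pi\<^sup>2 / e * real k powr (e - 1))"
      unfolding phi_def by (subst nn_integral_add) (simp_all only: 1 2 3 4, measurable)
    also have "\<dots> = ennreal ((pi / (1 - e) + pi\<^sup>2 / e) * real k powr (e - 1))"
      using assms by (subst ennreal_plus[symmetric]) (auto simp: distrib_right)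
    finally show ?thesis .
  qed
  have "(\<integral>\<^sup>+x. ennreal (ker k x * \<bar>sin (x / 2)\<bar> powr (- e)) \<partial>circ)
      = (\<integral>\<^sup>+x\<in>{0..2*pi}. ennreal (ker k x * \<bar>sin (x / 2)\<bar> powr (- e)) \<partial>lborel)"
    by (subst nn_integral_circ) auto
  \<comment> \<open>The second half period is the reflection of the first, because sin (x / 2) is
    symmetric about x = pi.\<close>
  also have "\<dots> \<le> (\<integral>\<^sup>+x. phi x + phi (2 * pi + (-1) * x) \<partial>lborel)"
  proof (intro nn_integral_mono)
    fix x :: real
    consider "x \<notin> {0..2*pi}" | "x = 0 \<or> x = 2 * pi" | "0 < x" "x \<le> pi" | "pi < x" "x < 2 * pi" by fastforce
    then show "ennreal (ker k x * \<bar>sin (x / 2)\<bar> powr (- e)) * indicator {0..2*pi} x \<le> phi x + phi (2 * pi + (-1) * x)"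
    proof cases
      case 3
      then show ?thesis using half[of x] by (auto intro: add_increasing2)
    next
      case 4
      have "sin ((2 * pi - x) / 2) = sin (x / 2)" by (simp add: diff_divide_distrib)
      then have "ker k (2 * pi - x) = ker k x" by (simp add: ker_def)
      then show ?thesis using half[of "2 * pi - x"] 4 \<open>sin ((2 * pi - x) / 2) = sin (x / 2)\<close>
        by (auto intro: add_increasing)
    qed auto
  qed
  also have "\<dots> = (\<integral>\<^sup>+x. phi x \<partial>lborel) + (\<integral>\<^sup>+x. phi (2 * pi + (-1) * x) \<partial>lborel)"
    by (rule nn_integral_add) measurable
  also have "(\<integral>\<^sup>+x. phi (2 * pi + (-1) * x) \<partial>lborel) = (\<integral>\<^sup>+x. phi x \<partial>lborel)"
    by (subst nn_integral_real_affine[of phi "-1" "2*pi"]) auto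
  also have "(\<integral>\<^sup>+x. phi x \<partial>lborel) + (\<integral>\<^sup>+x. phi x \<partial>lborel) = ennreal (2 * (pi / (1 - e) + pi\<^sup>2 / e) * real k powr (e - 1))"
    unfolding int_phi using assms by (subst ennreal_plus[symmetric]) (auto simp: algebra_simps)
  finally show ?thesis .
qed

text \<open>A Schur test: Jensen's inequality with weights ker k x * k powr (- h), whose sum is of
  order s powr (h - 1) for s = \<bar>sin (x / 2)\<bar>, moves the power p onto the single
  coefficients. What remains is the integral of one kernel against a power of s.\<close>

lemma hardy_littlewood_kernel:
  fixes p :: real
  assumes p: "1 < p"
  obtains C where "C > 0"
    "\<And>m A. (\<And>k. 0 \<le> A k) \<Longrightarrow> (\<integral>\<^sup>+x. ennreal ((\<Sum>k=1..m. A k * ker k x) powr p) \<partial>circ)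
       \<le> ennreal (C * (\<Sum>k=1..m. real k powr (p - 2) * A k powr p))"
proof -
  \<comment> \<open>Two conditions must hold together: h = 1 - d has to lie in (0, 1) for the sum of
    weights, and e = d (p - 1) has to lie in (0, 1) for the integral. The final exponent h (p - 1) +
    e - 1 equals p - 2 whatever d is.\<close>
  define d where "d = 1 / (2 * max 1 (p - 1))"
  have d: "0 < d" "d < 1" unfolding d_def by (auto simp: field_simps max_def)
  have dp: "d * (p - 1) < 1" "0 < d * (p - 1)" using p unfolding d_def by (auto simp: field_simps max_def)
  define h where "h = 1 - d"
  define e where "e = d * (p - 1)"
  define C1 where "C1 = 1 / (1 - h) + 2 / h"
  define C2 where "C2 = 2 * (pi / (1 - e) + pi\<^sup>2 / e)"
  have h: "0 < h" "h < 1" using d by (auto simp: h_def)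
  have e: "0 < e" "e < 1" using dp by (auto simp: e_def)
  have C: "C1 > 0" "C2 > 0" unfolding C1_def C2_def using h e
    by (auto intro!: mult_pos_pos add_pos_pos divide_pos_pos)
  show ?thesis
  proof (rule that[of "C1 powr (p - 1) * C2"])
    show "C1 powr (p - 1) * C2 > 0" using C by simp
    fix m and A :: "nat \<Rightarrow> real" assume A: "\<And>k. 0 \<le> A k"
    define B where "B k = C1 powr (p - 1) * (real k powr (h * (p - 1)) * A k powr p)" for k
    have pt: "(\<Sum>k=1..m. A k * ker k x) powr p \<le> (\<Sum>k=1..m. B k * (ker k x * \<bar>sin (x / 2)\<bar> powr (- e)))"
      if s0: "sin (x / 2) \<noteq> 0" for x
    proof -
      define s where "s = \<bar>sin (x / 2)\<bar>"
      have s: "0 < s" "s \<le> 1" using s0 by (auto simp: s_def)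
      have eq: "(\<Sum>k=1..m. A k * ker k x) = (\<Sum>k=1..m. (ker k x * real k powr (-h)) * (A k * real k powr h))"
        by (intro sum.cong) (auto simp: powr_minus_divide)
      have "(\<Sum>k=1..m. A k * ker k x) powr p \<le> (\<Sum>k=1..m. ker k x * real k powr (-h)) powr (p - 1) *
          (\<Sum>k=1..m. (ker k x * real k powr (-h)) * (A k * real k powr h) powr p)"
        unfolding eq using p A by (intro jensen_sum_powr) auto
      also have "\<dots> \<le> (C1 * s powr (h - 1)) powr (p - 1) *
          (\<Sum>k=1..m. (ker k x * real k powr (-h)) * (A k * real k powr h) powr p)"
      proof (intro mult_right_mono powr_mono2 sum_nonneg)
        have "(\<Sum>k=1..m. ker k x * real k powr (-h)) = (\<Sum>k=1..m. real k powr (-h) / (1 + real k * s))"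
          by (simp add: ker_def s_def)
        also have "\<dots> \<le> C1 * s powr (h - 1)"
          unfolding C1_def by (rule sum_kernel_weight_le) (use s h in auto)
        finally show "(\<Sum>k=1..m. ker k x * real k powr (-h)) \<le> C1 * s powr (h - 1)" .
      qed (use p A in \<open>auto intro!: sum_nonneg\<close>)
      also have "(C1 * s powr (h - 1)) powr (p - 1) = C1 powr (p - 1) * s powr (- e)"
        using C by (simp add: powr_mult powr_powr e_def h_def)
      also have "(\<Sum>k=1..m. (ker k x * real k powr (-h)) * (A k * real k powr h) powr p) =
          (\<Sum>k=1..m. ker k x * (real k powr (h * (p - 1)) * A k powr p))"
      proof (intro sum.cong refl)
        fix k assume "k \<in> {1..m}"
        have "real k powr (-h) * (A k * real k powr h) powr p = (real k powr (-h) * real k powr (h * p)) * A k powr p"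
          using A by (simp add: powr_mult powr_powr)
        also have "real k powr (-h) * real k powr (h * p) = real k powr (h * (p - 1))"
          by (simp flip: powr_add add: algebra_simps)
        finally show "(ker k x * real k powr (-h)) * (A k * real k powr h) powr p = ker k x * (real k powr (h * (p - 1)) * A k powr p)"
          by simp
      qed
      finally show ?thesis unfolding B_def s_def by (simp add: sum_distrib_left mult_ac)
    qed
    have B: "0 \<le> B k" for k using A by (simp add: B_def)
    have "(\<integral>\<^sup>+x. ennreal ((\<Sum>k=1..m. A k * ker k x) powr p) \<partial>circ)
       \<le> (\<integral>\<^sup>+x. (\<Sum>k=1..m. ennreal (B k) * ennreal (ker k x * \<bar>sin (x / 2)\<bar> powr (- e))) \<partial>circ)"
    proof (rule nn_integral_mono_AE)
      show "AE x in circ. ennreal ((\<Sum>k=1..m. A k * ker k x) powr p)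
         \<le> (\<Sum>k=1..m. ennreal (B k) * ennreal (ker k x * \<bar>sin (x / 2)\<bar> powr (- e)))"
        using AE_circ_sin_half
      proof eventually_elim
        case (elim x)
        have "(\<Sum>k=1..m. ennreal (B k) * ennreal (ker k x * \<bar>sin (x / 2)\<bar> powr (- e)))
          = ennreal (\<Sum>k=1..m. B k * (ker k x * \<bar>sin (x / 2)\<bar> powr (- e)))"
          using B by (subst sum_ennreal[symmetric]) (auto simp: ennreal_mult)
        then show ?case using pt[OF elim] by (simp add: ennreal_leI)
      qed
    qed
    also have "\<dots> = (\<Sum>k=1..m. ennreal (B k) * (\<integral>\<^sup>+x. ennreal (ker k x * \<bar>sin (x / 2)\<bar> powr (- e)) \<partial>circ))"
      by (subst nn_integral_sum) (auto intro!: sum.cong nn_integral_cmult)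
    also have "\<dots> \<le> (\<Sum>k=1..m. ennreal (B k) * ennreal (C2 * real k powr (e - 1)))"
      unfolding C2_def using e by (intro sum_mono mult_left_mono nn_integral_ker_weight_le) auto
    also have "\<dots> = ennreal (\<Sum>k=1..m. B k * (C2 * real k powr (e - 1)))"
      using B C by (subst sum_ennreal[symmetric]) (auto simp: ennreal_mult)
    also have "(\<Sum>k=1..m. B k * (C2 * real k powr (e - 1))) = C1 powr (p - 1) * C2 * (\<Sum>k=1..m. real k powr (p - 2) * A k powr p)"
      unfolding sum_distrib_left
    proof (intro sum.cong refl)
      fix k assume "k \<in> {1..m}"
      have "real k powr (h * (p - 1)) * real k powr (e - 1) = real k powr (p - 2)"
        by (simp flip: powr_add add: h_def e_def algebra_simps)
      then show "B k * (C2 * real k powr (e - 1)) = C1 powr (p - 1) * C2 * (real k powr (p - 2) * A k powr p)"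
        unfolding B_def by (simp add: mult_ac)
    qed
    finally show "(\<integral>\<^sup>+x. ennreal ((\<Sum>k=1..m. A k * ker k x) powr p) \<partial>circ)
      \<le> ennreal (C1 powr (p - 1) * C2 * (\<Sum>k=1..m. real k powr (p - 2) * A k powr p))" .
  qed
qed

definition sq :: "(real \<times> real) measure" where
  "sq = circ \<Otimes>\<^sub>M circ"

lemma sets_sq [simp, measurable_cong]: "sets sq = sets borel"
  and space_sq [simp]: "space sq = UNIV"
  unfolding sq_def by (simp_all add: borel_prod[symmetric] space_pair_measure cong: sets_pair_measure_cong)

text \<open>For fixed y the sums over l are again nonnegative coefficients, so the one-variable
  inequality applies in x and then, for each k, in y. Positivity of \<open>ker\<close> is what makes
  this iteration possible.\<close>

lemma hardy_littlewood_kernel_2: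
  fixes p :: real
  assumes p: "1 < p"
  obtains C where "C > 0"
    "\<And>m A. (\<And>k l. 0 \<le> A k l) \<Longrightarrow>
       (\<integral>\<^sup>+z. ennreal ((\<Sum>k=1..m. \<Sum>l=1..m. A k l * ker k (fst z) * ker l (snd z)) powr p) \<partial>sq)
       \<le> ennreal (C * (\<Sum>k=1..m. \<Sum>l=1..m. real k powr (p - 2) * real l powr (p - 2) * A k l powr p))"
proof -
  obtain C where C: "C > 0" and K: "\<And>m A. (\<And>k. 0 \<le> A k) \<Longrightarrow>
      (\<integral>\<^sup>+x. ennreal ((\<Sum>k=1..m. A k * ker k x) powr p) \<partial>circ)
       \<le> ennreal (C * (\<Sum>k=1..m. real k powr (p - 2) * A k powr p))"
    using hardy_littlewood_kernel[OF p] by blast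
  show ?thesis
  proof (rule that[of "C * C"])
    show "C * C > 0" using C by simp
    fix m and A :: "nat \<Rightarrow> nat \<Rightarrow> real" assume A: "\<And>k l. 0 \<le> A k l"
    have "(\<integral>\<^sup>+z. ennreal ((\<Sum>k=1..m. \<Sum>l=1..m. A k l * ker k (fst z) * ker l (snd z)) powr p) \<partial>sq)
      = (\<integral>\<^sup>+y. \<integral>\<^sup>+x. ennreal ((\<Sum>k=1..m. \<Sum>l=1..m. A k l * ker k x * ker l y) powr p) \<partial>circ \<partial>circ)"
      unfolding sq_def by (subst circ2.nn_integral_snd[symmetric]) simp_all
    also have "\<dots> = (\<integral>\<^sup>+y. \<integral>\<^sup>+x. ennreal ((\<Sum>k=1..m. (\<Sum>l=1..m. A k l * ker l y) * ker k x) powr p) \<partial>circ \<partial>circ)"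
      by (simp add: sum_distrib_left sum_distrib_right mult_ac)
    also have "\<dots> \<le> (\<integral>\<^sup>+y. ennreal (C * (\<Sum>k=1..m. real k powr (p - 2) * (\<Sum>l=1..m. A k l * ker l y) powr p)) \<partial>circ)"
      using A by (intro nn_integral_mono K sum_nonneg) auto
    also have "\<dots> = (\<integral>\<^sup>+y. (\<Sum>k=1..m. ennreal (C * real k powr (p - 2)) * ennreal ((\<Sum>l=1..m. A k l * ker l y) powr p)) \<partial>circ)"
      using C by (intro nn_integral_cong) (simp flip: ennreal_mult add: sum_distrib_left mult.assoc sum_ennreal)
    also have "\<dots> = (\<Sum>k=1..m. ennreal (C * real k powr (p - 2)) * (\<integral>\<^sup>+y. ennreal ((\<Sum>l=1..m. A k l * ker l y) powr p) \<partial>circ))"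
      by (subst nn_integral_sum) (auto intro!: sum.cong nn_integral_cmult)
    also have "\<dots> \<le> (\<Sum>k=1..m. ennreal (C * real k powr (p - 2)) * ennreal (C * (\<Sum>l=1..m. real l powr (p - 2) * A k l powr p)))"
      using A by (intro sum_mono mult_left_mono K) auto
    also have "\<dots> = ennreal (\<Sum>k=1..m. (C * real k powr (p - 2)) * (C * (\<Sum>l=1..m. real l powr (p - 2) * A k l powr p)))"
      using C by (intro sum_ennreal_mult) (auto intro!: mult_nonneg_nonneg sum_nonneg)
    also have "(\<Sum>k=1..m. (C * real k powr (p - 2)) * (C * (\<Sum>l=1..m. real l powr (p - 2) * A k l powr p)))
       = C * C * (\<Sum>k=1..m. \<Sum>l=1..m. real k powr (p - 2) * real l powr (p - 2) * A k l powr p)"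
      by (simp add: sum_distrib_left mult_ac)
    finally show "(\<integral>\<^sup>+z. ennreal ((\<Sum>k=1..m. \<Sum>l=1..m. A k l * ker k (fst z) * ker l (snd z)) powr p) \<partial>sq)
       \<le> ennreal (C * C * (\<Sum>k=1..m. \<Sum>l=1..m. real k powr (p - 2) * real l powr (p - 2) * A k l powr p))" .
  qed
qed

section \<open>Fractional differences of Dirichlet kernels\<close>

definition fcoef :: "real \<Rightarrow> nat \<Rightarrow> real" where
  "fcoef \<alpha> \<nu> = (-1) ^ \<nu> * (\<alpha> gchoose \<nu>)"

text \<open>Generalized binomial coefficients decay like \<nu> powr (- \<alpha> - 1), which is
  summable exactly because \<alpha> > 0.\<close>

lemma summable_abs_fcoef:
  assumes "0 < \<alpha>"
  shows "summable (\<lambda>\<nu>. \<bar>fcoef \<alpha> \<nu>\<bar>)"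
proof -
  have "Bseq (\<lambda>n. (\<alpha> gchoose n) / ((-1) ^ n / exp ((\<alpha> + 1) * of_real (ln (real n)))))"
    using gbinomial_asymptotic[of \<alpha>] by (intro convergent_imp_Bseq convergentI) auto
  then obtain K where K: "K > 0"
    "\<And>n. norm ((\<alpha> gchoose n) / ((-1) ^ n / exp ((\<alpha> + 1) * of_real (ln (real n))))) \<le> K"
    by (auto simp: Bseq_def)
  have "summable (\<lambda>n. K * real n powr (- \<alpha> - 1))"
    using summable_real_powr_iff[of "- \<alpha> - 1"] assms by (intro summable_mult) auto
  then show ?thesis
  proof (rule summable_comparison_test_ev[rotated])
    show "\<forall>\<^sub>F n in sequentially. norm \<bar>fcoef \<alpha> n\<bar> \<le> K * real n powr (- \<alpha> - 1)"
      using eventually_gt_at_top[of 0]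
    proof eventually_elim
      case (elim n)
      define E where "E = exp ((\<alpha> + 1) * ln (real n))"
      have "real n powr (- \<alpha> - 1) = exp (- ((\<alpha> + 1) * ln (real n)))"
        using elim by (simp add: powr_def algebra_simps)
      then have E: "real n powr (- \<alpha> - 1) = inverse E" unfolding E_def exp_minus .
      have "\<bar>\<alpha> gchoose n\<bar> * E \<le> K" using K(2)[of n] by (simp add: E_def abs_mult abs_divide)
      moreover have "0 < E" by (simp add: E_def)
      ultimately show ?case unfolding E by (simp add: fcoef_def abs_mult field_simps)
    qed
  qed
qed

text \<open>This is the binomial series of (1 - z) powr \<alpha> at z = cis (- \<theta>), on the
  boundary of the disc. It is reached radially from inside, with the absolutely summable
  coefficients as majorant. There 1 - z has modulus 2 sin (\<theta> / 2) and argument (pi -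
  \<theta>) / 2; multiplying by cis \<beta> and taking real parts gives the formula.\<close>

lemma fcoef_cos_sums:
  assumes \<alpha>: "0 < \<alpha>" and \<theta>: "0 \<le> \<theta>" "\<theta> \<le> pi"
  shows "(\<lambda>\<nu>. fcoef \<alpha> \<nu> * cos (\<beta> - real \<nu> * \<theta>)) sums
    ((2 * sin (\<theta> / 2)) powr \<alpha> * cos (\<beta> + \<alpha> * (pi - \<theta>) / 2))"
proof -
  define r where "r n = 1 - 1 / (real n + 2)" for n :: nat
  have r: "0 \<le> r n" "r n < 1" for n unfolding r_def by (auto simp: field_simps)
  have rlim: "r \<longlonglongrightarrow> 1" unfolding r_def by real_asymp
  define a where "a \<nu> n = complex_of_real (fcoef \<alpha> \<nu>) * (of_real (r n) * cis (- \<theta>)) ^ \<nu>" for \<nu> n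
  define b where "b \<nu> = complex_of_real (fcoef \<alpha> \<nu>) * cis (- \<theta>) ^ \<nu>" for \<nu>
  have T: "eventually (\<lambda>n. summable (\<lambda>k. norm (a k n))) sequentially \<and>
           summable (\<lambda>n. norm (b n)) \<and>
           (\<lambda>n. suminf (\<lambda>k. a k n)) \<longlonglongrightarrow> suminf b"
  proof (rule tannerys_theorem[OF _ _ summable_abs_fcoef[OF \<alpha>]])
    show "(\<lambda>n. a k n) \<longlonglongrightarrow> b k" for k
    proof -
      have "(\<lambda>n. a k n) \<longlonglongrightarrow> complex_of_real (fcoef \<alpha> k) * (of_real 1 * cis (- \<theta>)) ^ k"
        unfolding a_def by (intro tendsto_intros rlim)
      then show ?thesis by (simp add: b_def)
    qed
    have "norm (a k n) \<le> \<bar>fcoef \<alpha> k\<bar>" for k n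
      unfolding a_def using r[of n] by (auto simp: norm_mult norm_power intro!: mult_left_le power_le_one)
    then show "\<forall>\<^sub>F (k, n) in sequentially \<times>\<^sub>F sequentially. norm (a k n) \<le> \<bar>fcoef \<alpha> k\<bar>"
      by (intro always_eventually) auto
  qed auto
  have gc: "complex_of_real (\<alpha> gchoose k) = (of_real \<alpha> gchoose k)" for k
    by (simp add: gbinomial_prod_rev)
  have "(\<Sum>k. a k n) = (1 - of_real (r n) * cis (- \<theta>)) powr (of_real \<alpha>)" for n
  proof -
    have "(\<lambda>k. (complex_of_real \<alpha> gchoose k) * (- (of_real (r n) * cis (- \<theta>))) ^ k) sums
        (1 + (- (of_real (r n) * cis (- \<theta>)))) powr of_real \<alpha>"
      by (rule gen_binomial_complex) (use r[of n] in \<open>auto simp: norm_mult\<close>)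
    also have "(\<lambda>k. (complex_of_real \<alpha> gchoose k) * (- (of_real (r n) * cis (- \<theta>))) ^ k) = (\<lambda>k. a k n)"
      unfolding a_def fcoef_def
      by (subst power_minus) (simp add: gc[symmetric] mult_ac)
    finally show ?thesis by (simp add: sums_iff)
  qed
  \<comment> \<open>Complex \<open>powr\<close> is discontinuous across the negative real axis. The
    limit 1 - cis (- \<theta>) has positive real part unless \<theta> = 0, when the base tends to 0
    and the positive exponent saves continuity.\<close>
  moreover have "(\<lambda>n. (1 - of_real (r n) * cis (- \<theta>)) powr (of_real \<alpha>)) \<longlonglongrightarrow> (1 - 1 * cis (- \<theta>)) powr (of_real \<alpha>)"
  proof (rule tendsto_powr_complex')
    have "Re (1 - 1 * cis (- \<theta>)) > 0 \<or> 1 - 1 * cis (- \<theta>) = 0"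
    proof (cases "\<theta> = 0")
      case False
      then have "cos \<theta> < cos 0" using \<theta> by (intro cos_monotone_0_pi) auto
      then show ?thesis by simp
    qed simp
    then show "1 - 1 * cis (- \<theta>) \<notin> \<real>\<^sub>\<le>\<^sub>0 \<or> 1 - 1 * cis (- \<theta>) = 0 \<and> 0 < Re (complex_of_real \<alpha>)"
      using \<alpha> by (auto simp: complex_nonpos_Reals_iff)
    show "(\<lambda>n. 1 - complex_of_real (r n) * cis (- \<theta>)) \<longlonglongrightarrow> 1 - 1 * cis (- \<theta>)"
      using tendsto_of_real[OF rlim, where 'a = complex] by (intro tendsto_intros) simp
  qed auto
  ultimately have S: "suminf b = (1 - cis (- \<theta>)) powr (of_real \<alpha>)"
    using T LIMSEQ_unique by fastforce
  have P: "(1 - cis (- \<theta>)) powr (of_real \<alpha>) = of_real ((2 * sin (\<theta> / 2)) powr \<alpha>) * cis (\<alpha> * (pi - \<theta>) / 2)"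
  proof (cases "\<theta> = 0")
    case False
    have \<theta>3: "\<theta> < 3 * pi" using \<theta> pi_gt_zero by linarith
    have sp: "0 < 2 * sin (\<theta> / 2)" using False \<theta> by (auto intro!: sin_gt_zero)
    have "cis ((pi - \<theta>) / 2) = Complex (sin (\<theta> / 2)) (cos (\<theta> / 2))"
      by (auto simp: complex_eq_iff diff_divide_distrib cos_diff sin_diff)
    moreover have "1 - cos \<theta> = 2 * sin (\<theta> / 2) * sin (\<theta> / 2)"
      using cos_double_sin[of "\<theta> / 2"] by (simp add: power2_eq_square)
    moreover have "sin \<theta> = 2 * sin (\<theta> / 2) * cos (\<theta> / 2)" using sin_double[of "\<theta> / 2"] by simp
    ultimately have "1 - cis (- \<theta>) = of_real (2 * sin (\<theta> / 2)) * cis ((pi - \<theta>) / 2)"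
      by (simp add: complex_eq_iff)
    then have "(1 - cis (- \<theta>)) = rcis (2 * sin (\<theta> / 2)) ((pi - \<theta>) / 2)" by (simp add: rcis_def)
    moreover have "rcis (2 * sin (\<theta> / 2)) ((pi - \<theta>) / 2) \<noteq> 0" using sp by (auto simp: rcis_def)
    \<comment> \<open>For 0 \<le> \<theta> \<le> pi the argument (pi - \<theta>) / 2 lies between 0
      and pi / 2, so the principal logarithm returns it unchanged.\<close>
    moreover have "Ln (rcis (2 * sin (\<theta> / 2)) ((pi - \<theta>) / 2)) = Complex (ln (2 * sin (\<theta> / 2))) ((pi - \<theta>) / 2)"
      by (rule Ln_rcis) (use sp \<theta> \<theta>3 in auto)
    ultimately have "(1 - cis (- \<theta>)) powr (of_real \<alpha>)
        = exp (of_real \<alpha> * Complex (ln (2 * sin (\<theta> / 2))) ((pi - \<theta>) / 2))"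
      by (simp add: powr_def)
    also have "\<dots> = of_real (exp (\<alpha> * ln (2 * sin (\<theta> / 2)))) * cis (\<alpha> * (pi - \<theta>) / 2)"
      by (simp add: exp_eq_polar)
    also have "exp (\<alpha> * ln (2 * sin (\<theta> / 2))) = (2 * sin (\<theta> / 2)) powr \<alpha>"
      using sp by (simp add: powr_def)
    finally show ?thesis .
  qed (use \<alpha> in simp)
  have "summable b" using T by (blast intro: summable_norm_cancel)
  then have "b sums (of_real ((2 * sin (\<theta> / 2)) powr \<alpha>) * cis (\<alpha> * (pi - \<theta>) / 2))"
    using S P by (simp add: sums_iff)
  then have "(\<lambda>\<nu>. cis \<beta> * b \<nu>) sums (cis \<beta> * (of_real ((2 * sin (\<theta> / 2)) powr \<alpha>) * cis (\<alpha> * (pi - \<theta>) / 2)))"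
    by (rule sums_mult)
  then have "(\<lambda>\<nu>. Re (cis \<beta> * b \<nu>)) sums Re (cis \<beta> * (of_real ((2 * sin (\<theta> / 2)) powr \<alpha>) * cis (\<alpha> * (pi - \<theta>) / 2)))"
    by (rule sums_Re)
  moreover have "Re (cis \<beta> * b \<nu>) = fcoef \<alpha> \<nu> * cos (\<beta> - real \<nu> * \<theta>)" for \<nu>
  proof -
    have "cis \<beta> * b \<nu> = of_real (fcoef \<alpha> \<nu>) * (cis \<beta> * cis (- \<theta>) ^ \<nu>)" by (simp add: b_def)
    also have "cis \<beta> * cis (- \<theta>) ^ \<nu> = cis (\<beta> - real \<nu> * \<theta>)"
      by (simp only: Complex.DeMoivre Complex.cis_mult mult_minus_right diff_conv_add_uminus)
    finally show ?thesis by simp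
  qed
  moreover have "cis \<beta> * (of_real ((2 * sin (\<theta> / 2)) powr \<alpha>) * cis (\<alpha> * (pi - \<theta>) / 2))
     = of_real ((2 * sin (\<theta> / 2)) powr \<alpha>) * cis (\<beta> + \<alpha> * (pi - \<theta>) / 2)"
    by (simp add: cis_mult[symmetric] mult_ac)
  ultimately show ?thesis by simp
qed

text \<open>Two bounds are added: \<bar>S\<bar> \<le> m by counting, and s \<bar>S\<bar> \<le> 1 for
  s = \<bar>sin (x / 2)\<bar> by telescoping after multiplication with 2 sin (x / 2). Together
  \<bar>S\<bar> (1 + m s) \<le> 2 m. The free starting index and phase are needed for the blocks of
  the test functions.\<close>

lemma abs_sum_cos_le:
  assumes "1 \<le> i"
  shows "\<bar>\<Sum>k=i..m. cos (real k * x + \<theta>)\<bar> \<le> 2 * real m * ker m x"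
proof -
  define s where "s = \<bar>sin (x / 2)\<bar>"
  define S where "S = (\<Sum>k=i..m. cos (real k * x + \<theta>))"
  have "\<bar>S\<bar> \<le> (\<Sum>k=i..m. \<bar>cos (real k * x + \<theta>)\<bar>)" unfolding S_def by (rule sum_abs)
  also have "\<dots> \<le> (\<Sum>k=i..m. 1)" by (intro sum_mono) auto
  also have "\<dots> \<le> real m" using assms by simp
  finally have 1: "\<bar>S\<bar> \<le> real m" .
  have tele: "2 * sin (x / 2) * (\<Sum>k=i..m. cos (real k * x + \<theta>))
     = sin ((real m + 1/2) * x + \<theta>) - sin ((real i - 1/2) * x + \<theta>)" if "i \<le> Suc m"
    using that
  proof (induction m)
    case 0
    then have "i = 1" using assms by simp
    then show ?case by simp
  next
    case (Suc m)
    show ?case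
    proof (cases "i = Suc (Suc m)")
      case True
      then show ?thesis by (simp add: algebra_simps)
    next
      case False
      then have i: "i \<le> Suc m" using Suc by simp
      have "2 * sin (x / 2) * cos (real (Suc m) * x + \<theta>)
          = sin ((real (Suc m) + 1/2) * x + \<theta>) - sin ((real m + 1/2) * x + \<theta>)"
      proof -
        have "(real (Suc m) + 1/2) * x + \<theta> = (real (Suc m) * x + \<theta>) + x / 2"
          "(real m + 1/2) * x + \<theta> = (real (Suc m) * x + \<theta>) - x / 2"
          by (auto simp: field_simps)
        then show ?thesis
          by (simp only: sin_add[of "real (Suc m) * x + \<theta>"] sin_diff[of "real (Suc m) * x + \<theta>"]) simp
      qed
      then show ?thesis using Suc.IH[OF i] i by (simp add: algebra_simps)
    qed
  qed
  have 2: "s * \<bar>S\<bar> \<le> 1"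
  proof (cases "i \<le> Suc m")
    case True
    have "2 * (s * \<bar>S\<bar>) = \<bar>2 * sin (x / 2) * S\<bar>" by (simp add: s_def abs_mult)
    also have "\<dots> = \<bar>sin ((real m + 1/2) * x + \<theta>) - sin ((real i - 1/2) * x + \<theta>)\<bar>"
      using tele[OF True] by (simp add: S_def)
    also have "\<dots> \<le> \<bar>sin ((real m + 1/2) * x + \<theta>)\<bar> + \<bar>sin ((real i - 1/2) * x + \<theta>)\<bar>" by simp
    also have "\<dots> \<le> 2" using abs_sin_le_one[of "(real m + 1/2) * x + \<theta>"] abs_sin_le_one[of "(real i - 1/2) * x + \<theta>"] by linarith
    finally show ?thesis by simp
  qed (simp add: S_def)
  have "\<bar>S\<bar> * (1 + real m * s) = \<bar>S\<bar> + real m * (s * \<bar>S\<bar>)" by (simp add: algebra_simps)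
  also have "\<dots> \<le> real m + real m * 1" using 1 2 by (intro add_mono mult_left_mono) auto
  finally show ?thesis unfolding S_def[symmetric] ker_def s_def[symmetric]
    by (simp add: field_simps s_def add_pos_nonneg)
qed

lemma ker_antimono: "k \<le> m \<Longrightarrow> ker m x \<le> ker k x"
  unfolding ker_def by (intro divide_left_mono add_left_mono mult_right_mono) (auto intro!: mult_pos_pos add_pos_nonneg)

lemma mult_ker_mono: "k \<le> m \<Longrightarrow> real k * ker k x \<le> real m * ker m x"
  unfolding ker_def using mult_right_mono[of "real k" "real m" "\<bar>sin (x / 2)\<bar>"]
  by (simp add: divide_simps add_pos_nonneg) (simp add: algebra_simps)

lemma ker_periodic [simp]: "ker k (x + 2 * pi) = ker k x" and ker_minus [simp]: "ker k (- x) = ker k x"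
  unfolding ker_def by (simp_all add: add_divide_distrib)

text \<open>Summation by parts: for increasing nonnegative weights the increments add up to at most
  the last weight, and every partial sum is controlled by the largest one through monotonicity of k
  * ker k x.\<close>

lemma abs_weighted_sum_cos_le:
  assumes "\<And>k. 1 \<le> k \<Longrightarrow> k \<le> m \<Longrightarrow> 0 \<le> w k" "\<And>k. 1 \<le> k \<Longrightarrow> k < m \<Longrightarrow> w k \<le> w (Suc k)"
  shows "\<bar>\<Sum>k=1..m. w k * cos (real k * x + \<theta>)\<bar> \<le> 4 * w m * (real m * ker m x)"
proof (cases "m = 0")
  case False
  define S where "S n = (\<Sum>k=1..n. cos (real k * x + \<theta>))" for n
  have S: "\<bar>S n\<bar> \<le> 2 * (real m * ker m x)" if "n \<le> m" for n
    using abs_sum_cos_le[where i = 1 and m = n and x = x and \<theta> = \<theta>] mult_ker_mono[OF that, of x] unfolding S_def by simp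
  have abel: "(\<Sum>k=1..n. w k * cos (real k * x + \<theta>)) = w n * S n - (\<Sum>k=1..<n. (w (Suc k) - w k) * S k)"
    if "1 \<le> n" for n using that
  proof (induction n rule: dec_induct)
    case base
    then show ?case by (simp add: S_def)
  next
    case (step n)
    have "S (Suc n) = S n + cos (real (Suc n) * x + \<theta>)" using step by (simp add: S_def)
    then show ?case using step by (simp add: algebra_simps)
  qed
  have "\<bar>\<Sum>k=1..m. w k * cos (real k * x + \<theta>)\<bar> \<le> \<bar>w m * S m\<bar> + \<bar>\<Sum>k=1..<m. (w (Suc k) - w k) * S k\<bar>"
    using abel[of m] False by simp
  also have "\<bar>\<Sum>k=1..<m. (w (Suc k) - w k) * S k\<bar> \<le> (\<Sum>k=1..<m. \<bar>(w (Suc k) - w k) * S k\<bar>)" by (rule sum_abs)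
  also have "\<dots> \<le> (\<Sum>k=1..<m. (w (Suc k) - w k) * (2 * (real m * ker m x)))"
    unfolding abs_mult using S assms by (intro sum_mono mult_mono) auto
  also have "\<dots> = (w m - w 1) * (2 * (real m * ker m x))"
    using False by (simp add: sum_distrib_right[symmetric] sum_Suc_diff')
  also have "\<dots> \<le> w m * (2 * (real m * ker m x))" using assms(1)[of 1] False by (intro mult_right_mono) auto
  also have "\<bar>w m * S m\<bar> \<le> w m * (2 * (real m * ker m x))"
    unfolding abs_mult using S[of m] assms(1)[of m] False by (intro mult_mono) auto
  finally show ?thesis by (simp add: algebra_simps)
qed simp

text \<open>Stands in for the size of the multiplier of a difference of order \<alpha> with steps up
  to h: it grows like (k h) powr \<alpha> and saturates at frequency 1 / h.\<close>

definition cutoff :: "real \<Rightarrow> real \<Rightarrow> nat \<Rightarrow> real" where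
  "cutoff \<alpha> h k = min 1 (real k * h) powr \<alpha>"

lemma cutoff_nonneg [simp]: "0 \<le> cutoff \<alpha> h k" by (simp add: cutoff_def)

lemma cutoff_mono:
  assumes "0 \<le> h" "h \<le> h'" "k \<le> k'" "0 \<le> \<alpha>"
  shows "cutoff \<alpha> h k \<le> cutoff \<alpha> h' k'"
  unfolding cutoff_def using assms by (intro powr_mono2 min.mono mult_mono) auto

text \<open>Only the upper half of the indices is used: for k \<ge> m / 2 the cutoff at k is at
  least 2 powr (- \<alpha>) times the one at m, and these k make up at least half of all.\<close>

lemma sum_cutoff_ge:
  assumes "0 \<le> \<alpha>" "0 \<le> h"
  shows "real m * cutoff \<alpha> h m \<le> 2 powr (\<alpha> + 1) * (\<Sum>k=1..m. cutoff \<alpha> h k)"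
proof -
  have half: "cutoff \<alpha> h m \<le> 2 powr \<alpha> * cutoff \<alpha> h k" if "m \<le> 2 * k" for k
  proof -
    have "min 1 (real m * h) \<le> 2 * min 1 (real k * h)"
      using that assms mult_right_mono[of "real m" "2 * real k" h] by (auto simp: min_def)
    then have "cutoff \<alpha> h m \<le> (2 * min 1 (real k * h)) powr \<alpha>"
      unfolding cutoff_def using assms by (intro powr_mono2) auto
    also have "\<dots> = 2 powr \<alpha> * cutoff \<alpha> h k" unfolding cutoff_def by (rule powr_mult)
    finally show ?thesis .
  qed
  define n where "n = m div 2"
  have "real m \<le> 2 * real (card {Suc n..m})" unfolding n_def by simp
  then have "real m * cutoff \<alpha> h m \<le> 2 * real (card {Suc n..m}) * cutoff \<alpha> h m"
    by (intro mult_right_mono) auto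
  also have "\<dots> = 2 * (\<Sum>k\<in>{Suc n..m}. cutoff \<alpha> h m)" by simp
  also have "\<dots> \<le> 2 * (\<Sum>k\<in>{Suc n..m}. 2 powr \<alpha> * cutoff \<alpha> h k)"
    by (intro mult_left_mono sum_mono half) (auto simp: n_def)
  also have "\<dots> = 2 powr (\<alpha> + 1) * (\<Sum>k\<in>{Suc n..m}. cutoff \<alpha> h k)"
    by (simp add: sum_distrib_left powr_add mult_ac)
  also have "\<dots> \<le> 2 powr (\<alpha> + 1) * (\<Sum>k=1..m. cutoff \<alpha> h k)"
    by (intro mult_left_mono sum_mono2) auto
  finally show ?thesis .
qed

definition cutoff_ker :: "real \<Rightarrow> real \<Rightarrow> nat \<Rightarrow> real \<Rightarrow> real" where
  "cutoff_ker \<alpha> h m x = (\<Sum>k=1..m. cutoff \<alpha> h k * ker k x)"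

text \<open>Spreads the bound for one index m over all \<open>ker k\<close> with k \<le> m. After
  summation over m against the mixed differences, interchanging the sums then produces the
  coefficients themselves as the factors of \<open>ker k\<close>, which is the form the
  Hardy--Littlewood inequality accepts.\<close>

lemma cutoff_mult_ker_le:
  assumes "0 \<le> \<alpha>" "0 \<le> h"
  shows "cutoff \<alpha> h m * (real m * ker m x) \<le> 2 powr (\<alpha> + 1) * cutoff_ker \<alpha> h m x"
proof -
  have "cutoff \<alpha> h m * (real m * ker m x) = (real m * cutoff \<alpha> h m) * ker m x" by simp
  also have "\<dots> \<le> (2 powr (\<alpha> + 1) * (\<Sum>k=1..m. cutoff \<alpha> h k)) * ker m x"
    using assms by (intro mult_right_mono sum_cutoff_ge) auto
  also have "\<dots> = 2 powr (\<alpha> + 1) * (\<Sum>k=1..m. cutoff \<alpha> h k * ker m x)"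
    by (simp add: sum_distrib_right)
  also have "\<dots> \<le> 2 powr (\<alpha> + 1) * cutoff_ker \<alpha> h m x"
    unfolding cutoff_ker_def by (intro mult_left_mono sum_mono ker_antimono) auto
  finally show ?thesis .
qed

section \<open>Fractional differences in one variable\<close>

definition fdiff :: "real \<Rightarrow> real \<Rightarrow> (real \<Rightarrow> real) \<Rightarrow> real \<Rightarrow> real" where
  "fdiff \<alpha> h f x = (\<Sum>\<nu>. fcoef \<alpha> \<nu> * f (x + (\<alpha> - real \<nu>) * h))"

lemma summable_fdiff_norm:
  assumes "0 < \<alpha>" "\<And>x. \<bar>f x\<bar> \<le> B"
  shows "summable (\<lambda>\<nu>. \<bar>fcoef \<alpha> \<nu> * f (g \<nu>)\<bar>)"
proof (rule summable_comparison_test')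
  show "summable (\<lambda>\<nu>. \<bar>fcoef \<alpha> \<nu>\<bar> * B)" using summable_abs_fcoef[OF assms(1)] by (rule summable_mult2)
  show "norm \<bar>fcoef \<alpha> n * f (g n)\<bar> \<le> \<bar>fcoef \<alpha> n\<bar> * B" for n
    using assms(2)[of "g n"] by (auto simp: abs_mult intro: mult_left_mono)
qed

lemma summable_fdiff:
  assumes "0 < \<alpha>" "\<And>x. \<bar>f x\<bar> \<le> B"
  shows "summable (\<lambda>\<nu>. fcoef \<alpha> \<nu> * f (x + (\<alpha> - real \<nu>) * h))"
  using summable_fdiff_norm[OF assms, of "\<lambda>\<nu>. x + (\<alpha> - real \<nu>) * h"]
  by (rule summable_rabs_cancel)

lemma fdiff_sum:
  assumes "0 < \<alpha>" "finite S" "\<And>i x. i \<in> S \<Longrightarrow> \<bar>f i x\<bar> \<le> B i"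
  shows "fdiff \<alpha> h (\<lambda>x. \<Sum>i\<in>S. c i * f i x) x = (\<Sum>i\<in>S. c i * fdiff \<alpha> h (f i) x)"
proof -
  have "fdiff \<alpha> h (\<lambda>x. \<Sum>i\<in>S. c i * f i x) x = (\<Sum>\<nu>. \<Sum>i\<in>S. c i * (fcoef \<alpha> \<nu> * f i (x + (\<alpha> - real \<nu>) * h)))"
    unfolding fdiff_def by (simp add: sum_distrib_left mult_ac)
  also have "\<dots> = (\<Sum>i\<in>S. \<Sum>\<nu>. c i * (fcoef \<alpha> \<nu> * f i (x + (\<alpha> - real \<nu>) * h)))"
    by (rule suminf_sum) (use assms in \<open>auto intro!: summable_mult summable_fdiff\<close>)
  also have "\<dots> = (\<Sum>i\<in>S. c i * fdiff \<alpha> h (f i) x)"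
    unfolding fdiff_def by (intro sum.cong refl suminf_mult summable_fdiff[OF assms(1) assms(3)])
  finally show ?thesis .
qed

lemma fdiff_minus: "fdiff \<alpha> (- h) f x = fdiff \<alpha> h (\<lambda>x. f (- x)) (- x)"
  unfolding fdiff_def by (simp add: algebra_simps)

lemma fdiff_cos:
  assumes "0 < \<alpha>" "0 \<le> real k * h" "real k * h \<le> pi"
  shows "fdiff \<alpha> h (\<lambda>x. cos (real k * x)) x
    = (2 * sin (real k * h / 2)) powr \<alpha> * cos (real k * (x + \<alpha> * h / 2) + \<alpha> * pi / 2)"
proof -
  have "(\<lambda>\<nu>. fcoef \<alpha> \<nu> * cos ((real k * x + real k * \<alpha> * h) - real \<nu> * (real k * h))) sums
     ((2 * sin (real k * h / 2)) powr \<alpha> * cos ((real k * x + real k * \<alpha> * h) + \<alpha> * (pi - real k * h) / 2))"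
    by (rule fcoef_cos_sums) (use assms in auto)
  moreover have "(real k * x + real k * \<alpha> * h) - real \<nu> * (real k * h) = real k * (x + (\<alpha> - real \<nu>) * h)" for \<nu>
    by (simp add: algebra_simps)
  moreover have "(real k * x + real k * \<alpha> * h) + \<alpha> * (pi - real k * h) / 2 = real k * (x + \<alpha> * h / 2) + \<alpha> * pi / 2"
    by (simp add: field_simps)
  ultimately show ?thesis unfolding fdiff_def by (simp add: sums_iff)
qed

definition dirichlet :: "nat \<Rightarrow> real \<Rightarrow> real" where
  "dirichlet m x = (\<Sum>k=1..m. cos (real k * x))"

lemma abs_dirichlet_le_nat: "\<bar>dirichlet m x\<bar> \<le> real m"
proof -
  have "\<bar>dirichlet m x\<bar> \<le> (\<Sum>k=1..m. \<bar>cos (real k * x)\<bar>)" unfolding dirichlet_def by (rule sum_abs)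
  also have "\<dots> \<le> (\<Sum>k=1..m. 1)" by (intro sum_mono) auto
  finally show ?thesis by simp
qed

lemma abs_dirichlet_le: "\<bar>dirichlet m x\<bar> \<le> 2 * (real m * ker m x)"
  using abs_sum_cos_le[where i = 1 and m = m and x = x and \<theta> = 0] by (simp add: dirichlet_def)

lemma cutoff_ker_nonneg [simp]: "0 \<le> cutoff_ker \<alpha> h m x"
  unfolding cutoff_ker_def by (intro sum_nonneg) auto

lemma cutoff_le_1: "0 \<le> \<alpha> \<Longrightarrow> 0 \<le> h \<Longrightarrow> cutoff \<alpha> h k \<le> 1"
  unfolding cutoff_def using powr_mono2[of \<alpha> "min 1 (real k * h)" 1] by simp

lemma cutoff_ker_le:
  assumes "0 \<le> \<alpha>" "0 \<le> h"
  shows "cutoff_ker \<alpha> h m x \<le> real m"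
proof -
  have "cutoff_ker \<alpha> h m x \<le> (\<Sum>k=1..m. 1)"
    unfolding cutoff_ker_def using assms by (intro sum_mono mult_le_one ker_le_1 cutoff_le_1) auto
  then show ?thesis by simp
qed

text \<open>The weight at index 0 belongs to the translate by \<open>\<alpha> h / 2\<close>, which governs the frequencies
  below \<open>1 / h\<close>; the remaining ones are the translates occurring in the difference itself.\<close>

definition shift_weight :: "real \<Rightarrow> nat \<Rightarrow> real" where
  "shift_weight \<alpha> i = (case i of 0 \<Rightarrow> 1 | Suc \<nu> \<Rightarrow> \<bar>fcoef \<alpha> \<nu>\<bar>)"

definition shift_by :: "real \<Rightarrow> real \<Rightarrow> nat \<Rightarrow> real" where
  "shift_by \<alpha> h i = (case i of 0 \<Rightarrow> \<alpha> * h / 2 | Suc \<nu> \<Rightarrow> (\<alpha> - real \<nu>) * h)"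

lemma shift_weight_nonneg [simp]: "0 \<le> shift_weight \<alpha> i"
  by (simp add: shift_weight_def split: nat.split)

lemma summable_shift_weight: "0 < \<alpha> \<Longrightarrow> summable (shift_weight \<alpha>)"
  using summable_abs_fcoef[of \<alpha>] unfolding shift_weight_def by (subst summable_Suc_iff[symmetric]) simp

lemma summable_shift_weight_mult:
  assumes "0 < \<alpha>" "\<And>x. \<bar>f x\<bar> \<le> B"
  shows "summable (\<lambda>i. shift_weight \<alpha> i * f (g i))"
proof (rule summable_comparison_test')
  show "summable (\<lambda>i. shift_weight \<alpha> i * B)" using summable_shift_weight[OF assms(1)] by (rule summable_mult2)
  show "norm (shift_weight \<alpha> i * f (g i)) \<le> shift_weight \<alpha> i * B" for i
    using assms(2)[of "g i"] by (auto simp: abs_mult intro: mult_left_mono)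
qed

text \<open>Two regimes share one right-hand side. For m \<bar>h\<bar> \<le> 1 all multipliers are
  explicit and increasing, so the smallness of the difference is gained from them, at the single
  translate of index 0. For m \<bar>h\<bar> > 1 the cutoff at m is 1, nothing has to be gained, and
  each translate in the difference is bounded separately.\<close>

lemma abs_fdiff_dirichlet_le:
  assumes "0 < \<alpha>"
  shows "\<bar>fdiff \<alpha> h (dirichlet m) x\<bar> \<le>
    4 * 2 powr (\<alpha> + 1) * (\<Sum>i. shift_weight \<alpha> i * cutoff_ker \<alpha> \<bar>h\<bar> m (x + shift_by \<alpha> h i))"
proof -
  define C where "C = 2 powr (\<alpha> + 1)"
  have C: "C > 0" by (simp add: C_def)
  define w where "w i = shift_weight \<alpha> i * cutoff_ker \<alpha> \<bar>h\<bar> m (x + shift_by \<alpha> h i)" for i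
  have sw: "summable w" unfolding w_def
    using assms cutoff_ker_le[of \<alpha> "\<bar>h\<bar>" m] by (intro summable_shift_weight_mult[where B = "real m"]) auto
  have w0: "0 \<le> w i" for i by (simp add: w_def)
  have split: "suminf w = w 0 + (\<Sum>\<nu>. w (Suc \<nu>))" using suminf_split_head[OF sw] by simp
  have sw': "summable (\<lambda>\<nu>. w (Suc \<nu>))" using sw by (simp add: summable_Suc_iff)
  have "\<bar>fdiff \<alpha> h (dirichlet m) x\<bar> \<le> 4 * C * suminf w"
  proof (cases "real m * \<bar>h\<bar> \<le> 1")
    case True
    have pos: "\<bar>fdiff \<alpha> h (dirichlet m) x\<bar> \<le> 4 * C * cutoff_ker \<alpha> h m (x + \<alpha> * h / 2)" if h: "0 \<le> h" "real m * h \<le> 1" for h x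
    proof -
      have kh: "0 \<le> real k * h \<and> real k * h \<le> 1" if "k \<le> m" for k
        using mult_right_mono[of "real k" "real m" h] that h by auto
      have "fdiff \<alpha> h (dirichlet m) x = (\<Sum>k=1..m. fdiff \<alpha> h (\<lambda>x. cos (real k * x)) x)"
        unfolding dirichlet_def[abs_def]
        using fdiff_sum[OF assms, where S = "{1..m}" and f = "\<lambda>k x. cos (real k * x)" and B = "\<lambda>_. 1" and c = "\<lambda>_. 1" and h = h and x = x] by simp
      also have "\<dots> = (\<Sum>k=1..m. (2 * sin (real k * h / 2)) powr \<alpha> * cos (real k * (x + \<alpha> * h / 2) + \<alpha> * pi / 2))"
      proof (intro sum.cong refl fdiff_cos assms)
        fix k assume "k \<in> {1..m}"
        then show "0 \<le> real k * h" "real k * h \<le> pi" using kh[of k] pi_ge_two by auto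
      qed
      finally have "\<bar>fdiff \<alpha> h (dirichlet m) x\<bar> \<le> 4 * (2 * sin (real m * h / 2)) powr \<alpha> * (real m * ker m (x + \<alpha> * h / 2))"
      \<comment> \<open>The weights increase in k because k h / 2 stays at most 1 / 2, where the
        sine is nonnegative and increasing.\<close>
      proof (simp only:, intro abs_weighted_sum_cos_le)
        fix k assume k: "1 \<le> k" "k < m"
        have "0 \<le> real k * h" "real (Suc k) * h \<le> 1" "real k * h \<le> real (Suc k) * h"
          using kh[of k] kh[of "Suc k"] k h by (auto intro: mult_right_mono)
        then have "sin (real k * h / 2) \<le> sin (real (Suc k) * h / 2)"
          using pi_ge_two by (intro sin_monotone_2pi_le) linarith+
        moreover have "0 \<le> sin (real k * h / 2)" using kh[of k] k pi_ge_two by (intro sin_ge_zero) auto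
        ultimately show "(2 * sin (real k * h / 2)) powr \<alpha> \<le> (2 * sin (real (Suc k) * h / 2)) powr \<alpha>"
          using assms by (intro powr_mono2) auto
      qed auto
      also have "(2 * sin (real m * h / 2)) powr \<alpha> \<le> cutoff \<alpha> h m"
      proof -
        have "2 * sin (real m * h / 2) \<le> real m * h" using sin_x_le_x[of "real m * h / 2"] h by simp
        moreover have "0 \<le> sin (real m * h / 2)" using kh[of m] pi_ge_two by (intro sin_ge_zero) auto
        ultimately show ?thesis unfolding cutoff_def using h assms by (intro powr_mono2) auto
      qed
      also have "4 * cutoff \<alpha> h m * (real m * ker m (x + \<alpha> * h / 2)) \<le> 4 * C * cutoff_ker \<alpha> h m (x + \<alpha> * h / 2)"
        using cutoff_mult_ker_le[of \<alpha> h m "x + \<alpha> * h / 2"] h assms by (simp add: C_def)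
      finally show ?thesis by (auto simp: mult_right_mono)
    qed
    have "\<bar>fdiff \<alpha> h (dirichlet m) x\<bar> \<le> 4 * C * cutoff_ker \<alpha> \<bar>h\<bar> m (x + \<alpha> * h / 2)"
    proof (cases "0 \<le> h")
      case True
      then show ?thesis using pos[of h x] \<open>real m * \<bar>h\<bar> \<le> 1\<close> by simp
    next
      case False
      \<comment> \<open>A negative step turns into a positive one by reflection, since both the
        Dirichlet kernel and \<open>ker\<close> are even.\<close>
      have "(\<lambda>x. dirichlet m (- x)) = dirichlet m" by (auto simp: dirichlet_def)
      then have "fdiff \<alpha> h (dirichlet m) x = fdiff \<alpha> (- h) (dirichlet m) (- x)"
        using fdiff_minus[of \<alpha> "- h" "dirichlet m" x] by simp
      moreover have "cutoff_ker \<alpha> (- h) m (- x + \<alpha> * (- h) / 2) = cutoff_ker \<alpha> (- h) m (x + \<alpha> * h / 2)"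
        using ker_minus[of _ "x + \<alpha> * h / 2"] unfolding cutoff_ker_def by (simp add: algebra_simps)
      ultimately show ?thesis using pos[of "- h" "- x"] False \<open>real m * \<bar>h\<bar> \<le> 1\<close> by simp
    qed
    also have "cutoff_ker \<alpha> \<bar>h\<bar> m (x + \<alpha> * h / 2) = w 0" by (simp add: w_def shift_weight_def shift_by_def)
    also have "4 * C * w 0 \<le> 4 * C * suminf w"
      using C split suminf_nonneg[OF sw'] w0 by (intro mult_left_mono) auto
    finally show ?thesis .
  next
    case False
    then have c1: "cutoff \<alpha> \<bar>h\<bar> m = 1" by (simp add: cutoff_def)
    have bd: "\<bar>dirichlet m y\<bar> \<le> 2 * C * cutoff_ker \<alpha> \<bar>h\<bar> m y" for y
      using abs_dirichlet_le[of m y] cutoff_mult_ker_le[of \<alpha> "\<bar>h\<bar>" m y] assms c1 by (simp add: C_def)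
    have sd: "summable (\<lambda>\<nu>. \<bar>fcoef \<alpha> \<nu> * dirichlet m (x + (\<alpha> - real \<nu>) * h)\<bar>)"
      by (rule summable_fdiff_norm[OF assms abs_dirichlet_le_nat])
    have "\<bar>fdiff \<alpha> h (dirichlet m) x\<bar> \<le> (\<Sum>\<nu>. \<bar>fcoef \<alpha> \<nu> * dirichlet m (x + (\<alpha> - real \<nu>) * h)\<bar>)"
      unfolding fdiff_def by (rule summable_rabs[OF sd])
    also have "\<dots> \<le> (\<Sum>\<nu>. 2 * C * w (Suc \<nu>))"
    proof (rule suminf_le[OF _ sd])
      show "summable (\<lambda>\<nu>. 2 * C * w (Suc \<nu>))" by (rule summable_mult[OF sw'])
      show "\<bar>fcoef \<alpha> \<nu> * dirichlet m (x + (\<alpha> - real \<nu>) * h)\<bar> \<le> 2 * C * w (Suc \<nu>)" for \<nu>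
        unfolding w_def shift_weight_def shift_by_def abs_mult
        using mult_left_mono[OF bd[of "x + (\<alpha> - real \<nu>) * h"], of "\<bar>fcoef \<alpha> \<nu>\<bar>"] by (simp add: mult_ac)
    qed
    also have "\<dots> = 2 * C * (\<Sum>\<nu>. w (Suc \<nu>))" by (rule suminf_mult[OF sw'])
    also have "\<dots> \<le> 4 * C * suminf w"
      using C split suminf_nonneg[OF sw'] w0[of 0] w0[of "Suc _"] by (intro mult_mono) auto
    finally show ?thesis .
  qed
  then show ?thesis by (simp add: w_def[abs_def] C_def)
qed

section \<open>Translation invariance over a period and rearrangement of sums\<close>

lemma periodic_int:
  fixes f :: "real \<Rightarrow> 'a"
  assumes "\<And>x. f (x + 2 * pi) = f x"
  shows "f (x + 2 * pi * of_int n) = f x"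
proof -
  have nat: "f (x + 2 * pi * of_nat k) = f x" for k x
  proof (induction k)
    case (Suc k)
    have "f (x + 2 * pi * of_nat (Suc k)) = f ((x + 2 * pi * of_nat k) + 2 * pi)"
      by (simp add: algebra_simps)
    then show ?case using Suc assms by simp
  qed simp
  show ?thesis
  proof (cases "0 \<le> n")
    case True
    then show ?thesis using nat[of x "nat n"] by simp
  next
    case False
    then show ?thesis using nat[of "x + 2 * pi * of_int n" "nat (- n)"] by simp
  qed
qed

text \<open>Reduce the shift to r in [0, 2 pi], cut the translated interval at 2 pi and move the
  part beyond it back by one period.\<close>

lemma nn_integral_circ_shift:
  fixes f :: "real \<Rightarrow> ennreal"
  assumes f [measurable]: "f \<in> borel_measurable borel" and per: "\<And>x. f (x + 2 * pi) = f x"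
  shows "(\<integral>\<^sup>+x. f (x + s) \<partial>circ) = (\<integral>\<^sup>+x. f x \<partial>circ)"
proof -
  define n where "n = \<lfloor>s / (2 * pi)\<rfloor>"
  define r where "r = s - 2 * pi * of_int n"
  have "of_int n \<le> s / (2 * pi)" "s / (2 * pi) < of_int n + 1" unfolding n_def by linarith+
  then have r: "0 \<le> r" "r \<le> 2 * pi" unfolding r_def by (auto simp: field_simps)
  have "(\<integral>\<^sup>+x. f (x + s) \<partial>circ) = (\<integral>\<^sup>+x. f (x + r) \<partial>circ)"
  proof (intro nn_integral_cong)
    fix x show "f (x + s) = f (x + r)"
      using periodic_int[of f, OF per, of "x + r" n] by (simp add: r_def)
  qed
  also have "\<dots> = (\<integral>\<^sup>+x. f (r + 1 * x) * indicator {r..2*pi + r} (r + 1 * x) \<partial>lborel)"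
    by (subst nn_integral_circ) (auto intro!: nn_integral_cong simp: indicator_def add.commute)
  also have "\<dots> = (\<integral>\<^sup>+x. f x * indicator {r..2*pi + r} x \<partial>lborel)"
    using nn_integral_real_affine[of "\<lambda>x. f x * indicator {r..2*pi + r} x" 1 r] by simp
  also have "\<dots> = (\<integral>\<^sup>+x. f x * indicator {r..2*pi} x + f x * indicator {2*pi<..2*pi + r} x \<partial>lborel)"
    using r by (intro nn_integral_cong) (auto simp: indicator_def)
  also have "\<dots> = (\<integral>\<^sup>+x. f x * indicator {r..2*pi} x \<partial>lborel) + (\<integral>\<^sup>+x. f x * indicator {2*pi<..2*pi + r} x \<partial>lborel)"
    by (rule nn_integral_add) measurable
  also have "(\<integral>\<^sup>+x. f x * indicator {2*pi<..2*pi + r} x \<partial>lborel)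
      = (\<integral>\<^sup>+x. f (2*pi + 1 * x) * indicator {2*pi<..2*pi + r} (2*pi + 1 * x) \<partial>lborel)"
    using nn_integral_real_affine[of "\<lambda>x. f x * indicator {2*pi<..2*pi + r} x" 1 "2*pi"] by simp
  also have "\<dots> = (\<integral>\<^sup>+x. f x * indicator {0<..r} x \<partial>lborel)"
    using per by (intro nn_integral_cong) (auto simp: indicator_def add.commute)
  also have "(\<integral>\<^sup>+x. f x * indicator {r..2*pi} x \<partial>lborel) + (\<integral>\<^sup>+x. f x * indicator {0<..r} x \<partial>lborel)
     = (\<integral>\<^sup>+x. f x * indicator {r..2*pi} x + f x * indicator {0<..r} x \<partial>lborel)"
    by (rule nn_integral_add[symmetric]) measurable
  also have "\<dots> = (\<integral>\<^sup>+x. f x * indicator {0..2*pi} x \<partial>lborel)"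
  proof (rule nn_integral_cong_AE)
    show "AE x in lborel. f x * indicator {r..2*pi} x + f x * indicator {0<..r} x = f x * indicator {0..2*pi} x"
      using AE_lborel_singleton[of 0] AE_lborel_singleton[of r]
    proof eventually_elim
      case (elim x)
      then show ?case using r by (auto simp: indicator_def)
    qed
  qed
  also have "\<dots> = (\<integral>\<^sup>+x. f x \<partial>circ)" by (subst nn_integral_circ) auto
  finally show ?thesis .
qed

lemma nn_integral_sq:
  assumes "f \<in> borel_measurable borel"
  shows "(\<integral>\<^sup>+z. f z \<partial>sq) = (\<integral>\<^sup>+y. \<integral>\<^sup>+x. f (x, y) \<partial>circ \<partial>circ)"
proof -
  have "f \<in> borel_measurable (circ \<Otimes>\<^sub>M circ)" using assms sets_sq by (simp add: sq_def borel_prod[symmetric] cong: measurable_cong_sets)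
  then show ?thesis unfolding sq_def by (subst circ2.nn_integral_snd[symmetric]) auto
qed

lemma nn_integral_sq_shift:
  fixes f :: "real \<times> real \<Rightarrow> ennreal"
  assumes f [measurable]: "f \<in> borel_measurable borel"
    and per: "\<And>x y. f (x + 2 * pi, y) = f (x, y)" "\<And>x y. f (x, y + 2 * pi) = f (x, y)"
  shows "(\<integral>\<^sup>+z. f (fst z + s, snd z + t) \<partial>sq) = (\<integral>\<^sup>+z. f z \<partial>sq)"
proof -
  have [measurable]: "f \<in> borel_measurable (borel \<Otimes>\<^sub>M borel)" using f by (simp add: borel_prod)
  have "(\<integral>\<^sup>+z. f (fst z + s, snd z + t) \<partial>sq) = (\<integral>\<^sup>+y. \<integral>\<^sup>+x. f (x + s, y + t) \<partial>circ \<partial>circ)"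
    by (subst nn_integral_sq) (auto simp: borel_prod[symmetric])
  also have "\<dots> = (\<integral>\<^sup>+y. \<integral>\<^sup>+x. f (x, y + t) \<partial>circ \<partial>circ)"
    by (intro nn_integral_cong nn_integral_circ_shift[of "\<lambda>x. f (x, _)"]) (auto simp: per)
  also have "\<dots> = (\<integral>\<^sup>+y. \<integral>\<^sup>+x. f (x, y) \<partial>circ \<partial>circ)"
    by (intro nn_integral_circ_shift[of "\<lambda>y. \<integral>\<^sup>+x. f (x, y) \<partial>circ"]) (auto simp: per)
  also have "\<dots> = (\<integral>\<^sup>+z. f z \<partial>sq)" by (subst nn_integral_sq) auto
  finally show ?thesis .
qed

lemma nn_integral_le_of_tendsto:
  assumes "\<And>n. u n \<in> borel_measurable M" "AE x in M. (\<lambda>n. u n x) \<longlonglongrightarrow> (f x :: ennreal)"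
    and "\<And>n. (\<integral>\<^sup>+x. u n x \<partial>M) \<le> K"
  shows "(\<integral>\<^sup>+x. f x \<partial>M) \<le> K"
proof -
  have "(\<integral>\<^sup>+x. f x \<partial>M) = (\<integral>\<^sup>+x. liminf (\<lambda>n. u n x) \<partial>M)"
    using assms(2) by (intro nn_integral_cong_AE) (auto elim!: eventually_mono simp: lim_imp_Liminf)
  also have "\<dots> \<le> liminf (\<lambda>n. \<integral>\<^sup>+x. u n x \<partial>M)" by (rule nn_integral_liminf[OF assms(1)])
  also have "\<dots> \<le> liminf (\<lambda>n. K)" using assms(3) by (intro Liminf_mono) auto
  finally show ?thesis by (simp add: Liminf_const)
qed

lemma sum_triangle_swap:
  fixes F :: "nat \<Rightarrow> nat \<Rightarrow> 'a::comm_monoid_add"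
  shows "(\<Sum>m=1..M. \<Sum>k=1..m. F m k) = (\<Sum>k=1..M. \<Sum>m=k..M. F m k)"
proof -
  have "(\<Sum>m=1..M. \<Sum>k=1..m. F m k) = (\<Sum>m=1..M. \<Sum>k\<in>{k\<in>{1..M}. k \<le> m}. F m k)"
    by (intro sum.cong) auto
  also have "\<dots> = (\<Sum>k=1..M. \<Sum>m\<in>{m\<in>{1..M}. k \<le> m}. F m k)"
    by (rule sum.swap_restrict) auto
  also have "\<dots> = (\<Sum>k=1..M. \<Sum>m=k..M. F m k)"
    by (intro sum.cong) auto
  finally show ?thesis .
qed

text \<open>Summation by parts read backwards: products of initial sums with weights b become single
  terms weighted by tail sums of b. For mixed differences these tails telescope to the coefficients,
  up to boundary terms.\<close>

lemma sum_quad_swap: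
  fixes b :: "nat \<Rightarrow> nat \<Rightarrow> real"
  shows "(\<Sum>m=1..M. \<Sum>n=1..M. b m n * (\<Sum>k=1..m. f k) * (\<Sum>l=1..n. g l))
    = (\<Sum>k=1..M. \<Sum>l=1..M. (\<Sum>m=k..M. \<Sum>n=l..M. b m n) * f k * g l)"
proof -
  have "(\<Sum>m=1..M. \<Sum>n=1..M. b m n * (\<Sum>k=1..m. f k) * (\<Sum>l=1..n. g l))
      = (\<Sum>m=1..M. \<Sum>k=1..m. f k * (\<Sum>n=1..M. \<Sum>l=1..n. b m n * g l))"
    by (simp add: sum_distrib_left sum_distrib_right mult_ac) (rule sum.cong[OF refl], rule sum.swap)
  also have "\<dots> = (\<Sum>k=1..M. \<Sum>m=k..M. f k * (\<Sum>l=1..M. \<Sum>n=l..M. b m n * g l))"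
    by (subst sum_triangle_swap) (subst sum_triangle_swap, rule refl)
  also have "\<dots> = (\<Sum>k=1..M. \<Sum>l=1..M. \<Sum>m=k..M. \<Sum>n=l..M. b m n * f k * g l)"
    by (simp add: sum_distrib_left mult_ac) (rule sum.cong[OF refl], rule sum.swap)
  finally show ?thesis by (simp add: sum_distrib_right)
qed

lemma measurable_fdiff [measurable]:
  assumes [measurable]: "f \<in> borel_measurable borel"
  shows "fdiff \<alpha> h f \<in> borel_measurable borel"
  unfolding fdiff_def[abs_def] by measurable

lemma measurable_dirichlet [measurable]: "dirichlet m \<in> borel_measurable borel"
  unfolding dirichlet_def[abs_def] by measurable

lemma measurable_cutoff_ker [measurable]: "cutoff_ker \<alpha> h m \<in> borel_measurable borel"
  unfolding cutoff_ker_def[abs_def] by measurable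

lemma cutoff_ker_periodic [simp]: "cutoff_ker \<alpha> h m (x + 2 * pi) = cutoff_ker \<alpha> h m x"
  unfolding cutoff_ker_def by simp

text \<open>The pointwise majorant is a weighted series of translates of one positive function
  \<open>\<Phi>\<close>. Jensen's inequality for the summable weights and translation invariance
  bound every finite section by the norm of \<open>\<Phi>\<close>, the Hardy--Littlewood inequality
  bounds that norm, and Fatou's lemma passes to the whole series.\<close>

lemma Lp_fdiff_dirichlet:
  fixes p \<alpha>1 \<alpha>2 :: real
  assumes p: "1 < p" and \<alpha>: "0 < \<alpha>1" "0 < \<alpha>2"
  obtains C where "C > 0"
    "\<And>h1 h2 M b. (\<And>m n. 0 \<le> b m n) \<Longrightarrow>
      (\<integral>\<^sup>+z. ennreal ((\<Sum>m=1..M. \<Sum>n=1..M. b m n * \<bar>fdiff \<alpha>1 h1 (dirichlet m) (fst z)\<bar>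
          * \<bar>fdiff \<alpha>2 h2 (dirichlet n) (snd z)\<bar>) powr p) \<partial>sq)
      \<le> ennreal (C * (\<Sum>k=1..M. \<Sum>l=1..M. real k powr (p - 2) * real l powr (p - 2) *
          ((\<Sum>m=k..M. \<Sum>n=l..M. b m n) * cutoff \<alpha>1 \<bar>h1\<bar> k * cutoff \<alpha>2 \<bar>h2\<bar> l) powr p))"
proof -
  obtain C where C: "C > 0" and K: "\<And>m A. (\<And>k l. 0 \<le> A k l) \<Longrightarrow>
       (\<integral>\<^sup>+z. ennreal ((\<Sum>k=1..m. \<Sum>l=1..m. A k l * ker k (fst z) * ker l (snd z)) powr p) \<partial>sq)
       \<le> ennreal (C * (\<Sum>k=1..m. \<Sum>l=1..m. real k powr (p - 2) * real l powr (p - 2) * A k l powr p))"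
    using hardy_littlewood_kernel_2[OF p] by blast
  define w v where "w = shift_weight \<alpha>1" and "v = shift_weight \<alpha>2"
  define W V where "W = suminf w" and "V = suminf v"
  have w0: "0 \<le> w i" "0 \<le> v i" for i by (simp_all add: w_def v_def)
  have sw: "summable w" "summable v" unfolding w_def v_def using \<alpha> by (auto intro: summable_shift_weight)
  have Wle: "(\<Sum>i<I. w i) \<le> W" "(\<Sum>i<I. v i) \<le> V" for I
    unfolding W_def V_def using sum_le_suminf[OF sw(1)] sum_le_suminf[OF sw(2)] w0 by auto
  have WV0: "0 \<le> W" "0 \<le> V" using Wle[of 0] by auto
  define D where "D = (4 * 2 powr (\<alpha>1 + 1)) * (4 * 2 powr (\<alpha>2 + 1))"
  have D: "D > 0" by (simp add: D_def)
  show ?thesis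
  \<comment> \<open>The summand 1 makes the constant positive without a separate proof that the
    total weights are.\<close>
  proof (rule that[of "D powr p * (((W * V) powr (p - 1) * (W * V) + 1) * C)"])
    show "0 < D powr p * (((W * V) powr (p - 1) * (W * V) + 1) * C)"
      using C D WV0 by (auto intro!: mult_pos_pos add_nonneg_pos)
    fix h1 h2 M and b :: "nat \<Rightarrow> nat \<Rightarrow> real" assume b: "\<And>m n. 0 \<le> b m n"
    define S where "S = (\<Sum>k=1..M. \<Sum>l=1..M. real k powr (p - 2) * real l powr (p - 2) *
          ((\<Sum>m=k..M. \<Sum>n=l..M. b m n) * cutoff \<alpha>1 \<bar>h1\<bar> k * cutoff \<alpha>2 \<bar>h2\<bar> l) powr p)"
    have S0: "0 \<le> S" unfolding S_def by (intro sum_nonneg) auto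
    define P Q where "P = cutoff_ker \<alpha>1 \<bar>h1\<bar>" and "Q = cutoff_ker \<alpha>2 \<bar>h2\<bar>"
    have PQ0 [simp]: "0 \<le> P m x" "0 \<le> Q m x" for m x by (simp_all add: P_def Q_def)
    have [measurable]: "P m \<in> borel_measurable borel" "Q m \<in> borel_measurable borel" for m
      by (simp_all add: P_def Q_def)
    define \<Phi> where "\<Phi> z = (\<Sum>m=1..M. \<Sum>n=1..M. b m n * P m (fst z) * Q n (snd z))" for z
    have \<Phi>0: "0 \<le> \<Phi> z" for z unfolding \<Phi>_def using b by (intro sum_nonneg) auto
    have [measurable]: "\<Phi> \<in> borel_measurable borel"
      unfolding \<Phi>_def[abs_def] by (simp only: borel_prod[symmetric]) measurable
    have \<Phi>int: "(\<integral>\<^sup>+z. ennreal (\<Phi> z powr p) \<partial>sq) \<le> ennreal (C * S)"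
    proof -
      have "\<Phi> z = (\<Sum>k=1..M. \<Sum>l=1..M. ((\<Sum>m=k..M. \<Sum>n=l..M. b m n) * cutoff \<alpha>1 \<bar>h1\<bar> k * cutoff \<alpha>2 \<bar>h2\<bar> l) * ker k (fst z) * ker l (snd z))" for z
        unfolding \<Phi>_def P_def Q_def cutoff_ker_def by (subst sum_quad_swap) (simp add: mult_ac)
      then show ?thesis unfolding S_def using b by (simp only:) (intro K mult_nonneg_nonneg sum_nonneg, auto)
    qed
    define s t where "s = shift_by \<alpha>1 h1" and "t = shift_by \<alpha>2 h2"
    have \<Phi>shift: "(\<integral>\<^sup>+z. ennreal (\<Phi> (fst z + a, snd z + c) powr p) \<partial>sq) \<le> ennreal (C * S)" for a c
    proof -
      have "(\<integral>\<^sup>+z. ennreal (\<Phi> (fst z + a, snd z + c) powr p) \<partial>sq) = (\<integral>\<^sup>+z. ennreal (\<Phi> z powr p) \<partial>sq)"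
        by (rule nn_integral_sq_shift[of "\<lambda>z. ennreal (\<Phi> z powr p)"]) (measurable, simp_all add: \<Phi>_def P_def Q_def)
      then show ?thesis using \<Phi>int by simp
    qed
    \<comment> \<open>Square sections of the double series of translates; they carry total weight at
      most \<open>W * V\<close>, uniformly in \<open>I\<close>.\<close>
    define G where "G I z = (\<Sum>i<I. \<Sum>j<I. (w i * v j) * \<Phi> (fst z + s i, snd z + t j))" for I z
    have G0: "0 \<le> G I z" for I z unfolding G_def using w0 \<Phi>0 by (intro sum_nonneg) auto
    have [measurable]: "(\<lambda>z. \<Phi> (fst z + a, snd z + c)) \<in> borel_measurable borel" for a c
      by (rule measurable_compose[of "\<lambda>z. (fst z + a, snd z + c)" borel borel \<Phi>])
         (intro borel_measurable_continuous_onI continuous_intros, measurable)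
    have [measurable]: "G I \<in> borel_measurable borel" for I
      unfolding G_def[abs_def] by measurable
    have Gint: "(\<integral>\<^sup>+z. ennreal (G I z powr p) \<partial>sq) \<le> ennreal ((W * V) powr (p - 1) * (W * V) * (C * S))" for I
    proof -
      define J where "J = {..<I} \<times> {..<I}"
      define wt where "wt ij = w (fst ij) * v (snd ij)" for ij
      have wt0: "0 \<le> wt ij" for ij by (simp add: wt_def w0)
      have wtle: "(\<Sum>ij\<in>J. wt ij) \<le> W * V"
      proof -
        have "(\<Sum>ij\<in>J. wt ij) = (\<Sum>i<I. w i) * (\<Sum>j<I. v j)"
          unfolding J_def wt_def by (simp add: sum_product sum.cartesian_product split_def)
        also have "\<dots> \<le> W * V" using Wle w0 WV0 by (intro mult_mono sum_nonneg) auto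
        finally show ?thesis .
      qed
      have pt: "G I z powr p \<le> (W * V) powr (p - 1) * (\<Sum>ij\<in>J. wt ij * \<Phi> (fst z + s (fst ij), snd z + t (snd ij)) powr p)" for z
      proof -
        have eq: "G I z = (\<Sum>ij\<in>J. wt ij * \<Phi> (fst z + s (fst ij), snd z + t (snd ij)))"
          unfolding G_def J_def wt_def by (simp add: sum.cartesian_product split_def)
        have "G I z powr p \<le> (\<Sum>ij\<in>J. wt ij) powr (p - 1) * (\<Sum>ij\<in>J. wt ij * \<Phi> (fst z + s (fst ij), snd z + t (snd ij)) powr p)"
          unfolding eq using p wt0 \<Phi>0 by (intro jensen_sum_powr) (auto simp: J_def)
        also have "\<dots> \<le> (W * V) powr (p - 1) * (\<Sum>ij\<in>J. wt ij * \<Phi> (fst z + s (fst ij), snd z + t (snd ij)) powr p)"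
          using p wt0 wtle by (intro mult_right_mono powr_mono2 sum_nonneg) auto
        finally show ?thesis .
      qed
      have "(\<integral>\<^sup>+z. ennreal (G I z powr p) \<partial>sq)
        \<le> (\<integral>\<^sup>+z. ennreal ((W * V) powr (p - 1)) * (\<Sum>ij\<in>J. ennreal (wt ij) * ennreal (\<Phi> (fst z + s (fst ij), snd z + t (snd ij)) powr p)) \<partial>sq)"
      proof (intro nn_integral_mono)
        fix z
        have "ennreal (G I z powr p) \<le> ennreal ((W * V) powr (p - 1) * (\<Sum>ij\<in>J. wt ij * \<Phi> (fst z + s (fst ij), snd z + t (snd ij)) powr p))"
          by (rule ennreal_leI[OF pt])
        then show "ennreal (G I z powr p) \<le> ennreal ((W * V) powr (p - 1)) * (\<Sum>ij\<in>J. ennreal (wt ij) * ennreal (\<Phi> (fst z + s (fst ij), snd z + t (snd ij)) powr p))"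
          using wt0 by (subst sum_ennreal_mult) (auto simp: ennreal_mult sum_nonneg)
      qed
      also have "\<dots> = ennreal ((W * V) powr (p - 1)) * (\<Sum>ij\<in>J. ennreal (wt ij) * (\<integral>\<^sup>+z. ennreal (\<Phi> (fst z + s (fst ij), snd z + t (snd ij)) powr p) \<partial>sq))"
        by (subst nn_integral_cmult, measurable) (subst nn_integral_sum, measurable, simp add: nn_integral_cmult)
      also have "\<dots> \<le> ennreal ((W * V) powr (p - 1)) * (\<Sum>ij\<in>J. ennreal (wt ij) * ennreal (C * S))"
        by (intro mult_left_mono sum_mono \<Phi>shift) auto
      also have "\<dots> = ennreal ((W * V) powr (p - 1) * ((\<Sum>ij\<in>J. wt ij) * (C * S)))"
        using wt0 C S0 by (subst sum_ennreal_mult) (auto simp: ennreal_mult sum_nonneg sum_distrib_right)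
      also have "\<dots> \<le> ennreal ((W * V) powr (p - 1) * ((W * V) * (C * S)))"
        using wtle C S0 by (intro ennreal_leI mult_left_mono mult_right_mono) auto
      finally show ?thesis by (simp add: mult_ac)
    qed
    define L where "L z = (\<Sum>m=1..M. \<Sum>n=1..M. b m n * (\<Sum>i. w i * P m (fst z + s i)) * (\<Sum>j. v j * Q n (snd z + t j)))" for z
    have sP: "summable (\<lambda>i. w i * P m (x + s i))" "summable (\<lambda>i. v i * Q m (x + t i))" for m x
    proof -
      show "summable (\<lambda>i. w i * P m (x + s i))" unfolding w_def P_def
        using \<alpha> cutoff_ker_le[of \<alpha>1 "\<bar>h1\<bar>" m]
        by (intro summable_shift_weight_mult[where f = "cutoff_ker \<alpha>1 \<bar>h1\<bar> m" and B = "real m"]) auto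
      show "summable (\<lambda>i. v i * Q m (x + t i))" unfolding v_def Q_def
        using \<alpha> cutoff_ker_le[of \<alpha>2 "\<bar>h2\<bar>" m]
        by (intro summable_shift_weight_mult[where f = "cutoff_ker \<alpha>2 \<bar>h2\<bar> m" and B = "real m"]) auto
    qed
    have L0: "0 \<le> L z" for z
      unfolding L_def using b w0 sP by (intro sum_nonneg mult_nonneg_nonneg suminf_nonneg) auto
    \<comment> \<open>Moving the finite sums over m and n outside turns each section into products
      of one-variable partial sums, which converge separately.\<close>
    have GL: "(\<lambda>I. G I z) \<longlonglongrightarrow> L z" for z
    proof -
      have "G I z = (\<Sum>m=1..M. \<Sum>n=1..M. b m n * (\<Sum>i<I. w i * P m (fst z + s i)) * (\<Sum>j<I. v j * Q n (snd z + t j)))" for I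
      proof -
        have "G I z = (\<Sum>i<I. \<Sum>j<I. \<Sum>m=1..M. \<Sum>n=1..M. b m n * (w i * P m (fst z + s i)) * (v j * Q n (snd z + t j)))"
          unfolding G_def \<Phi>_def by (simp add: sum_distrib_left mult_ac)
        also have "\<dots> = (\<Sum>i<I. \<Sum>m=1..M. \<Sum>j<I. \<Sum>n=1..M. b m n * (w i * P m (fst z + s i)) * (v j * Q n (snd z + t j)))"
          by (rule sum.cong[OF refl], rule sum.swap)
        also have "\<dots> = (\<Sum>m=1..M. \<Sum>i<I. \<Sum>j<I. \<Sum>n=1..M. b m n * (w i * P m (fst z + s i)) * (v j * Q n (snd z + t j)))"
          by (rule sum.swap)
        also have "\<dots> = (\<Sum>m=1..M. \<Sum>i<I. \<Sum>n=1..M. \<Sum>j<I. b m n * (w i * P m (fst z + s i)) * (v j * Q n (snd z + t j)))"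
          by (rule sum.cong[OF refl], rule sum.cong[OF refl], rule sum.swap)
        also have "\<dots> = (\<Sum>m=1..M. \<Sum>n=1..M. \<Sum>i<I. \<Sum>j<I. b m n * (w i * P m (fst z + s i)) * (v j * Q n (snd z + t j)))"
          by (rule sum.cong[OF refl], rule sum.swap)
        finally show ?thesis by (simp add: sum_distrib_left sum_distrib_right mult_ac)
      qed
      then show ?thesis unfolding L_def
        by (simp only:) (intro tendsto_intros summable_LIMSEQ sP)
    qed
    have Lint: "(\<integral>\<^sup>+z. ennreal (L z powr p) \<partial>sq) \<le> ennreal ((W * V) powr (p - 1) * (W * V) * (C * S))"
    proof (rule nn_integral_le_of_tendsto[OF _ _ Gint])
      show "AE z in sq. (\<lambda>I. ennreal (G I z powr p)) \<longlonglongrightarrow> ennreal (L z powr p)"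
        using GL G0 p by (intro AE_I2 tendsto_ennrealI tendsto_powr') (auto intro!: tendsto_intros)
    qed measurable
    have ptw: "(\<Sum>m=1..M. \<Sum>n=1..M. b m n * \<bar>fdiff \<alpha>1 h1 (dirichlet m) (fst z)\<bar>
          * \<bar>fdiff \<alpha>2 h2 (dirichlet n) (snd z)\<bar>) \<le> D * L z" for z
    proof -
      have "(\<Sum>m=1..M. \<Sum>n=1..M. b m n * \<bar>fdiff \<alpha>1 h1 (dirichlet m) (fst z)\<bar> * \<bar>fdiff \<alpha>2 h2 (dirichlet n) (snd z)\<bar>)
        \<le> (\<Sum>m=1..M. \<Sum>n=1..M. b m n * (4 * 2 powr (\<alpha>1 + 1) * (\<Sum>i. w i * P m (fst z + s i)))
            * (4 * 2 powr (\<alpha>2 + 1) * (\<Sum>j. v j * Q n (snd z + t j))))"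
      proof (intro sum_mono mult_mono)
        fix m n
        show "\<bar>fdiff \<alpha>1 h1 (dirichlet m) (fst z)\<bar> \<le> 4 * 2 powr (\<alpha>1 + 1) * (\<Sum>i. w i * P m (fst z + s i))"
          unfolding w_def P_def s_def by (rule abs_fdiff_dirichlet_le[OF \<alpha>(1)])
        show "\<bar>fdiff \<alpha>2 h2 (dirichlet n) (snd z)\<bar> \<le> 4 * 2 powr (\<alpha>2 + 1) * (\<Sum>j. v j * Q n (snd z + t j))"
          unfolding v_def Q_def t_def by (rule abs_fdiff_dirichlet_le[OF \<alpha>(2)])
        show "0 \<le> b m n * (4 * 2 powr (\<alpha>1 + 1) * (\<Sum>i. w i * P m (fst z + s i)))"
          using b w0 sP by (intro mult_nonneg_nonneg suminf_nonneg) auto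
      qed (use b in auto)
      also have "\<dots> = D * L z" unfolding L_def D_def by (simp add: sum_distrib_left mult_ac)
      finally show ?thesis .
    qed
    have "(\<integral>\<^sup>+z. ennreal ((\<Sum>m=1..M. \<Sum>n=1..M. b m n * \<bar>fdiff \<alpha>1 h1 (dirichlet m) (fst z)\<bar>
          * \<bar>fdiff \<alpha>2 h2 (dirichlet n) (snd z)\<bar>) powr p) \<partial>sq)
      \<le> (\<integral>\<^sup>+z. ennreal (D powr p) * ennreal (L z powr p) \<partial>sq)"
    proof (intro nn_integral_mono)
      fix z
      have "(\<Sum>m=1..M. \<Sum>n=1..M. b m n * \<bar>fdiff \<alpha>1 h1 (dirichlet m) (fst z)\<bar>
          * \<bar>fdiff \<alpha>2 h2 (dirichlet n) (snd z)\<bar>) powr p \<le> (D * L z) powr p"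
        using p b by (intro powr_mono2 ptw sum_nonneg) auto
      also have "\<dots> = D powr p * L z powr p" by (rule powr_mult)
      finally show "ennreal ((\<Sum>m=1..M. \<Sum>n=1..M. b m n * \<bar>fdiff \<alpha>1 h1 (dirichlet m) (fst z)\<bar>
          * \<bar>fdiff \<alpha>2 h2 (dirichlet n) (snd z)\<bar>) powr p) \<le> ennreal (D powr p) * ennreal (L z powr p)"
        by (simp add: ennreal_leI flip: ennreal_mult)
    qed
    also have "\<dots> = ennreal (D powr p) * (\<integral>\<^sup>+z. ennreal (L z powr p) \<partial>sq)"
    proof (rule nn_integral_cmult)
      have "L \<in> borel_measurable borel" by (rule borel_measurable_LIMSEQ_metric[OF _ GL]) measurable
      then show "(\<lambda>z. ennreal (L z powr p)) \<in> borel_measurable sq" by measurable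
    qed
    also have "\<dots> \<le> ennreal (D powr p) * ennreal ((W * V) powr (p - 1) * (W * V) * (C * S))"
      by (intro mult_left_mono Lint) auto
    also have "\<dots> = ennreal (D powr p * ((W * V) powr (p - 1) * (W * V) * (C * S)))"
      by (simp flip: ennreal_mult')
    also have "\<dots> \<le> ennreal (D powr p * (((W * V) powr (p - 1) * (W * V) + 1) * C) * S)"
    proof (intro ennreal_leI)
      have "(W * V) powr (p - 1) * (W * V) * (C * S) \<le> ((W * V) powr (p - 1) * (W * V) + 1) * (C * S)"
        using C S0 by (intro mult_right_mono) auto
      then show "D powr p * ((W * V) powr (p - 1) * (W * V) * (C * S)) \<le> D powr p * (((W * V) powr (p - 1) * (W * V) + 1) * C) * S"
        using mult_left_mono[of _ _ "D powr p"] by (simp add: mult.assoc)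
    qed
    finally show "(\<integral>\<^sup>+z. ennreal ((\<Sum>m=1..M. \<Sum>n=1..M. b m n * \<bar>fdiff \<alpha>1 h1 (dirichlet m) (fst z)\<bar>
          * \<bar>fdiff \<alpha>2 h2 (dirichlet n) (snd z)\<bar>) powr p) \<partial>sq)
      \<le> ennreal (D powr p * (((W * V) powr (p - 1) * (W * V) + 1) * C) * (\<Sum>k=1..M. \<Sum>l=1..M. real k powr (p - 2) * real l powr (p - 2) *
          ((\<Sum>m=k..M. \<Sum>n=l..M. b m n) * cutoff \<alpha>1 \<bar>h1\<bar> k * cutoff \<alpha>2 \<bar>h2\<bar> l) powr p))"
      unfolding S_def .
  qed
qed

section \<open>Decay and uniqueness of Fourier coefficients\<close>

lemma sq_eq_density: "sq = density lborel (\<lambda>z. indicator period_square z)"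
proof -
  have "sigma_finite_measure (density lborel (\<lambda>x::real. indicator {0..2 * pi} x :: ennreal))"
    using circ.sigma_finite_measure_axioms by (simp add: circ_def)
  then have "sq = density (lborel \<Otimes>\<^sub>M lborel) (\<lambda>(x, y). indicator {0..2 * pi} x * indicator {0..2 * pi} y)"
    unfolding sq_def circ_def by (intro pair_measure_density) (auto intro: sigma_finite_lborel)
  also have "(\<lambda>(x, y). indicator {0..2 * pi} x * indicator {0..2 * pi} y) = (\<lambda>z. indicator period_square z :: ennreal)"
    by (auto simp: period_square_def indicator_def)
  finally show ?thesis by (simp add: lborel_prod)
qed

interpretation sq: finite_measure sq
  unfolding sq_def by (intro finite_measure_pair_measure circ.finite_measure_axioms)

lemma period_square_borel [measurable]: "period_square \<in> sets borel"
  unfolding period_square_def by (intro borel_closed closed_Times) auto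

lemma integral_sq: "f \<in> borel_measurable borel \<Longrightarrow> (\<integral>z. f z \<partial>sq) = (LINT z:period_square|lborel. f z)"
  for f :: "real \<times> real \<Rightarrow> real"
  unfolding sq_eq_density set_lebesgue_integral_def
  by (subst integral_density[of f lborel "\<lambda>z. indicator period_square z", symmetric]) (auto simp: ennreal_indicator)

lemma integrable_sq: "f \<in> borel_measurable borel \<Longrightarrow> integrable sq f \<longleftrightarrow> set_integrable lborel period_square f"
  for f :: "real \<times> real \<Rightarrow> real"
  unfolding sq_eq_density set_integrable_def
  using integrable_density[of f lborel "\<lambda>z. indicator period_square z"] by (simp add: ennreal_indicator)

text \<open>The bridge from Lebesgue-measurable functions to Borel representatives; product measures
  and Fubini are used only on the Borel side.\<close>

lemma set_integral_lebesgue_sq: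
  fixes f g :: "real \<times> real \<Rightarrow> real"
  assumes "f \<in> borel_measurable lebesgue" "g \<in> borel_measurable borel" "AE z in lborel. f z = g z"
  shows "(LINT z:period_square|lebesgue. f z) = (\<integral>z. g z \<partial>sq)"
    and "set_integrable lebesgue period_square f \<longleftrightarrow> integrable sq g"
proof -
  have g: "g \<in> borel_measurable lebesgue" using assms(2) by (intro measurable_completion) simp
  have ae: "AE z in lebesgue. indicator period_square z *\<^sub>R f z = indicator period_square z *\<^sub>R g z"
    using AE_completion[OF assms(3)] by (auto elim: eventually_mono)
  have Q: "period_square \<in> sets lebesgue" by auto
  have m: "(\<lambda>z. indicator period_square z *\<^sub>R f z) \<in> borel_measurable lebesgue"
     "(\<lambda>z. indicator period_square z *\<^sub>R g z) \<in> borel_measurable lebesgue"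
    by (intro borel_measurable_scaleR borel_measurable_indicator Q assms(1) g)+
  have m': "(\<lambda>z. indicator period_square z *\<^sub>R g z) \<in> borel_measurable lborel"
    using assms(2) by simp
  have "(LINT z:period_square|lebesgue. f z) = (LINT z:period_square|lborel. g z)"
    unfolding set_lebesgue_integral_def
    using integral_cong_AE[OF m ae] integral_completion[OF m'] by simp
  then show "(LINT z:period_square|lebesgue. f z) = (\<integral>z. g z \<partial>sq)" using integral_sq[OF assms(2)] by simp
  show "set_integrable lebesgue period_square f \<longleftrightarrow> integrable sq g"
    unfolding integrable_sq[OF assms(2)] set_integrable_def
    using integrable_cong_AE[OF m ae] integrable_completion[OF m'] by simp
qed

section \<open>Orthogonality relations and the Riemann--Lebesgue lemma\<close>

lemma integral_circ_cos: "(\<integral>x. cos (real k * x + \<phi>) \<partial>circ) = (if k = 0 then 2 * pi * cos \<phi> else 0)"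
proof -
  have "(\<integral>x. cos (real k * x + \<phi>) \<partial>circ) = (\<integral>x. indicator {0..2*pi} x *\<^sub>R cos (real k * x + \<phi>) \<partial>lborel)"
    unfolding circ_def by (subst integral_density[symmetric]) (auto simp: ennreal_indicator)
  also have "\<dots> = (if k = 0 then 2 * pi * cos \<phi> else 0)"
  proof (cases "k = 0")
    case False
    have "(\<integral>x. indicator {0..2*pi} x *\<^sub>R cos (real k * x + \<phi>) \<partial>lborel)
      = sin (real k * (2*pi) + \<phi>) / real k - sin (real k * 0 + \<phi>) / real k"
      by (rule integral_FTC_Icc)
         (use False in \<open>auto intro!: derivative_eq_intros continuous_intros simp: has_real_derivative_iff_has_vector_derivative[symmetric]\<close>)
    moreover have "sin (real k * (2*pi) + \<phi>) = sin \<phi>"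
      using sin.plus_of_nat[of \<phi> k] by (simp add: add.commute mult_ac)
    ultimately show ?thesis using False by simp
  qed simp
  finally show ?thesis .
qed

lemma integral_circ_cos_cos:
  "(\<integral>x. cos (real j * x + \<phi>) * cos (real k * x + \<psi>) \<partial>circ) =
     (if j \<noteq> k then 0 else if j = 0 then 2 * pi * cos \<phi> * cos \<psi> else pi * cos (\<phi> - \<psi>))"
proof -
  have int: "integrable circ (\<lambda>x. cos (real k * x + \<phi>) / 2)" for k \<phi>
    by (rule circ.integrable_const_bound[where B = 1]) (auto intro!: AE_I2 order_trans[OF abs_cos_le_one])
  \<comment> \<open>The difference j - k of naturals is meaningful only for k \<le> j; the other
    case follows by exchanging the two factors.\<close>
  have *: "(\<integral>x. cos (real j * x + \<phi>) * cos (real k * x + \<psi>) \<partial>circ) =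
     (if j \<noteq> k then 0 else if j = 0 then 2 * pi * cos \<phi> * cos \<psi> else pi * cos (\<phi> - \<psi>))"
    if "k \<le> j" for j k \<phi> \<psi>
  proof -
    have "cos (real j * x + \<phi>) * cos (real k * x + \<psi>)
       = cos (real (j - k) * x + (\<phi> - \<psi>)) / 2 + cos (real (j + k) * x + (\<phi> + \<psi>)) / 2" for x
      using that by (simp add: cos_times_cos of_nat_diff algebra_simps add_divide_distrib)
    then have "(\<integral>x. cos (real j * x + \<phi>) * cos (real k * x + \<psi>) \<partial>circ)
      = (\<integral>x. cos (real (j - k) * x + (\<phi> - \<psi>)) \<partial>circ) / 2 + (\<integral>x. cos (real (j + k) * x + (\<phi> + \<psi>)) \<partial>circ) / 2"
      using int[of "j - k"] int[of "j + k"] by (simp del: of_nat_add)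
    then show ?thesis using that unfolding integral_circ_cos
      by (auto simp: cos_add cos_diff algebra_simps add_divide_distrib diff_divide_distrib)
  qed
  show ?thesis
  proof (cases "k \<le> j")
    case False
    then show ?thesis using *[of j k \<psi> \<phi>] by (simp add: mult.commute)
  qed (rule *)
qed

lemma integral_sq_mult:
  fixes f g :: "real \<Rightarrow> real"
  assumes [measurable]: "f \<in> borel_measurable borel" "g \<in> borel_measurable borel"
    and b: "\<And>x. \<bar>f x\<bar> \<le> B" "\<And>x. \<bar>g x\<bar> \<le> B"
  shows "(\<integral>z. f (fst z) * g (snd z) \<partial>sq) = (\<integral>x. f x \<partial>circ) * (\<integral>y. g y \<partial>circ)"
proof -
  have "integrable (circ \<Otimes>\<^sub>M circ) (\<lambda>z. f (fst z) * g (snd z))"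
  proof (rule finite_measure.integrable_const_bound[where B = "B * B"])
    show "finite_measure (circ \<Otimes>\<^sub>M circ)" using sq.finite_measure_axioms by (simp add: sq_def)
    have "0 \<le> B" using b(1)[of 0] by linarith
    then show "AE z in circ \<Otimes>\<^sub>M circ. norm (f (fst z) * g (snd z)) \<le> B * B"
      using b by (auto simp: abs_mult intro!: mult_mono)
  qed measurable
  then have "(\<integral>x. \<integral>y. f x * g y \<partial>circ \<partial>circ) = (\<integral>z. f (fst z) * g (snd z) \<partial>(circ \<Otimes>\<^sub>M circ))"
    using circ2.integral_fst'[of "\<lambda>z. f (fst z) * g (snd z)"] by simp
  then show ?thesis by (simp add: sq_def)
qed

text \<open>Bessel's inequality gives the claim for bounded functions, whose squared coefficients
  are summable. An integrable function need not be square integrable, so it is truncated; the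
  truncation error in the mean bounds all coefficient errors at once because \<bar>e m x\<bar> \<le>
  1.\<close>

lemma (in finite_measure) orthogonal_coeffs_tendsto_0:
  fixes g :: "'a \<Rightarrow> real" and e :: "nat \<Rightarrow> 'a \<Rightarrow> real"
  assumes g: "integrable M g" and e [measurable]: "\<And>m. e m \<in> borel_measurable M"
    and e1: "\<And>m x. \<bar>e m x\<bar> \<le> 1"
    and orth: "\<And>m k. m \<noteq> k \<Longrightarrow> (\<integral>x. e m x * e k x \<partial>M) = 0"
  shows "(\<lambda>m. \<integral>x. g x * e m x \<partial>M) \<longlonglongrightarrow> 0"
proof -
  have [measurable]: "g \<in> borel_measurable M" using g by auto
  have bdd: "(\<lambda>m. \<integral>x. f x * e m x \<partial>M) \<longlonglongrightarrow> 0"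
    if [measurable]: "f \<in> borel_measurable M" and fR: "\<And>x. \<bar>f x\<bar> \<le> R" for f R
  proof -
    define c where "c m = (\<integral>x. f x * e m x \<partial>M)" for m
    \<comment> \<open>Bounds the squared norms of all \<open>e m\<close>; the added 1 keeps it
      positive for a null measure.\<close>
    define A where "A = measure M (space M) + 1"
    have A: "A > 0" unfolding A_def by (simp add: add_nonneg_pos)
    have R: "0 \<le> R" using fR[of undefined] by linarith
    have ie: "integrable M (\<lambda>x. e m x * e k x)" for m k
      by (rule integrable_const_bound[where B = 1]) (use e1 in \<open>auto simp: abs_mult intro!: mult_le_one\<close>)
    have if1: "integrable M (\<lambda>x. f x * e m x)" for m
      by (rule integrable_const_bound[where B = "R * 1"]) (use e1 fR R in \<open>auto simp: abs_mult intro!: mult_mono[of _ R _ 1, simplified]\<close>)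
    have "\<bar>f x\<bar> * \<bar>f x\<bar> \<le> R * R" for x using fR[of x] R by (intro mult_mono) auto
    then have if2: "integrable M (\<lambda>x. f x * f x)"
      by (intro integrable_const_bound[where B = "R * R"]) auto
    have e2: "(\<integral>x. e m x * e m x \<partial>M) \<le> A" for m
    proof -
      have "e m x * e m x \<le> 1" for x using e1[of m x] by (metis abs_mult_self_eq abs_ge_zero mult_le_one)
      then have "(\<integral>x. e m x * e m x \<partial>M) \<le> (\<integral>x. 1 \<partial>M)"
        by (intro integral_mono ie) auto
      then show ?thesis by (simp add: A_def)
    qed
    have bessel: "(\<Sum>m<N. c m * c m) \<le> A * (\<integral>x. f x * f x \<partial>M)" for N
    proof -
      \<comment> \<open>Expanding the square of f - t S leaves the terms - 2 t + t * t * A in front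
        of the sum of squares; this choice minimizes them and yields - 1 / A.\<close>
      define t where "t = 1 / A"
      define S where "S x = (\<Sum>m<N. c m * e m x)" for x
      have SS: "S x * S x = (\<Sum>m<N. \<Sum>k<N. (c m * c k) * (e m x * e k x))" for x
        unfolding S_def by (simp add: sum_product mult_ac)
      have fS: "f x * S x = (\<Sum>m<N. c m * (f x * e m x))" for x
        unfolding S_def by (simp add: sum_distrib_left mult_ac)
      have iS: "integrable M (\<lambda>x. S x * S x)" "integrable M (\<lambda>x. f x * S x)"
        unfolding SS fS using ie if1 by auto
      have IS: "(\<integral>x. S x * S x \<partial>M) \<le> A * (\<Sum>m<N. c m * c m)"
      proof -
        have "(\<integral>x. S x * S x \<partial>M) = (\<Sum>m<N. \<Sum>k<N. (c m * c k) * (\<integral>x. e m x * e k x \<partial>M))"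
          unfolding SS using ie by simp
        also have "\<dots> = (\<Sum>m<N. \<Sum>k<N. if k = m then (c m * c m) * (\<integral>x. e m x * e m x \<partial>M) else 0)"
          using orth by (intro sum.cong refl) auto
        also have "\<dots> = (\<Sum>m<N. (c m * c m) * (\<integral>x. e m x * e m x \<partial>M))" by simp
        also have "\<dots> \<le> (\<Sum>m<N. (c m * c m) * A)" by (intro sum_mono mult_left_mono e2) auto
        finally show ?thesis by (simp add: sum_distrib_left mult.commute)
      qed
      have If: "(\<integral>x. f x * S x \<partial>M) = (\<Sum>m<N. c m * c m)"
        unfolding fS using if1 by (simp add: c_def)
      have "0 \<le> (\<integral>x. (f x - t * S x) * (f x - t * S x) \<partial>M)" by (intro integral_nonneg_AE) auto
      also have "\<dots> = (\<integral>x. (f x * f x - 2 * t * (f x * S x)) + t * t * (S x * S x) \<partial>M)"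
        by (simp add: algebra_simps)
      also have "\<dots> = (\<integral>x. f x * f x \<partial>M) - 2 * t * (\<Sum>m<N. c m * c m) + t * t * (\<integral>x. S x * S x \<partial>M)"
        using if2 iS If by simp
      also have "\<dots> \<le> (\<integral>x. f x * f x \<partial>M) - 2 * t * (\<Sum>m<N. c m * c m) + t * t * (A * (\<Sum>m<N. c m * c m))"
        using IS by (intro add_left_mono mult_left_mono) auto
      also have "\<dots> = (\<integral>x. f x * f x \<partial>M) - (\<Sum>m<N. c m * c m) / A"
        using A by (simp add: t_def)
      finally show ?thesis using A by (simp add: field_simps)
    qed
    have "summable (\<lambda>m. c m * c m)"
      by (rule summableI_nonneg_bounded[OF _ bessel]) auto
    then have "(\<lambda>m. (c m)\<^sup>2) \<longlonglongrightarrow> 0" using summable_LIMSEQ_zero by (simp add: power2_eq_square)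
    then have "(\<lambda>m. sqrt ((c m)\<^sup>2)) \<longlonglongrightarrow> sqrt 0" by (rule tendsto_real_sqrt)
    then have "c \<longlonglongrightarrow> 0" by (intro tendsto_rabs_zero_cancel[of c]) simp
    then show ?thesis by (simp add: c_def[abs_def])
  qed
  \<comment> \<open>Large values are replaced by 0, not clipped, so that \<bar>g\<bar> itself
    dominates the error.\<close>
  define gR where "gR R x = (if \<bar>g x\<bar> \<le> real R then g x else 0)" for R :: nat and x
  have [measurable]: "gR R \<in> borel_measurable M" for R unfolding gR_def[abs_def] by measurable
  have lim: "(\<lambda>R. \<integral>x. \<bar>g x - gR R x\<bar> \<partial>M) \<longlonglongrightarrow> (\<integral>x. 0 \<partial>M)"
  proof (rule integral_dominated_convergence[where w = "\<lambda>x. \<bar>g x\<bar>"])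
    show "AE x in M. (\<lambda>R. \<bar>g x - gR R x\<bar>) \<longlonglongrightarrow> 0"
    proof (rule AE_I2)
      fix x
      have "\<forall>\<^sub>F R in sequentially. \<bar>g x\<bar> \<le> real R"
        by (metis (mono_tags, lifting) eventually_sequentiallyI nat_ceiling_le_eq)
      then have "\<forall>\<^sub>F R in sequentially. \<bar>g x - gR R x\<bar> = 0" by eventually_elim (simp add: gR_def)
      then show "(\<lambda>R. \<bar>g x - gR R x\<bar>) \<longlonglongrightarrow> 0" by (rule tendsto_eventually)
    qed
    show "AE x in M. norm \<bar>g x - gR i x\<bar> \<le> \<bar>g x\<bar>" for i by (auto simp: gR_def)
  qed (use g in auto)
  have igR: "integrable M (gR R)" for R
    by (rule integrable_const_bound[where B = "real R"]) (auto simp: gR_def)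
  show ?thesis
  proof (rule LIMSEQ_I)
    fix r :: real assume r: "0 < r"
    have "\<forall>\<^sub>F R in sequentially. (\<integral>x. \<bar>g x - gR R x\<bar> \<partial>M) < r / 2"
      using order_tendstoD(2)[OF lim, of "r / 2"] r by simp
    then obtain R where R: "(\<integral>x. \<bar>g x - gR R x\<bar> \<partial>M) < r / 2"
      by (auto simp: eventually_sequentially)
    have "(\<lambda>m. \<bar>\<integral>x. gR R x * e m x \<partial>M\<bar>) \<longlonglongrightarrow> 0"
      by (intro tendsto_rabs_zero bdd[where R = "real R"]) (auto simp: gR_def)
    then have "\<forall>\<^sub>F m in sequentially. \<bar>\<integral>x. gR R x * e m x \<partial>M\<bar> < r / 2"
      using r by (intro order_tendstoD(2)) auto
    then obtain N where N: "\<And>m. m \<ge> N \<Longrightarrow> \<bar>\<integral>x. gR R x * e m x \<partial>M\<bar> < r / 2"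
      unfolding eventually_sequentially by blast
    have ii: "integrable M (\<lambda>x. h x * e m x)" if "integrable M h" for h m
    proof (rule Bochner_Integration.integrable_bound[OF that])
      show "AE x in M. norm (h x * e m x) \<le> norm (h x)" using e1 by (auto simp: abs_mult mult_left_le)
    qed (use that in auto)
    have "\<bar>\<integral>x. g x * e m x \<partial>M\<bar> < r" if "m \<ge> N" for m
    proof -
      have "(\<integral>x. g x * e m x \<partial>M) = (\<integral>x. (g x - gR R x) * e m x \<partial>M) + (\<integral>x. gR R x * e m x \<partial>M)"
        using ii[OF g, of m] ii[OF igR, of R m] by (simp add: left_diff_distrib)
      also have "\<bar>\<dots>\<bar> \<le> \<bar>\<integral>x. (g x - gR R x) * e m x \<partial>M\<bar> + \<bar>\<integral>x. gR R x * e m x \<partial>M\<bar>" by simp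
      also have "\<bar>\<integral>x. (g x - gR R x) * e m x \<partial>M\<bar> \<le> (\<integral>x. \<bar>g x - gR R x\<bar> \<partial>M)"
      proof -
        have "\<bar>\<integral>x. (g x - gR R x) * e m x \<partial>M\<bar> \<le> (\<integral>x. \<bar>(g x - gR R x) * e m x\<bar> \<partial>M)"
          by (rule integral_abs_bound)
        also have "\<dots> \<le> (\<integral>x. \<bar>g x - gR R x\<bar> \<partial>M)"
        proof (intro integral_mono integrable_abs ii)
          show "integrable M (\<lambda>x. g x - gR R x)" using g igR by auto
          then show "integrable M (\<lambda>x. g x - gR R x)" .
          show "\<bar>(g x - gR R x) * e m x\<bar> \<le> \<bar>g x - gR R x\<bar>" for x using e1 by (simp add: abs_mult mult_left_le)
        qed
        finally show ?thesis .
      qed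
      finally show ?thesis using R N[OF that] by linarith
    qed
    then show "\<exists>N. \<forall>m\<ge>N. norm ((\<integral>x. g x * e m x \<partial>M) - 0) < r" by auto
  qed
qed

section \<open>Uniqueness of double Fourier coefficients\<close>

lemma cos_mult_cos_split:
  "cos (real j * x + \<phi>) * cos (x - c) = (if j = 0 then cos \<phi> * cos (real 1 * x + (- c))
     else (cos (real (j + 1) * x + (\<phi> - c)) + cos (real (j - 1) * x + (\<phi> + c))) / 2)"
proof (cases "j = 0")
  case False
  then have "real j * x + \<phi> - (x - c) = real (j - 1) * x + (\<phi> + c)"
    "real j * x + \<phi> + (x - c) = real (j + 1) * x + (\<phi> - c)"
    by (simp_all add: of_nat_diff algebra_simps)
  then show ?thesis using False by (simp only: cos_times_cos if_False) simp
qed simp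

text \<open>Continuous ramps of slope i decrease to nothing outside the half-line and reach 1
  inside; Weierstrass approximates the i-th ramp within 1 / (i + 1). The uniform bound 2 later
  serves as dominating constant.\<close>

lemma polynomial_indicator_approx:
  fixes r :: real
  obtains P :: "nat \<Rightarrow> real \<Rightarrow> real" where "\<And>i. real_polynomial_function (P i)"
    "\<And>i u. u \<in> {-1..1} \<Longrightarrow> \<bar>P i u\<bar> \<le> 2"
    "\<And>u. u \<in> {-1..1} \<Longrightarrow> (\<lambda>i. P i u) \<longlonglongrightarrow> indicator {r<..} u"
proof -
  define q where "q i u = min 1 (max 0 (real i * (u - r)))" for i u
  have "\<exists>P. real_polynomial_function P \<and> (\<forall>u\<in>{-1..1}. \<bar>q i u - P u\<bar> < 1 / (real i + 1))" for i
  proof -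
    have "continuous_on {-1..1} (q i)" unfolding q_def by (intro continuous_intros)
    then obtain g where "real_polynomial_function g" "\<And>u. u \<in> {-1..1} \<Longrightarrow> \<bar>q i u - g u\<bar> < 1 / (real i + 1)"
      using Stone_Weierstrass_real_polynomial_function[of "{-1..1::real}" "q i" "1 / (real i + 1)"] by auto
    then show ?thesis by blast
  qed
  then obtain P where P: "\<And>i. real_polynomial_function (P i)"
    "\<And>i u. u \<in> {-1..1} \<Longrightarrow> \<bar>q i u - P i u\<bar> < 1 / (real i + 1)" by metis
  show ?thesis
  proof (rule that[of P])
    show "real_polynomial_function (P i)" for i by (rule P)
    fix u :: real assume u: "u \<in> {-1..1}"
    have "\<bar>P i u\<bar> \<le> 2" for i
    proof -
      have "1 / (real i + 1) \<le> 1" by simp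
      moreover have "\<bar>q i u\<bar> \<le> 1" by (simp add: q_def)
      ultimately show ?thesis using P(2)[OF u, of i] by linarith
    qed
    then show "\<bar>P i u\<bar> \<le> 2" for i .
    have ql: "(\<lambda>i. q i u) \<longlonglongrightarrow> indicator {r<..} u"
    proof (cases "r < u")
      case True
      have "\<forall>\<^sub>F i in sequentially. 1 \<le> real i * (u - r)"
        using True by (intro eventually_sequentiallyI[of "nat \<lceil>1 / (u - r)\<rceil>"]) (simp add: field_simps nat_le_iff ceiling_le_iff)
      then have "\<forall>\<^sub>F i in sequentially. q i u = 1" by eventually_elim (simp add: q_def)
      then show ?thesis using True by (auto intro: tendsto_eventually)
    next
      case False
      then have "real i * (u - r) \<le> 0" for i by (intro mult_nonneg_nonpos) auto
      then have "q i u = 0" for i by (simp add: q_def)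
      then show ?thesis using False by simp
    qed
    have "(\<lambda>i. q i u - P i u) \<longlonglongrightarrow> 0"
    proof (rule Lim_null_comparison)
      show "\<forall>\<^sub>F i in sequentially. norm (q i u - P i u) \<le> 1 / (real i + 1)"
        using P(2)[OF u] by (auto intro!: always_eventually less_imp_le)
      show "(\<lambda>i. 1 / (real i + 1)) \<longlonglongrightarrow> 0" by real_asymp
    qed
    from tendsto_diff[OF ql this] show "(\<lambda>i. P i u) \<longlonglongrightarrow> indicator {r<..} u" by simp
  qed
qed

text \<open>Inside a period this set is the interval from 0 to \<open>s\<close>; as a superlevel set of
  \<open>cos (x - s / 2)\<close> it has an indicator approximable by trigonometric polynomials.\<close>

definition initial_arc :: "real \<Rightarrow> real set" where
  "initial_arc s = {x. cos (s / 2) < cos (x - s / 2)}"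

lemma initial_arc_borel [measurable]: "initial_arc s \<in> sets borel"
  unfolding initial_arc_def by measurable

text \<open>The cosine of the distance to the midpoint s / 2 exceeds cos (s / 2) exactly when that
  distance, measured around the circle, is below s / 2. The last case goes round the other way,
  replacing the distance d by 2 pi - d.\<close>

lemma initial_arc_eq:
  assumes s: "0 < s" "s \<le> 2 * pi" and x: "0 < x" "x < 2 * pi"
  shows "x \<in> initial_arc s \<longleftrightarrow> x < s"
proof -
  consider "x < s" | "s \<le> x" "x - s / 2 \<le> pi" | "pi < x - s / 2" by linarith
  then show ?thesis
  proof cases
    case 1
    then have "\<bar>x - s / 2\<bar> < s / 2" unfolding abs_less_iff using x by linarith
    then have "cos (s / 2) < cos \<bar>x - s / 2\<bar>" using s by (intro cos_monotone_0_pi) auto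
    then show ?thesis using 1 by (simp add: initial_arc_def)
  next
    case 2
    then have "cos (x - s / 2) \<le> cos (s / 2)" using s x by (intro cos_monotone_0_pi_le) auto
    then show ?thesis using 2 by (simp add: initial_arc_def)
  next
    case 3
    have "cos (2 * pi - (x - s / 2)) \<le> cos (s / 2)" using s x 3 by (intro cos_monotone_0_pi_le) auto
    then have "cos (x - s / 2) \<le> cos (s / 2)" by simp
    then show ?thesis using 3 s by (simp add: initial_arc_def)
  qed
qed

text \<open>Vanishing against all cosines extends to polynomials in cos (X - c) by the product
  formula, and by dominated convergence to the indicator of a superlevel set of cos (X - c). The
  abstract \<open>X\<close> allows use in either coordinate.\<close>

lemma integral_initial_arc_eq_0:
  fixes h :: "'a \<Rightarrow> real" and X :: "'a \<Rightarrow> real"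
  assumes h: "integrable M h" and [measurable]: "X \<in> borel_measurable M"
    and zero: "\<And>j \<phi>. (\<integral>z. h z * cos (real j * X z + \<phi>) \<partial>M) = 0"
  shows "(\<integral>z. h z * indicator (initial_arc s) (X z) \<partial>M) = 0"
proof -
  have [measurable]: "h \<in> borel_measurable M" using h by auto
  define c where "c = s / 2"
  have ib: "integrable M (\<lambda>z. h z * \<psi> z)" if "\<psi> \<in> borel_measurable M" "\<And>z. \<bar>\<psi> z\<bar> \<le> B" for \<psi> B
  proof (rule Bochner_Integration.integrable_bound[where f = "\<lambda>z. h z * B"])
    show "AE z in M. norm (h z * \<psi> z) \<le> norm (h z * B)"
      using that(2) by (auto simp: abs_mult intro!: mult_left_mono order_trans[OF that(2)] AE_I2)
  qed (use h that in auto)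
  have ii: "integrable M (\<lambda>z. h z * (cos (real j * X z + \<phi>) * cos (X z - c) ^ n))" for j \<phi> n
    by (rule ib[where B = 1]) (auto simp: abs_mult power_abs intro!: mult_le_one power_le_one)
  \<comment> \<open>The frequency and phase must be general in the induction, since each factor cos
    (X - c) shifts both.\<close>
  have pw: "(\<integral>z. h z * (cos (real j * X z + \<phi>) * cos (X z - c) ^ n) \<partial>M) = 0" for n j \<phi>
  proof (induction n arbitrary: j \<phi>)
    case (Suc n)
    have "h z * (cos (real j * X z + \<phi>) * cos (X z - c) ^ Suc n) =
       (if j = 0 then cos \<phi> * (h z * (cos (real 1 * X z + (- c)) * cos (X z - c) ^ n))
        else (h z * (cos (real (j + 1) * X z + (\<phi> - c)) * cos (X z - c) ^ n)
            + h z * (cos (real (j - 1) * X z + (\<phi> + c)) * cos (X z - c) ^ n)) / 2)" for z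
    proof -
      have "h z * (cos (real j * X z + \<phi>) * cos (X z - c) ^ Suc n)
        = h z * ((cos (real j * X z + \<phi>) * cos (X z - c)) * cos (X z - c) ^ n)" by simp
      also have "\<dots> = (if j = 0 then cos \<phi> * (h z * (cos (real 1 * X z + (- c)) * cos (X z - c) ^ n))
        else (h z * (cos (real (j + 1) * X z + (\<phi> - c)) * cos (X z - c) ^ n)
            + h z * (cos (real (j - 1) * X z + (\<phi> + c)) * cos (X z - c) ^ n)) / 2)"
        unfolding cos_mult_cos_split by (simp add: algebra_simps add_divide_distrib)
      finally show ?thesis .
    qed
    then show ?case
      using Suc.IH[of 1 "- c"] Suc.IH[of "j + 1" "\<phi> - c"] Suc.IH[of "j - 1" "\<phi> + c"]
        ii[of "j + 1" "\<phi> - c" n] ii[of "j - 1" "\<phi> + c" n]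
      by (cases "j = 0") (simp_all only: if_True if_False, simp_all)
  qed (use zero in simp)
  obtain P where P: "\<And>i. real_polynomial_function (P i)" "\<And>i u. u \<in> {-1..1} \<Longrightarrow> \<bar>P i u\<bar> \<le> 2"
    "\<And>u. u \<in> {-1..1} \<Longrightarrow> (\<lambda>i. P i u) \<longlonglongrightarrow> indicator {cos c<..} u"
    using polynomial_indicator_approx[of "cos c"] by blast
  have Pz: "(\<integral>z. h z * P i (cos (X z - c)) \<partial>M) = 0" for i
  proof -
    obtain a n where a: "P i = (\<lambda>x. \<Sum>k\<le>n. a k * x ^ k)"
      using P(1)[of i] unfolding real_polynomial_function_iff_sum by blast
    have 0: "(\<integral>z. h z * cos (X z - c) ^ k \<partial>M) = 0" "integrable M (\<lambda>z. h z * cos (X z - c) ^ k)" for k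
      using pw[of 0 0 k] ii[of 0 0 k] by simp_all
    have "h z * P i (cos (X z - c)) = (\<Sum>k\<le>n. a k * (h z * cos (X z - c) ^ k))" for z
      unfolding a by (simp add: sum_distrib_left mult_ac)
    then show ?thesis using 0 by simp
  qed
  have [measurable]: "P i \<in> borel_measurable borel" for i
    using P(1)[of i] unfolding real_polynomial_function_iff_sum by auto
  have "(\<lambda>i. \<integral>z. h z * P i (cos (X z - c)) \<partial>M) \<longlonglongrightarrow> (\<integral>z. h z * indicator {cos c<..} (cos (X z - c)) \<partial>M)"
  proof (rule integral_dominated_convergence[where w = "\<lambda>z. \<bar>h z\<bar> * 2"])
    show "AE z in M. (\<lambda>i. h z * P i (cos (X z - c))) \<longlonglongrightarrow> h z * indicator {cos c<..} (cos (X z - c))"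
      by (intro AE_I2 tendsto_intros P(3)) auto
    show "AE z in M. norm (h z * P i (cos (X z - c))) \<le> \<bar>h z\<bar> * 2" for i
      by (intro AE_I2) (auto simp: abs_mult intro!: mult_left_mono P(2))
  qed (use h in auto)
  then have "(\<integral>z. h z * indicator {cos c<..} (cos (X z - c)) \<partial>M) = 0"
    unfolding Pz by (simp add: LIMSEQ_const_iff)
  also have "(\<lambda>z. h z * indicator {cos c<..} (cos (X z - c))) = (\<lambda>z. h z * indicator (initial_arc s) (X z))"
    by (auto simp: indicator_def initial_arc_def c_def)
  finally show ?thesis .
qed

lemma AE_sq_interior: "AE z in sq. 0 < fst z \<and> fst z < 2 * pi \<and> 0 < snd z \<and> snd z < 2 * pi"
proof -
  have 1: "AE x in circ. 0 < x \<and> x < 2 * pi"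
  proof -
    have "AE x in lborel. x \<in> {0..2 * pi} \<longrightarrow> 0 < x \<and> x < 2 * pi"
      using AE_lborel_singleton[of 0] AE_lborel_singleton[of "2 * pi"] by eventually_elim auto
    then show ?thesis unfolding circ_def by (subst AE_density) (auto simp: indicator_def)
  qed
  have 2: "{z \<in> space (circ \<Otimes>\<^sub>M circ). 0 < fst z \<and> fst z < 2 * pi \<and> 0 < snd z \<and> snd z < 2 * pi} \<in> sets (circ \<Otimes>\<^sub>M circ)"
    by measurable
  have "AE x in circ. AE y in circ. 0 < x \<and> x < 2 * pi \<and> 0 < y \<and> y < 2 * pi"
    using 1 by eventually_elim (use 1 in \<open>auto elim: eventually_mono\<close>)
  then show ?thesis unfolding sq_def
    using 2 by (intro circ2.AE_pair_measure) (auto simp: space_pair_measure)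
qed

text \<open>One arc in each coordinate shows that g has integral 0 over every box with a corner at
  the origin. These boxes are stable under intersection and generate the Borel sets, so the
  densities given by the positive and negative parts of g are the same measure.\<close>

lemma fourier_unique_sq:
  fixes g :: "real \<times> real \<Rightarrow> real"
  assumes g: "integrable sq g"
    and zero: "\<And>j k \<phi> \<psi>. (\<integral>z. g z * cos (real j * fst z + \<phi>) * cos (real k * snd z + \<psi>) \<partial>sq) = 0"
  shows "AE z in sq. g z = 0"
proof -
  have gm: "g \<in> borel_measurable borel" using g by (auto dest: borel_measurable_integrable)
  have gm' [measurable]: "g \<in> borel_measurable sq" using g by auto
  have fm [measurable]: "fst \<in> borel_measurable sq" "snd \<in> borel_measurable sq"
    by (auto simp: sq_def)
  have ib: "integrable sq (\<lambda>z. g z * \<psi> z)" if "\<psi> \<in> borel_measurable sq" "\<And>z. \<bar>\<psi> z\<bar> \<le> 1" for \<psi>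
  proof (rule Bochner_Integration.integrable_bound[OF g])
    show "AE z in sq. norm (g z * \<psi> z) \<le> norm (g z)"
      using that(2) by (auto simp: abs_mult mult_left_le)
  qed (use that in auto)
  have 1: "(\<integral>z. (g z * cos (real k * snd z + \<psi>)) * indicator (initial_arc s) (fst z) \<partial>sq) = 0" for k \<psi> s
    by (rule integral_initial_arc_eq_0) (use zero[of _ _ k \<psi>] in \<open>auto intro!: ib simp: mult_ac\<close>)
  have 2: "(\<integral>z. (g z * indicator (initial_arc s) (fst z)) * indicator (initial_arc t) (snd z) \<partial>sq) = 0" for s t
    by (rule integral_initial_arc_eq_0) (use 1[of _ _ s] in \<open>auto intro!: ib simp: mult_ac indicator_def\<close>)
  \<comment> \<open>As \<open>ennreal\<close> sends negative numbers to 0, ennreal (g z) and ennreal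
    (- g z) are the positive and the negative part.\<close>
  have eq: "(\<integral>\<^sup>+z. ennreal (g z) * (indicator {..<a} (fst z) * indicator {..<b} (snd z)) \<partial>sq)
      = (\<integral>\<^sup>+z. ennreal (- g z) * (indicator {..<a} (fst z) * indicator {..<b} (snd z)) \<partial>sq)" for a b
  proof (cases "0 < a \<and> 0 < b")
    case False
    have "(\<integral>\<^sup>+z. ennreal (u z) * (indicator {..<a} (fst z) * indicator {..<b} (snd z)) \<partial>sq) = (\<integral>\<^sup>+z. 0 \<partial>sq)" for u
    proof (rule nn_integral_cong_AE)
      show "AE z in sq. ennreal (u z) * (indicator {..<a} (fst z) * indicator {..<b} (snd z)) = 0"
        using AE_sq_interior by eventually_elim (use False in \<open>auto simp: indicator_def\<close>)
    qed
    then show ?thesis by simp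
  next
    case True
    define s t where "s = min a (2 * pi)" and "t = min b (2 * pi)"
    have st: "0 < s" "s \<le> 2 * pi" "0 < t" "t \<le> 2 * pi" using True by (auto simp: s_def t_def)
    define h where "h z = (g z * indicator (initial_arc s) (fst z)) * indicator (initial_arc t) (snd z)" for z
    have ih: "integrable sq h"
    proof -
      have "integrable sq (\<lambda>z. g z * (indicator (initial_arc s) (fst z) * indicator (initial_arc t) (snd z)))"
        by (rule ib) (auto simp: indicator_def)
      then show ?thesis by (simp add: h_def[abs_def] mult.assoc)
    qed
    have "(\<integral>\<^sup>+z. ennreal (h z) \<partial>sq) = (\<integral>\<^sup>+z. ennreal (- h z) \<partial>sq)"
    proof -
      have fin: "(\<integral>\<^sup>+z. ennreal (h z) \<partial>sq) < \<infinity>" "(\<integral>\<^sup>+z. ennreal (- h z) \<partial>sq) < \<infinity>"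
        using ih by (auto simp: real_integrable_def top.not_eq_extremum)
      have "enn2real (\<integral>\<^sup>+z. ennreal (h z) \<partial>sq) = enn2real (\<integral>\<^sup>+z. ennreal (- h z) \<partial>sq)"
        using real_lebesgue_integral_def[OF ih] 2[of s t] by (simp add: h_def[abs_def])
      then show ?thesis using fin by (metis ennreal_enn2real infinity_ennreal_def)
    qed
    moreover have "AE z in sq. ennreal (g z) * (indicator {..<a} (fst z) * indicator {..<b} (snd z)) = ennreal (h z)
        \<and> ennreal (- g z) * (indicator {..<a} (fst z) * indicator {..<b} (snd z)) = ennreal (- h z)"
      using AE_sq_interior
    proof eventually_elim
      case (elim z)
      then have "fst z \<in> initial_arc s \<longleftrightarrow> fst z < a" "snd z \<in> initial_arc t \<longleftrightarrow> snd z < b"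
        using st by (auto simp: initial_arc_eq s_def t_def)
      then show ?case by (auto simp: h_def indicator_def)
    qed
    ultimately have
      "(\<integral>\<^sup>+z. ennreal (g z) * (indicator {..<a} (fst z) * indicator {..<b} (snd z)) \<partial>sq) = (\<integral>\<^sup>+z. ennreal (- h z) \<partial>sq)"
      "(\<integral>\<^sup>+z. ennreal (- g z) * (indicator {..<a} (fst z) * indicator {..<b} (snd z)) \<partial>sq) = (\<integral>\<^sup>+z. ennreal (- h z) \<partial>sq)"
      by (auto cong: nn_integral_cong_AE)
    then show ?thesis by simp
  qed
  have lt': "{z. eucl_less z a} = {z. fst z < fst a \<and> snd z < snd a}" for a :: "real \<times> real"
    unfolding eucl_less_def by (cases a) (auto simp: Basis_prod_def)
  have lt: "{z. eucl_less z (a, b)} = {z. fst z < a \<and> snd z < b}" for a b :: real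
      unfolding eucl_less_def by (auto simp: Basis_prod_def)
  have dens: "density sq (\<lambda>z. ennreal (g z)) = density sq (\<lambda>z. ennreal (- g z))"
  proof (rule measure_eqI_generator_eq[where E = "range (\<lambda>a. {z. eucl_less z a})" and \<Omega> = UNIV and A = "\<lambda>i. {z. eucl_less z (real i, real i)}"])
    show "Int_stable (range (\<lambda>a::real \<times> real. {z. eucl_less z a}))"
    proof (rule Int_stableI)
      fix A B assume "A \<in> range (\<lambda>a::real \<times> real. {z. eucl_less z a})" "B \<in> range (\<lambda>a::real \<times> real. {z. eucl_less z a})"
      then obtain a b :: "real \<times> real" where ab: "A = {z. eucl_less z a}" "B = {z. eucl_less z b}" by auto
      have "A \<inter> B = {z. eucl_less z (min (fst a) (fst b), min (snd a) (snd b))}"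
        unfolding ab lt' by auto
      then show "A \<inter> B \<in> range (\<lambda>a::real \<times> real. {z. eucl_less z a})" by blast
    qed
    show "emeasure (density sq (\<lambda>z. ennreal (g z))) X = emeasure (density sq (\<lambda>z. ennreal (- g z))) X"
      if "X \<in> range (\<lambda>a::real \<times> real. {z. eucl_less z a})" for X
    proof -
      from that obtain a b where X: "X = {z. fst z < a \<and> snd z < b}" using lt by auto
      have "X \<in> sets sq" unfolding X by measurable
      moreover have "indicator X z = (indicator {..<a} (fst z) * indicator {..<b} (snd z) :: ennreal)" for z
        by (auto simp: X indicator_def)
      ultimately show ?thesis using eq[of a b] by (simp add: emeasure_density)
    qed
    show "sets (density sq (\<lambda>z. ennreal (g z))) = sigma_sets UNIV (range (\<lambda>a. {z. eucl_less z a}))"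
      "sets (density sq (\<lambda>z. ennreal (- g z))) = sigma_sets UNIV (range (\<lambda>a. {z. eucl_less z a}))"
      by (simp_all add: borel_eq_lessThan)
    show "(\<Union>i. {z. eucl_less z (real i, real i)}) = UNIV"
    proof -
      have "\<exists>i. fst z < real i \<and> snd z < real i" for z :: "real \<times> real"
        using reals_Archimedean2[of "max (fst z) (snd z)"] by auto
      then show ?thesis unfolding lt by auto
    qed
    show "emeasure (density sq (\<lambda>z. ennreal (g z))) {z. eucl_less z (real i, real i)} \<noteq> \<infinity>" for i
    proof -
      have "emeasure (density sq (\<lambda>z. ennreal (g z))) {z. eucl_less z (real i, real i)} \<le> (\<integral>\<^sup>+z. ennreal (g z) \<partial>sq)"
        unfolding lt by (subst emeasure_density) (auto intro!: nn_integral_mono simp: indicator_def)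
      also have "\<dots> < \<infinity>" using g by (auto simp: real_integrable_def top.not_eq_extremum)
      finally show ?thesis by simp
    qed
  qed auto
  have "AE z in sq. ennreal (g z) = ennreal (- g z)"
    using dens g by (subst (asm) finite_density_unique) (auto simp: real_integrable_def)
  then show ?thesis
  proof eventually_elim
    case (elim z)
    then show ?case by (cases "0 \<le> g z") (auto simp: ennreal_neg ennreal_eq_0_iff)
  qed
qed

section \<open>Duality with trigonometric test functions\<close>

text \<open>Young's inequality without the sharp constants: the first or the second summand
  dominates according to whether y is at most x powr (p - 1).\<close>

lemma mult_le_powr_add_powr:
  fixes x y p q :: real
  assumes p: "1 < p" and q: "q = p / (p - 1)" and xy: "0 \<le> x" "0 \<le> y"
  shows "x * y \<le> x powr p + y powr q"
proof (cases "y \<le> x powr (p - 1)")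
  case True
  have "x * y \<le> x * x powr (p - 1)" using True xy by (intro mult_left_mono) auto
  also have "\<dots> = x powr p" using xy by (cases "x = 0") (auto simp: powr_mult_base)
  finally show ?thesis by (simp add: add_increasing2)
next
  case False
  have y: "0 < y" using False powr_ge_zero[of x "p - 1"] xy by linarith
  have "x = (x powr (p - 1)) powr (1 / (p - 1))" using p xy by (simp add: powr_powr)
  also have "\<dots> \<le> y powr (1 / (p - 1))" using False p by (intro powr_mono2) auto
  finally have "x * y \<le> y powr (1 / (p - 1)) * y" using xy by (intro mult_right_mono) auto
  also have "\<dots> = y powr (1 + 1 / (p - 1))" using y by (simp add: powr_add)
  also have "1 + 1 / (p - 1) = q" using p q by (simp add: field_simps)
  finally show ?thesis by (simp add: add_increasing)
qed

text \<open>The converse of Hoelder's inequality in additive form. Testing with the extremal b,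
  scaled by a small t, makes both sums multiples of the target sum \<open>W\<close>; t is small
  enough that the error term absorbs only half of the left-hand side.\<close>

lemma duality_bound:
  fixes p q c C :: real
  assumes p: "1 < p" and q: "q = p / (p - 1)" and c: "0 < c" and C: "0 < C"
  obtains K where "K > 0"
    "\<And>J x r I. finite J \<Longrightarrow> (\<And>j. j \<in> J \<Longrightarrow> 0 < x j) \<Longrightarrow> (\<And>j. j \<in> J \<Longrightarrow> 0 \<le> r j) \<Longrightarrow>
       (\<And>b. (\<And>j. 0 \<le> b j) \<Longrightarrow> c * (\<Sum>j\<in>J. b j * x j * r j) \<le> I + C * (\<Sum>j\<in>J. x j powr (2 * q - 2) * b j powr q)) \<Longrightarrow>
       (\<Sum>j\<in>J. x j powr (p - 2) * r j powr p) \<le> K * (I::real)"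
proof -
  \<comment> \<open>Solves C * t powr q = t * c / 2, so that half of the main term survives.\<close>
  define t where "t = (c / (2 * C)) powr (1 / (q - 1))"
  have q1: "q - 1 = 1 / (p - 1)" using p q by (simp add: field_simps)
  then have q1': "0 < q - 1" using p by simp
  have t: "0 < t" using c C by (simp add: t_def)
  have tq: "C * t powr q = t * c / 2"
  proof -
    have "t powr q = t * t powr (q - 1)" using t by (simp add: powr_mult_base)
    also have "t powr (q - 1) = c / (2 * C)" unfolding t_def using q1' c C by (simp add: powr_powr)
    finally show ?thesis using C by simp
  qed
  show ?thesis
  proof (rule that[of "2 / (t * c)"])
    show "0 < 2 / (t * c)" using t c by simp
    fix J and x r :: "'a \<Rightarrow> real" and I :: real
    assume J: "finite J" and x: "\<And>j. j \<in> J \<Longrightarrow> 0 < x j" and r: "\<And>j. j \<in> J \<Longrightarrow> 0 \<le> r j"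
      and H: "\<And>b. (\<And>j. 0 \<le> b j) \<Longrightarrow> c * (\<Sum>j\<in>J. b j * x j * r j) \<le> I + C * (\<Sum>j\<in>J. x j powr (2 * q - 2) * b j powr q)"
    define W where "W = (\<Sum>j\<in>J. x j powr (p - 2) * r j powr p)"
    \<comment> \<open>The equality case of Hoelder's inequality: as (p - 1) q = p, both x powr (p -
      3) * x and x powr (2 q - 2 + (p - 3) q) equal x powr (p - 2), and the powers of r match as
      well.\<close>
    define b where "b j = t * (x j powr (p - 3) * r j powr (p - 1))" for j
    have 1: "(\<Sum>j\<in>J. b j * x j * r j) = t * W"
      unfolding W_def sum_distrib_left
    proof (intro sum.cong refl)
      fix j assume j: "j \<in> J"
      have "x j powr (p - 3) * x j = x j powr (p - 2)"
        using x[OF j] powr_mult_base[of "x j" "p - 3"] by (simp add: mult.commute)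
      moreover have "r j powr (p - 1) * r j = r j powr p"
        using r[OF j] powr_mult_base[of "r j" "p - 1"] by (cases "r j = 0") (auto simp: mult.commute)
      moreover have "b j * x j * r j = t * ((x j powr (p - 3) * x j) * (r j powr (p - 1) * r j))"
        by (simp add: b_def mult_ac)
      ultimately show "b j * x j * r j = t * (x j powr (p - 2) * r j powr p)" by simp
    qed
    have 2: "(\<Sum>j\<in>J. x j powr (2 * q - 2) * b j powr q) = t powr q * W"
      unfolding W_def sum_distrib_left
    proof (intro sum.cong refl)
      fix j assume j: "j \<in> J"
      have e: "(p - 1) * q = p" using p q by simp
      have "b j powr q = t powr q * (x j powr ((p - 3) * q) * r j powr ((p - 1) * q))"
        unfolding b_def by (simp add: powr_mult powr_powr)
      moreover have "x j powr (2 * q - 2) * x j powr ((p - 3) * q) = x j powr (p - 2)"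
      proof -
        have "(2 * q - 2) + (p - 3) * q = p - 2" using e by (simp add: algebra_simps)
        then show ?thesis unfolding powr_add[symmetric] by (rule arg_cong)
      qed
      ultimately show "x j powr (2 * q - 2) * b j powr q = t powr q * (x j powr (p - 2) * r j powr p)"
        using e by (simp add: mult_ac)
    qed
    have "c * (t * W) \<le> I + C * (t powr q * W)"
      using H[of b] t unfolding 1 2 by (simp add: b_def)
    also have "C * (t powr q * W) = t * c / 2 * W" using tq by (simp add: mult.assoc[symmetric])
    finally have "W * (t * c) \<le> 2 * I" by (simp add: algebra_simps)
    then show "(\<Sum>j\<in>J. x j powr (p - 2) * r j powr p) \<le> 2 / (t * c) * I"
      unfolding W_def[symmetric] using t c by (simp add: field_simps)
  qed
qed

text \<open>The shift and the phase will be tuned to make the multipliers of a difference positive;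
  \<open>lo\<close> discards frequencies at which this is impossible.\<close>

definition trig_block :: "nat \<Rightarrow> real \<Rightarrow> real \<Rightarrow> nat \<Rightarrow> real \<Rightarrow> real" where
  "trig_block lo s \<theta> m x = (\<Sum>k=lo..m. cos (real k * (x + s) + \<theta>))"

definition test_fun where
  "test_fun M b U V z = (\<Sum>m=1..M. \<Sum>n=1..M. b m n * U m (fst z) * V n (snd z))"
  for M :: nat and b :: "nat \<Rightarrow> nat \<Rightarrow> real" and U V :: "nat \<Rightarrow> real \<Rightarrow> real"

lemma borel_measurable_fst_snd:
  fixes g :: "real \<Rightarrow> real"
  assumes "g \<in> borel_measurable borel"
  shows borel_measurable_comp_fst: "(\<lambda>z :: real \<times> real. g (fst z)) \<in> borel_measurable borel"
    and borel_measurable_comp_snd: "(\<lambda>z :: real \<times> real. g (snd z)) \<in> borel_measurable borel"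
  by (rule measurable_compose[OF borel_measurable_continuous_onI assms], intro continuous_intros)+

lemma trig_block_measurable [measurable]: "trig_block lo s \<theta> m \<in> borel_measurable borel"
  unfolding trig_block_def[abs_def] by measurable

lemma test_fun_measurable [measurable]:
  assumes "\<And>m. U m \<in> borel_measurable borel" "\<And>m. V m \<in> borel_measurable borel"
  shows "test_fun M b U V \<in> borel_measurable borel"
  unfolding test_fun_def[abs_def]
  by (intro borel_measurable_sum borel_measurable_times borel_measurable_const
      borel_measurable_comp_fst[OF assms(1)] borel_measurable_comp_snd[OF assms(2)])

text \<open>A block ending at m is bounded by 2 m * ker m at the shifted point, whatever its start
  and phase, and translation invariance removes the shift. Hence the constant is uniform in all
  these parameters. The factors m n enter the Hardy--Littlewood sum with power q, turning q - 2 into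
  2 q - 2.\<close>

lemma Lp_test_fun:
  fixes q :: real
  assumes q: "1 < q"
  obtains C where "C > 0"
    "\<And>M b (lo1::nat) s1 \<theta>1 (lo2::nat) s2 \<theta>2. (\<And>m n. 0 \<le> b m n) \<Longrightarrow> 1 \<le> lo1 \<Longrightarrow> 1 \<le> lo2 \<Longrightarrow>
      (\<integral>\<^sup>+z. ennreal (\<bar>test_fun M b (trig_block lo1 s1 \<theta>1) (trig_block lo2 s2 \<theta>2) z\<bar> powr q) \<partial>sq)
      \<le> ennreal (C * (\<Sum>m=1..M. \<Sum>n=1..M. (real m * real n) powr (2 * q - 2) * b m n powr q))"
proof -
  obtain C where C: "C > 0" and K: "\<And>m A. (\<And>k l. 0 \<le> A k l) \<Longrightarrow>
       (\<integral>\<^sup>+z. ennreal ((\<Sum>k=1..m. \<Sum>l=1..m. A k l * ker k (fst z) * ker l (snd z)) powr q) \<partial>sq)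
       \<le> ennreal (C * (\<Sum>k=1..m. \<Sum>l=1..m. real k powr (q - 2) * real l powr (q - 2) * A k l powr q))"
    using hardy_littlewood_kernel_2[OF q] by blast
  show ?thesis
  proof (rule that[of "C * 4 powr q"])
    show "C * 4 powr q > 0" using C by simp
    fix M lo1 lo2 :: nat and b :: "nat \<Rightarrow> nat \<Rightarrow> real" and s1 \<theta>1 s2 \<theta>2 :: real
    assume b: "\<And>m n. 0 \<le> b m n" and lo: "1 \<le> lo1" "1 \<le> lo2"
    define g where "g = test_fun M b (trig_block lo1 s1 \<theta>1) (trig_block lo2 s2 \<theta>2)"
    define \<Phi> where "\<Phi> z = (\<Sum>m=1..M. \<Sum>n=1..M. (4 * (real m * real n) * b m n) * ker m (fst z) * ker n (snd z))" for z
    have [measurable]: "\<Phi> \<in> borel_measurable borel" unfolding \<Phi>_def[abs_def]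
      by (intro borel_measurable_sum borel_measurable_times borel_measurable_const
          borel_measurable_comp_fst[OF ker_measurable] borel_measurable_comp_snd[OF ker_measurable])
    have pt: "\<bar>g z\<bar> \<le> \<Phi> (fst z + s1, snd z + s2)" for z
    proof -
      have "\<bar>g z\<bar> \<le> (\<Sum>m=1..M. \<Sum>n=1..M. \<bar>b m n * trig_block lo1 s1 \<theta>1 m (fst z) * trig_block lo2 s2 \<theta>2 n (snd z)\<bar>)"
        unfolding g_def test_fun_def by (rule order_trans[OF sum_abs]) (intro sum_mono sum_abs)
      also have "\<dots> \<le> (\<Sum>m=1..M. \<Sum>n=1..M. b m n * (2 * real m * ker m (fst z + s1)) * (2 * real n * ker n (snd z + s2)))"
        unfolding abs_mult trig_block_def using b lo by (intro sum_mono mult_mono abs_sum_cos_le) auto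
      also have "\<dots> = \<Phi> (fst z + s1, snd z + s2)" unfolding \<Phi>_def by (simp add: mult_ac)
      finally show ?thesis .
    qed
    have "(\<integral>\<^sup>+z. ennreal (\<bar>g z\<bar> powr q) \<partial>sq) \<le> (\<integral>\<^sup>+z. ennreal (\<Phi> (fst z + s1, snd z + s2) powr q) \<partial>sq)"
      using q pt by (intro nn_integral_mono ennreal_leI powr_mono2) auto
    also have "\<dots> = (\<integral>\<^sup>+z. ennreal (\<Phi> z powr q) \<partial>sq)"
      by (rule nn_integral_sq_shift[of "\<lambda>z. ennreal (\<Phi> z powr q)"]) (measurable, simp_all add: \<Phi>_def)
    also have "\<dots> \<le> ennreal (C * (\<Sum>m=1..M. \<Sum>n=1..M. real m powr (q - 2) * real n powr (q - 2) * (4 * (real m * real n) * b m n) powr q))"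
      unfolding \<Phi>_def using b by (intro K) auto
    also have "(\<Sum>m=1..M. \<Sum>n=1..M. real m powr (q - 2) * real n powr (q - 2) * (4 * (real m * real n) * b m n) powr q)
      = 4 powr q * (\<Sum>m=1..M. \<Sum>n=1..M. (real m * real n) powr (2 * q - 2) * b m n powr q)"
      unfolding sum_distrib_left
    proof (intro sum.cong refl)
      fix m n
      have x: "x powr (q - 2) * x powr q = x powr (2 * q - 2)" for x :: real
        by (simp flip: powr_add)
      have "real m powr (q - 2) * real n powr (q - 2) * (real m * real n) powr q
        = (real m powr (q - 2) * real m powr q) * (real n powr (q - 2) * real n powr q)"
        by (simp add: powr_mult)
      also have "\<dots> = (real m * real n) powr (2 * q - 2)" unfolding x by (simp add: powr_mult)
      finally have "real m powr (q - 2) * real n powr (q - 2) * (real m * real n) powr q = (real m * real n) powr (2 * q - 2)" .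
      then show "real m powr (q - 2) * real n powr (q - 2) * (4 * (real m * real n) * b m n) powr q
        = 4 powr q * ((real m * real n) powr (2 * q - 2) * b m n powr q)"
        by (simp add: powr_mult mult_ac)
    qed
    finally show "(\<integral>\<^sup>+z. ennreal (\<bar>test_fun M b (trig_block lo1 s1 \<theta>1) (trig_block lo2 s2 \<theta>2) z\<bar> powr q) \<partial>sq)
      \<le> ennreal (C * 4 powr q * (\<Sum>m=1..M. \<Sum>n=1..M. (real m * real n) powr (2 * q - 2) * b m n powr q))"
      by (simp add: g_def mult_ac)
  qed
qed

lemma integrable_sq_mult_bounded:
  fixes \<Psi> g :: "real \<times> real \<Rightarrow> real"
  assumes \<Psi>: "integrable sq \<Psi>" and g: "g \<in> borel_measurable borel" "\<And>z. \<bar>g z\<bar> \<le> B"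
  shows "integrable sq (\<lambda>z. \<Psi> z * g z)"
proof (rule Bochner_Integration.integrable_bound[where f = "\<lambda>z. \<Psi> z * B"])
  show "AE z in sq. norm (\<Psi> z * g z) \<le> norm (\<Psi> z * B)"
    using g(2) by (auto simp: abs_mult intro!: mult_left_mono order_trans[OF g(2)] AE_I2)
qed (use \<Psi> g in auto)

lemma integrable_sq_of_powr:
  fixes \<Psi> :: "real \<times> real \<Rightarrow> real"
  assumes p: "1 < p" and [measurable]: "\<Psi> \<in> borel_measurable borel" and int: "integrable sq (\<lambda>z. \<bar>\<Psi> z\<bar> powr p)"
  shows "integrable sq \<Psi>"
proof (rule Bochner_Integration.integrable_bound[where f = "\<lambda>z. 1 + \<bar>\<Psi> z\<bar> powr p"])
  have "\<bar>u\<bar> \<le> 1 + \<bar>u\<bar> powr p" for u :: real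
    using powr_mono[of 1 p "\<bar>u\<bar>"] p by (cases "\<bar>u\<bar> \<le> 1") (auto intro: add_increasing2 simp: add_increasing)
  then show "AE z in sq. norm (\<Psi> z) \<le> norm (1 + \<bar>\<Psi> z\<bar> powr p)" by (auto simp: abs_of_nonneg add_nonneg_nonneg)
qed (use int in auto)

text \<open>The abstract factors \<open>T1\<close> and \<open>T2\<close> let one computation serve
  the function itself, where they are pi times the cosine of the phase, and its differences, where
  they are the multipliers.\<close>

lemma test_fun_pairing:
  fixes \<Psi> :: "real \<times> real \<Rightarrow> real"
  assumes \<Psi>: "integrable sq \<Psi>" and lo: "1 \<le> lo1" "1 \<le> lo2"
    and pair: "\<And>j k \<phi> \<psi>. 1 \<le> j \<Longrightarrow> 1 \<le> k \<Longrightarrow>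
      (\<integral>z. \<Psi> z * (cos (real j * fst z + \<phi>) * cos (real k * snd z + \<psi>)) \<partial>sq) = a j k * T1 j \<phi> * T2 k \<psi>"
  shows "(\<integral>z. \<Psi> z * test_fun M b (trig_block lo1 s1 \<theta>1) (trig_block lo2 s2 \<theta>2) z \<partial>sq)
    = (\<Sum>m=1..M. \<Sum>n=1..M. b m n * (\<Sum>k=lo1..m. \<Sum>l=lo2..n. a k l * T1 k (real k * s1 + \<theta>1) * T2 l (real l * s2 + \<theta>2)))"
proof -
  define e where "e k l z = cos (real k * fst z + (real k * s1 + \<theta>1)) * cos (real l * snd z + (real l * s2 + \<theta>2))" for k l z
  have "\<Psi> z * test_fun M b (trig_block lo1 s1 \<theta>1) (trig_block lo2 s2 \<theta>2) z
     = (\<Sum>m=1..M. \<Sum>n=1..M. b m n * (\<Sum>k=lo1..m. \<Sum>l=lo2..n. \<Psi> z * e k l z))" for z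
  proof -
    have eq: "trig_block lo1 s1 \<theta>1 m (fst z) * trig_block lo2 s2 \<theta>2 n (snd z) = (\<Sum>k=lo1..m. \<Sum>l=lo2..n. e k l z)" for m n
      unfolding trig_block_def e_def sum_product by (intro sum.cong refl) (simp add: algebra_simps)
    show ?thesis unfolding test_fun_def mult.assoc eq by (simp add: sum_distrib_left mult_ac)
  qed
  moreover have i: "integrable sq (\<lambda>z. \<Psi> z * e k l z)" for k l
  proof (rule integrable_sq_mult_bounded[OF \<Psi>, where B = 1])
    show "e k l \<in> borel_measurable borel" unfolding e_def[abs_def]
      by (intro borel_measurable_times borel_measurable_comp_fst[where g = "\<lambda>x. cos (real k * x + (real k * s1 + \<theta>1))"]
          borel_measurable_comp_snd[where g = "\<lambda>x. cos (real l * x + (real l * s2 + \<theta>2))"]) measurable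
    show "\<bar>e k l z\<bar> \<le> 1" for z unfolding e_def abs_mult by (intro mult_le_one) auto
  qed
  moreover have "(\<integral>z. (\<Sum>m=1..M. \<Sum>n=1..M. b m n * (\<Sum>k=lo1..m. \<Sum>l=lo2..n. \<Psi> z * e k l z)) \<partial>sq)
    = (\<Sum>m=1..M. \<Sum>n=1..M. b m n * (\<Sum>k=lo1..m. \<Sum>l=lo2..n. (\<integral>z. \<Psi> z * e k l z \<partial>sq)))"
    using i by simp
  moreover have "(\<integral>z. \<Psi> z * e k l z \<partial>sq) = a k l * T1 k (real k * s1 + \<theta>1) * T2 l (real l * s2 + \<theta>2)"
    if "lo1 \<le> k" "lo2 \<le> l" for k l
    unfolding e_def using that lo by (intro pair) auto
  ultimately show ?thesis by (auto intro!: sum.cong arg_cong2[where f = "(*)"])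
qed

lemma test_fun_pairing_le:
  fixes \<Psi> :: "real \<times> real \<Rightarrow> real"
  assumes p: "1 < p" and q: "q = p / (p - 1)" and [measurable]: "\<Psi> \<in> borel_measurable borel"
    and int: "integrable sq (\<lambda>z. \<bar>\<Psi> z\<bar> powr p)"
    and [measurable]: "\<And>m. U m \<in> borel_measurable borel" "\<And>m. V m \<in> borel_measurable borel"
    and Y: "(\<integral>\<^sup>+z. ennreal (\<bar>test_fun M b U V z\<bar> powr q) \<partial>sq) \<le> ennreal Y" "0 \<le> Y"
  shows "(\<integral>z. \<Psi> z * test_fun M b U V z \<partial>sq) \<le> (\<integral>z. \<bar>\<Psi> z\<bar> powr p \<partial>sq) + Y"
proof -
  let ?g = "test_fun M b U V"
  have iq: "integrable sq (\<lambda>z. \<bar>?g z\<bar> powr q)"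
    using Y by (intro integrableI_nonneg) (auto simp: top.extremum_strict order.strict_trans1)
  have Yq: "(\<integral>z. \<bar>?g z\<bar> powr q \<partial>sq) \<le> Y"
    using Y by (intro integral_real_bounded) auto
  have pt: "\<Psi> z * ?g z \<le> \<bar>\<Psi> z\<bar> powr p + \<bar>?g z\<bar> powr q" for z
    using mult_le_powr_add_powr[OF p q, of "\<bar>\<Psi> z\<bar>" "\<bar>?g z\<bar>"] by (simp flip: abs_mult)
  have "(\<integral>z. \<Psi> z * ?g z \<partial>sq) \<le> (\<integral>z. \<bar>\<Psi> z\<bar> powr p + \<bar>?g z\<bar> powr q \<partial>sq)"
    using int iq pt by (intro integral_mono') auto
  also have "\<dots> = (\<integral>z. \<bar>\<Psi> z\<bar> powr p \<partial>sq) + (\<integral>z. \<bar>?g z\<bar> powr q \<partial>sq)" using int iq by simp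
  finally show ?thesis using Yq by linarith
qed

text \<open>The pairing inequality is assumed for multipliers \<open>\<mu>\<close> and \<open>\<nu>\<close> that may be averages over the
  step; \<open>R1\<close> and \<open>R2\<close> are the frequencies on which the weights \<open>\<rho>\<close> and \<open>\<sigma>\<close> are controlled.\<close>

definition pairing_data ::
  "real \<Rightarrow> real \<Rightarrow> real \<Rightarrow> nat \<Rightarrow> nat set \<Rightarrow> nat set \<Rightarrow> nat \<Rightarrow> nat \<Rightarrow> (nat \<Rightarrow> nat \<Rightarrow> real) \<Rightarrow>
   (nat \<Rightarrow> real) \<Rightarrow> (nat \<Rightarrow> real) \<Rightarrow> (nat \<Rightarrow> real) \<Rightarrow> (nat \<Rightarrow> real) \<Rightarrow> real \<Rightarrow> bool" where
  "pairing_data q C d M R1 R2 lo1 lo2 a \<mu> \<nu> \<rho> \<sigma> I \<longleftrightarrow>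
     R1 \<subseteq> {1..M} \<and> R2 \<subseteq> {1..M} \<and> 1 \<le> lo1 \<and> 1 \<le> lo2 \<and>
     (\<forall>m n. 1 \<le> m \<longrightarrow> 1 \<le> n \<longrightarrow> 0 \<le> a m n) \<and>
     (\<forall>m n m' n'. 1 \<le> m \<longrightarrow> m \<le> m' \<longrightarrow> 1 \<le> n \<longrightarrow> n \<le> n' \<longrightarrow> a m' n' \<le> a m n) \<and>
     (\<forall>k. 0 \<le> \<rho> k) \<and> (\<forall>k. 0 \<le> \<sigma> k) \<and>
     (\<forall>m\<in>R1. \<forall>k\<in>{lo1..m}. d * \<rho> k \<le> \<mu> k) \<and>
     (\<forall>n\<in>R2. \<forall>k\<in>{lo2..n}. d * \<sigma> k \<le> \<nu> k) \<and>
     (\<forall>m\<in>R1. d * (real m * \<rho> m) \<le> (\<Sum>k=lo1..m. \<rho> k)) \<and>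
     (\<forall>n\<in>R2. d * (real n * \<sigma> n) \<le> (\<Sum>k=lo2..n. \<sigma> k)) \<and>
     (\<forall>b. (\<forall>m n. 0 \<le> b m n) \<longrightarrow> (\<forall>m n. m \<notin> R1 \<or> n \<notin> R2 \<longrightarrow> b m n = 0) \<longrightarrow>
        (\<Sum>m=1..M. \<Sum>n=1..M. b m n * (\<Sum>k=lo1..m. \<Sum>l=lo2..n. a k l * \<mu> k * \<nu> l))
        \<le> I + C * (\<Sum>m=1..M. \<Sum>n=1..M. (real m * real n) powr (2 * q - 2) * b m n powr q))"

text \<open>Inside a block ending at (m, n) monotonicity replaces every a k l by the smaller a m n,
  so the pairing dominates a m n times sums of the weights, which are at least d m \<rho> m and d n
  \<sigma> n. The result is the hypothesis of \<open>duality_bound\<close> with x = m n and r = a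
  \<rho> \<sigma>. Each variable costs d twice, once for the multiplier and once for the sum, hence
  d * d * (d * d).\<close>

lemma coefficient_lower_bound:
  fixes p q C d :: real
  assumes p: "1 < p" and q: "q = p / (p - 1)" and C: "0 < C" and d: "0 < d"
  obtains K where "K > 0"
    "\<And>M R1 R2 lo1 lo2 a \<mu> \<nu> \<rho> \<sigma> I. pairing_data q C d M R1 R2 lo1 lo2 a \<mu> \<nu> \<rho> \<sigma> I \<Longrightarrow>
      (\<Sum>m\<in>R1. \<Sum>n\<in>R2. (real m * real n) powr (p - 2) * (a m n * \<rho> m * \<sigma> n) powr p) \<le> K * I"
proof -
  have d4: "0 < d * d * (d * d)" using d by simp
  obtain K where K: "K > 0"
    "\<And>(J::(nat \<times> nat) set) x r I. finite J \<Longrightarrow> (\<And>j. j \<in> J \<Longrightarrow> 0 < x j) \<Longrightarrow> (\<And>j. j \<in> J \<Longrightarrow> 0 \<le> r j) \<Longrightarrow>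
       (\<And>b. (\<And>j. 0 \<le> b j) \<Longrightarrow> (d * d * (d * d)) * (\<Sum>j\<in>J. b j * x j * r j) \<le> I + C * (\<Sum>j\<in>J. x j powr (2 * q - 2) * b j powr q)) \<Longrightarrow>
       (\<Sum>j\<in>J. x j powr (p - 2) * r j powr p) \<le> K * (I::real)"
    using duality_bound[OF p q d4 C] by blast
  show ?thesis
  proof (rule that[OF K(1)])
    fix M :: nat and R1 R2 :: "nat set" and lo1 lo2 :: nat and a :: "nat \<Rightarrow> nat \<Rightarrow> real" and \<mu> \<nu> \<rho> \<sigma> :: "nat \<Rightarrow> real" and I :: real
    assume PD: "pairing_data q C d M R1 R2 lo1 lo2 a \<mu> \<nu> \<rho> \<sigma> I"
    have R: "R1 \<subseteq> {1..M}" "R2 \<subseteq> {1..M}" and lo: "1 \<le> lo1" "1 \<le> lo2"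
      and a0: "\<And>m n. 1 \<le> m \<Longrightarrow> 1 \<le> n \<Longrightarrow> 0 \<le> a m n"
      and am: "\<And>m n m' n'. 1 \<le> m \<Longrightarrow> m \<le> m' \<Longrightarrow> 1 \<le> n \<Longrightarrow> n \<le> n' \<Longrightarrow> a m' n' \<le> a m n"
      and \<rho>0: "\<And>k. 0 \<le> \<rho> k" and \<sigma>0: "\<And>k. 0 \<le> \<sigma> k"
      and \<mu>: "\<And>m k. m \<in> R1 \<Longrightarrow> lo1 \<le> k \<Longrightarrow> k \<le> m \<Longrightarrow> d * \<rho> k \<le> \<mu> k"
      and \<nu>: "\<And>n k. n \<in> R2 \<Longrightarrow> lo2 \<le> k \<Longrightarrow> k \<le> n \<Longrightarrow> d * \<sigma> k \<le> \<nu> k"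
      and s1: "\<And>m. m \<in> R1 \<Longrightarrow> d * (real m * \<rho> m) \<le> (\<Sum>k=lo1..m. \<rho> k)"
      and s2: "\<And>m. m \<in> R2 \<Longrightarrow> d * (real m * \<sigma> m) \<le> (\<Sum>k=lo2..m. \<sigma> k)"
      using PD unfolding pairing_data_def by (simp_all del: One_nat_def)
    have H: "(\<Sum>m=1..M. \<Sum>n=1..M. b m n * (\<Sum>k=lo1..m. \<Sum>l=lo2..n. a k l * \<mu> k * \<nu> l))
         \<le> I + C * (\<Sum>m=1..M. \<Sum>n=1..M. (real m * real n) powr (2 * q - 2) * b m n powr q)"
      if "\<And>m n. 0 \<le> b m n" "\<And>m n. m \<notin> R1 \<or> n \<notin> R2 \<Longrightarrow> b m n = 0" for b
      using PD that unfolding pairing_data_def by (elim conjE allE[where x = b]) blast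
    define J where "J = R1 \<times> R2"
    define x where "x j = real (fst j) * real (snd j)" for j :: "nat \<times> nat"
    define r where "r j = a (fst j) (snd j) * \<rho> (fst j) * \<sigma> (snd j)" for j
    have fin: "finite R1" "finite R2" using R finite_subset by auto
    have restr: "(\<Sum>m=1..M. \<Sum>n=1..M. g m n) = (\<Sum>j\<in>J. g (fst j) (snd j))"
      if "\<And>m n. m \<notin> R1 \<or> n \<notin> R2 \<Longrightarrow> g m n = 0" for g :: "nat \<Rightarrow> nat \<Rightarrow> real"
    proof -
      have "(\<Sum>m=1..M. \<Sum>n=1..M. g m n) = (\<Sum>j\<in>{1..M} \<times> {1..M}. g (fst j) (snd j))"
        by (simp add: sum.cartesian_product split_def)
      also have "\<dots> = (\<Sum>j\<in>J. g (fst j) (snd j))"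
      proof (rule sum.mono_neutral_right)
        show "\<forall>j\<in>{1..M} \<times> {1..M} - J. g (fst j) (snd j) = 0"
        proof
          fix j assume "j \<in> {1..M} \<times> {1..M} - J"
          then have "fst j \<notin> R1 \<or> snd j \<notin> R2" by (auto simp: J_def mem_Times_iff)
          then show "g (fst j) (snd j) = 0" by (rule that)
        qed
      qed (use R in \<open>auto simp: J_def\<close>)
      finally show ?thesis .
    qed
    have "(\<Sum>j\<in>J. x j powr (p - 2) * r j powr p) \<le> K * I"
    proof (rule K(2))
      show "finite J" using fin by (simp add: J_def)
      show "0 < x j" if "j \<in> J" for j
      proof -
        have "1 \<le> fst j" "1 \<le> snd j" using that R by (auto simp: J_def)
        then show ?thesis by (simp add: x_def)
      qed
      show "0 \<le> r j" if "j \<in> J" for j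
        using that R a0 \<rho>0 \<sigma>0 by (auto simp: J_def r_def subset_iff intro!: mult_nonneg_nonneg)
      fix b :: "nat \<times> nat \<Rightarrow> real" assume b: "\<And>j. 0 \<le> b j"
      \<comment> \<open>Extension by 0 outside R1 and R2, where neither the multipliers nor the sums
        of the weights are controlled.\<close>
      define b' where "b' m n = (if m \<in> R1 \<and> n \<in> R2 then b (m, n) else 0)" for m n
      have key: "(d * d * (d * d)) * (x j * r j) \<le> (\<Sum>k=lo1..fst j. \<Sum>l=lo2..snd j. a k l * \<mu> k * \<nu> l)" if j: "j \<in> J" for j
      proof -
        obtain m n where mn: "j = (m, n)" "m \<in> R1" "n \<in> R2" using j by (auto simp: J_def)
        have mn1: "1 \<le> m" "1 \<le> n" using mn R by auto
        have "(d * d * (d * d)) * (x j * r j) = a m n * (d * (d * (real m * \<rho> m))) * (d * (d * (real n * \<sigma> n)))"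
          by (simp add: mn x_def r_def mult_ac)
        also have "\<dots> \<le> a m n * (d * (\<Sum>k=lo1..m. \<rho> k)) * (d * (\<Sum>l=lo2..n. \<sigma> l))"
          using s1[OF mn(2)] s2[OF mn(3)] a0[OF mn1] d \<rho>0 \<sigma>0
          by (intro mult_mono mult_nonneg_nonneg sum_nonneg) auto
        also have "\<dots> = (\<Sum>k=lo1..m. \<Sum>l=lo2..n. a m n * (d * \<rho> k) * (d * \<sigma> l))"
          by (simp add: sum_product sum_distrib_left mult_ac)
        also have "\<dots> \<le> (\<Sum>k=lo1..m. \<Sum>l=lo2..n. a k l * \<mu> k * \<nu> l)"
        proof (intro sum_mono)
          fix k l assume "k \<in> {lo1..m}" "l \<in> {lo2..n}"
          then have kl: "lo1 \<le> k" "k \<le> m" "lo2 \<le> l" "l \<le> n" "1 \<le> k" "1 \<le> l" using lo by auto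
          have 1: "0 \<le> d * \<rho> k" "0 \<le> d * \<sigma> l" using d \<rho>0 \<sigma>0 by auto
          have 2: "0 \<le> \<mu> k" using 1(1) \<mu>[OF mn(2) kl(1,2)] by linarith
          show "a m n * (d * \<rho> k) * (d * \<sigma> l) \<le> a k l * \<mu> k * \<nu> l"
            using am[OF kl(5,2,6,4)] \<mu>[OF mn(2) kl(1,2)] \<nu>[OF mn(3) kl(3,4)] a0[OF kl(5,6)] 1 2 d \<rho>0 \<sigma>0
            by (intro mult_mono mult_nonneg_nonneg) auto
        qed
        finally show ?thesis by (simp add: mn)
      qed
      have "(d * d * (d * d)) * (\<Sum>j\<in>J. b j * x j * r j) = (\<Sum>j\<in>J. b j * ((d * d * (d * d)) * (x j * r j)))"
        by (simp add: sum_distrib_left mult_ac)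
      also have "\<dots> \<le> (\<Sum>j\<in>J. b j * (\<Sum>k=lo1..fst j. \<Sum>l=lo2..snd j. a k l * \<mu> k * \<nu> l))"
        by (intro sum_mono mult_left_mono key b) auto
      also have "\<dots> = (\<Sum>j\<in>J. b' (fst j) (snd j) * (\<Sum>k=lo1..fst j. \<Sum>l=lo2..snd j. a k l * \<mu> k * \<nu> l))"
        by (intro sum.cong) (auto simp: b'_def J_def)
      also have "\<dots> = (\<Sum>m=1..M. \<Sum>n=1..M. b' m n * (\<Sum>k=lo1..m. \<Sum>l=lo2..n. a k l * \<mu> k * \<nu> l))"
        by (rule restr[symmetric]) (auto simp: b'_def)
      also have "\<dots> \<le> I + C * (\<Sum>m=1..M. \<Sum>n=1..M. (real m * real n) powr (2 * q - 2) * b' m n powr q)"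
        by (rule H) (use b in \<open>auto simp: b'_def\<close>)
      also have "(\<Sum>m=1..M. \<Sum>n=1..M. (real m * real n) powr (2 * q - 2) * b' m n powr q)
        = (\<Sum>j\<in>J. (real (fst j) * real (snd j)) powr (2 * q - 2) * b' (fst j) (snd j) powr q)"
        by (rule restr) (auto simp: b'_def)
      also have "\<dots> = (\<Sum>j\<in>J. x j powr (2 * q - 2) * b j powr q)"
        by (intro sum.cong) (auto simp: b'_def J_def x_def)
      finally show "(d * d * (d * d)) * (\<Sum>j\<in>J. b j * x j * r j) \<le> I + C * (\<Sum>j\<in>J. x j powr (2 * q - 2) * b j powr q)" .
    qed
    then show "(\<Sum>m\<in>R1. \<Sum>n\<in>R2. (real m * real n) powr (p - 2) * (a m n * \<rho> m * \<sigma> n) powr p) \<le> K * I"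
      unfolding J_def x_def r_def by (simp add: sum.cartesian_product split_def)
  qed
qed

section \<open>Cosine series with nonnegative mixed differences\<close>

text \<open>The phases \<open>\<phi>\<close> and \<open>\<psi>\<close> put the conditions on all four kinds of coefficients into one.\<close>

locale cosine_class =
  fixes p :: real and f :: "real \<times> real \<Rightarrow> real" and a :: "nat \<Rightarrow> nat \<Rightarrow> real"
  assumes p: "1 < p" and f_borel [measurable]: "f \<in> borel_measurable borel"
    and f_powr: "integrable sq (\<lambda>z. \<bar>f z\<bar> powr p)"
    and coeff: "\<And>j k \<phi> \<psi>. (\<integral>z. f z * (cos (real j * fst z + \<phi>) * cos (real k * snd z + \<psi>)) \<partial>sq) =
        (if 1 \<le> j \<and> 1 \<le> k then a j k * (pi * cos \<phi>) * (pi * cos \<psi>) else 0)"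
    and mixed: "\<And>m n. 1 \<le> m \<Longrightarrow> 1 \<le> n \<Longrightarrow> 0 \<le> a m n - a (m + 1) n - a m (n + 1) + a (m + 1) (n + 1)"
begin

lemma f_integrable: "integrable sq f"
  by (rule integrable_sq_of_powr[OF p f_borel f_powr])

text \<open>Riemann--Lebesgue along one frequency with the other held fixed; the products of cosines
  with one common factor still form an orthogonal system.\<close>

lemma coeff_tendsto_0:
  assumes "1 \<le> n"
  shows "(\<lambda>m. a m n) \<longlonglongrightarrow> 0" and "(\<lambda>m. a n m) \<longlonglongrightarrow> 0"
proof -
  have c: "(\<lambda>x. cos (real k * x)) \<in> borel_measurable borel" for k by measurable
  have cc: "\<bar>cos u * cos v\<bar> \<le> 1" for u v :: real
    unfolding abs_mult by (intro mult_le_one) auto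
  have o: "(\<integral>x. cos (real j * x) * cos (real k * x) \<partial>circ) = 0" if "j \<noteq> k" for j k
    using integral_circ_cos_cos[of j 0 k 0] that by simp
  have "(\<lambda>m. \<integral>z. f z * (cos (real m * fst z) * cos (real n * snd z)) \<partial>sq) \<longlonglongrightarrow> 0"
  proof (rule sq.orthogonal_coeffs_tendsto_0[OF f_integrable])
    show "(\<lambda>z. cos (real m * fst z) * cos (real n * snd z)) \<in> borel_measurable sq" for m
      using borel_measurable_comp_fst[OF c] borel_measurable_comp_snd[OF c] by simp
    show "\<bar>cos (real m * fst z) * cos (real n * snd z)\<bar> \<le> 1" for m z
      unfolding abs_mult by (intro mult_le_one) auto
    fix m k :: nat assume "m \<noteq> k"
    have "(\<integral>z. (cos (real m * fst z) * cos (real k * fst z)) * (cos (real n * snd z) * cos (real n * snd z)) \<partial>sq)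
       = (\<integral>x. cos (real m * x) * cos (real k * x) \<partial>circ) * (\<integral>x. cos (real n * x) * cos (real n * x) \<partial>circ)"
      by (rule integral_sq_mult[where B = 1]) (measurable, rule cc, rule cc)
    then show "(\<integral>z. (cos (real m * fst z) * cos (real n * snd z)) * (cos (real k * fst z) * cos (real n * snd z)) \<partial>sq) = 0"
      using o[OF \<open>m \<noteq> k\<close>] by (simp add: mult_ac)
  qed
  then have "(\<lambda>m. (\<integral>z. f z * (cos (real m * fst z) * cos (real n * snd z)) \<partial>sq) / (pi * pi)) \<longlonglongrightarrow> 0 / (pi * pi)"
    by (intro tendsto_intros) auto
  moreover have "\<forall>\<^sub>F m in sequentially. (\<integral>z. f z * (cos (real m * fst z) * cos (real n * snd z)) \<partial>sq) / (pi * pi) = a m n"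
    using eventually_ge_at_top[of 1] by eventually_elim (use coeff[of _ 0 n 0] assms in simp)
  ultimately have "(\<lambda>m. a m n) \<longlonglongrightarrow> 0 / (pi * pi)" by (rule Lim_transform_eventually)
  then show "(\<lambda>m. a m n) \<longlonglongrightarrow> 0" by simp
  have "(\<lambda>m. \<integral>z. f z * (cos (real n * fst z) * cos (real m * snd z)) \<partial>sq) \<longlonglongrightarrow> 0"
  proof (rule sq.orthogonal_coeffs_tendsto_0[OF f_integrable])
    show "(\<lambda>z. cos (real n * fst z) * cos (real m * snd z)) \<in> borel_measurable sq" for m
      using borel_measurable_comp_fst[OF c] borel_measurable_comp_snd[OF c] by simp
    show "\<bar>cos (real n * fst z) * cos (real m * snd z)\<bar> \<le> 1" for m z
      unfolding abs_mult by (intro mult_le_one) auto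
    fix m k :: nat assume "m \<noteq> k"
    have "(\<integral>z. (cos (real n * fst z) * cos (real n * fst z)) * (cos (real m * snd z) * cos (real k * snd z)) \<partial>sq)
       = (\<integral>x. cos (real n * x) * cos (real n * x) \<partial>circ) * (\<integral>x. cos (real m * x) * cos (real k * x) \<partial>circ)"
      by (rule integral_sq_mult[where B = 1]) (measurable, rule cc, rule cc)
    then show "(\<integral>z. (cos (real n * fst z) * cos (real m * snd z)) * (cos (real n * fst z) * cos (real k * snd z)) \<partial>sq) = 0"
      using o[OF \<open>m \<noteq> k\<close>] by (simp add: mult_ac)
  qed
  then have "(\<lambda>m. (\<integral>z. f z * (cos (real n * fst z) * cos (real m * snd z)) \<partial>sq) / (pi * pi)) \<longlonglongrightarrow> 0 / (pi * pi)"
    by (intro tendsto_intros) auto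
  moreover have "\<forall>\<^sub>F m in sequentially. (\<integral>z. f z * (cos (real n * fst z) * cos (real m * snd z)) \<partial>sq) / (pi * pi) = a n m"
    using eventually_ge_at_top[of 1] by eventually_elim (use coeff[of n 0 _ 0] assms in simp)
  ultimately have "(\<lambda>m. a n m) \<longlonglongrightarrow> 0 / (pi * pi)" by (rule Lim_transform_eventually)
  then show "(\<lambda>m. a n m) \<longlonglongrightarrow> 0" by simp
qed

text \<open>A nonnegative mixed difference says that the difference in one index decreases in the
  other index. Its limit is 0 by Riemann--Lebesgue, so it is nonnegative; the two indices are then
  moved one after the other.\<close>

lemma coeff_antimono:
  assumes "1 \<le> m" "m \<le> m'" "1 \<le> n" "n \<le> n'"
  shows "a m' n' \<le> a m n"
proof -
  have 1: "a (m + 1) n \<le> a m n" if mn: "1 \<le> m" "1 \<le> n" for m n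
  proof -
    define X where "X i = a m (i + n) - a (m + 1) (i + n)" for i
    have "decseq X" unfolding decseq_Suc_iff X_def
    proof
      fix i show "a m (Suc i + n) - a (m + 1) (Suc i + n) \<le> a m (i + n) - a (m + 1) (i + n)"
        using mixed[of m "i + n"] mn by simp
    qed
    moreover have "X \<longlonglongrightarrow> 0 - 0" unfolding X_def
      using LIMSEQ_ignore_initial_segment[OF coeff_tendsto_0(2)[of m], of n] mn
        LIMSEQ_ignore_initial_segment[OF coeff_tendsto_0(2)[of "m + 1"], of n]
      by (intro tendsto_diff) auto
    ultimately have "0 \<le> X 0" using decseq_ge[of X 0] by simp
    then show ?thesis by (simp add: X_def)
  qed
  have 2: "a m (n + 1) \<le> a m n" if mn: "1 \<le> m" "1 \<le> n" for m n
  proof -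
    define X where "X i = a (i + m) n - a (i + m) (n + 1)" for i
    have "decseq X" unfolding decseq_Suc_iff X_def
    proof
      fix i show "a (Suc i + m) n - a (Suc i + m) (n + 1) \<le> a (i + m) n - a (i + m) (n + 1)"
        using mixed[of "i + m" n] mn by simp
    qed
    moreover have "X \<longlonglongrightarrow> 0 - 0" unfolding X_def
      using LIMSEQ_ignore_initial_segment[OF coeff_tendsto_0(1)[of n], of m] mn
        LIMSEQ_ignore_initial_segment[OF coeff_tendsto_0(1)[of "n + 1"], of m]
      by (intro tendsto_diff) auto
    ultimately have "0 \<le> X 0" using decseq_ge[of X 0] by simp
    then show ?thesis by (simp add: X_def)
  qed
  have "a m' n' \<le> a m n'" using assms(2)
    by (induction m' rule: dec_induct) (use 1 assms in \<open>auto intro: order_trans\<close>)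
  also have "\<dots> \<le> a m n" using assms(4)
    by (induction n' rule: dec_induct) (use 2 assms in \<open>auto intro: order_trans\<close>)
  finally show ?thesis .
qed

lemma coeff_nonneg:
  assumes "1 \<le> m" "1 \<le> n"
  shows "0 \<le> a m n"
proof -
  have "decseq (\<lambda>i. a (m + i) n)" unfolding decseq_def using coeff_antimono assms by auto
  moreover have "(\<lambda>i. a (m + i) n) \<longlonglongrightarrow> 0"
    using coeff_tendsto_0(1)[OF assms(2)] LIMSEQ_ignore_initial_segment[of "\<lambda>i. a i n" 0 m] by (simp add: add.commute)
  ultimately show ?thesis using decseq_ge[of "\<lambda>i. a (m + i) n" 0 0] by simp
qed

text \<open>The duality argument applied to the function itself: the multipliers are the constant
  pi, the weights are 1 and the blocks start at 1, so d = 1 is admissible.\<close>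

lemma coeff_sum_finite:
  obtains K where "\<And>M. (\<Sum>k=1..M. \<Sum>l=1..M. (real k * real l) powr (p - 2) * a k l powr p) \<le> K"
proof -
  define q where "q = p / (p - 1)"
  have q: "1 < q" using p by (simp add: q_def field_simps)
  obtain C where C: "C > 0" and T:
    "\<And>M b (lo1::nat) s1 \<theta>1 (lo2::nat) s2 \<theta>2. (\<And>m n. 0 \<le> b m n) \<Longrightarrow> 1 \<le> lo1 \<Longrightarrow> 1 \<le> lo2 \<Longrightarrow>
      (\<integral>\<^sup>+z. ennreal (\<bar>test_fun M b (trig_block lo1 s1 \<theta>1) (trig_block lo2 s2 \<theta>2) z\<bar> powr q) \<partial>sq)
      \<le> ennreal (C * (\<Sum>m=1..M. \<Sum>n=1..M. (real m * real n) powr (2 * q - 2) * b m n powr q))"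
    using Lp_test_fun[OF q] by blast
  obtain K where K: "K > 0" and L: "\<And>M R1 R2 lo1 lo2 a \<mu> \<nu> \<rho> \<sigma> I.
      pairing_data q C 1 M R1 R2 lo1 lo2 a \<mu> \<nu> \<rho> \<sigma> I \<Longrightarrow>
      (\<Sum>m\<in>R1. \<Sum>n\<in>R2. (real m * real n) powr (p - 2) * (a m n * \<rho> m * \<sigma> n) powr p) \<le> K * I"
    using coefficient_lower_bound[OF p q_def C zero_less_one] by blast
  show ?thesis
  proof (rule that[of "K * (\<integral>z. \<bar>f z\<bar> powr p \<partial>sq)"])
    fix M
    have pi1: "1 \<le> pi" using pi_ge_two by linarith
    have "(\<Sum>k\<in>{1..M}. \<Sum>l\<in>{1..M}. (real k * real l) powr (p - 2) * (a k l * 1 * 1) powr p) \<le> K * (\<integral>z. \<bar>f z\<bar> powr p \<partial>sq)"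
    proof (rule L[of M "{1..M}" "{1..M}" 1 1 a "\<lambda>_. pi" "\<lambda>_. pi" "\<lambda>_. 1" "\<lambda>_. 1"], unfold pairing_data_def, intro conjI allI impI ballI)
      fix b :: "nat \<Rightarrow> nat \<Rightarrow> real" assume b': "\<forall>m n. 0 \<le> b m n"
      then have b: "\<And>m n. 0 \<le> b m n" by blast
      have "(\<integral>z. f z * test_fun M b (trig_block 1 0 0) (trig_block 1 0 0) z \<partial>sq)
        = (\<Sum>m=1..M. \<Sum>n=1..M. b m n * (\<Sum>k=1..m. \<Sum>l=1..n. a k l * (pi * cos (real k * 0 + 0)) * (pi * cos (real l * 0 + 0))))"
        by (rule test_fun_pairing[OF f_integrable]) (use coeff in auto)
      moreover have "(\<integral>z. f z * test_fun M b (trig_block 1 0 0) (trig_block 1 0 0) z \<partial>sq) \<le> (\<integral>z. \<bar>f z\<bar> powr p \<partial>sq)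
          + C * (\<Sum>m=1..M. \<Sum>n=1..M. (real m * real n) powr (2 * q - 2) * b m n powr q)"
        by (rule test_fun_pairing_le[OF p q_def f_borel f_powr _ _ T[OF b]])
           (use C in \<open>auto intro!: mult_nonneg_nonneg sum_nonneg\<close>)
      ultimately show "(\<Sum>m=1..M. \<Sum>n=1..M. b m n * (\<Sum>k=1..m. \<Sum>l=1..n. a k l * pi * pi))
        \<le> (\<integral>z. \<bar>f z\<bar> powr p \<partial>sq) + C * (\<Sum>m=1..M. \<Sum>n=1..M. (real m * real n) powr (2 * q - 2) * b m n powr q)"
        by simp
    qed (use coeff_nonneg coeff_antimono pi1 in auto)
    then show "(\<Sum>k=1..M. \<Sum>l=1..M. (real k * real l) powr (p - 2) * a k l powr p) \<le> K * (\<integral>z. \<bar>f z\<bar> powr p \<partial>sq)"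
      by simp
  qed
qed

end

text \<open>The finite nested series of majorants makes every row finite, and dividing by the
  positive w1 \<nu> makes the row sums \<open>\<gamma> \<nu>\<close> usable as majorants. Tannery's
  theorem is then applied to the inner series and once more to the outer one.\<close>

lemma double_tannery:
  fixes u :: "nat \<Rightarrow> nat \<Rightarrow> nat \<Rightarrow> real"
  assumes lim: "\<And>\<nu> \<mu>. (\<lambda>M. u M \<nu> \<mu>) \<longlonglongrightarrow> v \<nu> \<mu>"
    and bd: "\<And>M \<nu> \<mu>. \<bar>u M \<nu> \<mu>\<bar> \<le> g \<nu> \<mu>"
    and c: "\<And>\<nu>. \<bar>c \<nu>\<bar> \<le> w1 \<nu>" and d: "\<And>\<mu>. \<bar>d \<mu>\<bar> \<le> w2 \<mu>"
    and w1: "\<And>\<nu>. 0 < w1 \<nu>"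
    and fin: "(\<Sum>\<nu>. \<Sum>\<mu>. ennreal (w1 \<nu> * w2 \<mu> * g \<nu> \<mu>)) = ennreal T" "0 \<le> T"
  shows "(\<lambda>M. \<Sum>\<nu>. c \<nu> * (\<Sum>\<mu>. d \<mu> * u M \<nu> \<mu>)) \<longlonglongrightarrow> (\<Sum>\<nu>. c \<nu> * (\<Sum>\<mu>. d \<mu> * v \<nu> \<mu>))"
    and "\<bar>\<Sum>\<nu>. c \<nu> * (\<Sum>\<mu>. d \<mu> * u M \<nu> \<mu>)\<bar> \<le> T"
proof -
  have w2: "0 \<le> w2 \<mu>" for \<mu> using d[of \<mu>] by linarith
  have g0: "0 \<le> g \<nu> \<mu>" for \<nu> \<mu> using bd[of 0 \<nu> \<mu>] by linarith
  have row: "(\<Sum>\<mu>. ennreal (w1 \<nu> * w2 \<mu> * g \<nu> \<mu>)) < \<infinity>" for \<nu>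
  proof -
    have "(\<Sum>\<mu>. ennreal (w1 \<nu> * w2 \<mu> * g \<nu> \<mu>)) \<le> (\<Sum>\<nu>. \<Sum>\<mu>. ennreal (w1 \<nu> * w2 \<mu> * g \<nu> \<mu>))"
      using sum_le_suminf[of "\<lambda>\<nu>. \<Sum>\<mu>. ennreal (w1 \<nu> * w2 \<mu> * g \<nu> \<mu>)" "{\<nu>}"] by auto
    then show ?thesis unfolding fin by (simp add: order.strict_trans1)
  qed
  have s2': "summable (\<lambda>\<mu>. w1 \<nu> * w2 \<mu> * g \<nu> \<mu>)" for \<nu>
    using row[of \<nu>] w1[of \<nu>] w2 g0 by (intro summable_suminf_not_top) auto
  have s2: "summable (\<lambda>\<mu>. w2 \<mu> * g \<nu> \<mu>)" for \<nu>
    using s2'[of \<nu>] w1[of \<nu>] by (simp add: mult.assoc summable_cmult_iff)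
  define \<gamma> where "\<gamma> \<nu> = (\<Sum>\<mu>. w2 \<mu> * g \<nu> \<mu>)" for \<nu>
  have \<gamma>0: "0 \<le> \<gamma> \<nu>" for \<nu> unfolding \<gamma>_def using s2 w2 g0 by (intro suminf_nonneg) auto
  have row_eq: "(\<Sum>\<mu>. ennreal (w1 \<nu> * w2 \<mu> * g \<nu> \<mu>)) = ennreal (w1 \<nu> * \<gamma> \<nu>)" for \<nu>
  proof -
    have "(\<Sum>\<mu>. ennreal (w1 \<nu> * w2 \<mu> * g \<nu> \<mu>)) = ennreal (\<Sum>\<mu>. w1 \<nu> * w2 \<mu> * g \<nu> \<mu>)"
      using w1[of \<nu>] w2 g0 s2'[of \<nu>] by (intro suminf_ennreal2) auto
    also have "(\<Sum>\<mu>. w1 \<nu> * w2 \<mu> * g \<nu> \<mu>) = w1 \<nu> * \<gamma> \<nu>"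
      unfolding \<gamma>_def mult.assoc by (rule suminf_mult[OF s2])
    finally show ?thesis .
  qed
  have s1: "summable (\<lambda>\<nu>. w1 \<nu> * \<gamma> \<nu>)"
    using fin w1 \<gamma>0 unfolding row_eq by (intro summable_suminf_not_top) (auto intro!: mult_nonneg_nonneg intro: less_imp_le)
  have T: "(\<Sum>\<nu>. w1 \<nu> * \<gamma> \<nu>) = T"
  proof -
    have "ennreal (\<Sum>\<nu>. w1 \<nu> * \<gamma> \<nu>) = ennreal T"
      using fin s1 w1 \<gamma>0 unfolding row_eq by (subst suminf_ennreal2[symmetric]) (auto intro!: mult_nonneg_nonneg intro: less_imp_le)
    then show ?thesis using fin(2) s1 w1 \<gamma>0 by (subst (asm) ennreal_inj) (auto intro!: suminf_nonneg mult_nonneg_nonneg intro: less_imp_le)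
  qed
  have in_le: "norm (d \<mu> * u M \<nu> \<mu>) \<le> w2 \<mu> * g \<nu> \<mu>" for M \<nu> \<mu>
    unfolding norm_mult using d[of \<mu>] bd[of M \<nu> \<mu>] w2[of \<mu>] by (intro mult_mono) auto
  have inner: "(\<lambda>M. \<Sum>\<mu>. d \<mu> * u M \<nu> \<mu>) \<longlonglongrightarrow> (\<Sum>\<mu>. d \<mu> * v \<nu> \<mu>)" for \<nu>
  proof -
    have "eventually (\<lambda>M. summable (\<lambda>\<mu>. norm (d \<mu> * u M \<nu> \<mu>))) sequentially \<and> summable (\<lambda>\<mu>. norm (d \<mu> * v \<nu> \<mu>)) \<and>
      (\<lambda>M. \<Sum>\<mu>. d \<mu> * u M \<nu> \<mu>) \<longlonglongrightarrow> (\<Sum>\<mu>. d \<mu> * v \<nu> \<mu>)"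
      by (rule tannerys_theorem[where M = "\<lambda>\<mu>. w2 \<mu> * g \<nu> \<mu>"])
         (use in_le s2 in \<open>auto intro!: tendsto_intros lim always_eventually simp del: norm_mult real_norm_def\<close>)
    then show ?thesis by blast
  qed
  have in_bd: "\<bar>\<Sum>\<mu>. d \<mu> * u M \<nu> \<mu>\<bar> \<le> \<gamma> \<nu>" for M \<nu>
  proof -
    have "summable (\<lambda>\<mu>. norm (d \<mu> * u M \<nu> \<mu>))"
      by (rule summable_comparison_test'[OF s2]) (use in_le in auto)
    then have "norm (\<Sum>\<mu>. d \<mu> * u M \<nu> \<mu>) \<le> (\<Sum>\<mu>. norm (d \<mu> * u M \<nu> \<mu>))" by (rule summable_norm)
    also have "\<dots> \<le> \<gamma> \<nu>" unfolding \<gamma>_def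
      by (rule suminf_le[OF in_le _ s2]) fact
    finally show ?thesis by simp
  qed
  have out_le: "norm (c \<nu> * (\<Sum>\<mu>. d \<mu> * u M \<nu> \<mu>)) \<le> w1 \<nu> * \<gamma> \<nu>" for M \<nu>
    unfolding norm_mult using c[of \<nu>] in_bd[of M \<nu>] w1[of \<nu>] by (intro mult_mono) auto
  show "(\<lambda>M. \<Sum>\<nu>. c \<nu> * (\<Sum>\<mu>. d \<mu> * u M \<nu> \<mu>)) \<longlonglongrightarrow> (\<Sum>\<nu>. c \<nu> * (\<Sum>\<mu>. d \<mu> * v \<nu> \<mu>))"
  proof -
    have "eventually (\<lambda>M. summable (\<lambda>\<nu>. norm (c \<nu> * (\<Sum>\<mu>. d \<mu> * u M \<nu> \<mu>)))) sequentially \<and>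
      summable (\<lambda>\<nu>. norm (c \<nu> * (\<Sum>\<mu>. d \<mu> * v \<nu> \<mu>))) \<and>
      (\<lambda>M. \<Sum>\<nu>. c \<nu> * (\<Sum>\<mu>. d \<mu> * u M \<nu> \<mu>)) \<longlonglongrightarrow> (\<Sum>\<nu>. c \<nu> * (\<Sum>\<mu>. d \<mu> * v \<nu> \<mu>))"
      by (rule tannerys_theorem[where M = "\<lambda>\<nu>. w1 \<nu> * \<gamma> \<nu>"])
         (use out_le s1 in \<open>auto intro!: tendsto_intros inner always_eventually simp del: norm_mult real_norm_def\<close>)
    then show ?thesis by blast
  qed
  have sn: "summable (\<lambda>\<nu>. norm (c \<nu> * (\<Sum>\<mu>. d \<mu> * u M \<nu> \<mu>)))"
    by (rule summable_comparison_test'[OF s1]) (use out_le in auto)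
  then have "norm (\<Sum>\<nu>. c \<nu> * (\<Sum>\<mu>. d \<mu> * u M \<nu> \<mu>)) \<le> (\<Sum>\<nu>. norm (c \<nu> * (\<Sum>\<mu>. d \<mu> * u M \<nu> \<mu>)))"
    by (rule summable_norm)
  also have "\<dots> \<le> T" unfolding T[symmetric]
    by (rule suminf_le[OF out_le sn s1])
  finally show "\<bar>\<Sum>\<nu>. c \<nu> * (\<Sum>\<mu>. d \<mu> * u M \<nu> \<mu>)\<bar> \<le> T" by simp
qed

lemma integral_sq_double_sum_cos:
  fixes X Y :: "nat \<Rightarrow> real \<Rightarrow> real"
  assumes X: "\<And>k. X k \<in> borel_measurable borel" "\<And>k x. \<bar>X k x\<bar> \<le> B"
    and Y: "\<And>k. Y k \<in> borel_measurable borel" "\<And>k x. \<bar>Y k x\<bar> \<le> B"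
    and T1: "\<And>k j \<phi>. 1 \<le> k \<Longrightarrow> (\<integral>x. X k x * cos (real j * x + \<phi>) \<partial>circ) = (if j = k then T1 j \<phi> else 0)"
    and T2: "\<And>k j \<phi>. 1 \<le> k \<Longrightarrow> (\<integral>x. Y k x * cos (real j * x + \<phi>) \<partial>circ) = (if j = k then T2 j \<phi> else 0)"
  shows "(\<integral>z. (\<Sum>k=1..M. \<Sum>l=1..M. c k l * X k (fst z) * Y l (snd z)) * (cos (real j * fst z + \<phi>) * cos (real i * snd z + \<psi>)) \<partial>sq)
    = (if j \<in> {1..M} \<and> i \<in> {1..M} then c j i * T1 j \<phi> * T2 i \<psi> else 0)"
proof -
  define e where "e k l z = (X k (fst z) * cos (real j * fst z + \<phi>)) * (Y l (snd z) * cos (real i * snd z + \<psi>))" for k l z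
  have Xc: "(\<lambda>x. X k x * cos (real j * x + \<phi>)) \<in> borel_measurable borel"
    "(\<lambda>x. Y k x * cos (real i * x + \<psi>)) \<in> borel_measurable borel" for k
    using X(1) Y(1) by (intro borel_measurable_times; measurable)+
  have B0: "0 \<le> B" using X(2)[of 0 0] by linarith
  have Xb: "\<bar>X k x * cos (real j * x + \<phi>)\<bar> \<le> B" "\<bar>Y k x * cos (real i * x + \<psi>)\<bar> \<le> B" for k x
    unfolding abs_mult using X(2)[of k x] Y(2)[of k x] B0 by (auto intro!: mult_mono[of _ B _ 1, simplified])
  have ie: "(\<integral>z. e k l z \<partial>sq) = (\<integral>x. X k x * cos (real j * x + \<phi>) \<partial>circ) * (\<integral>x. Y l x * cos (real i * x + \<psi>) \<partial>circ)" for k l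
    unfolding e_def by (rule integral_sq_mult[OF Xc Xb])
  have int: "integrable sq (\<lambda>z. e k l z)" for k l
  proof (rule sq.integrable_const_bound[where B = "B * B"])
    show "AE z in sq. norm (e k l z) \<le> B * B"
      unfolding e_def norm_mult[of "_ * _" "_ * _"] using Xb B0 by (intro AE_I2 mult_mono) auto
    show "e k l \<in> borel_measurable sq" unfolding e_def[abs_def]
      using borel_measurable_comp_fst[OF Xc(1)] borel_measurable_comp_snd[OF Xc(2)] by simp
  qed
  have "(\<integral>z. (\<Sum>k=1..M. \<Sum>l=1..M. c k l * X k (fst z) * Y l (snd z)) * (cos (real j * fst z + \<phi>) * cos (real i * snd z + \<psi>)) \<partial>sq)
     = (\<integral>z. (\<Sum>k=1..M. \<Sum>l=1..M. c k l * e k l z) \<partial>sq)"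
    unfolding e_def by (simp add: sum_distrib_left sum_distrib_right mult_ac)
  also have "\<dots> = (\<Sum>k=1..M. \<Sum>l=1..M. c k l * (\<integral>z. e k l z \<partial>sq))" using int by simp
  also have "\<dots> = (\<Sum>k=1..M. \<Sum>l=1..M. if l = i then (if k = j then c j i * T1 j \<phi> * T2 i \<psi> else 0) else 0)"
    unfolding ie by (intro sum.cong refl) (auto simp: T1 T2)
  also have "\<dots> = (if j \<in> {1..M} \<and> i \<in> {1..M} then c j i * T1 j \<phi> * T2 i \<psi> else 0)"
  proof -
    have "(\<Sum>l=1..M. if l = i then (if k = j then X else 0) else 0) = (if k = j then (if i \<in> {1..M} then X else 0) else 0)"
      for k and X :: real
      by (simp add: sum.delta)
    then show ?thesis by (simp add: sum.delta)
  qed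
  finally show ?thesis .
qed

text \<open>The integral over a period of the difference of cos (j x) against cos (j x + \<phi>),
  for j \<ge> 1; the factor pi is the squared norm of the cosine.\<close>

definition diff_multiplier :: "real \<Rightarrow> real \<Rightarrow> nat \<Rightarrow> real \<Rightarrow> real" where
  "diff_multiplier \<alpha> h j \<phi> = pi * (\<Sum>\<nu>. fcoef \<alpha> \<nu> * cos (real j * ((\<alpha> - real \<nu>) * h) - \<phi>))"

lemma integral_fdiff_cos:
  assumes \<alpha>: "0 < \<alpha>" and k: "1 \<le> k"
  shows "(\<integral>x. fdiff \<alpha> h (\<lambda>x. cos (real k * x)) x * cos (real j * x + \<phi>) \<partial>circ) = (if j = k then diff_multiplier \<alpha> h j \<phi> else 0)"
proof -
  define e where "e \<nu> x = fcoef \<alpha> \<nu> * cos (real k * (x + (\<alpha> - real \<nu>) * h)) * cos (real j * x + \<phi>)" for \<nu> x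
  have eb: "norm (e \<nu> x) \<le> \<bar>fcoef \<alpha> \<nu>\<bar>" for \<nu> x
    unfolding e_def norm_mult by (auto intro!: mult_left_le mult_le_one simp: mult.assoc)
  have [measurable]: "e \<nu> \<in> borel_measurable borel" for \<nu> unfolding e_def[abs_def] by measurable
  have ei: "integrable circ (e \<nu>)" for \<nu>
    by (rule circ.integrable_const_bound[where B = "\<bar>fcoef \<alpha> \<nu>\<bar>"]) (use eb in auto)
  have sum: "summable (\<lambda>\<nu>. norm (e \<nu> x))" for x
    by (rule summable_comparison_test'[OF summable_abs_fcoef[OF \<alpha>]]) (use eb in auto)
  have isum: "summable (\<lambda>\<nu>. \<integral>x. norm (e \<nu> x) \<partial>circ)"
  proof (rule summable_comparison_test')
    show "summable (\<lambda>\<nu>. \<bar>fcoef \<alpha> \<nu>\<bar> * measure circ (space circ))"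
      by (rule summable_mult2[OF summable_abs_fcoef[OF \<alpha>]])
    fix \<nu>
    have "(\<integral>x. norm (e \<nu> x) \<partial>circ) \<le> (\<integral>x. \<bar>fcoef \<alpha> \<nu>\<bar> \<partial>circ)"
      using ei eb by (intro integral_mono) auto
    then show "norm (\<integral>x. norm (e \<nu> x) \<partial>circ) \<le> \<bar>fcoef \<alpha> \<nu>\<bar> * measure circ (space circ)"
      by (simp add: mult.commute)
  qed
  have "fdiff \<alpha> h (\<lambda>x. cos (real k * x)) x * cos (real j * x + \<phi>) = (\<Sum>\<nu>. e \<nu> x)" for x
    unfolding fdiff_def e_def
    by (subst suminf_mult2) (rule summable_fdiff[OF \<alpha>, where B = 1], auto)
  then have "(\<integral>x. fdiff \<alpha> h (\<lambda>x. cos (real k * x)) x * cos (real j * x + \<phi>) \<partial>circ) = (\<integral>x. (\<Sum>\<nu>. e \<nu> x) \<partial>circ)"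
    by simp
  also have "\<dots> = (\<Sum>\<nu>. \<integral>x. e \<nu> x \<partial>circ)"
    by (rule integral_suminf[OF ei _ isum]) (use sum in auto)
  also have "(\<lambda>\<nu>. \<integral>x. e \<nu> x \<partial>circ) = (\<lambda>\<nu>. if j = k then pi * (fcoef \<alpha> \<nu> * cos (real j * ((\<alpha> - real \<nu>) * h) - \<phi>)) else 0)"
  proof
    fix \<nu>
    have "(\<integral>x. e \<nu> x \<partial>circ) = fcoef \<alpha> \<nu> * (\<integral>x. cos (real k * x + real k * ((\<alpha> - real \<nu>) * h)) * cos (real j * x + \<phi>) \<partial>circ)"
      unfolding e_def by (simp add: mult.assoc distrib_left)
    then show "(\<integral>x. e \<nu> x \<partial>circ) = (if j = k then pi * (fcoef \<alpha> \<nu> * cos (real j * ((\<alpha> - real \<nu>) * h) - \<phi>)) else 0)"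
      using k integral_circ_cos_cos[of k "real k * ((\<alpha> - real \<nu>) * h)" j \<phi>] by (cases "j = k") simp_all
  qed
  also have "(\<Sum>\<nu>. if j = k then pi * (fcoef \<alpha> \<nu> * cos (real j * ((\<alpha> - real \<nu>) * h) - \<phi>)) else 0) = (if j = k then diff_multiplier \<alpha> h j \<phi> else 0)"
  proof (cases "j = k")
    case True
    have "summable (\<lambda>\<nu>. fcoef \<alpha> \<nu> * cos (real j * ((\<alpha> - real \<nu>) * h) - \<phi>))"
      by (rule summable_rabs_cancel,
          rule summable_fdiff_norm[OF \<alpha>, where f = "\<lambda>y. cos (y - \<phi>)" and B = 1 and g = "\<lambda>\<nu>. real j * ((\<alpha> - real \<nu>) * h)"])
         (rule abs_cos_le_one)
    then show ?thesis using True by (simp add: diff_multiplier_def suminf_mult)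
  qed simp
  finally show ?thesis .
qed

lemma frac_diff_eq:
  "frac_diff_1 \<alpha>1 h1 (frac_diff_2 \<alpha>2 h2 F) z =
    (\<Sum>\<nu>. fcoef \<alpha>1 \<nu> * (\<Sum>\<mu>. fcoef \<alpha>2 \<mu> * F (fst z + (\<alpha>1 - real \<nu>) * h1, snd z + (\<alpha>2 - real \<mu>) * h2)))"
  by (cases z) (simp add: frac_diff_1_def frac_diff_2_def fcoef_def)

lemma frac_diff_double_sum:
  fixes X Y :: "nat \<Rightarrow> real \<Rightarrow> real"
  assumes \<alpha>: "0 < \<alpha>1" "0 < \<alpha>2" and X: "\<And>k x. \<bar>X k x\<bar> \<le> B k" and Y: "\<And>k x. \<bar>Y k x\<bar> \<le> B k"
  shows "frac_diff_1 \<alpha>1 h1 (frac_diff_2 \<alpha>2 h2 (\<lambda>z. \<Sum>m=1..M. \<Sum>n=1..M. c m n * X m (fst z) * Y n (snd z))) z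
    = (\<Sum>m=1..M. \<Sum>n=1..M. c m n * fdiff \<alpha>1 h1 (X m) (fst z) * fdiff \<alpha>2 h2 (Y n) (snd z))"
proof -
  have "(\<Sum>\<mu>. fcoef \<alpha>2 \<mu> * (\<Sum>m=1..M. \<Sum>n=1..M. c m n * X m x * Y n (snd z + (\<alpha>2 - real \<mu>) * h2)))
     = (\<Sum>m=1..M. (\<Sum>n=1..M. c m n * fdiff \<alpha>2 h2 (Y n) (snd z)) * X m x)" for x
  proof -
    have "(\<Sum>\<mu>. fcoef \<alpha>2 \<mu> * (\<Sum>m=1..M. \<Sum>n=1..M. c m n * X m x * Y n (snd z + (\<alpha>2 - real \<mu>) * h2)))
      = (\<Sum>\<mu>. fcoef \<alpha>2 \<mu> * (\<Sum>n=1..M. (\<Sum>m=1..M. c m n * X m x) * Y n (snd z + (\<alpha>2 - real \<mu>) * h2)))"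
      by (subst sum.swap) (simp add: sum_distrib_right)
    also have "\<dots> = fdiff \<alpha>2 h2 (\<lambda>y. \<Sum>n=1..M. (\<Sum>m=1..M. c m n * X m x) * Y n y) (snd z)"
      by (simp add: fdiff_def)
    also have "\<dots> = (\<Sum>n=1..M. (\<Sum>m=1..M. c m n * X m x) * fdiff \<alpha>2 h2 (Y n) (snd z))"
      by (rule fdiff_sum[OF \<alpha>(2), where B = B]) (use Y in auto)
    also have "\<dots> = (\<Sum>m=1..M. (\<Sum>n=1..M. c m n * fdiff \<alpha>2 h2 (Y n) (snd z)) * X m x)"
      unfolding sum_distrib_right by (subst sum.swap) (simp add: mult_ac)
    finally show ?thesis .
  qed
  then have "frac_diff_1 \<alpha>1 h1 (frac_diff_2 \<alpha>2 h2 (\<lambda>z. \<Sum>m=1..M. \<Sum>n=1..M. c m n * X m (fst z) * Y n (snd z))) z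
    = fdiff \<alpha>1 h1 (\<lambda>x. \<Sum>m=1..M. (\<Sum>n=1..M. c m n * fdiff \<alpha>2 h2 (Y n) (snd z)) * X m x) (fst z)"
    unfolding frac_diff_eq by (simp add: fdiff_def)
  also have "\<dots> = (\<Sum>m=1..M. (\<Sum>n=1..M. c m n * fdiff \<alpha>2 h2 (Y n) (snd z)) * fdiff \<alpha>1 h1 (X m) (fst z))"
    by (rule fdiff_sum[OF \<alpha>(1), where B = B]) (use X in auto)
  finally show ?thesis by (simp add: sum_distrib_left sum_distrib_right mult_ac)
qed

lemma dirichlet_periodic [simp]: "dirichlet m (x + 2 * pi) = dirichlet m x"
proof -
  have "cos (real k * (x + 2 * pi)) = cos (real k * x)" for k
    using cos.plus_of_nat[of "real k * x" k] by (simp add: algebra_simps)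
  then show ?thesis by (simp add: dirichlet_def)
qed

section \<open>The series of Dirichlet kernels and its almost everywhere limit\<close>

context cosine_class begin

text \<open>Set to 0 at index 0, where nothing is known about \<open>a\<close>, so that it is
  nonnegative everywhere and fits the unrestricted positivity hypotheses on weights.\<close>

definition mixed_diff :: "nat \<Rightarrow> nat \<Rightarrow> real" where
  "mixed_diff m n = (if 1 \<le> m \<and> 1 \<le> n then a m n - a (m + 1) n - a m (n + 1) + a (m + 1) (n + 1) else 0)"

lemma mixed_diff_nonneg [simp]: "0 \<le> mixed_diff m n" using mixed by (simp add: mixed_diff_def)

definition trunc_coeff :: "nat \<Rightarrow> nat \<Rightarrow> nat \<Rightarrow> real" where
  "trunc_coeff M k l = (\<Sum>m=k..M. \<Sum>n=l..M. mixed_diff m n)"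

lemma trunc_coeff_eq:
  assumes "1 \<le> k" "k \<le> M" "1 \<le> l" "l \<le> M"
  shows "trunc_coeff M k l = a k l - a (Suc M) l - a k (Suc M) + a (Suc M) (Suc M)"
proof -
  have inner: "(\<Sum>n=l..M. mixed_diff m n) = (a m l - a m (Suc M)) - (a (Suc m) l - a (Suc m) (Suc M))" if "1 \<le> m" for m
  proof -
    have "(\<Sum>n=l..M. mixed_diff m n) = (\<Sum>n=l..M. (a (m + 1) (Suc n) - a m (Suc n)) - (a (m + 1) n - a m n))"
      using that assms by (intro sum.cong) (auto simp: mixed_diff_def)
    also have "\<dots> = (a (m + 1) (Suc M) - a m (Suc M)) - (a (m + 1) l - a m l)"
      using assms by (subst sum_Suc_diff) auto
    finally show ?thesis by simp
  qed
  have "trunc_coeff M k l = (\<Sum>m=k..M. - (a (Suc m) l - a (Suc m) (Suc M)) - (- (a m l - a m (Suc M))))"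
    unfolding trunc_coeff_def using assms by (intro sum.cong) (auto simp: inner)
  also have "\<dots> = - (a (Suc M) l - a (Suc M) (Suc M)) - (- (a k l - a k (Suc M)))"
    using assms by (subst sum_Suc_diff[of k M "\<lambda>m. - (a m l - a m (Suc M))"]) auto
  finally show ?thesis by simp
qed

lemma trunc_coeff_nonneg [simp]: "0 \<le> trunc_coeff M k l" unfolding trunc_coeff_def by (intro sum_nonneg) auto

lemma trunc_coeff_le: "1 \<le> k \<Longrightarrow> k \<le> M \<Longrightarrow> 1 \<le> l \<Longrightarrow> l \<le> M \<Longrightarrow> trunc_coeff M k l \<le> a k l"
  using coeff_antimono[of "Suc M" "Suc M" l "Suc M"] coeff_nonneg[of k "Suc M"] by (simp add: trunc_coeff_eq)

lemma trunc_coeff_tendsto: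
  assumes "1 \<le> k" "1 \<le> l"
  shows "(\<lambda>M. trunc_coeff M k l) \<longlonglongrightarrow> a k l"
proof -
  \<comment> \<open>Riemann--Lebesgue was proved with one index fixed; the diagonal is squeezed
    below the first column by monotonicity.\<close>
  have d: "(\<lambda>M. a (Suc M) (Suc M)) \<longlonglongrightarrow> 0"
  proof (rule tendsto_sandwich[of "\<lambda>_. 0" _ _ "\<lambda>M. a (Suc M) 1"])
    show "(\<lambda>M. a (Suc M) 1) \<longlonglongrightarrow> 0" by (rule LIMSEQ_Suc[OF coeff_tendsto_0(1)]) simp
    show "\<forall>\<^sub>F M in sequentially. 0 \<le> a (Suc M) (Suc M)" using coeff_nonneg by auto
    show "\<forall>\<^sub>F M in sequentially. a (Suc M) (Suc M) \<le> a (Suc M) 1" using coeff_antimono by auto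
  qed auto
  have "(\<lambda>M. a k l - a (Suc M) l - a k (Suc M) + a (Suc M) (Suc M)) \<longlonglongrightarrow> a k l - 0 - 0 + 0"
    by (intro tendsto_intros d LIMSEQ_Suc[OF coeff_tendsto_0(1)] LIMSEQ_Suc[OF coeff_tendsto_0(2)] assms)
  moreover have "\<forall>\<^sub>F M in sequentially. a k l - a (Suc M) l - a k (Suc M) + a (Suc M) (Suc M) = trunc_coeff M k l"
    using eventually_ge_at_top[of "max k l"] by eventually_elim (use assms in \<open>simp add: trunc_coeff_eq\<close>)
  ultimately have "(\<lambda>M. trunc_coeff M k l) \<longlonglongrightarrow> a k l - 0 - 0 + 0" by (rule Lim_transform_eventually)
  then show ?thesis by simp
qed

text \<open>Not a rectangular partial sum of the Fourier series: its cosine coefficients are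
  \<open>trunc_coeff M\<close>, tails of mixed differences cut at M, which lie below the true
  coefficients and converge to them. The nonnegative weights are the point of this choice.\<close>

definition FM :: "nat \<Rightarrow> real \<times> real \<Rightarrow> real" where
  "FM M z = (\<Sum>m=1..M. \<Sum>n=1..M. mixed_diff m n * dirichlet m (fst z) * dirichlet n (snd z))"

definition GM :: "nat \<Rightarrow> real \<times> real \<Rightarrow> real" where
  "GM M z = (\<Sum>m=1..M. \<Sum>n=1..M. mixed_diff m n * \<bar>dirichlet m (fst z)\<bar> * \<bar>dirichlet n (snd z)\<bar>)"

lemma FM_eq: "FM M z = (\<Sum>k=1..M. \<Sum>l=1..M. trunc_coeff M k l * cos (real k * fst z) * cos (real l * snd z))"
  unfolding FM_def dirichlet_def trunc_coeff_def by (rule sum_quad_swap)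

lemma measurable_dirichlet_prod: "(\<lambda>z. mixed_diff m n * dirichlet m (fst z) * dirichlet n (snd z)) \<in> borel_measurable borel"
  by (intro borel_measurable_times borel_measurable_const borel_measurable_comp_fst borel_measurable_comp_snd measurable_dirichlet)

lemma FM_measurable [measurable]: "FM M \<in> borel_measurable borel"
  unfolding FM_def[abs_def] by (intro borel_measurable_sum measurable_dirichlet_prod)

lemma GM_alt: "GM M z = (\<Sum>m=1..M. \<Sum>n=1..M. \<bar>mixed_diff m n * dirichlet m (fst z) * dirichlet n (snd z)\<bar>)"
  unfolding GM_def by (simp add: abs_mult)

lemma GM_measurable [measurable]: "GM M \<in> borel_measurable borel"
  unfolding GM_alt[abs_def] by (intro borel_measurable_sum borel_measurable_abs measurable_dirichlet_prod)

lemma GM_nonneg [simp]: "0 \<le> GM M z" unfolding GM_alt by (intro sum_nonneg) auto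

lemma FM_le_GM: "\<bar>FM M z\<bar> \<le> GM M z"
  unfolding FM_def GM_alt by (rule order_trans[OF sum_abs]) (intro sum_mono sum_abs)

lemma square_sum_mono:
  fixes g :: "nat \<Rightarrow> nat \<Rightarrow> real"
  assumes "M \<le> M'" "\<And>m n. 0 \<le> g m n"
  shows "(\<Sum>m=1..M. \<Sum>n=1..M. g m n) \<le> (\<Sum>m=1..M'. \<Sum>n=1..M'. g m n)"
proof -
  have "(\<Sum>m=1..M. \<Sum>n=1..M. g m n) \<le> (\<Sum>m=1..M. \<Sum>n=1..M'. g m n)"
    using assms by (intro sum_mono sum_mono2) auto
  also have "\<dots> \<le> (\<Sum>m=1..M'. \<Sum>n=1..M'. g m n)"
    using assms by (intro sum_mono2 sum_nonneg) auto
  finally show ?thesis .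
qed

lemma GM_mono: "M \<le> M' \<Longrightarrow> GM M z \<le> GM M' z"
  unfolding GM_alt by (rule square_sum_mono) auto

definition GS :: "real \<times> real \<Rightarrow> ennreal" where
  "GS z = (SUP M. ennreal (GM M z))"

lemma GS_measurable [measurable]: "GS \<in> borel_measurable borel"
  unfolding GS_def[abs_def] by measurable

lemma GM_le_GS: "GS z < \<infinity> \<Longrightarrow> GM M z \<le> enn2real (GS z)"
  unfolding GS_def by (metis SUP_upper UNIV_I enn2real_ennreal enn2real_mono GM_nonneg infinity_ennreal_def)

text \<open>Absolute convergence along squares: the positive and the negative parts of the terms
  each give increasing sums bounded by \<open>GS\<close>.\<close>

lemma FM_convergent:
  assumes "GS z < \<infinity>"
  shows "convergent (\<lambda>M. FM M z)"
proof -
  define e where "e m n = mixed_diff m n * dirichlet m (fst z) * dirichlet n (snd z)" for m n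
  have conv: "convergent (\<lambda>M. \<Sum>m=1..M. \<Sum>n=1..M. g m n)"
    if g: "\<And>m n. 0 \<le> g m n" "\<And>m n. g m n \<le> \<bar>e m n\<bar>" for g
  proof (rule Bseq_monoseq_convergent)
    have "(\<Sum>m=1..M. \<Sum>n=1..M. g m n) \<le> enn2real (GS z)" for M
    proof -
      have "(\<Sum>m=1..M. \<Sum>n=1..M. g m n) \<le> GM M z"
        unfolding GM_alt using g(2) by (intro sum_mono) (simp add: e_def)
      then show ?thesis using GM_le_GS[OF assms, of M] by linarith
    qed
    moreover have "0 \<le> (\<Sum>m=1..M. \<Sum>n=1..M. g m n)" for M using g by (intro sum_nonneg) auto
    ultimately have "norm (\<Sum>m=1..M. \<Sum>n=1..M. g m n) \<le> enn2real (GS z)" for M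
      by (simp only: real_norm_def abs_of_nonneg)
    then show "Bseq (\<lambda>M. \<Sum>m=1..M. \<Sum>n=1..M. g m n)" by (rule BseqI')
    show "monoseq (\<lambda>M. \<Sum>m=1..M. \<Sum>n=1..M. g m n)"
      unfolding monoseq_def using square_sum_mono[of _ _ g] g by blast
  qed
  have "FM M z = (\<Sum>m=1..M. \<Sum>n=1..M. max 0 (e m n)) - (\<Sum>m=1..M. \<Sum>n=1..M. max 0 (- e m n))" for M
  proof -
    have "FM M z = (\<Sum>m=1..M. \<Sum>n=1..M. e m n)" by (simp only: FM_def e_def)
    also have "\<dots> = (\<Sum>m=1..M. \<Sum>n=1..M. max 0 (e m n) - max 0 (- e m n))"
      by (intro sum.cong refl) (simp add: max_def)
    finally show ?thesis by (simp only: sum_subtractf)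
  qed
  moreover have "convergent (\<lambda>M. \<Sum>m=1..M. \<Sum>n=1..M. max 0 (e m n))" by (rule conv) auto
  moreover have "convergent (\<lambda>M. \<Sum>m=1..M. \<Sum>n=1..M. max 0 (- e m n))" by (rule conv) auto
  ultimately show ?thesis by (simp add: convergent_diff)
qed

text \<open>A Borel representative of the function that is periodic everywhere: where the limit
  fails to exist, \<open>lim\<close> still sees the same sequence at all translates by
  periods.\<close>

definition F :: "real \<times> real \<Rightarrow> real" where
  "F z = lim (\<lambda>M. FM M z)"

lemma F_measurable [measurable]: "F \<in> borel_measurable borel"
  unfolding F_def[abs_def] by measurable

lemma FM_tendsto: "GS z < \<infinity> \<Longrightarrow> (\<lambda>M. FM M z) \<longlonglongrightarrow> F z"
  using FM_convergent unfolding F_def by (simp add: convergent_LIMSEQ_iff)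

lemma FM_periodic: "FM M (x + 2 * pi, y) = FM M (x, y)" "FM M (x, y + 2 * pi) = FM M (x, y)"
  by (simp_all add: FM_def)

lemma F_periodic: "F (x + 2 * pi, y) = F (x, y)" "F (x, y + 2 * pi) = F (x, y)"
  by (simp_all add: F_def FM_periodic)

lemma GS_periodic: "GS (x + 2 * pi, y) = GS (x, y)" "GS (x, y + 2 * pi) = GS (x, y)"
  by (simp_all add: GS_def GM_def)

text \<open>Each \<open>GM M\<close> lies below a positive combination of kernels with coefficients
  at most 16 times those of the function, so its p-th power has a uniformly bounded integral. On a
  finite measure space this controls the integral itself, through S \<le> 1 + S powr p, and monotone
  convergence gives the supremum.\<close>

lemma GS_nn_integral: "(\<integral>\<^sup>+z. GS z \<partial>sq) < \<infinity>"
proof -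
  obtain C where C: "C > 0" and K: "\<And>m A. (\<And>k l. 0 \<le> A k l) \<Longrightarrow>
       (\<integral>\<^sup>+z. ennreal ((\<Sum>k=1..m. \<Sum>l=1..m. A k l * ker k (fst z) * ker l (snd z)) powr p) \<partial>sq)
       \<le> ennreal (C * (\<Sum>k=1..m. \<Sum>l=1..m. real k powr (p - 2) * real l powr (p - 2) * A k l powr p))"
    using hardy_littlewood_kernel_2[OF p] by blast
  obtain L where L: "\<And>M. (\<Sum>k=1..M. \<Sum>l=1..M. (real k * real l) powr (p - 2) * a k l powr p) \<le> L"
    using coeff_sum_finite by blast
  have dk: "\<bar>dirichlet m x\<bar> \<le> 4 * (\<Sum>k=1..m. ker k x)" if "1 \<le> m" for m x
  proof -
    \<comment> \<open>Order 0 switches the cutoff off, so the spreading estimate applies to the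
      plain Dirichlet kernel.\<close>
    have "cutoff 0 1 k = 1" if "1 \<le> k" for k using that by (simp add: cutoff_def)
    then have "real m * ker m x \<le> 2 * (\<Sum>k=1..m. ker k x)"
      using cutoff_mult_ker_le[of 0 1 m x] that by (simp add: cutoff_ker_def)
    then show ?thesis using abs_dirichlet_le[of m x] by linarith
  qed
  have pt: "GM M z \<le> (\<Sum>k=1..M. \<Sum>l=1..M. (16 * trunc_coeff M k l) * ker k (fst z) * ker l (snd z))" for M z
  proof -
    have "GM M z \<le> (\<Sum>m=1..M. \<Sum>n=1..M. mixed_diff m n * (4 * (\<Sum>k=1..m. ker k (fst z))) * (4 * (\<Sum>l=1..n. ker l (snd z))))"
      unfolding GM_def by (intro sum_mono mult_mono dk mult_nonneg_nonneg sum_nonneg) auto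
    also have "\<dots> = (\<Sum>m=1..M. \<Sum>n=1..M. (16 * mixed_diff m n) * (\<Sum>k=1..m. ker k (fst z)) * (\<Sum>l=1..n. ker l (snd z)))"
      by (simp add: mult_ac)
    also have "\<dots> = (\<Sum>k=1..M. \<Sum>l=1..M. (16 * trunc_coeff M k l) * ker k (fst z) * ker l (snd z))"
      unfolding trunc_coeff_def by (subst sum_quad_swap) (simp add: sum_distrib_left)
    finally show ?thesis .
  qed
  have bound: "(\<integral>\<^sup>+z. ennreal (GM M z) \<partial>sq) \<le> emeasure sq (space sq) + ennreal (C * (16 powr p * L))" for M
  proof -
    have "(\<integral>\<^sup>+z. ennreal (GM M z) \<partial>sq) \<le> (\<integral>\<^sup>+z. 1 + ennreal ((\<Sum>k=1..M. \<Sum>l=1..M. (16 * trunc_coeff M k l) * ker k (fst z) * ker l (snd z)) powr p) \<partial>sq)"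
    proof (intro nn_integral_mono)
      fix z
      define S where "S = (\<Sum>k=1..M. \<Sum>l=1..M. (16 * trunc_coeff M k l) * ker k (fst z) * ker l (snd z))"
      have "GM M z \<le> S" using pt by (simp add: S_def)
      moreover have S0: "0 \<le> S" using calculation GM_nonneg[of M z] by linarith
      moreover have "S \<le> 1 + S powr p"
        using powr_mono[of 1 p S] p S0 by (cases "S \<le> 1") (auto intro: add_increasing2 simp: add_increasing)
      ultimately have "GM M z \<le> 1 + S powr p" by linarith
      then have "ennreal (GM M z) \<le> ennreal (1 + S powr p)" by (rule ennreal_leI)
      then show "ennreal (GM M z) \<le> 1 + ennreal ((\<Sum>k=1..M. \<Sum>l=1..M. (16 * trunc_coeff M k l) * ker k (fst z) * ker l (snd z)) powr p)"
        unfolding S_def[symmetric] by (simp add: ennreal_plus)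
    qed
    also have "\<dots> = emeasure sq (space sq) + (\<integral>\<^sup>+z. ennreal ((\<Sum>k=1..M. \<Sum>l=1..M. (16 * trunc_coeff M k l) * ker k (fst z) * ker l (snd z)) powr p) \<partial>sq)"
    proof -
      have "(\<lambda>z. (\<Sum>k=1..M. \<Sum>l=1..M. (16 * trunc_coeff M k l) * ker k (fst z) * ker l (snd z))) \<in> borel_measurable borel"
        by (intro borel_measurable_sum borel_measurable_times borel_measurable_const borel_measurable_comp_fst borel_measurable_comp_snd ker_measurable)
      then show ?thesis by (subst nn_integral_add) auto
    qed
    also have "\<dots> \<le> emeasure sq (space sq) + ennreal (C * (\<Sum>k=1..M. \<Sum>l=1..M. real k powr (p - 2) * real l powr (p - 2) * (16 * trunc_coeff M k l) powr p))"
      by (intro add_left_mono K) auto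
    also have "\<dots> \<le> emeasure sq (space sq) + ennreal (C * (16 powr p * L))"
    proof (intro add_left_mono ennreal_leI mult_left_mono)
      have "(\<Sum>k=1..M. \<Sum>l=1..M. real k powr (p - 2) * real l powr (p - 2) * (16 * trunc_coeff M k l) powr p)
         \<le> (\<Sum>k=1..M. \<Sum>l=1..M. 16 powr p * ((real k * real l) powr (p - 2) * a k l powr p))"
      proof (intro sum_mono)
        fix k l assume kl: "k \<in> {1..M}" "l \<in> {1..M}"
        have "(16 * trunc_coeff M k l) powr p \<le> (16 * a k l) powr p"
          using kl p trunc_coeff_le[of k M l] by (intro powr_mono2) auto
        then have "real k powr (p - 2) * real l powr (p - 2) * (16 * trunc_coeff M k l) powr p \<le> real k powr (p - 2) * real l powr (p - 2) * (16 * a k l) powr p"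
          by (intro mult_left_mono) auto
        then show "real k powr (p - 2) * real l powr (p - 2) * (16 * trunc_coeff M k l) powr p
            \<le> 16 powr p * ((real k * real l) powr (p - 2) * a k l powr p)"
          by (simp add: powr_mult mult_ac)
      qed
      also have "\<dots> \<le> 16 powr p * L" using L[of M] by (simp flip: sum_distrib_left)
      finally show "(\<Sum>k=1..M. \<Sum>l=1..M. real k powr (p - 2) * real l powr (p - 2) * (16 * trunc_coeff M k l) powr p) \<le> 16 powr p * L" .
    qed (use C in auto)
    finally show ?thesis .
  qed
  have "(\<integral>\<^sup>+z. GS z \<partial>sq) = (SUP M. \<integral>\<^sup>+z. ennreal (GM M z) \<partial>sq)"
    unfolding GS_def by (rule nn_integral_monotone_convergence_SUP) (auto simp: incseq_def le_fun_def intro!: ennreal_leI GM_mono)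
  also have "\<dots> \<le> emeasure sq (space sq) + ennreal (C * (16 powr p * L))"
    by (intro SUP_least bound)
  also have "\<dots> < \<infinity>"
    unfolding sq.emeasure_eq_measure by (simp flip: ennreal_plus)
  finally show ?thesis .
qed

end

section \<open>Coefficient bounds for the differences\<close>

text \<open>The multiplier \<open>m\<close> is that of the difference for one step, or its average over the steps \<open>H t\<close>;
  the quantification over \<open>N\<close>, \<open>c\<close> and \<open>Y\<close> says this without mentioning the averaging measure.\<close>

definition good_test :: "real \<Rightarrow> real \<Rightarrow> real \<Rightarrow> nat \<Rightarrow> nat set \<Rightarrow> (nat \<Rightarrow> real) \<Rightarrow> (real \<Rightarrow> real) \<Rightarrow> (real \<Rightarrow> real) \<Rightarrow> real \<Rightarrow> bool" where
  "good_test \<alpha> \<delta> d lo R m H s \<theta> \<longleftrightarrow> 1 \<le> lo \<and> (\<forall>t. \<bar>H t\<bar> \<le> \<delta>) \<and>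
     (\<forall>N c Y. (\<forall>t. (\<Sum>k=1..N. c k * diff_multiplier \<alpha> (H t) k (real k * s t + \<theta>)) \<le> Y) \<longrightarrow> (\<Sum>k=1..N. c k * m k) \<le> (Y::real)) \<and>
     (\<forall>n\<in>R. \<forall>k\<in>{lo..n}. d * cutoff \<alpha> \<delta> k \<le> m k) \<and>
     (\<forall>n\<in>R. d * (real n * cutoff \<alpha> \<delta> n) \<le> (\<Sum>k=lo..n. cutoff \<alpha> \<delta> k))"

text \<open>For \<open>k \<delta> \<le> L\<close> a single small step suffices: the phase makes every multiplier positive.\<close>

lemma good_test_low:
  assumes \<alpha>: "0 < \<alpha>" and \<delta>: "0 < \<delta>" and L: "1 \<le> L"
    and d: "0 \<le> d" "d \<le> (1 / (2 * L)) powr \<alpha>" "d \<le> 1 / 2 powr (\<alpha> + 1)"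
  shows "\<exists>m H s \<theta>. good_test \<alpha> \<delta> d 1 {n \<in> {1..M}. real n * \<delta> \<le> L} m H s \<theta>"
proof -
  \<comment> \<open>All frequencies with k \<delta> \<le> L then satisfy k h \<le> 1, inside the
    range where the multiplier is explicit and comparable with (k h) powr \<alpha>.\<close>
  define h where "h = \<delta> / L"
  have h: "0 < h" "h \<le> \<delta>" using \<delta> L by (auto simp: h_def field_simps)
  define m where "m k = diff_multiplier \<alpha> h k (real k * (\<alpha> * h / 2) + \<alpha> * pi / 2)" for k
  have m: "d * cutoff \<alpha> \<delta> k \<le> m k" if k: "real k * \<delta> \<le> L" for k
  proof -
    have kh: "0 \<le> real k * h" "real k * h \<le> 1" using k L h by (auto simp: h_def field_simps)
    have khp: "real k * h \<le> pi" using kh pi_ge_two by linarith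
    \<comment> \<open>Translation by \<alpha> h / 2 and phase \<alpha> pi / 2 are exactly what
      cancels the argument of the cosine in \<open>fcoef_cos_sums\<close>, leaving the factor cos
      0.\<close>
    define \<beta> where "\<beta> = real k * \<alpha> * h - (real k * (\<alpha> * h / 2) + \<alpha> * pi / 2)"
    have "(\<lambda>\<nu>. fcoef \<alpha> \<nu> * cos (\<beta> - real \<nu> * (real k * h))) sums
      ((2 * sin (real k * h / 2)) powr \<alpha> * cos (\<beta> + \<alpha> * (pi - real k * h) / 2))"
      by (rule fcoef_cos_sums[OF \<alpha> kh(1) khp])
    moreover have "\<beta> + \<alpha> * (pi - real k * h) / 2 = 0"
      by (simp add: \<beta>_def field_simps)
    moreover have "\<beta> - real \<nu> * (real k * h)
        = real k * ((\<alpha> - real \<nu>) * h) - (real k * (\<alpha> * h / 2) + \<alpha> * pi / 2)" for \<nu>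
      by (simp add: \<beta>_def algebra_simps)
    ultimately have "(\<lambda>\<nu>. fcoef \<alpha> \<nu> * cos (real k * ((\<alpha> - real \<nu>) * h) - (real k * (\<alpha> * h / 2) + \<alpha> * pi / 2))) sums
      ((2 * sin (real k * h / 2)) powr \<alpha>)"
      by (simp only: cos_zero mult_1_right)
    then have mk: "m k = pi * (2 * sin (real k * h / 2)) powr \<alpha>"
      unfolding m_def diff_multiplier_def by (simp only: sums_iff)
    have "real k * h / 4 \<le> real k * h / pi"
      using kh pi_less_4 by (intro divide_left_mono) auto
    also have "\<dots> = 2 * (real k * h / 2) / pi" by simp
    also have "\<dots> \<le> sin (real k * h / 2)"
      using kh pi_ge_two by (intro sin_ge_two_pi) auto
    finally have "real k * h / 2 \<le> 2 * sin (real k * h / 2)" by simp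
    moreover have "min 1 (real k * \<delta>) * (1 / (2 * L)) \<le> real k * h / 2"
      using L \<delta> by (simp add: h_def min_def field_simps)
    ultimately have "(min 1 (real k * \<delta>) * (1 / (2 * L))) powr \<alpha> \<le> (2 * sin (real k * h / 2)) powr \<alpha>"
      using \<alpha> L \<delta> by (intro powr_mono2) auto
    moreover have "(min 1 (real k * \<delta>) * (1 / (2 * L))) powr \<alpha> = cutoff \<alpha> \<delta> k * (1 / (2 * L)) powr \<alpha>"
      unfolding cutoff_def by (rule powr_mult)
    ultimately have "cutoff \<alpha> \<delta> k * (1 / (2 * L)) powr \<alpha> \<le> (2 * sin (real k * h / 2)) powr \<alpha>" by simp
    moreover have "d * cutoff \<alpha> \<delta> k \<le> cutoff \<alpha> \<delta> k * (1 / (2 * L)) powr \<alpha>"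
      using mult_right_mono[OF d(2), of "cutoff \<alpha> \<delta> k"] by (simp add: mult.commute)
    moreover have "(2 * sin (real k * h / 2)) powr \<alpha> \<le> m k"
      unfolding mk using pi_ge_two mult_right_mono[of 1 pi "(2 * sin (real k * h / 2)) powr \<alpha>"] by simp
    ultimately show ?thesis by linarith
  qed
  have S: "d * (real n * cutoff \<alpha> \<delta> n) \<le> (\<Sum>k=1..n. cutoff \<alpha> \<delta> k)" for n
  proof -
    have "d * (real n * cutoff \<alpha> \<delta> n) \<le> d * (2 powr (\<alpha> + 1) * (\<Sum>k=1..n. cutoff \<alpha> \<delta> k))"
      using \<alpha> \<delta> d(1) by (intro mult_left_mono sum_cutoff_ge) auto
    also have "\<dots> = (d * 2 powr (\<alpha> + 1)) * (\<Sum>k=1..n. cutoff \<alpha> \<delta> k)" by simp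
    also have "\<dots> \<le> 1 * (\<Sum>k=1..n. cutoff \<alpha> \<delta> k)"
      using d(3) by (intro mult_right_mono sum_nonneg) (auto simp: field_simps)
    finally show ?thesis by simp
  qed
  have "good_test \<alpha> \<delta> d 1 {n \<in> {1..M}. real n * \<delta> \<le> L} m (\<lambda>_. h) (\<lambda>_. \<alpha> * h / 2) (\<alpha> * pi / 2)"
    unfolding good_test_def
  proof (intro conjI ballI allI impI)
    fix n k assume "n \<in> {n \<in> {1..M}. real n * \<delta> \<le> L}" "k \<in> {1..n}"
    then have "k \<le> n" "real n * \<delta> \<le> L" by auto
    moreover from this have "real k * \<delta> \<le> real n * \<delta>" using \<delta> by (intro mult_right_mono) auto
    ultimately have "real k * \<delta> \<le> L" by linarith
    then show "d * cutoff \<alpha> \<delta> k \<le> m k" by (rule m)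
  qed (use h S in \<open>auto simp: m_def\<close>)
  then show ?thesis by blast
qed

text \<open>For large \<open>k \<delta>\<close> averaging over the steps in \<open>[0, \<delta>]\<close> damps all terms of the difference except the
  one with \<open>\<nu> = 0\<close>, which the translation makes constant.\<close>

lemma good_test_high:
  assumes \<alpha>: "0 < \<alpha>" and \<delta>: "0 < \<delta>" and lo: "1 \<le> lo" "2 * (\<Sum>\<nu>. \<bar>fcoef \<alpha> \<nu>\<bar>) \<le> real lo * \<delta>"
    and d: "0 \<le> d" "d \<le> 1 / 2"
  shows "\<exists>m H s \<theta>. good_test \<alpha> \<delta> d lo {n \<in> {1..M}. 2 * lo \<le> n} m H s \<theta>"
proof -
  define A where "A = (\<Sum>\<nu>. \<bar>fcoef \<alpha> \<nu>\<bar>)"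
  have sA: "summable (\<lambda>\<nu>. \<bar>fcoef \<alpha> \<nu>\<bar>)" by (rule summable_abs_fcoef[OF \<alpha>])
  have A1: "1 \<le> A"
    using sum_le_suminf[OF sA, of "{0}"] by (simp add: A_def fcoef_def)
  define U where "U = density lborel (\<lambda>x. indicator {0..\<delta>} x :: ennreal)"
  have [measurable_cong, simp]: "sets U = sets borel" by (simp add: U_def)
  have [simp]: "space U = UNIV" by (simp add: U_def)
  have eU: "emeasure U (space U) = ennreal \<delta>" unfolding U_def using \<delta> by (subst emeasure_density) auto
  interpret U: finite_measure U by (rule finite_measureI) (simp only: eU, simp)
  have mU: "measure U UNIV = \<delta>" using eU \<delta> by (simp add: measure_def)
  have AEU: "AE t in U. t \<in> {0..\<delta>}" unfolding U_def by (subst AE_density) (auto simp: indicator_def)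
  define \<mu> where "\<mu> k t = diff_multiplier \<alpha> t k (real k * (\<alpha> * t))" for k t
  define e where "e k \<nu> t = fcoef \<alpha> \<nu> * cos (real (\<nu> * k) * t)" for k \<nu> t
  have eb: "norm (e k \<nu> t) \<le> \<bar>fcoef \<alpha> \<nu>\<bar>" for k \<nu> t unfolding e_def norm_mult by (auto intro: mult_left_le)
  have \<mu>_eq: "\<mu> k t = pi * (\<Sum>\<nu>. e k \<nu> t)" for k t
  proof -
    have "cos (real k * ((\<alpha> - real \<nu>) * t) - real k * (\<alpha> * t)) = cos (real (\<nu> * k) * t)" for \<nu>
    proof -
      have "real k * ((\<alpha> - real \<nu>) * t) - real k * (\<alpha> * t) = - (real (\<nu> * k) * t)" by (simp add: algebra_simps)
      then show ?thesis by (simp only: cos_minus)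
    qed
    then show ?thesis unfolding \<mu>_def diff_multiplier_def e_def by simp
  qed
  have [measurable]: "e k \<nu> \<in> borel_measurable borel" for k \<nu> unfolding e_def[abs_def] by measurable
  have [measurable]: "\<mu> k \<in> borel_measurable borel" for k unfolding \<mu>_eq[abs_def] by measurable
  have ei: "integrable U (e k \<nu>)" for k \<nu>
    by (rule U.integrable_const_bound[where B = "\<bar>fcoef \<alpha> \<nu>\<bar>"]) (use eb in auto)
  have esum: "summable (\<lambda>\<nu>. norm (e k \<nu> t))" for k t
    by (rule summable_comparison_test'[OF sA]) (use eb in auto)
  have \<mu>b: "\<bar>\<mu> k t\<bar> \<le> pi * A" for k t
  proof -
    have "norm (\<Sum>\<nu>. e k \<nu> t) \<le> (\<Sum>\<nu>. norm (e k \<nu> t))" by (rule summable_norm[OF esum])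
    also have "\<dots> \<le> A" unfolding A_def by (rule suminf_le[OF eb esum sA])
    finally show ?thesis unfolding \<mu>_eq abs_mult by simp
  qed
  have \<mu>i: "integrable U (\<mu> k)" for k
    by (rule U.integrable_const_bound[where B = "pi * A"]) (use \<mu>b in auto)
  define m where "m k = (\<integral>t. \<mu> k t \<partial>U) / \<delta>" for k
  have int_cos: "(\<integral>t. cos (real j * t) \<partial>U) = (if j = 0 then \<delta> else sin (real j * \<delta>) / real j)" for j
  proof (cases "j = 0")
    case False
    have "(\<integral>t. cos (real j * t) \<partial>U) = (\<integral>t. indicator {0..\<delta>} t *\<^sub>R cos (real j * t) \<partial>lborel)"
      unfolding U_def by (subst integral_density[symmetric]) (auto simp: ennreal_indicator)
    also have "\<dots> = sin (real j * \<delta>) / real j - sin (real j * 0) / real j"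
      by (rule integral_FTC_Icc)
         (use False \<delta> in \<open>auto intro!: derivative_eq_intros continuous_intros simp: has_real_derivative_iff_has_vector_derivative[symmetric]\<close>)
    finally show ?thesis using False by simp
  qed (simp add: mU)
  \<comment> \<open>The term \<nu> = 0 integrates to \<delta>. Every other one is an integral of cos
    (\<nu> k t), at most 1 / k in modulus, so together they contribute at most A / k \<le> \<delta>
    / 2.\<close>
  have mlow: "1 / 2 \<le> m k" if k: "lo \<le> k" for k
  proof -
    have k0: "0 < real k" using k lo by simp
    have kd: "2 * A \<le> real k * \<delta>"
    proof -
      have "real lo * \<delta> \<le> real k * \<delta>" using k \<delta> by (intro mult_right_mono) auto
      then show ?thesis using lo(2) unfolding A_def by linarith
    qed
    define r where "r \<nu> = (\<integral>t. e k \<nu> t \<partial>U)" for \<nu>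
    have r0: "r 0 = \<delta>" unfolding r_def e_def by (simp add: fcoef_def mU)
    have rb: "\<bar>r (Suc \<nu>)\<bar> \<le> \<bar>fcoef \<alpha> (Suc \<nu>)\<bar> * (1 / real k)" for \<nu>
    proof -
      have "r (Suc \<nu>) = fcoef \<alpha> (Suc \<nu>) * (sin (real (Suc \<nu> * k) * \<delta>) / real (Suc \<nu> * k))"
        unfolding r_def e_def using int_cos[of "Suc \<nu> * k"] k0 by simp
      moreover have "\<bar>sin (real (Suc \<nu> * k) * \<delta>) / real (Suc \<nu> * k)\<bar> \<le> 1 / real k"
      proof -
        have "\<bar>sin (real (Suc \<nu> * k) * \<delta>)\<bar> / real (Suc \<nu> * k) \<le> 1 / real (Suc \<nu> * k)"
          by (intro divide_right_mono) auto
        also have "\<dots> \<le> 1 / real k"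
          using k0 by (intro divide_left_mono mult_pos_pos) (auto intro!: add_pos_nonneg)
        finally show ?thesis by (simp add: abs_divide)
      qed
      ultimately show ?thesis unfolding abs_mult by (simp only: abs_mult) (intro mult_left_mono, auto)
    qed
    have isum: "summable (\<lambda>\<nu>. \<integral>t. norm (e k \<nu> t) \<partial>U)"
    proof (rule summable_comparison_test')
      show "summable (\<lambda>\<nu>. \<bar>fcoef \<alpha> \<nu>\<bar> * measure U (space U))" by (rule summable_mult2[OF sA])
      fix \<nu>
      have "(\<integral>t. norm (e k \<nu> t) \<partial>U) \<le> (\<integral>t. \<bar>fcoef \<alpha> \<nu>\<bar> \<partial>U)"
        using ei eb by (intro integral_mono) auto
      then show "norm (\<integral>t. norm (e k \<nu> t) \<partial>U) \<le> \<bar>fcoef \<alpha> \<nu>\<bar> * measure U (space U)" by (simp add: mult.commute)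
    qed
    have AEs: "AE t in U. summable (\<lambda>\<nu>. norm (e k \<nu> t))" using esum by simp
    have rs: "summable r" unfolding r_def[abs_def] by (rule summable_integral[OF ei AEs isum])
    have "(\<integral>t. \<mu> k t \<partial>U) = pi * (\<integral>t. (\<Sum>\<nu>. e k \<nu> t) \<partial>U)"
      unfolding \<mu>_eq by simp
    also have "(\<integral>t. (\<Sum>\<nu>. e k \<nu> t) \<partial>U) = suminf r"
      unfolding r_def[abs_def] by (rule integral_suminf[OF ei AEs isum])
    also have "suminf r = \<delta> + (\<Sum>\<nu>. r (Suc \<nu>))" using suminf_split_head[OF rs] r0 by simp
    finally have I: "(\<integral>t. \<mu> k t \<partial>U) = pi * (\<delta> + (\<Sum>\<nu>. r (Suc \<nu>)))" .
    have sA': "summable (\<lambda>\<nu>. \<bar>fcoef \<alpha> (Suc \<nu>)\<bar>)" using summable_ignore_initial_segment[OF sA, of 1] by simp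
    have sb: "summable (\<lambda>\<nu>. \<bar>fcoef \<alpha> (Suc \<nu>)\<bar> * (1 / real k))" by (rule summable_mult2[OF sA'])
    have sr: "summable (\<lambda>\<nu>. norm (r (Suc \<nu>)))"
      by (rule summable_comparison_test'[OF sb]) (use rb in simp)
    have "norm (\<Sum>\<nu>. r (Suc \<nu>)) \<le> (\<Sum>\<nu>. norm (r (Suc \<nu>)))" by (rule summable_norm[OF sr])
    also have "\<dots> \<le> (\<Sum>\<nu>. \<bar>fcoef \<alpha> (Suc \<nu>)\<bar> * (1 / real k))"
      by (rule suminf_le[OF _ sr sb]) (use rb in simp)
    also have "\<dots> = (\<Sum>\<nu>. \<bar>fcoef \<alpha> (Suc \<nu>)\<bar>) * (1 / real k)" by (rule suminf_mult2[symmetric, OF sA'])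
    also have "\<dots> \<le> A * (1 / real k)"
      using suminf_split_head[OF sA] k0 unfolding A_def by (intro mult_right_mono) auto
    also have "\<dots> \<le> \<delta> / 2" using kd k0 by (simp add: field_simps)
    finally have "\<delta> / 2 \<le> \<delta> + (\<Sum>\<nu>. r (Suc \<nu>))" by (simp add: abs_le_iff)
    then have "1 * (\<delta> / 2) \<le> pi * (\<delta> + (\<Sum>\<nu>. r (Suc \<nu>)))"
      using pi_ge_two \<delta> by (intro mult_mono) auto
    then show ?thesis unfolding m_def I using \<delta> by (simp add: field_simps)
  qed
  \<comment> \<open>\<open>good_test\<close> quantifies over all real t, so parameters outside the
    interval of integration are sent to the admissible step 0.\<close>
  define H where "H t = (if t \<in> {0..\<delta>} then t else 0)" for t
  have c1: "cutoff \<alpha> \<delta> k = 1" if k: "lo \<le> k" for k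
  proof -
    have "1 \<le> real k * \<delta>"
    proof -
      have "real lo * \<delta> \<le> real k * \<delta>" using k \<delta> by (intro mult_right_mono) auto
      then show ?thesis using lo(2) A1 unfolding A_def by linarith
    qed
    then show ?thesis by (simp add: cutoff_def)
  qed
  have "good_test \<alpha> \<delta> d lo {n \<in> {1..M}. 2 * lo \<le> n} m H (\<lambda>t. \<alpha> * H t) 0"
    unfolding good_test_def
  proof (intro conjI ballI allI impI)
    show "\<bar>H t\<bar> \<le> \<delta>" for t using \<delta> by (auto simp: H_def)
    fix N c Y assume Y: "\<forall>t. (\<Sum>k=1..N. c k * diff_multiplier \<alpha> (H t) k (real k * (\<alpha> * H t) + 0)) \<le> (Y::real)"
    have "(\<integral>t. (\<Sum>k=1..N. c k * \<mu> k t) \<partial>U) \<le> (\<integral>t. Y \<partial>U)"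
    proof (rule integral_mono_AE)
      show "AE t in U. (\<Sum>k=1..N. c k * \<mu> k t) \<le> Y"
        using AEU
      proof eventually_elim
        case (elim t)
        then show ?case using Y[rule_format, of t] by (simp add: \<mu>_def H_def)
      qed
    qed (use \<mu>i in auto)
    also have "(\<integral>t. Y \<partial>U) = \<delta> * Y" by (simp add: mU)
    also have "(\<integral>t. (\<Sum>k=1..N. c k * \<mu> k t) \<partial>U) = \<delta> * (\<Sum>k=1..N. c k * m k)"
      using \<mu>i \<delta> by (simp add: m_def sum_distrib_left)
    finally show "(\<Sum>k=1..N. c k * m k) \<le> Y" using \<delta> by simp
  next
    fix n k assume "n \<in> {n \<in> {1..M}. 2 * lo \<le> n}" "k \<in> {lo..n}"
    then show "d * cutoff \<alpha> \<delta> k \<le> m k" using mlow[of k] c1[of k] d by simp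
  next
    fix n assume n: "n \<in> {n \<in> {1..M}. 2 * lo \<le> n}"
    have "(\<Sum>k=lo..n. cutoff \<alpha> \<delta> k) = (\<Sum>k=lo..n. 1)" by (intro sum.cong) (auto simp: c1)
    also have "\<dots> = real (Suc n - lo)" by simp
    finally have S: "(\<Sum>k=lo..n. cutoff \<alpha> \<delta> k) = real (Suc n - lo)" .
    \<comment> \<open>For n \<ge> 2 lo the block from lo to n contains at least n / 2 frequencies,
      and all of them have cutoff 1.\<close>
    have "d * real n \<le> 1 / 2 * real n" by (intro mult_right_mono d) auto
    also have "\<dots> \<le> real (Suc n - lo)" using n by (simp add: of_nat_diff)
    finally show "d * (real n * cutoff \<alpha> \<delta> n) \<le> (\<Sum>k=lo..n. cutoff \<alpha> \<delta> k)"
      using n c1[of n] S by simp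
  qed (use lo in auto)
  then show ?thesis by blast
qed

text \<open>The geometric summand keeps the weights positive where \<open>\<alpha> gchoose \<nu>\<close> vanishes, so that a finite
  weighted series of majorants has all its terms finite.\<close>

definition pos_weight :: "real \<Rightarrow> nat \<Rightarrow> real" where
  "pos_weight \<alpha> \<nu> = \<bar>fcoef \<alpha> \<nu>\<bar> + (1 / 2) ^ \<nu>"

lemma pos_weight_pos [simp]: "0 < pos_weight \<alpha> \<nu>" by (simp add: pos_weight_def add_nonneg_pos)

lemma pos_weight_ge: "\<bar>fcoef \<alpha> \<nu>\<bar> \<le> pos_weight \<alpha> \<nu>" by (simp add: pos_weight_def)

lemma summable_pos_weight: "0 < \<alpha> \<Longrightarrow> summable (pos_weight \<alpha>)"
  unfolding pos_weight_def[abs_def] by (intro summable_add summable_abs_fcoef summable_geometric) auto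

lemma ennreal_enn2real_le: "ennreal (enn2real x) \<le> x"
  by (cases x) auto

section \<open>Differences of the limit function: convergence, pairings and upper bound\<close>

context cosine_class begin

definition shift_majorant :: "real \<Rightarrow> real \<Rightarrow> real \<Rightarrow> real \<Rightarrow> real \<times> real \<Rightarrow> ennreal" where
  "shift_majorant \<alpha>1 \<alpha>2 h1 h2 z = (\<Sum>\<nu>. \<Sum>\<mu>. ennreal (pos_weight \<alpha>1 \<nu> * pos_weight \<alpha>2 \<mu>) *
     GS (fst z + (\<alpha>1 - real \<nu>) * h1, snd z + (\<alpha>2 - real \<mu>) * h2))"

lemma GS_shift_measurable [measurable]: "(\<lambda>z. GS (fst z + s, snd z + t)) \<in> borel_measurable borel"
  by (rule measurable_compose[of "\<lambda>z. (fst z + s, snd z + t)" borel borel GS])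
     (intro borel_measurable_continuous_onI continuous_intros, measurable)

lemma shift_majorant_measurable [measurable]: "shift_majorant \<alpha>1 \<alpha>2 h1 h2 \<in> borel_measurable borel"
  unfolding shift_majorant_def[abs_def] by measurable

text \<open>All translates of the periodic \<open>GS\<close> have the same integral, so the total is
  that integral times the product of the two sums of weights.\<close>

lemma shift_majorant_nn_integral:
  assumes "0 < \<alpha>1" "0 < \<alpha>2"
  shows "(\<integral>\<^sup>+z. shift_majorant \<alpha>1 \<alpha>2 h1 h2 z \<partial>sq) < \<infinity>"
proof -
  define w1 w2 where "w1 = pos_weight \<alpha>1" and "w2 = pos_weight \<alpha>2"
  define K where "K = (\<integral>\<^sup>+z. GS z \<partial>sq)"
  have w0: "0 \<le> w1 i" "0 \<le> w2 i" for i by (simp_all add: w1_def w2_def less_imp_le)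
  have sw: "summable w1" "summable w2" using assms by (auto simp: w1_def w2_def summable_pos_weight)
  have "(\<integral>\<^sup>+z. shift_majorant \<alpha>1 \<alpha>2 h1 h2 z \<partial>sq) = (\<Sum>\<nu>. \<Sum>\<mu>. ennreal (w1 \<nu> * w2 \<mu>) * (\<integral>\<^sup>+z. GS (fst z + (\<alpha>1 - real \<nu>) * h1, snd z + (\<alpha>2 - real \<mu>) * h2) \<partial>sq))"
    unfolding shift_majorant_def w1_def w2_def by (subst nn_integral_suminf, measurable) (subst nn_integral_suminf, measurable, subst nn_integral_cmult, measurable)
  also have "\<dots> = (\<Sum>\<nu>. \<Sum>\<mu>. ennreal (w1 \<nu> * w2 \<mu>) * K)"
    unfolding K_def by (subst nn_integral_sq_shift) (auto simp: GS_periodic)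
  also have "\<dots> = (\<Sum>\<nu>. ennreal (w1 \<nu>) * (\<Sum>\<mu>. ennreal (w2 \<mu>)) * K)"
    using w0 by (simp add: ennreal_mult ennreal_suminf_multc ennreal_suminf_cmult)
  also have "\<dots> = (\<Sum>\<nu>. ennreal (w1 \<nu>)) * (\<Sum>\<mu>. ennreal (w2 \<mu>)) * K"
    by (simp add: ennreal_suminf_multc)
  also have "\<dots> = ennreal (suminf w1) * ennreal (suminf w2) * K"
    using w0 sw by (simp add: suminf_ennreal2)
  also have "\<dots> < \<infinity>" using GS_nn_integral by (simp add: K_def ennreal_mult_less_top)
  finally show ?thesis .
qed

lemma shift_majorant_integrable:
  assumes "0 < \<alpha>1" "0 < \<alpha>2"
  shows "integrable sq (\<lambda>z. enn2real (shift_majorant \<alpha>1 \<alpha>2 h1 h2 z))"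
proof (rule integrableI_nonneg)
  have "(\<integral>\<^sup>+z. ennreal (enn2real (shift_majorant \<alpha>1 \<alpha>2 h1 h2 z)) \<partial>sq) \<le> (\<integral>\<^sup>+z. shift_majorant \<alpha>1 \<alpha>2 h1 h2 z \<partial>sq)"
    by (intro nn_integral_mono) (rule ennreal_enn2real_le)
  also have "\<dots> < \<infinity>" by (rule shift_majorant_nn_integral[OF assms])
  finally show "(\<integral>\<^sup>+z. ennreal (enn2real (shift_majorant \<alpha>1 \<alpha>2 h1 h2 z)) \<partial>sq) < \<infinity>" .
qed auto

lemma AE_TT_finite:
  assumes "0 < \<alpha>1" "0 < \<alpha>2"
  shows "AE z in sq. shift_majorant \<alpha>1 \<alpha>2 h1 h2 z < \<infinity>"
  using nn_integral_PInf_AE[of "shift_majorant \<alpha>1 \<alpha>2 h1 h2" sq] shift_majorant_nn_integral[OF assms, of h1 h2]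
  by (auto simp: less_top)

definition Psi :: "real \<Rightarrow> real \<Rightarrow> real \<Rightarrow> real \<Rightarrow> real \<times> real \<Rightarrow> real" where
  "Psi \<alpha>1 \<alpha>2 h1 h2 = frac_diff_1 \<alpha>1 h1 (frac_diff_2 \<alpha>2 h2 F)"

definition PsiM :: "nat \<Rightarrow> real \<Rightarrow> real \<Rightarrow> real \<Rightarrow> real \<Rightarrow> real \<times> real \<Rightarrow> real" where
  "PsiM M \<alpha>1 \<alpha>2 h1 h2 = frac_diff_1 \<alpha>1 h1 (frac_diff_2 \<alpha>2 h2 (FM M))"

lemma frac_diff_measurable:
  assumes [measurable]: "G \<in> borel_measurable borel"
  shows "frac_diff_1 \<alpha>1 h1 (frac_diff_2 \<alpha>2 h2 G) \<in> borel_measurable borel"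
proof -
  have [measurable]: "(\<lambda>z. G (fst z + s, snd z + t)) \<in> borel_measurable borel" for s t
    by (rule measurable_compose[of "\<lambda>z. (fst z + s, snd z + t)" borel borel G])
       (intro borel_measurable_continuous_onI continuous_intros, measurable)
  show ?thesis unfolding frac_diff_eq[abs_def] by measurable
qed

lemma Psi_measurable [measurable]: "Psi \<alpha>1 \<alpha>2 h1 h2 \<in> borel_measurable borel"
  unfolding Psi_def by (rule frac_diff_measurable) measurable

lemma PsiM_measurable [measurable]: "PsiM M \<alpha>1 \<alpha>2 h1 h2 \<in> borel_measurable borel"
  unfolding PsiM_def by (rule frac_diff_measurable) measurable

text \<open>Because the weights are strictly positive, finiteness of the majorant at z makes
  \<open>GS\<close> finite at every translate in the difference. So \<open>FM\<close> converges and
  is dominated at each of them, and \<open>double_tannery\<close> applies.\<close>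

lemma PsiM_limit:
  assumes \<alpha>: "0 < \<alpha>1" "0 < \<alpha>2" and fin: "shift_majorant \<alpha>1 \<alpha>2 h1 h2 z < \<infinity>"
  shows "(\<lambda>M. PsiM M \<alpha>1 \<alpha>2 h1 h2 z) \<longlonglongrightarrow> Psi \<alpha>1 \<alpha>2 h1 h2 z"
    and "\<bar>PsiM M \<alpha>1 \<alpha>2 h1 h2 z\<bar> \<le> enn2real (shift_majorant \<alpha>1 \<alpha>2 h1 h2 z)"
proof -
  define P where "P \<nu> \<mu> = (fst z + (\<alpha>1 - real \<nu>) * h1, snd z + (\<alpha>2 - real \<mu>) * h2)" for \<nu> \<mu>
  have GSfin: "GS (P \<nu> \<mu>) < \<infinity>" for \<nu> \<mu>
  proof (rule ccontr)
    assume "\<not> GS (P \<nu> \<mu>) < \<infinity>"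
    then have top: "GS (P \<nu> \<mu>) = top" by (metis infinity_ennreal_def top.not_eq_extremum)
    have "ennreal (pos_weight \<alpha>1 \<nu> * pos_weight \<alpha>2 \<mu>) * GS (P \<nu> \<mu>) \<le> (\<Sum>\<mu>. ennreal (pos_weight \<alpha>1 \<nu> * pos_weight \<alpha>2 \<mu>) * GS (P \<nu> \<mu>))"
      using sum_le_suminf[of "\<lambda>\<mu>. ennreal (pos_weight \<alpha>1 \<nu> * pos_weight \<alpha>2 \<mu>) * GS (P \<nu> \<mu>)" "{\<mu>}"] by auto
    also have "\<dots> \<le> shift_majorant \<alpha>1 \<alpha>2 h1 h2 z" unfolding shift_majorant_def P_def
      using sum_le_suminf[of "\<lambda>\<nu>. \<Sum>\<mu>. ennreal (pos_weight \<alpha>1 \<nu> * pos_weight \<alpha>2 \<mu>) * GS (fst z + (\<alpha>1 - real \<nu>) * h1, snd z + (\<alpha>2 - real \<mu>) * h2)" "{\<nu>}"]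
      by auto
    finally show False
      using fin mult_pos_pos[OF pos_weight_pos pos_weight_pos, of \<alpha>1 \<nu> \<alpha>2 \<mu>]
      by (simp add: top ennreal_mult_top ennreal_eq_0_iff)
  qed
  have eq: "(\<Sum>\<nu>. \<Sum>\<mu>. ennreal (pos_weight \<alpha>1 \<nu> * pos_weight \<alpha>2 \<mu> * enn2real (GS (P \<nu> \<mu>)))) = ennreal (enn2real (shift_majorant \<alpha>1 \<alpha>2 h1 h2 z))"
  proof -
    have "ennreal (pos_weight \<alpha>1 \<nu> * pos_weight \<alpha>2 \<mu> * enn2real (GS (P \<nu> \<mu>))) = ennreal (pos_weight \<alpha>1 \<nu> * pos_weight \<alpha>2 \<mu>) * GS (P \<nu> \<mu>)" for \<nu> \<mu>
      using GSfin[of \<nu> \<mu>] by (simp add: ennreal_mult less_imp_le mult_pos_pos)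
    then show ?thesis using fin by (simp add: shift_majorant_def P_def)
  qed
  note DT = double_tannery[where u = "\<lambda>M \<nu> \<mu>. FM M (P \<nu> \<mu>)" and v = "\<lambda>\<nu> \<mu>. F (P \<nu> \<mu>)" and g = "\<lambda>\<nu> \<mu>. enn2real (GS (P \<nu> \<mu>))"
      and c = "fcoef \<alpha>1" and d = "fcoef \<alpha>2" and ?w1.0 = "pos_weight \<alpha>1" and ?w2.0 = "pos_weight \<alpha>2" and T = "enn2real (shift_majorant \<alpha>1 \<alpha>2 h1 h2 z)",
      OF FM_tendsto[OF GSfin] order_trans[OF FM_le_GM GM_le_GS[OF GSfin]] pos_weight_ge pos_weight_ge pos_weight_pos eq enn2real_nonneg]
  show "(\<lambda>M. PsiM M \<alpha>1 \<alpha>2 h1 h2 z) \<longlonglongrightarrow> Psi \<alpha>1 \<alpha>2 h1 h2 z"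
    using DT(1) unfolding PsiM_def Psi_def frac_diff_eq P_def .
  show "\<bar>PsiM M \<alpha>1 \<alpha>2 h1 h2 z\<bar> \<le> enn2real (shift_majorant \<alpha>1 \<alpha>2 h1 h2 z)"
    using DT(2)[of M] unfolding PsiM_def frac_diff_eq P_def .
qed

lemma dominated_pairing:
  assumes \<Theta>: "integrable sq \<Theta>" and X: "X \<in> borel_measurable borel" "\<And>n. XM n \<in> borel_measurable borel"
    and lim: "AE z in sq. (\<lambda>M. XM M z) \<longlonglongrightarrow> X z" and bd: "\<And>M. AE z in sq. \<bar>XM M z\<bar> \<le> \<Theta> z"
    and g: "g \<in> borel_measurable borel" "\<And>z. \<bar>g z\<bar> \<le> (1::real)"
  shows "integrable sq X" and "(\<lambda>M. \<integral>z. XM M z * g z \<partial>sq) \<longlonglongrightarrow> (\<integral>z. X z * g z \<partial>sq)"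
proof -
  show "integrable sq X"
    by (rule integrable_dominated_convergence[OF _ _ \<Theta> lim]) (use X bd in auto)
  show "(\<lambda>M. \<integral>z. XM M z * g z \<partial>sq) \<longlonglongrightarrow> (\<integral>z. X z * g z \<partial>sq)"
  proof (rule integral_dominated_convergence[OF _ _ \<Theta>])
    show "AE z in sq. (\<lambda>M. XM M z * g z) \<longlonglongrightarrow> X z * g z"
      using lim by eventually_elim (intro tendsto_intros)
    show "AE z in sq. norm (XM M z * g z) \<le> \<Theta> z" for M
      using bd[of M]
    proof eventually_elim
      case (elim z)
      have "\<bar>XM M z\<bar> * \<bar>g z\<bar> \<le> \<bar>XM M z\<bar> * 1" using g(2) by (intro mult_left_mono) auto
      then show ?case using elim by (simp add: abs_mult)
    qed
  qed (use X g in auto)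
qed

lemma cos_prod_test: "(\<lambda>z. cos (real j * fst z + \<phi>) * cos (real k * snd z + \<psi>)) \<in> borel_measurable borel"
  "\<bar>cos (real j * fst z + \<phi>) * cos (real k * snd z + \<psi>)\<bar> \<le> 1"
proof -
  show "(\<lambda>z. cos (real j * fst z + \<phi>) * cos (real k * snd z + \<psi>)) \<in> borel_measurable borel"
    by (intro borel_measurable_times borel_measurable_comp_fst[where g = "\<lambda>x. cos (real j * x + \<phi>)"]
          borel_measurable_comp_snd[where g = "\<lambda>x. cos (real k * x + \<psi>)"]) measurable
  show "\<bar>cos (real j * fst z + \<phi>) * cos (real k * snd z + \<psi>)\<bar> \<le> 1"
    unfolding abs_mult by (intro mult_le_one) auto
qed

lemma abs_fdiff_cos_le: "0 < \<alpha> \<Longrightarrow> \<bar>fdiff \<alpha> h (\<lambda>x. cos (real k * x)) x\<bar> \<le> (\<Sum>\<nu>. \<bar>fcoef \<alpha> \<nu>\<bar>)"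
proof -
  assume \<alpha>: "0 < \<alpha>"
  have s: "summable (\<lambda>\<nu>. \<bar>fcoef \<alpha> \<nu> * cos (real k * (x + (\<alpha> - real \<nu>) * h))\<bar>)"
    by (rule summable_fdiff_norm[OF \<alpha>, where f = "\<lambda>x. cos (real k * x)" and B = 1]) auto
  have "\<bar>fdiff \<alpha> h (\<lambda>x. cos (real k * x)) x\<bar> \<le> (\<Sum>\<nu>. \<bar>fcoef \<alpha> \<nu> * cos (real k * (x + (\<alpha> - real \<nu>) * h))\<bar>)"
    unfolding fdiff_def by (rule summable_rabs[OF s])
  also have "\<dots> \<le> (\<Sum>\<nu>. \<bar>fcoef \<alpha> \<nu>\<bar>)"
    by (rule suminf_le[OF _ s summable_abs_fcoef[OF \<alpha>]]) (auto simp: abs_mult mult_left_le)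
  finally show ?thesis .
qed

text \<open>For M at least both frequencies the pairing is \<open>trunc_coeff M j i\<close> times
  constants, and these coefficients tend to a j i; uniqueness of limits identifies L.\<close>

lemma trunc_coeff_pairing_limit:
  assumes "\<And>M. (\<integral>z. XM M z * g z \<partial>sq) = (if j \<in> {1..M} \<and> i \<in> {1..M} then trunc_coeff M j i * (c1::real) * c2 else 0)"
    and "(\<lambda>M. \<integral>z. XM M z * g z \<partial>sq) \<longlonglongrightarrow> L"
  shows "L = (if 1 \<le> j \<and> 1 \<le> i then a j i * c1 * c2 else 0)"
proof -
  have "(\<lambda>M. if j \<in> {1..M} \<and> i \<in> {1..M} then trunc_coeff M j i * c1 * c2 else 0) \<longlonglongrightarrow> (if 1 \<le> j \<and> 1 \<le> i then a j i * c1 * c2 else 0)"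
  proof (cases "1 \<le> j \<and> 1 \<le> i")
    case True
    have "(\<lambda>M. trunc_coeff M j i * c1 * c2) \<longlonglongrightarrow> a j i * c1 * c2" using True by (intro tendsto_intros trunc_coeff_tendsto) auto
    moreover have "\<forall>\<^sub>F M in sequentially. trunc_coeff M j i * c1 * c2 = (if j \<in> {1..M} \<and> i \<in> {1..M} then trunc_coeff M j i * c1 * c2 else 0)"
      using eventually_ge_at_top[of "max j i"] by eventually_elim (use True in auto)
    ultimately show ?thesis using True by (auto elim: Lim_transform_eventually)
  qed auto
  then show ?thesis using assms(2) LIMSEQ_unique unfolding assms(1) by blast
qed

text \<open>For the finite sums \<open>PsiM\<close> the pairing factorizes by orthogonality;
  dominated convergence with the integrable \<open>shift_majorant\<close> carries it to the
  limit.\<close>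

lemma Psi_pairing:
  assumes \<alpha>: "0 < \<alpha>1" "0 < \<alpha>2" and jk: "1 \<le> j" "1 \<le> k"
  shows "(\<integral>z. Psi \<alpha>1 \<alpha>2 h1 h2 z * (cos (real j * fst z + \<phi>) * cos (real k * snd z + \<psi>)) \<partial>sq)
    = a j k * diff_multiplier \<alpha>1 h1 j \<phi> * diff_multiplier \<alpha>2 h2 k \<psi>"
proof -
  define B where "B = max (\<Sum>\<nu>. \<bar>fcoef \<alpha>1 \<nu>\<bar>) (\<Sum>\<nu>. \<bar>fcoef \<alpha>2 \<nu>\<bar>)"
  define X Y where "X k = fdiff \<alpha>1 h1 (\<lambda>x. cos (real k * x))" and "Y k = fdiff \<alpha>2 h2 (\<lambda>x. cos (real k * x))" for k
  have eq: "PsiM M \<alpha>1 \<alpha>2 h1 h2 z = (\<Sum>k=1..M. \<Sum>l=1..M. trunc_coeff M k l * X k (fst z) * Y l (snd z))" for M z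
  proof -
    have "FM M = (\<lambda>z. \<Sum>k=1..M. \<Sum>l=1..M. trunc_coeff M k l * cos (real k * fst z) * cos (real l * snd z))"
      using FM_eq by blast
    then show ?thesis unfolding PsiM_def X_def Y_def
      using frac_diff_double_sum[OF \<alpha>, where X = "\<lambda>k x. cos (real k * x)" and Y = "\<lambda>k x. cos (real k * x)" and B = "\<lambda>_. 1" and c = "trunc_coeff M"]
      by simp
  qed
  have I: "(\<integral>z. PsiM M \<alpha>1 \<alpha>2 h1 h2 z * (cos (real j * fst z + \<phi>) * cos (real k * snd z + \<psi>)) \<partial>sq)
      = (if j \<in> {1..M} \<and> k \<in> {1..M} then trunc_coeff M j k * diff_multiplier \<alpha>1 h1 j \<phi> * diff_multiplier \<alpha>2 h2 k \<psi> else 0)" for M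
    unfolding eq
  proof (rule integral_sq_double_sum_cos[where B = B])
    show "X k \<in> borel_measurable borel" "Y k \<in> borel_measurable borel" for k unfolding X_def Y_def by measurable
    show "\<bar>X k x\<bar> \<le> B" "\<bar>Y k x\<bar> \<le> B" for k x unfolding X_def Y_def B_def
      using abs_fdiff_cos_le[OF \<alpha>(1), of h1 k x] abs_fdiff_cos_le[OF \<alpha>(2), of h2 k x] by auto
  qed (use \<alpha> in \<open>auto simp: X_def Y_def integral_fdiff_cos\<close>)
  have lim: "(\<lambda>M. \<integral>z. PsiM M \<alpha>1 \<alpha>2 h1 h2 z * (cos (real j * fst z + \<phi>) * cos (real k * snd z + \<psi>)) \<partial>sq) \<longlonglongrightarrow>
     (\<integral>z. Psi \<alpha>1 \<alpha>2 h1 h2 z * (cos (real j * fst z + \<phi>) * cos (real k * snd z + \<psi>)) \<partial>sq)"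
  proof (rule dominated_pairing(2)[OF shift_majorant_integrable[OF \<alpha>, of h1 h2] Psi_measurable PsiM_measurable _ _ cos_prod_test])
    show "AE z in sq. (\<lambda>M. PsiM M \<alpha>1 \<alpha>2 h1 h2 z) \<longlonglongrightarrow> Psi \<alpha>1 \<alpha>2 h1 h2 z"
      using AE_TT_finite[OF \<alpha>] by eventually_elim (rule PsiM_limit(1)[OF \<alpha>])
    show "AE z in sq. \<bar>PsiM M \<alpha>1 \<alpha>2 h1 h2 z\<bar> \<le> enn2real (shift_majorant \<alpha>1 \<alpha>2 h1 h2 z)" for M
      using AE_TT_finite[OF \<alpha>] by eventually_elim (rule PsiM_limit(2)[OF \<alpha>])
  qed
  show ?thesis using trunc_coeff_pairing_limit[OF I lim] jk by simp
qed

text \<open>Dominated convergence gives the limit the same coefficients as f at all frequencies and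
  phases, and uniqueness does the rest.\<close>

lemma f_eq_F: "AE z in sq. f z = F z"
proof -
  have fin: "AE z in sq. GS z < \<infinity>"
    using nn_integral_PInf_AE[of GS sq] GS_nn_integral by (auto simp: less_top)
  have int: "integrable sq (\<lambda>z. enn2real (GS z))"
  proof (rule integrableI_nonneg)
    have "(\<integral>\<^sup>+z. ennreal (enn2real (GS z)) \<partial>sq) \<le> (\<integral>\<^sup>+z. GS z \<partial>sq)"
      by (intro nn_integral_mono) (rule ennreal_enn2real_le)
    then show "(\<integral>\<^sup>+z. ennreal (enn2real (GS z)) \<partial>sq) < \<infinity>" using GS_nn_integral by (rule order.strict_trans1)
  qed auto
  have lim: "AE z in sq. (\<lambda>M. FM M z) \<longlonglongrightarrow> F z" using fin by eventually_elim (rule FM_tendsto)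
  have bd: "AE z in sq. \<bar>FM M z\<bar> \<le> enn2real (GS z)" for M
    using fin by eventually_elim (rule order_trans[OF FM_le_GM GM_le_GS])
  note D = dominated_pairing[OF int F_measurable FM_measurable lim bd cos_prod_test]
  have F_int: "integrable sq F" by (rule D(1))
  have coefF: "(\<integral>z. F z * (cos (real j * fst z + \<phi>) * cos (real k * snd z + \<psi>)) \<partial>sq) =
        (if 1 \<le> j \<and> 1 \<le> k then a j k * (pi * cos \<phi>) * (pi * cos \<psi>) else 0)" for j k \<phi> \<psi>
  proof (rule trunc_coeff_pairing_limit[OF _ D(2)])
    fix M
    have *: "(\<integral>x. cos (real k * x) * cos (real j * x + \<phi>) \<partial>circ) = (if j = k then pi * cos \<phi> else 0)" if "1 \<le> k" for k j \<phi>
      using integral_circ_cos_cos[of k 0 j \<phi>] that by auto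
    show "(\<integral>z. FM M z * (cos (real j * fst z + \<phi>) * cos (real k * snd z + \<psi>)) \<partial>sq)
      = (if j \<in> {1..M} \<and> k \<in> {1..M} then trunc_coeff M j k * (pi * cos \<phi>) * (pi * cos \<psi>) else 0)"
      unfolding FM_eq
      by (rule integral_sq_double_sum_cos[where B = 1 and X = "\<lambda>k x. cos (real k * x)" and Y = "\<lambda>k x. cos (real k * x)"]) (auto simp: *)
  qed
  have "AE z in sq. f z - F z = 0"
  proof (rule fourier_unique_sq)
    show "integrable sq (\<lambda>z. f z - F z)" using f_integrable F_int by simp
    fix j k \<phi> \<psi>
    have i: "integrable sq (\<lambda>z. G z * (cos (real j * fst z + \<phi>) * cos (real k * snd z + \<psi>)))" if "integrable sq G" for G
      by (rule integrable_sq_mult_bounded[OF that cos_prod_test])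
    show "(\<integral>z. (f z - F z) * cos (real j * fst z + \<phi>) * cos (real k * snd z + \<psi>) \<partial>sq) = 0"
      using coeff[of j \<phi> k \<psi>] coefF[of j \<phi> k \<psi>] i[OF f_integrable] i[OF F_int]
      by (simp add: left_diff_distrib mult.assoc)
  qed
  then show ?thesis by eventually_elim simp
qed

definition coeff_sum :: "real \<Rightarrow> real \<Rightarrow> real \<Rightarrow> real \<Rightarrow> nat \<Rightarrow> real" where
  "coeff_sum \<alpha>1 \<alpha>2 \<delta>1 \<delta>2 M = (\<Sum>k=1..M. \<Sum>l=1..M. (real k * real l) powr (p - 2) *
     (a k l * cutoff \<alpha>1 \<delta>1 k * cutoff \<alpha>2 \<delta>2 l) powr p)"

text \<open>For the finite sums the estimate \<open>U\<close> applies with the mixed differences as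
  weights, whose tail sums are at most the coefficients; Fatou's lemma passes to the limit.
  \<open>U\<close> is a hypothesis so that C can be fixed before f.\<close>

lemma Psi_upper:
  assumes \<alpha>: "0 < \<alpha>1" "0 < \<alpha>2" and C: "0 < C"
    and U: "\<And>h1 h2 M b. (\<And>m n. 0 \<le> b m n) \<Longrightarrow>
      (\<integral>\<^sup>+z. ennreal ((\<Sum>m=1..M. \<Sum>n=1..M. b m n * \<bar>fdiff \<alpha>1 h1 (dirichlet m) (fst z)\<bar>
          * \<bar>fdiff \<alpha>2 h2 (dirichlet n) (snd z)\<bar>) powr p) \<partial>sq)
      \<le> ennreal (C * (\<Sum>k=1..M. \<Sum>l=1..M. real k powr (p - 2) * real l powr (p - 2) *
          ((\<Sum>m=k..M. \<Sum>n=l..M. b m n) * cutoff \<alpha>1 \<bar>h1\<bar> k * cutoff \<alpha>2 \<bar>h2\<bar> l) powr p))"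
    and B: "\<And>M. coeff_sum \<alpha>1 \<alpha>2 \<bar>h1\<bar> \<bar>h2\<bar> M \<le> B"
  shows "integrable sq (\<lambda>z. \<bar>Psi \<alpha>1 \<alpha>2 h1 h2 z\<bar> powr p)"
    and "(\<integral>z. \<bar>Psi \<alpha>1 \<alpha>2 h1 h2 z\<bar> powr p \<partial>sq) \<le> C * B"
proof -
  have B0: "0 \<le> B" using B[of 0] by (simp add: coeff_sum_def)
  have bM: "(\<integral>\<^sup>+z. ennreal (\<bar>PsiM M \<alpha>1 \<alpha>2 h1 h2 z\<bar> powr p) \<partial>sq) \<le> ennreal (C * B)" for M
  proof -
    have eq: "PsiM M \<alpha>1 \<alpha>2 h1 h2 z = (\<Sum>m=1..M. \<Sum>n=1..M. mixed_diff m n * fdiff \<alpha>1 h1 (dirichlet m) (fst z) * fdiff \<alpha>2 h2 (dirichlet n) (snd z))" for z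
      unfolding PsiM_def FM_def[abs_def]
      by (rule frac_diff_double_sum[OF \<alpha>, where B = real]) (rule abs_dirichlet_le_nat)+
    have "(\<integral>\<^sup>+z. ennreal (\<bar>PsiM M \<alpha>1 \<alpha>2 h1 h2 z\<bar> powr p) \<partial>sq) \<le>
      (\<integral>\<^sup>+z. ennreal ((\<Sum>m=1..M. \<Sum>n=1..M. mixed_diff m n * \<bar>fdiff \<alpha>1 h1 (dirichlet m) (fst z)\<bar>
          * \<bar>fdiff \<alpha>2 h2 (dirichlet n) (snd z)\<bar>) powr p) \<partial>sq)"
    proof (intro nn_integral_mono ennreal_leI powr_mono2)
      fix z
      have "\<bar>PsiM M \<alpha>1 \<alpha>2 h1 h2 z\<bar> \<le> (\<Sum>m=1..M. \<Sum>n=1..M. \<bar>mixed_diff m n * fdiff \<alpha>1 h1 (dirichlet m) (fst z) * fdiff \<alpha>2 h2 (dirichlet n) (snd z)\<bar>)"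
        unfolding eq by (rule order_trans[OF sum_abs]) (intro sum_mono sum_abs)
      then show "\<bar>PsiM M \<alpha>1 \<alpha>2 h1 h2 z\<bar> \<le> (\<Sum>m=1..M. \<Sum>n=1..M. mixed_diff m n * \<bar>fdiff \<alpha>1 h1 (dirichlet m) (fst z)\<bar>
          * \<bar>fdiff \<alpha>2 h2 (dirichlet n) (snd z)\<bar>)" by (simp add: abs_mult)
    qed (use p in auto)
    also have "\<dots> \<le> ennreal (C * (\<Sum>k=1..M. \<Sum>l=1..M. real k powr (p - 2) * real l powr (p - 2) *
          (trunc_coeff M k l * cutoff \<alpha>1 \<bar>h1\<bar> k * cutoff \<alpha>2 \<bar>h2\<bar> l) powr p))"
      unfolding trunc_coeff_def by (rule U) simp
    also have "\<dots> \<le> ennreal (C * B)"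
    proof (intro ennreal_leI mult_left_mono)
      have "(\<Sum>k=1..M. \<Sum>l=1..M. real k powr (p - 2) * real l powr (p - 2) *
          (trunc_coeff M k l * cutoff \<alpha>1 \<bar>h1\<bar> k * cutoff \<alpha>2 \<bar>h2\<bar> l) powr p) \<le> coeff_sum \<alpha>1 \<alpha>2 \<bar>h1\<bar> \<bar>h2\<bar> M"
        unfolding coeff_sum_def powr_mult[of "real _" "real _"] using p
        by (intro sum_mono mult_left_mono powr_mono2 mult_right_mono trunc_coeff_le mult_nonneg_nonneg) auto
      then show "(\<Sum>k=1..M. \<Sum>l=1..M. real k powr (p - 2) * real l powr (p - 2) *
          (trunc_coeff M k l * cutoff \<alpha>1 \<bar>h1\<bar> k * cutoff \<alpha>2 \<bar>h2\<bar> l) powr p) \<le> B"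
        using B[of M] by linarith
    qed (use C in auto)
    finally show ?thesis .
  qed
  have nn: "(\<integral>\<^sup>+z. ennreal (\<bar>Psi \<alpha>1 \<alpha>2 h1 h2 z\<bar> powr p) \<partial>sq) \<le> ennreal (C * B)"
  proof (rule nn_integral_le_of_tendsto[OF _ _ bM])
    show "AE z in sq. (\<lambda>M. ennreal (\<bar>PsiM M \<alpha>1 \<alpha>2 h1 h2 z\<bar> powr p)) \<longlonglongrightarrow> ennreal (\<bar>Psi \<alpha>1 \<alpha>2 h1 h2 z\<bar> powr p)"
      using AE_TT_finite[OF \<alpha>, of h1 h2]
    proof eventually_elim
      case (elim z)
      show ?case using PsiM_limit(1)[OF \<alpha> elim] p
        by (intro tendsto_ennrealI tendsto_powr' tendsto_rabs) (auto intro!: tendsto_intros)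
    qed
  qed measurable
  show int: "integrable sq (\<lambda>z. \<bar>Psi \<alpha>1 \<alpha>2 h1 h2 z\<bar> powr p)"
    using nn by (intro integrableI_nonneg) (auto simp: order.strict_trans1)
  show "(\<integral>z. \<bar>Psi \<alpha>1 \<alpha>2 h1 h2 z\<bar> powr p \<partial>sq) \<le> C * B"
    using nn B0 C by (intro integral_real_bounded) auto
qed

end

section \<open>Lower bounds by averaged pairings, and uniform constants\<close>

lemma sum4_swap:
  "(\<Sum>m\<in>A. \<Sum>n\<in>B. \<Sum>k\<in>C. \<Sum>l\<in>D. X m n k l) = (\<Sum>k\<in>C. \<Sum>l\<in>D. \<Sum>m\<in>A. \<Sum>n\<in>B. (X m n k l :: real))"
proof -
  have "(\<Sum>m\<in>A. \<Sum>n\<in>B. \<Sum>k\<in>C. \<Sum>l\<in>D. X m n k l) = (\<Sum>m\<in>A. \<Sum>k\<in>C. \<Sum>n\<in>B. \<Sum>l\<in>D. X m n k l)"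
    by (rule sum.cong[OF refl], rule sum.swap)
  also have "\<dots> = (\<Sum>k\<in>C. \<Sum>m\<in>A. \<Sum>n\<in>B. \<Sum>l\<in>D. X m n k l)" by (rule sum.swap)
  also have "\<dots> = (\<Sum>k\<in>C. \<Sum>m\<in>A. \<Sum>l\<in>D. \<Sum>n\<in>B. X m n k l)"
    by (rule sum.cong[OF refl], rule sum.cong[OF refl], rule sum.swap)
  also have "\<dots> = (\<Sum>k\<in>C. \<Sum>l\<in>D. \<Sum>m\<in>A. \<Sum>n\<in>B. X m n k l)"
    by (rule sum.cong[OF refl], rule sum.swap)
  finally show ?thesis .
qed

text \<open>Collects everything independent of the multipliers u and v into one coefficient per
  frequency pair. The form is bilinear over fixed index ranges, as needed for averaging u and v
  separately.\<close>

lemma block_sum_swap: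
  fixes b a :: "nat \<Rightarrow> nat \<Rightarrow> real"
  assumes lo: "1 \<le> lo1" "1 \<le> lo2"
  shows "(\<Sum>m=1..M. \<Sum>n=1..M. b m n * (\<Sum>k=lo1..m. \<Sum>l=lo2..n. a k l * u k * v l))
    = (\<Sum>k=1..M. \<Sum>l=1..M. (\<Sum>m=1..M. \<Sum>n=1..M. if lo1 \<le> k \<and> k \<le> m \<and> lo2 \<le> l \<and> l \<le> n then b m n * a k l else 0) * u k * v l)"
proof -
  have "(\<Sum>k=lo1..m. \<Sum>l=lo2..n. a k l * u k * v l)
    = (\<Sum>k=1..M. \<Sum>l=1..M. if lo1 \<le> k \<and> k \<le> m \<and> lo2 \<le> l \<and> l \<le> n then a k l * u k * v l else 0)"
    if "m \<le> M" "n \<le> M" for m n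
  proof -
    have "(\<Sum>k=lo1..m. \<Sum>l=lo2..n. a k l * u k * v l) = (\<Sum>k=1..M. if lo1 \<le> k \<and> k \<le> m then (\<Sum>l=lo2..n. a k l * u k * v l) else 0)"
      by (rule sum.mono_neutral_cong_left) (use that lo in auto)
    also have "\<dots> = (\<Sum>k=1..M. if lo1 \<le> k \<and> k \<le> m then (\<Sum>l=1..M. if lo2 \<le> l \<and> l \<le> n then a k l * u k * v l else 0) else 0)"
    proof -
      have "(\<Sum>l=lo2..n. a k l * u k * v l) = (\<Sum>l=1..M. if lo2 \<le> l \<and> l \<le> n then a k l * u k * v l else 0)" for k
        by (rule sum.mono_neutral_cong_left) (use that lo in auto)
      then show ?thesis by (simp only:)
    qed
    also have "\<dots> = (\<Sum>k=1..M. \<Sum>l=1..M. if lo1 \<le> k \<and> k \<le> m \<and> lo2 \<le> l \<and> l \<le> n then a k l * u k * v l else 0)"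
      by (intro sum.cong refl) auto
    finally show ?thesis .
  qed
  then have "(\<Sum>m=1..M. \<Sum>n=1..M. b m n * (\<Sum>k=lo1..m. \<Sum>l=lo2..n. a k l * u k * v l))
    = (\<Sum>m=1..M. \<Sum>n=1..M. \<Sum>k=1..M. \<Sum>l=1..M. b m n * (if lo1 \<le> k \<and> k \<le> m \<and> lo2 \<le> l \<and> l \<le> n then a k l * u k * v l else 0))"
    by (intro sum.cong refl) (simp add: sum_distrib_left)
  also have "\<dots> = (\<Sum>k=1..M. \<Sum>l=1..M. \<Sum>m=1..M. \<Sum>n=1..M. b m n * (if lo1 \<le> k \<and> k \<le> m \<and> lo2 \<le> l \<and> l \<le> n then a k l * u k * v l else 0))"
    by (rule sum4_swap)
  also have "\<dots> = (\<Sum>k=1..M. \<Sum>l=1..M. (\<Sum>m=1..M. \<Sum>n=1..M. if lo1 \<le> k \<and> k \<le> m \<and> lo2 \<le> l \<and> l \<le> n then b m n * a k l else 0) * u k * v l)"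
    unfolding sum_distrib_right by (intro sum.cong refl) auto
  finally show ?thesis .
qed

context cosine_class begin

text \<open>Each pair of steps H1 t, H2 t' has its own test function, with a shift depending on the
  step, but the same bound since \<open>T\<close> is uniform in shifts. The resulting inequality is
  linear in either family of multipliers, so both may be replaced by their averages.\<close>

lemma Psi_lower:
  assumes \<alpha>: "0 < \<alpha>1" "0 < \<alpha>2" and C: "0 < C" and q: "q = p / (p - 1)"
    and T: "\<And>M b (lo1::nat) s1 \<theta>1 (lo2::nat) s2 \<theta>2. (\<And>m n. 0 \<le> b m n) \<Longrightarrow> 1 \<le> lo1 \<Longrightarrow> 1 \<le> lo2 \<Longrightarrow>
      (\<integral>\<^sup>+z. ennreal (\<bar>test_fun M b (trig_block lo1 s1 \<theta>1) (trig_block lo2 s2 \<theta>2) z\<bar> powr q) \<partial>sq)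
      \<le> ennreal (C * (\<Sum>m=1..M. \<Sum>n=1..M. (real m * real n) powr (2 * q - 2) * b m n powr q))"
    and L: "\<And>M R1 R2 lo1 lo2 a \<mu> \<nu> \<rho> \<sigma> I. pairing_data q C d M R1 R2 lo1 lo2 a \<mu> \<nu> \<rho> \<sigma> I \<Longrightarrow>
      (\<Sum>m\<in>R1. \<Sum>n\<in>R2. (real m * real n) powr (p - 2) * (a m n * \<rho> m * \<sigma> n) powr p) \<le> K * I"
    and G1: "good_test \<alpha>1 \<delta>1 d lo1 R1 m1 H1 s1 \<theta>1" "R1 \<subseteq> {1..M}"
    and G2: "good_test \<alpha>2 \<delta>2 d lo2 R2 m2 H2 s2 \<theta>2" "R2 \<subseteq> {1..M}"
    and I: "\<And>h1 h2. \<bar>h1\<bar> \<le> \<delta>1 \<Longrightarrow> \<bar>h2\<bar> \<le> \<delta>2 \<Longrightarrow> integrable sq (\<lambda>z. \<bar>Psi \<alpha>1 \<alpha>2 h1 h2 z\<bar> powr p)"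
      "\<And>h1 h2. \<bar>h1\<bar> \<le> \<delta>1 \<Longrightarrow> \<bar>h2\<bar> \<le> \<delta>2 \<Longrightarrow> (\<integral>z. \<bar>Psi \<alpha>1 \<alpha>2 h1 h2 z\<bar> powr p \<partial>sq) \<le> I"
  shows "(\<Sum>m\<in>R1. \<Sum>n\<in>R2. (real m * real n) powr (p - 2) * (a m n * cutoff \<alpha>1 \<delta>1 m * cutoff \<alpha>2 \<delta>2 n) powr p) \<le> K * I"
proof -
  have lo: "1 \<le> lo1" "1 \<le> lo2" and H: "\<And>t. \<bar>H1 t\<bar> \<le> \<delta>1" "\<And>t. \<bar>H2 t\<bar> \<le> \<delta>2"
    using G1(1) G2(1) unfolding good_test_def by blast+
  have av1: "(\<Sum>k=1..N. c k * m1 k) \<le> Y" if "\<And>t. (\<Sum>k=1..N. c k * diff_multiplier \<alpha>1 (H1 t) k (real k * s1 t + \<theta>1)) \<le> Y" for N c Y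
    using G1(1) that unfolding good_test_def by blast
  have av2: "(\<Sum>k=1..N. c k * m2 k) \<le> Y" if "\<And>t. (\<Sum>k=1..N. c k * diff_multiplier \<alpha>2 (H2 t) k (real k * s2 t + \<theta>2)) \<le> Y" for N c Y
    using G2(1) that unfolding good_test_def by blast
  have gt: "\<forall>n\<in>R1. \<forall>k\<in>{lo1..n}. d * cutoff \<alpha>1 \<delta>1 k \<le> m1 k" "\<forall>n\<in>R2. \<forall>k\<in>{lo2..n}. d * cutoff \<alpha>2 \<delta>2 k \<le> m2 k"
    "\<forall>n\<in>R1. d * (real n * cutoff \<alpha>1 \<delta>1 n) \<le> (\<Sum>k=lo1..n. cutoff \<alpha>1 \<delta>1 k)"
    "\<forall>n\<in>R2. d * (real n * cutoff \<alpha>2 \<delta>2 n) \<le> (\<Sum>k=lo2..n. cutoff \<alpha>2 \<delta>2 k)"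
    using G1(1) G2(1) unfolding good_test_def by blast+
  have pairing: "(\<Sum>m=1..M. \<Sum>n=1..M. b m n * (\<Sum>k=lo1..m. \<Sum>l=lo2..n. a k l * m1 k * m2 l))
       \<le> I + C * (\<Sum>m=1..M. \<Sum>n=1..M. (real m * real n) powr (2 * q - 2) * b m n powr q)"
    if b: "\<And>m n. 0 \<le> b m n" for b
  proof -
    define Y where "Y = I + C * (\<Sum>m=1..M. \<Sum>n=1..M. (real m * real n) powr (2 * q - 2) * b m n powr q)"
    define \<Lambda> where "\<Lambda> k l = (\<Sum>m=1..M. \<Sum>n=1..M. if lo1 \<le> k \<and> k \<le> m \<and> lo2 \<le> l \<and> l \<le> n then b m n * a k l else 0)" for k l
    define u v where "u t k = diff_multiplier \<alpha>1 (H1 t) k (real k * s1 t + \<theta>1)" and "v t k = diff_multiplier \<alpha>2 (H2 t) k (real k * s2 t + \<theta>2)" for t k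
    have Pt: "(\<Sum>k=1..M. \<Sum>l=1..M. \<Lambda> k l * u t k * v t' l) \<le> Y" for t t'
    proof -
      note h = H(1)[of t] H(2)[of t']
      have ip: "integrable sq (Psi \<alpha>1 \<alpha>2 (H1 t) (H2 t'))"
        by (rule integrable_sq_of_powr[OF p Psi_measurable I(1)[OF h]])
      have "(\<Sum>k=1..M. \<Sum>l=1..M. \<Lambda> k l * u t k * v t' l)
        = (\<integral>z. Psi \<alpha>1 \<alpha>2 (H1 t) (H2 t') z * test_fun M b (trig_block lo1 (s1 t) \<theta>1) (trig_block lo2 (s2 t') \<theta>2) z \<partial>sq)"
        unfolding \<Lambda>_def u_def v_def block_sum_swap[OF lo, symmetric]
        by (rule test_fun_pairing[symmetric, OF ip lo]) (rule Psi_pairing[OF \<alpha>])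
      also have "\<dots> \<le> (\<integral>z. \<bar>Psi \<alpha>1 \<alpha>2 (H1 t) (H2 t') z\<bar> powr p \<partial>sq) + C * (\<Sum>m=1..M. \<Sum>n=1..M. (real m * real n) powr (2 * q - 2) * b m n powr q)"
        by (rule test_fun_pairing_le[OF p q Psi_measurable I(1)[OF h] _ _ T[OF b lo]])
           (use C in \<open>auto intro!: mult_nonneg_nonneg sum_nonneg\<close>)
      also have "\<dots> \<le> Y" unfolding Y_def using I(2)[OF h] by simp
      finally show ?thesis .
    qed
    \<comment> \<open>Averaging goes one variable at a time: first over t with t' fixed, then over
      t' with the averaged \<open>m1\<close> in place.\<close>
    have "(\<Sum>k=1..M. (\<Sum>l=1..M. \<Lambda> k l * v t' l) * m1 k) \<le> Y" for t'
    proof (rule av1)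
      fix t
      show "(\<Sum>k=1..M. (\<Sum>l=1..M. \<Lambda> k l * v t' l) * diff_multiplier \<alpha>1 (H1 t) k (real k * s1 t + \<theta>1)) \<le> Y"
        using Pt[of t t'] unfolding u_def by (simp add: sum_distrib_left sum_distrib_right mult_ac)
    qed
    then have "(\<Sum>l=1..M. (\<Sum>k=1..M. \<Lambda> k l * m1 k) * v t' l) \<le> Y" for t'
      unfolding sum_distrib_right by (subst sum.swap) (simp add: mult_ac)
    then have "(\<Sum>l=1..M. (\<Sum>k=1..M. \<Lambda> k l * m1 k) * m2 l) \<le> Y"
      unfolding v_def by (rule av2)
    then have "(\<Sum>k=1..M. \<Sum>l=1..M. \<Lambda> k l * m1 k * m2 l) \<le> Y"
      unfolding sum_distrib_right by (subst sum.swap)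
    then show "(\<Sum>m=1..M. \<Sum>n=1..M. b m n * (\<Sum>k=lo1..m. \<Sum>l=lo2..n. a k l * m1 k * m2 l))
       \<le> I + C * (\<Sum>m=1..M. \<Sum>n=1..M. (real m * real n) powr (2 * q - 2) * b m n powr q)"
      unfolding Y_def \<Lambda>_def block_sum_swap[OF lo] .
  qed
  have "pairing_data q C d M R1 R2 lo1 lo2 a m1 m2 (cutoff \<alpha>1 \<delta>1) (cutoff \<alpha>2 \<delta>2) I"
    unfolding pairing_data_def
    by (intro conjI allI impI G1(2) G2(2) lo gt coeff_nonneg coeff_antimono cutoff_nonneg pairing) blast+
  then show ?thesis by (rule L)
qed

lemma coeff_sum_bounded:
  obtains K where "\<And>\<alpha>1 \<alpha>2 \<delta>1 \<delta>2 M. 0 < \<alpha>1 \<Longrightarrow> 0 < \<alpha>2 \<Longrightarrow> 0 \<le> \<delta>1 \<Longrightarrow> 0 \<le> \<delta>2 \<Longrightarrow> coeff_sum \<alpha>1 \<alpha>2 \<delta>1 \<delta>2 M \<le> K"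
proof -
  obtain K where K: "\<And>M. (\<Sum>k=1..M. \<Sum>l=1..M. (real k * real l) powr (p - 2) * a k l powr p) \<le> K"
    using coeff_sum_finite by blast
  show ?thesis
  proof (rule that[of K])
    fix \<alpha>1 \<alpha>2 \<delta>1 \<delta>2 :: real and M assume A: "0 < \<alpha>1" "0 < \<alpha>2" "0 \<le> \<delta>1" "0 \<le> (\<delta>2::real)"
    have "coeff_sum \<alpha>1 \<alpha>2 \<delta>1 \<delta>2 M \<le> (\<Sum>k=1..M. \<Sum>l=1..M. (real k * real l) powr (p - 2) * a k l powr p)"
      unfolding coeff_sum_def
    proof (intro sum_mono mult_left_mono powr_mono2)
      fix k l assume kl: "k \<in> {1..M}" "l \<in> {1..M}"
      then have a0: "0 \<le> a k l" using coeff_nonneg by auto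
      show "0 \<le> a k l * cutoff \<alpha>1 \<delta>1 k * cutoff \<alpha>2 \<delta>2 l" using a0 by simp
      have "cutoff \<alpha>1 \<delta>1 k * cutoff \<alpha>2 \<delta>2 l \<le> 1" using A by (intro mult_le_one cutoff_le_1) auto
      then show "a k l * cutoff \<alpha>1 \<delta>1 k * cutoff \<alpha>2 \<delta>2 l \<le> a k l"
        using a0 by (simp add: mult.assoc mult_left_le)
    qed (use p in auto)
    then show "coeff_sum \<alpha>1 \<alpha>2 \<delta>1 \<delta>2 M \<le> K" using K[of M] by linarith
  qed
qed

lemma coeff_sum_mono: "M \<le> M' \<Longrightarrow> coeff_sum \<alpha>1 \<alpha>2 \<delta>1 \<delta>2 M \<le> coeff_sum \<alpha>1 \<alpha>2 \<delta>1 \<delta>2 M'"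
  unfolding coeff_sum_def by (rule square_sum_mono) auto

lemma coeff_sum_mono_step:
  assumes "0 < \<alpha>1" "0 < \<alpha>2" "0 \<le> \<delta>1" "\<delta>1 \<le> \<delta>1'" "0 \<le> \<delta>2" "\<delta>2 \<le> \<delta>2'"
  shows "coeff_sum \<alpha>1 \<alpha>2 \<delta>1 \<delta>2 M \<le> coeff_sum \<alpha>1 \<alpha>2 \<delta>1' \<delta>2' M"
  unfolding coeff_sum_def
proof (intro sum_mono mult_left_mono powr_mono2 mult_mono)
  fix k l assume kl: "k \<in> {1..M}" "l \<in> {1..M}"
  then have a0: "0 \<le> a k l" using coeff_nonneg by auto
  then show "0 \<le> a k l" "0 \<le> a k l * cutoff \<alpha>1 \<delta>1' k" "0 \<le> a k l * cutoff \<alpha>1 \<delta>1 k * cutoff \<alpha>2 \<delta>2 l" by auto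
  show "cutoff \<alpha>1 \<delta>1 k \<le> cutoff \<alpha>1 \<delta>1' k" "cutoff \<alpha>2 \<delta>2 l \<le> cutoff \<alpha>2 \<delta>2' l"
    using assms by (auto intro!: cutoff_mono)
qed (use p in auto)

end

lemma Psi_upper_uniform:
  fixes p \<alpha>1 \<alpha>2 :: real
  assumes p: "1 < p" and \<alpha>: "0 < \<alpha>1" "0 < \<alpha>2"
  obtains C where "C > 0"
    "\<And>f a h1 h2 B. cosine_class p f a \<Longrightarrow> (\<And>M. cosine_class.coeff_sum p a \<alpha>1 \<alpha>2 \<bar>h1\<bar> \<bar>h2\<bar> M \<le> B) \<Longrightarrow>
       integrable sq (\<lambda>z. \<bar>cosine_class.Psi a \<alpha>1 \<alpha>2 h1 h2 z\<bar> powr p) \<and>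
       (\<integral>z. \<bar>cosine_class.Psi a \<alpha>1 \<alpha>2 h1 h2 z\<bar> powr p \<partial>sq) \<le> C * B"
proof -
  obtain C where C: "C > 0" and U: "\<And>h1 h2 M b. (\<And>m n. 0 \<le> b m n) \<Longrightarrow>
      (\<integral>\<^sup>+z. ennreal ((\<Sum>m=1..M. \<Sum>n=1..M. b m n * \<bar>fdiff \<alpha>1 h1 (dirichlet m) (fst z)\<bar>
          * \<bar>fdiff \<alpha>2 h2 (dirichlet n) (snd z)\<bar>) powr p) \<partial>sq)
      \<le> ennreal (C * (\<Sum>k=1..M. \<Sum>l=1..M. real k powr (p - 2) * real l powr (p - 2) *
          ((\<Sum>m=k..M. \<Sum>n=l..M. b m n) * cutoff \<alpha>1 \<bar>h1\<bar> k * cutoff \<alpha>2 \<bar>h2\<bar> l) powr p))"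
    using Lp_fdiff_dirichlet[OF p \<alpha>] by blast
  show ?thesis
  proof (rule that[OF C], intro conjI)
    fix f a h1 h2 B assume cc: "cosine_class p f a" and B: "\<And>M. cosine_class.coeff_sum p a \<alpha>1 \<alpha>2 \<bar>h1\<bar> \<bar>h2\<bar> M \<le> B"
    interpret cosine_class p f a by fact
    show "integrable sq (\<lambda>z. \<bar>Psi \<alpha>1 \<alpha>2 h1 h2 z\<bar> powr p)" "(\<integral>z. \<bar>Psi \<alpha>1 \<alpha>2 h1 h2 z\<bar> powr p \<partial>sq) \<le> C * B"
      using Psi_upper[OF \<alpha> C U B] by blast+
  qed
qed

text \<open>In each variable the frequencies are covered by a low range tested with one step and a
  high range tested with an average. The four combinations of ranges account for the factor
  4.\<close>

lemma Psi_lower_uniform: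
  fixes p \<alpha>1 \<alpha>2 :: real
  assumes p: "1 < p" and \<alpha>: "0 < \<alpha>1" "0 < \<alpha>2"
  obtains K where "K > 0"
    "\<And>f a \<delta>1 \<delta>2 I M. cosine_class p f a \<Longrightarrow> 0 < \<delta>1 \<Longrightarrow> \<delta>1 \<le> 1 \<Longrightarrow> 0 < \<delta>2 \<Longrightarrow> \<delta>2 \<le> 1 \<Longrightarrow>
       (\<And>h1 h2. \<bar>h1\<bar> \<le> \<delta>1 \<Longrightarrow> \<bar>h2\<bar> \<le> \<delta>2 \<Longrightarrow> integrable sq (\<lambda>z. \<bar>cosine_class.Psi a \<alpha>1 \<alpha>2 h1 h2 z\<bar> powr p)) \<Longrightarrow>
       (\<And>h1 h2. \<bar>h1\<bar> \<le> \<delta>1 \<Longrightarrow> \<bar>h2\<bar> \<le> \<delta>2 \<Longrightarrow> (\<integral>z. \<bar>cosine_class.Psi a \<alpha>1 \<alpha>2 h1 h2 z\<bar> powr p \<partial>sq) \<le> I) \<Longrightarrow>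
       cosine_class.coeff_sum p a \<alpha>1 \<alpha>2 \<delta>1 \<delta>2 M \<le> K * I"
proof -
  define q where "q = p / (p - 1)"
  have q: "1 < q" using p by (simp add: q_def field_simps)
  define A1 A2 where "A1 = (\<Sum>\<nu>. \<bar>fcoef \<alpha>1 \<nu>\<bar>)" and "A2 = (\<Sum>\<nu>. \<bar>fcoef \<alpha>2 \<nu>\<bar>)"
  define L1 L2 where "L1 = 4 * A1 + 2" and "L2 = 4 * A2 + 2"
  have A: "1 \<le> A1" "1 \<le> A2"
    using sum_le_suminf[OF summable_abs_fcoef[OF \<alpha>(1)], of "{0}"] sum_le_suminf[OF summable_abs_fcoef[OF \<alpha>(2)], of "{0}"]
    by (simp_all add: A1_def A2_def fcoef_def)
  have L1: "1 \<le> L1" "1 \<le> L2" using A by (auto simp: L1_def L2_def)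
  \<comment> \<open>The largest value meeting the demands of \<open>good_test_low\<close> in both
    variables and of \<open>good_test_high\<close>.\<close>
  define d where "d = min (min (min ((1 / (2 * L1)) powr \<alpha>1) (1 / 2 powr (\<alpha>1 + 1))) (min ((1 / (2 * L2)) powr \<alpha>2) (1 / 2 powr (\<alpha>2 + 1)))) (1 / 2)"
  have d: "0 < d" using L1 by (simp add: d_def)
  have d': "0 \<le> d" "d \<le> (1 / (2 * L1)) powr \<alpha>1" "d \<le> 1 / 2 powr (\<alpha>1 + 1)" "d \<le> (1 / (2 * L2)) powr \<alpha>2" "d \<le> 1 / 2 powr (\<alpha>2 + 1)" "d \<le> 1 / 2"
    using d by (auto simp: d_def)
  obtain C where C: "C > 0" and T:
    "\<And>M b (lo1::nat) s1 \<theta>1 (lo2::nat) s2 \<theta>2. (\<And>m n. 0 \<le> b m n) \<Longrightarrow> 1 \<le> lo1 \<Longrightarrow> 1 \<le> lo2 \<Longrightarrow>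
      (\<integral>\<^sup>+z. ennreal (\<bar>test_fun M b (trig_block lo1 s1 \<theta>1) (trig_block lo2 s2 \<theta>2) z\<bar> powr q) \<partial>sq)
      \<le> ennreal (C * (\<Sum>m=1..M. \<Sum>n=1..M. (real m * real n) powr (2 * q - 2) * b m n powr q))"
    using Lp_test_fun[OF q] by blast
  obtain K where K: "K > 0" and L: "\<And>M R1 R2 lo1 lo2 a \<mu> \<nu> \<rho> \<sigma> I.
      pairing_data q C d M R1 R2 lo1 lo2 a \<mu> \<nu> \<rho> \<sigma> I \<Longrightarrow>
      (\<Sum>m\<in>R1. \<Sum>n\<in>R2. (real m * real n) powr (p - 2) * (a m n * \<rho> m * \<sigma> n) powr p) \<le> K * I"
    using coefficient_lower_bound[OF p q_def C d] by blast
  have tests: "\<exists>R R'. {1..M} = R \<union> R' \<and> (\<exists>lo m H s \<theta>. good_test \<alpha> \<delta> d lo R m H s \<theta>) \<and> (\<exists>lo m H s \<theta>. good_test \<alpha> \<delta> d lo R' m H s \<theta>)"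
    if \<alpha>0: "0 < \<alpha>" and \<delta>: "0 < \<delta>" "\<delta> \<le> 1" and A_def: "A = (\<Sum>\<nu>. \<bar>fcoef \<alpha> \<nu>\<bar>)" and A1: "1 \<le> A"
      and L_def: "L = 4 * A + 2" and dd: "d \<le> (1 / (2 * L)) powr \<alpha>" "d \<le> 1 / 2 powr (\<alpha> + 1)" for \<alpha> \<delta> A L M
  proof -
    \<comment> \<open>The first frequency at which averaging over the steps works. The high range
      starts only at 2 lo, and L = 4 A + 2 is chosen so that n < 2 lo forces n \<delta> \<le> 4 A +
      2 \<delta> \<le> L, leaving no gap.\<close>
    define lo where "lo = nat \<lceil>2 * A / \<delta>\<rceil>"
    have lo1: "2 * A / \<delta> \<le> real lo" "real lo < 2 * A / \<delta> + 1"
      unfolding lo_def using A1 \<delta> by (auto simp: le_of_int_ceiling) linarith+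
    have "0 < 2 * A / \<delta>" using A1 \<delta> by auto
    then have lo: "1 \<le> lo" using lo1 by (cases lo) auto
    have lod: "2 * A \<le> real lo * \<delta>" using lo1(1) \<delta> by (simp add: field_simps)
    have cov: "{1..M} = {n \<in> {1..M}. real n * \<delta> \<le> L} \<union> {n \<in> {1..M}. 2 * lo \<le> n}"
    proof -
      have "real n * \<delta> \<le> L" if "n < 2 * lo" for n
      proof -
        have "real n \<le> 2 * real lo" using that by simp
        also have "\<dots> \<le> 2 * (2 * A / \<delta> + 1)" using lo1(2) by (intro mult_left_mono) auto
        finally have "real n \<le> 2 * (2 * A / \<delta> + 1)" .
        then have "real n * \<delta> \<le> 2 * (2 * A / \<delta> + 1) * \<delta>" using \<delta> by (intro mult_right_mono) auto
        also have "\<dots> = 4 * A + 2 * \<delta>" using \<delta> by (simp add: field_simps)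
        finally show ?thesis using \<delta> by (simp add: L_def)
      qed
      then show ?thesis by (auto simp: not_le)
    qed
    have L: "1 \<le> L" using A1 by (simp add: L_def)
    have low: "\<exists>lo m H s \<theta>. good_test \<alpha> \<delta> d lo {n \<in> {1..M}. real n * \<delta> \<le> L} m H s \<theta>"
      by (rule exI[of _ 1], rule good_test_low[OF \<alpha>0 \<delta>(1) L d'(1) dd])
    have high: "\<exists>lo' m H s \<theta>. good_test \<alpha> \<delta> d lo' {n \<in> {1..M}. 2 * lo \<le> n} m H s \<theta>"
      by (rule exI[of _ lo], rule good_test_high[OF \<alpha>0 \<delta>(1) lo lod[unfolded A_def] d'(1,6)])
    show ?thesis
      by (rule exI[of _ "{n \<in> {1..M}. real n * \<delta> \<le> L}"], rule exI[of _ "{n \<in> {1..M}. 2 * lo \<le> n}"])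
         (intro conjI cov low high)
  qed
  show ?thesis
  proof (rule that[of "4 * K"])
    show "4 * K > 0" using K by simp
    fix f a \<delta>1 \<delta>2 I M assume cc: "cosine_class p f a" and \<delta>: "0 < \<delta>1" "\<delta>1 \<le> 1" "0 < \<delta>2" "\<delta>2 \<le> 1"
      and I: "\<And>h1 h2. \<bar>h1\<bar> \<le> \<delta>1 \<Longrightarrow> \<bar>h2\<bar> \<le> \<delta>2 \<Longrightarrow> integrable sq (\<lambda>z. \<bar>cosine_class.Psi a \<alpha>1 \<alpha>2 h1 h2 z\<bar> powr p)"
       "\<And>h1 h2. \<bar>h1\<bar> \<le> \<delta>1 \<Longrightarrow> \<bar>h2\<bar> \<le> \<delta>2 \<Longrightarrow> (\<integral>z. \<bar>cosine_class.Psi a \<alpha>1 \<alpha>2 h1 h2 z\<bar> powr p \<partial>sq) \<le> I"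
    interpret cosine_class p f a by fact
    define e where "e m n = (real m * real n) powr (p - 2) * (a m n * cutoff \<alpha>1 \<delta>1 m * cutoff \<alpha>2 \<delta>2 n) powr p" for m n
    have e0: "0 \<le> e m n" for m n by (simp add: e_def)
    obtain R1 R1' where "{1..M} = R1 \<union> R1' \<and> (\<exists>lo m H s \<theta>. good_test \<alpha>1 \<delta>1 d lo R1 m H s \<theta>) \<and> (\<exists>lo m H s \<theta>. good_test \<alpha>1 \<delta>1 d lo R1' m H s \<theta>)"
      using tests[OF \<alpha>(1) \<delta>(1,2) A1_def A(1) L1_def d'(2,3), of M] by (elim exE)
    note R1 = this[THEN conjunct1] this[THEN conjunct2, THEN conjunct1] this[THEN conjunct2, THEN conjunct2]
    obtain R2 R2' where "{1..M} = R2 \<union> R2' \<and> (\<exists>lo m H s \<theta>. good_test \<alpha>2 \<delta>2 d lo R2 m H s \<theta>) \<and> (\<exists>lo m H s \<theta>. good_test \<alpha>2 \<delta>2 d lo R2' m H s \<theta>)"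
      using tests[OF \<alpha>(2) \<delta>(3,4) A2_def A(2) L2_def d'(4,5), of M] by (elim exE)
    note R2 = this[THEN conjunct1] this[THEN conjunct2, THEN conjunct1] this[THEN conjunct2, THEN conjunct2]
    have block: "(\<Sum>m\<in>S1. \<Sum>n\<in>S2. e m n) \<le> K * I"
      if S1: "\<exists>lo m H s \<theta>. good_test \<alpha>1 \<delta>1 d lo S1 m H s \<theta>" "S1 \<subseteq> {1..M}"
        and S2: "\<exists>lo m H s \<theta>. good_test \<alpha>2 \<delta>2 d lo S2 m H s \<theta>" "S2 \<subseteq> {1..M}" for S1 S2
    proof -
      from S1(1) obtain lo1 m1 H1 s1 \<theta>1 where G1: "good_test \<alpha>1 \<delta>1 d lo1 S1 m1 H1 s1 \<theta>1" by blast
      from S2(1) obtain lo2 m2 H2 s2 \<theta>2 where G2: "good_test \<alpha>2 \<delta>2 d lo2 S2 m2 H2 s2 \<theta>2" by blast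
      show ?thesis unfolding e_def
        by (rule Psi_lower[OF \<alpha> C q_def T L G1 S1(2) G2 S2(2) I])
    qed
    \<comment> \<open>The two ranges may overlap, so only subadditivity for nonnegative terms is
      claimed.\<close>
    have un: "(\<Sum>m\<in>S \<union> S'. g m) \<le> (\<Sum>m\<in>S. g m) + (\<Sum>m\<in>S'. g m)" if "finite S" "finite S'" "\<And>m. 0 \<le> g m" for S S' :: "nat set" and g :: "nat \<Rightarrow> real"
      using sum.union_inter[OF that(1,2), of g] sum_nonneg[of "S \<inter> S'" g] that(3) by auto
    have fin: "finite R1" "finite R1'" "finite R2" "finite R2'"
      using R1(1) R2(1) finite_subset[of _ "{1..M}"] by (metis Un_upper1 Un_upper2 finite_atLeastAtMost)+
    have sub: "R1 \<subseteq> {1..M}" "R1' \<subseteq> {1..M}" "R2 \<subseteq> {1..M}" "R2' \<subseteq> {1..M}"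
      using R1(1) R2(1) by auto
    have "coeff_sum \<alpha>1 \<alpha>2 \<delta>1 \<delta>2 M = (\<Sum>m\<in>R1 \<union> R1'. \<Sum>n\<in>R2 \<union> R2'. e m n)"
      unfolding coeff_sum_def e_def R1(1)[symmetric] R2(1)[symmetric] ..
    also have "\<dots> \<le> (\<Sum>m\<in>R1 \<union> R1'. (\<Sum>n\<in>R2. e m n) + (\<Sum>n\<in>R2'. e m n))"
      by (intro sum_mono un fin e0)
    also have "\<dots> \<le> (\<Sum>m\<in>R1. (\<Sum>n\<in>R2. e m n) + (\<Sum>n\<in>R2'. e m n)) + (\<Sum>m\<in>R1'. (\<Sum>n\<in>R2. e m n) + (\<Sum>n\<in>R2'. e m n))"
      by (intro un fin add_nonneg_nonneg sum_nonneg e0)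
    also have "\<dots> = (\<Sum>m\<in>R1. \<Sum>n\<in>R2. e m n) + (\<Sum>m\<in>R1. \<Sum>n\<in>R2'. e m n) + ((\<Sum>m\<in>R1'. \<Sum>n\<in>R2. e m n) + (\<Sum>m\<in>R1'. \<Sum>n\<in>R2'. e m n))"
      by (simp add: sum.distrib)
    also have "\<dots> \<le> K * I + K * I + (K * I + K * I)"
      by (intro add_mono block R1 R2 sub)
    finally show "coeff_sum \<alpha>1 \<alpha>2 \<delta>1 \<delta>2 M \<le> 4 * K * I" by (simp add: mult_ac)
  qed
qed

section \<open>The mixed modulus of smoothness in terms of the coefficients\<close>

lemma AE_lborel_translate:
  fixes v :: "'a::euclidean_space"
  assumes "AE z in lborel. P z"
  shows "AE z in lborel. P (v + z)"
proof (rule AE_distrD[where M' = borel and f = "(+) v" and P = P])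
  show "AE z in distr lborel borel ((+) v). P z" unfolding lborel_distr_plus by (rule assms)
qed simp

lemma trig_coeff_eq_integral_sq:
  assumes f: "f \<in> borel_measurable lebesgue" and f0: "f0 \<in> borel_measurable borel" "AE z in lborel. f z = f0 z"
    and uv: "u \<in> borel_measurable borel" "v \<in> borel_measurable borel"
  shows "trig_coeff u v f m n = (if m = 0 then 1 else 2) * (if n = 0 then 1 else 2) / (2 * pi)\<^sup>2 *
     (\<integral>z. f0 z * (u (real m * fst z) * v (real n * snd z)) \<partial>sq)"
proof -
  have e: "(\<lambda>z. u (real m * fst z) * v (real n * snd z)) \<in> borel_measurable borel"
    by (intro borel_measurable_times borel_measurable_comp_fst[where g = "\<lambda>x. u (real m * x)"]
        borel_measurable_comp_snd[where g = "\<lambda>x. v (real n * x)"]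
        measurable_compose[OF _ uv(1)] measurable_compose[OF _ uv(2)]) measurable
  have el: "(\<lambda>z. u (real m * fst z) * v (real n * snd z)) \<in> borel_measurable lebesgue"
    by (rule measurable_completion) (use e in simp)
  have "(LINT (x, y):period_square|lebesgue. f (x, y) * u (real m * x) * v (real n * y))
    = (LINT z:period_square|lebesgue. f z * (u (real m * fst z) * v (real n * snd z)))"
    by (simp add: case_prod_beta' mult.assoc)
  also have "\<dots> = (\<integral>z. f0 z * (u (real m * fst z) * v (real n * snd z)) \<partial>sq)"
  proof (rule set_integral_lebesgue_sq(1))
    show "(\<lambda>z. f z * (u (real m * fst z) * v (real n * snd z))) \<in> borel_measurable lebesgue"
      by (intro borel_measurable_times f el)
    show "(\<lambda>z. f0 z * (u (real m * fst z) * v (real n * snd z))) \<in> borel_measurable borel"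
      by (intro borel_measurable_times f0 e)
    show "AE z in lborel. f z * (u (real m * fst z) * v (real n * snd z)) = f0 z * (u (real m * fst z) * v (real n * snd z))"
      using f0(2) by eventually_elim simp
  qed
  finally show ?thesis unfolding trig_coeff_def by simp
qed

text \<open>Pass to a Borel representative; the normalizing factors of \<open>trig_coeff\<close>
  turn into pi * pi at positive frequencies.\<close>

lemma M_class_cosine_class:
  assumes p: "1 < p" and f: "f \<in> M_class p"
  obtains f0 a where "cosine_class p f0 a" "AE z in lborel. f z = f0 z"
proof -
  from f obtain a where fm: "f \<in> borel_measurable lebesgue"
    and fi: "set_integrable lebesgue period_square (\<lambda>z. \<bar>f z\<bar> powr p)"
    and fs: "has_cos_cos_fourier_series f a"
    and mixed: "\<forall>m\<ge>1. \<forall>n\<ge>1. a m n - a (m + 1) n - a m (n + 1) + a (m + 1) (n + 1) \<ge> 0"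
    unfolding M_class_def Lp0_T2_def Lp_T2_def by auto
  obtain f0 where f0: "f0 \<in> borel_measurable borel" "AE z in lborel. f z = f0 z"
    using completion_ex_borel_measurable_real[OF fm] by auto
  have int: "integrable sq (\<lambda>z. \<bar>f0 z\<bar> powr p)"
  proof -
    have "set_integrable lebesgue period_square (\<lambda>z. \<bar>f z\<bar> powr p) \<longleftrightarrow> integrable sq (\<lambda>z. \<bar>f0 z\<bar> powr p)"
    proof (rule set_integral_lebesgue_sq(2))
      show "(\<lambda>z. \<bar>f z\<bar> powr p) \<in> borel_measurable lebesgue" using fm by measurable
      show "(\<lambda>z. \<bar>f0 z\<bar> powr p) \<in> borel_measurable borel" using f0(1) by measurable
      show "AE z in lborel. \<bar>f z\<bar> powr p = \<bar>f0 z\<bar> powr p" using f0(2) by eventually_elim simp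
    qed
    then show ?thesis using fi by simp
  qed
  have i1: "integrable sq f0" by (rule integrable_sq_of_powr[OF p f0(1) int])
  have cm: "(cos :: real \<Rightarrow> real) \<in> borel_measurable borel" "(sin :: real \<Rightarrow> real) \<in> borel_measurable borel"
    by (auto intro!: borel_measurable_continuous_onI continuous_intros)
  define E where "E u v j k = (\<integral>z. f0 z * (u (real j * fst z) * v (real k * snd z)) \<partial>sq)" for u v :: "real \<Rightarrow> real" and j k
  have tc: "trig_coeff u v f j k = (if j = 0 then 1 else 2) * (if k = 0 then 1 else 2) / (2 * pi)\<^sup>2 * E u v j k"
    if "u \<in> borel_measurable borel" "v \<in> borel_measurable borel" for u v j k
    unfolding E_def by (rule trig_coeff_eq_integral_sq[OF fm f0 that])
  have fs': "trig_coeff cos cos f j k = (if 1 \<le> j \<and> 1 \<le> k then a j k else 0)"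
    "trig_coeff cos sin f j k = 0" "trig_coeff sin cos f j k = 0" "trig_coeff sin sin f j k = 0" for j k
    using fs unfolding has_cos_cos_fourier_series_def by blast+
  have z: "E cos sin j k = 0" "E sin cos j k = 0" "E sin sin j k = 0" for j k
    using fs'(2-4)[of j k] cm by (auto simp: tc split: if_splits)
  have cc: "E cos cos j k = (if 1 \<le> j \<and> 1 \<le> k then a j k * pi * pi else 0)" for j k
    using fs'(1)[of j k] cm by (auto simp: tc power2_eq_square field_simps split: if_splits)
  have "cosine_class p f0 a"
  proof
    show "1 < p" "f0 \<in> borel_measurable borel" "integrable sq (\<lambda>z. \<bar>f0 z\<bar> powr p)" by fact+
    show "0 \<le> a m n - a (m + 1) n - a m (n + 1) + a (m + 1) (n + 1)" if "1 \<le> m" "1 \<le> n" for m n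
      using mixed that by blast
    fix j k :: nat and \<phi> \<psi> :: real
    have ii: "integrable sq (\<lambda>z. f0 z * (u (real j * fst z) * v (real k * snd z)))"
      if "u \<in> {cos, sin}" "v \<in> {cos, sin}" for u v :: "real \<Rightarrow> real"
    proof (rule integrable_sq_mult_bounded[OF i1, where B = 1])
      show "(\<lambda>z. u (real j * fst z) * v (real k * snd z)) \<in> borel_measurable borel"
        using that cm by (intro borel_measurable_times borel_measurable_comp_fst[where g = "\<lambda>x. u (real j * x)"]
          borel_measurable_comp_snd[where g = "\<lambda>x. v (real k * x)"]) (auto intro!: measurable_compose[OF _ cm(1)] measurable_compose[OF _ cm(2)])
      show "\<bar>u (real j * fst z) * v (real k * snd z)\<bar> \<le> 1" for z
        using that unfolding abs_mult by (intro mult_le_one) auto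
    qed
    \<comment> \<open>The addition formula expresses a pairing with phases through the four kinds of
      coefficients, of which only the cosine-cosine one survives.\<close>
    have "f0 z * (cos (real j * fst z + \<phi>) * cos (real k * snd z + \<psi>))
      = cos \<phi> * cos \<psi> * (f0 z * (cos (real j * fst z) * cos (real k * snd z)))
      - cos \<phi> * sin \<psi> * (f0 z * (cos (real j * fst z) * sin (real k * snd z)))
      - sin \<phi> * cos \<psi> * (f0 z * (sin (real j * fst z) * cos (real k * snd z)))
      + sin \<phi> * sin \<psi> * (f0 z * (sin (real j * fst z) * sin (real k * snd z)))" for z
      by (simp add: cos_add algebra_simps)
    then have "(\<integral>z. f0 z * (cos (real j * fst z + \<phi>) * cos (real k * snd z + \<psi>)) \<partial>sq)
      = cos \<phi> * cos \<psi> * E cos cos j k - cos \<phi> * sin \<psi> * E cos sin j k - sin \<phi> * cos \<psi> * E sin cos j k + sin \<phi> * sin \<psi> * E sin sin j k"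
      using ii[of cos cos] ii[of cos sin] ii[of sin cos] ii[of sin sin] by (simp add: E_def)
    then show "(\<integral>z. f0 z * (cos (real j * fst z + \<phi>) * cos (real k * snd z + \<psi>)) \<partial>sq) =
        (if 1 \<le> j \<and> 1 \<le> k then a j k * (pi * cos \<phi>) * (pi * cos \<psi>) else 0)"
      unfolding z cc by simp
  qed
  then show ?thesis using f0(2) that by blast
qed

lemma periodic_plane_cover:
  obtains i j :: int where "(x + 2 * pi * of_int i, y + 2 * pi * of_int j) \<in> period_square"
proof -
  have *: "\<exists>i::int. x + 2 * pi * of_int i \<in> {0..2 * pi}" for x
  proof -
    define n where "n = \<lfloor>x / (2 * pi)\<rfloor>"
    have "of_int n \<le> x / (2 * pi)" "x / (2 * pi) < of_int n + 1" unfolding n_def by linarith+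
    then have "0 \<le> x + 2 * pi * of_int (- n)" "x + 2 * pi * of_int (- n) \<le> 2 * pi" by (auto simp: field_simps)
    then show ?thesis by (intro exI[of _ "- n"]) simp
  qed
  from *[of x] *[of y] show ?thesis using that unfolding period_square_def by auto
qed

context cosine_class begin

text \<open>The Borel representative f need not be periodic, so the periodic g is compared with the
  periodic \<open>F\<close>. Equality almost everywhere on the square spreads over countably many
  translates by periods, and then over the countably many translates in the difference.\<close>

lemma frac_diff_eq_Psi:
  assumes g: "g \<in> borel_measurable lebesgue" "periodic2 g" "AE z in lborel. g z = f z"
  shows "AE z in lborel. frac_diff_1 \<alpha>1 h1 (frac_diff_2 \<alpha>2 h2 g) z = Psi \<alpha>1 \<alpha>2 h1 h2 z"
proof -
  have gp: "g (x + 2 * pi * of_int i, y + 2 * pi * of_int j) = g (x, y)" for x y i j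
    using periodic_int[of "\<lambda>x. g (x, y + 2 * pi * of_int j)" x i] periodic_int[of "\<lambda>y. g (x, y)" y j] g(2)
    unfolding periodic2_def by auto
  have Fp: "F (x + 2 * pi * of_int i, y + 2 * pi * of_int j) = F (x, y)" for x y i j
    using periodic_int[of "\<lambda>x. F (x, y + 2 * pi * of_int j)" x i] periodic_int[of "\<lambda>y. F (x, y)" y j] F_periodic
    by auto
  have "AE z in lborel. z \<in> period_square \<longrightarrow> f z = F z"
    using f_eq_F unfolding sq_eq_density by (subst (asm) AE_density) (auto simp: indicator_def)
  with g(3) have Q: "AE z in lborel. z \<in> period_square \<longrightarrow> g z = F z"
    by eventually_elim auto
  have "AE z in lborel. \<forall>i j::int. (2 * pi * of_int i, 2 * pi * of_int j) + z \<in> period_square \<longrightarrow>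
      g ((2 * pi * of_int i, 2 * pi * of_int j) + z) = F ((2 * pi * of_int i, 2 * pi * of_int j) + z)"
    unfolding AE_all_countable using AE_lborel_translate[OF Q] by blast
  then have gF: "AE z in lborel. g z = F z"
  proof eventually_elim
    case (elim z)
    obtain x y where z: "z = (x, y)" by (cases z)
    obtain i j :: int where "(x + 2 * pi * of_int i, y + 2 * pi * of_int j) \<in> period_square"
      using periodic_plane_cover[of x y] by blast
    then show ?case using elim[rule_format, of i j] gp[of x i y j] Fp[of x i y j] by (simp add: z add.commute)
  qed
  have "AE z in lborel. \<forall>\<nu> \<mu>::nat. g (((\<alpha>1 - real \<nu>) * h1, (\<alpha>2 - real \<mu>) * h2) + z) = F (((\<alpha>1 - real \<nu>) * h1, (\<alpha>2 - real \<mu>) * h2) + z)"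
    unfolding AE_all_countable using AE_lborel_translate[OF gF] by blast
  then show ?thesis
  proof eventually_elim
    case (elim z)
    have "g (fst z + (\<alpha>1 - real \<nu>) * h1, snd z + (\<alpha>2 - real \<mu>) * h2) = F (fst z + (\<alpha>1 - real \<nu>) * h1, snd z + (\<alpha>2 - real \<mu>) * h2)" for \<nu> \<mu>
      using elim[rule_format, of \<nu> \<mu>] by (cases z) (simp add: add.commute)
    then show ?case unfolding Psi_def frac_diff_eq by simp
  qed
qed

lemma Lp_norm_frac_diff:
  assumes g: "g \<in> borel_measurable lebesgue" "periodic2 g" "AE z in lborel. g z = f z"
  shows "Lp_norm p (frac_diff_1 \<alpha>1 h1 (frac_diff_2 \<alpha>2 h2 g)) = (\<integral>z. \<bar>Psi \<alpha>1 \<alpha>2 h1 h2 z\<bar> powr p \<partial>sq) powr (1 / p)"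
proof -
  let ?d = "frac_diff_1 \<alpha>1 h1 (frac_diff_2 \<alpha>2 h2 g)"
  have ae: "AE z in lborel. ?d z = Psi \<alpha>1 \<alpha>2 h1 h2 z" by (rule frac_diff_eq_Psi[OF g])
  have "Psi \<alpha>1 \<alpha>2 h1 h2 \<in> borel_measurable lebesgue" by (rule measurable_completion) simp
  moreover have "AE z in lebesgue. Psi \<alpha>1 \<alpha>2 h1 h2 z = ?d z"
    using AE_completion[OF ae] by (auto elim: eventually_mono)
  ultimately have m: "?d \<in> borel_measurable lebesgue" by (rule borel_measurable_AE)
  have "(LINT z:period_square|lebesgue. \<bar>?d z\<bar> powr p) = (\<integral>z. \<bar>Psi \<alpha>1 \<alpha>2 h1 h2 z\<bar> powr p \<partial>sq)"
  proof (rule set_integral_lebesgue_sq(1))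
    show "(\<lambda>z. \<bar>?d z\<bar> powr p) \<in> borel_measurable lebesgue" using m by measurable
    show "AE z in lborel. \<bar>?d z\<bar> powr p = \<bar>Psi \<alpha>1 \<alpha>2 h1 h2 z\<bar> powr p" using ae by eventually_elim simp
  qed measurable
  then show ?thesis unfolding Lp_norm_def by simp
qed

definition coeff_series :: "real \<Rightarrow> real \<Rightarrow> real \<Rightarrow> real \<Rightarrow> real" where
  "coeff_series \<alpha>1 \<alpha>2 \<delta>1 \<delta>2 = (SUP M. coeff_sum \<alpha>1 \<alpha>2 \<delta>1 \<delta>2 M)"

lemma coeff_sum_bdd_above:
  assumes "0 < \<alpha>1" "0 < \<alpha>2" "0 \<le> \<delta>1" "0 \<le> \<delta>2"
  shows "bdd_above (range (coeff_sum \<alpha>1 \<alpha>2 \<delta>1 \<delta>2))"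
proof -
  obtain K where "\<And>\<alpha>1 \<alpha>2 \<delta>1 \<delta>2 M. 0 < \<alpha>1 \<Longrightarrow> 0 < \<alpha>2 \<Longrightarrow> 0 \<le> \<delta>1 \<Longrightarrow> 0 \<le> \<delta>2 \<Longrightarrow> coeff_sum \<alpha>1 \<alpha>2 \<delta>1 \<delta>2 M \<le> K"
    using coeff_sum_bounded by blast
  then show ?thesis using assms by (intro bdd_aboveI[of _ K]) auto
qed

lemma coeff_sum_le_coeff_series:
  assumes "0 < \<alpha>1" "0 < \<alpha>2" "0 \<le> \<delta>1" "0 \<le> \<delta>2"
  shows "coeff_sum \<alpha>1 \<alpha>2 \<delta>1 \<delta>2 M \<le> coeff_series \<alpha>1 \<alpha>2 \<delta>1 \<delta>2"
  unfolding coeff_series_def by (intro cSUP_upper coeff_sum_bdd_above assms) auto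

lemma coeff_sum_tendsto_coeff_series:
  assumes "0 < \<alpha>1" "0 < \<alpha>2" "0 \<le> \<delta>1" "0 \<le> \<delta>2"
  shows "(\<lambda>M. coeff_sum \<alpha>1 \<alpha>2 \<delta>1 \<delta>2 M) \<longlonglongrightarrow> coeff_series \<alpha>1 \<alpha>2 \<delta>1 \<delta>2"
  unfolding coeff_series_def by (intro LIMSEQ_incseq_SUP coeff_sum_bdd_above assms) (auto simp: incseq_def intro: coeff_sum_mono)

end

text \<open>The coefficient bound is monotone in the steps, so the bound at the largest steps covers
  the whole supremum. Conversely the supremum bounds the norms for all steps that the test functions
  use. Monotonicity of the modulus is exported because the later integration over steps draws its
  measurability from it.\<close>

lemma mixed_modulus_equiv:
  fixes p \<alpha>1 \<alpha>2 :: real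
  assumes p: "1 < p" and \<alpha>: "0 < \<alpha>1" "0 < \<alpha>2"
  obtains C where "C > 0"
    "\<And>f f0 a \<delta>1 \<delta>2. f \<in> M_class p \<Longrightarrow> cosine_class p f0 a \<Longrightarrow> AE z in lborel. f z = f0 z \<Longrightarrow>
      0 < \<delta>1 \<Longrightarrow> \<delta>1 \<le> 1 \<Longrightarrow> 0 < \<delta>2 \<Longrightarrow> \<delta>2 \<le> 1 \<Longrightarrow>
      0 \<le> mixed_modulus p \<alpha>1 \<alpha>2 f \<delta>1 \<delta>2 \<and>
      mixed_modulus p \<alpha>1 \<alpha>2 f \<delta>1 \<delta>2 powr p \<le> C * cosine_class.coeff_series p a \<alpha>1 \<alpha>2 \<delta>1 \<delta>2 \<and>
      cosine_class.coeff_series p a \<alpha>1 \<alpha>2 \<delta>1 \<delta>2 \<le> C * mixed_modulus p \<alpha>1 \<alpha>2 f \<delta>1 \<delta>2 powr p"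
    "\<And>f f0 a \<delta>1 \<delta>2 \<delta>1' \<delta>2'. f \<in> M_class p \<Longrightarrow> cosine_class p f0 a \<Longrightarrow> AE z in lborel. f z = f0 z \<Longrightarrow>
      0 < \<delta>1 \<Longrightarrow> \<delta>1 \<le> \<delta>1' \<Longrightarrow> \<delta>1' \<le> 1 \<Longrightarrow> 0 < \<delta>2 \<Longrightarrow> \<delta>2 \<le> \<delta>2' \<Longrightarrow> \<delta>2' \<le> 1 \<Longrightarrow>
      mixed_modulus p \<alpha>1 \<alpha>2 f \<delta>1 \<delta>2 \<le> mixed_modulus p \<alpha>1 \<alpha>2 f \<delta>1' \<delta>2'"
proof -
  obtain C where C: "C > 0" and U:
    "\<And>f a h1 h2 B. cosine_class p f a \<Longrightarrow> (\<And>M. cosine_class.coeff_sum p a \<alpha>1 \<alpha>2 \<bar>h1\<bar> \<bar>h2\<bar> M \<le> B) \<Longrightarrow>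
       integrable sq (\<lambda>z. \<bar>cosine_class.Psi a \<alpha>1 \<alpha>2 h1 h2 z\<bar> powr p) \<and>
       (\<integral>z. \<bar>cosine_class.Psi a \<alpha>1 \<alpha>2 h1 h2 z\<bar> powr p \<partial>sq) \<le> C * B"
    using Psi_upper_uniform[OF p \<alpha>] by blast
  obtain K where K: "K > 0" and L:
    "\<And>f a \<delta>1 \<delta>2 I M. cosine_class p f a \<Longrightarrow> 0 < \<delta>1 \<Longrightarrow> \<delta>1 \<le> 1 \<Longrightarrow> 0 < \<delta>2 \<Longrightarrow> \<delta>2 \<le> 1 \<Longrightarrow>
       (\<And>h1 h2. \<bar>h1\<bar> \<le> \<delta>1 \<Longrightarrow> \<bar>h2\<bar> \<le> \<delta>2 \<Longrightarrow> integrable sq (\<lambda>z. \<bar>cosine_class.Psi a \<alpha>1 \<alpha>2 h1 h2 z\<bar> powr p)) \<Longrightarrow>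
       (\<And>h1 h2. \<bar>h1\<bar> \<le> \<delta>1 \<Longrightarrow> \<bar>h2\<bar> \<le> \<delta>2 \<Longrightarrow> (\<integral>z. \<bar>cosine_class.Psi a \<alpha>1 \<alpha>2 h1 h2 z\<bar> powr p \<partial>sq) \<le> I) \<Longrightarrow>
       cosine_class.coeff_sum p a \<alpha>1 \<alpha>2 \<delta>1 \<delta>2 M \<le> K * I"
    using Psi_lower_uniform[OF p \<alpha>] by blast
  define S where "S \<delta>1 \<delta>2 = {(h1, h2). \<bar>h1\<bar> \<le> \<delta>1 \<and> \<bar>h2\<bar> \<le> (\<delta>2::real)}" for \<delta>1 \<delta>2 :: real
  define N where "N a h = (\<integral>z. \<bar>cosine_class.Psi a \<alpha>1 \<alpha>2 (fst h) (snd h) z\<bar> powr p \<partial>sq)" for a and h :: "real \<times> real"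
  have mm: "mixed_modulus p \<alpha>1 \<alpha>2 f \<delta>1 \<delta>2 = (SUP h\<in>S \<delta>1 \<delta>2. N a h powr (1 / p))"
    if f: "f \<in> M_class p" "cosine_class p f0 a" "AE z in lborel. f z = f0 z" for f f0 a \<delta>1 \<delta>2
  proof -
    have fm: "f \<in> borel_measurable lebesgue" "periodic2 f"
      using f(1) unfolding M_class_def Lp0_T2_def Lp_T2_def by auto
    show ?thesis unfolding mixed_modulus_def S_def[symmetric] N_def
      using cosine_class.Lp_norm_frac_diff[OF f(2) fm f(3)] by (simp add: case_prod_beta')
  qed
  have Nle: "N a h \<le> C * cosine_class.coeff_series p a \<alpha>1 \<alpha>2 \<delta>1 \<delta>2"
    and Nint: "integrable sq (\<lambda>z. \<bar>cosine_class.Psi a \<alpha>1 \<alpha>2 (fst h) (snd h) z\<bar> powr p)"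
    if cc: "cosine_class p f0 a" and \<delta>: "0 < \<delta>1" "0 < \<delta>2" and h: "h \<in> S \<delta>1 \<delta>2" for f0 a \<delta>1 \<delta>2 h
  proof -
    interpret cosine_class p f0 a by fact
    have "coeff_sum \<alpha>1 \<alpha>2 \<bar>fst h\<bar> \<bar>snd h\<bar> M \<le> coeff_series \<alpha>1 \<alpha>2 \<delta>1 \<delta>2" for M
      using h \<delta> coeff_sum_mono_step[OF \<alpha>, of "\<bar>fst h\<bar>" \<delta>1 "\<bar>snd h\<bar>" \<delta>2 M] coeff_sum_le_coeff_series[OF \<alpha>, of \<delta>1 \<delta>2 M] by (auto simp: S_def)
    from U[OF cc this] show "N a h \<le> C * coeff_series \<alpha>1 \<alpha>2 \<delta>1 \<delta>2"
      "integrable sq (\<lambda>z. \<bar>Psi \<alpha>1 \<alpha>2 (fst h) (snd h) z\<bar> powr p)"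
      by (auto simp: N_def)
  qed
  have N0: "0 \<le> N a h" for a h unfolding N_def by (intro integral_nonneg_AE) auto
  have bdd: "bdd_above ((\<lambda>h. N a h powr (1 / p)) ` S \<delta>1 \<delta>2)"
    if cc: "cosine_class p f0 a" and \<delta>: "0 < \<delta>1" "0 < \<delta>2" for f0 a \<delta>1 \<delta>2
    using Nle[OF cc \<delta>] N0 p
    by (intro bdd_aboveI[of _ "(C * cosine_class.coeff_series p a \<alpha>1 \<alpha>2 \<delta>1 \<delta>2) powr (1 / p)"]) (auto intro!: powr_mono2)
  show ?thesis
  proof (rule that[of "max C K"])
    show "max C K > 0" using C by simp
  next
    fix f f0 a and \<delta>1 \<delta>2 :: real
    assume f: "f \<in> M_class p" "cosine_class p f0 a" "AE z in lborel. f z = f0 z"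
      and \<delta>: "0 < \<delta>1" "\<delta>1 \<le> 1" "0 < \<delta>2" "\<delta>2 \<le> (1::real)"
    interpret cosine_class p f0 a by fact
    define \<omega> where "\<omega> = mixed_modulus p \<alpha>1 \<alpha>2 f \<delta>1 \<delta>2"
    have \<omega>: "\<omega> = (SUP h\<in>S \<delta>1 \<delta>2. N a h powr (1 / p))" unfolding \<omega>_def by (rule mm[OF f])
    have ne: "(0, 0) \<in> S \<delta>1 \<delta>2" using \<delta> by (simp add: S_def)
    have up: "N a h powr (1 / p) \<le> \<omega>" if "h \<in> S \<delta>1 \<delta>2" for h
      unfolding \<omega> by (rule cSUP_upper[OF that bdd[OF f(2) \<delta>(1,3)]])
    have \<omega>0: "0 \<le> \<omega>" using up[OF ne] powr_ge_zero order_trans by blast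
    have W0: "0 \<le> coeff_series \<alpha>1 \<alpha>2 \<delta>1 \<delta>2" using coeff_sum_le_coeff_series[OF \<alpha>, of \<delta>1 \<delta>2 0] \<delta> by (simp add: coeff_sum_def)
    have 1: "\<omega> powr p \<le> C * coeff_series \<alpha>1 \<alpha>2 \<delta>1 \<delta>2"
    proof -
      have "\<omega> \<le> (C * coeff_series \<alpha>1 \<alpha>2 \<delta>1 \<delta>2) powr (1 / p)" unfolding \<omega>
        using ne p N0 by (intro cSUP_least powr_mono2 Nle[OF f(2) \<delta>(1,3)]) auto
      then have "\<omega> powr p \<le> ((C * coeff_series \<alpha>1 \<alpha>2 \<delta>1 \<delta>2) powr (1 / p)) powr p"
        using \<omega>0 p by (intro powr_mono2) auto
      also have "\<dots> = C * coeff_series \<alpha>1 \<alpha>2 \<delta>1 \<delta>2" using p C W0 by (simp add: powr_powr)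
      finally show ?thesis .
    qed
    have 2: "coeff_series \<alpha>1 \<alpha>2 \<delta>1 \<delta>2 \<le> K * \<omega> powr p"
    proof -
      have "N a h \<le> \<omega> powr p" if "h \<in> S \<delta>1 \<delta>2" for h
      proof -
        have "N a h = (N a h powr (1 / p)) powr p" using p N0 by (simp add: powr_powr)
        also have "\<dots> \<le> \<omega> powr p" using up[OF that] p by (intro powr_mono2) auto
        finally show ?thesis .
      qed
      then have "coeff_sum \<alpha>1 \<alpha>2 \<delta>1 \<delta>2 M \<le> K * \<omega> powr p" for M
        using Nint[OF f(2) \<delta>(1,3)] by (intro L[OF f(2) \<delta>]) (auto simp: S_def N_def)
      then show ?thesis unfolding coeff_series_def by (intro cSUP_least) auto
    qed
    have "C * coeff_series \<alpha>1 \<alpha>2 \<delta>1 \<delta>2 \<le> max C K * coeff_series \<alpha>1 \<alpha>2 \<delta>1 \<delta>2" using W0 by (intro mult_right_mono) auto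
    moreover have "K * \<omega> powr p \<le> max C K * \<omega> powr p" by (intro mult_right_mono) auto
    ultimately show "0 \<le> mixed_modulus p \<alpha>1 \<alpha>2 f \<delta>1 \<delta>2 \<and>
      mixed_modulus p \<alpha>1 \<alpha>2 f \<delta>1 \<delta>2 powr p \<le> max C K * coeff_series \<alpha>1 \<alpha>2 \<delta>1 \<delta>2 \<and>
      coeff_series \<alpha>1 \<alpha>2 \<delta>1 \<delta>2 \<le> max C K * mixed_modulus p \<alpha>1 \<alpha>2 f \<delta>1 \<delta>2 powr p"
      using 1 2 \<omega>0 unfolding \<omega>_def[symmetric] by linarith
  next
    fix f f0 a and \<delta>1 \<delta>2 \<delta>1' \<delta>2' :: real
    assume f: "f \<in> M_class p" "cosine_class p f0 a" "AE z in lborel. f z = f0 z"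
      and \<delta>: "0 < \<delta>1" "\<delta>1 \<le> \<delta>1'" "\<delta>1' \<le> (1::real)" "0 < \<delta>2" "\<delta>2 \<le> \<delta>2'" "\<delta>2' \<le> (1::real)"
    have "(0, 0) \<in> S \<delta>1 \<delta>2" "S \<delta>1 \<delta>2 \<subseteq> S \<delta>1' \<delta>2'" using \<delta> by (auto simp: S_def)
    then show "mixed_modulus p \<alpha>1 \<alpha>2 f \<delta>1 \<delta>2 \<le> mixed_modulus p \<alpha>1 \<alpha>2 f \<delta>1' \<delta>2'"
      unfolding mm[OF f] using \<delta> by (intro cSUP_subset_mono bdd[OF f(2)]) auto
  qed
qed

section \<open>Integration over the steps\<close>

text \<open>If k \<delta> \<ge> 1 the cutoff is simply bounded by 1. Otherwise split at t = 1 / k: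
  below, the cutoff is (k t) powr b and b > a gives convergence at 0; above, a > 0 gives convergence
  at infinity. Both parts are multiples of k powr a, which equals \<delta> powr (- a) times the
  cutoff of order a.\<close>

lemma nn_integral_cutoff_upper:
  fixes a b \<delta> :: real
  assumes a: "0 < a" "a < b" and \<delta>: "0 < \<delta>" and k: "1 \<le> k"
  shows "(\<integral>\<^sup>+t. ennreal (t powr (- a - 1)) * indicator {\<delta>..1} t * ennreal (cutoff b t k) \<partial>lborel)
    \<le> ennreal ((1 / a + 1 / (b - a)) * (\<delta> powr (- a) * cutoff a \<delta> k))"
proof -
  have tail: "(\<integral>\<^sup>+t. ennreal (t powr (- a - 1)) * indicator {s..} t \<partial>lborel) = ennreal (s powr (- a) / a)" if "0 < s" for s
  proof -
    have "((\<lambda>x. x powr (- a - 1)) has_integral - (s powr ((- a - 1) + 1)) / ((- a - 1) + 1)) {s..}"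
      using a that by (intro has_integral_powr_to_inf) auto
    from nn_integral_has_integral_lebesgue'[OF _ this] show ?thesis by simp
  qed
  show ?thesis
  proof (cases "1 \<le> real k * \<delta>")
    case True
    have "(\<integral>\<^sup>+t. ennreal (t powr (- a - 1)) * indicator {\<delta>..1} t * ennreal (cutoff b t k) \<partial>lborel)
      \<le> (\<integral>\<^sup>+t. ennreal (t powr (- a - 1)) * indicator {\<delta>..} t \<partial>lborel)"
    proof (intro nn_integral_mono)
      fix t
      have "cutoff b t k \<le> 1" if "\<delta> \<le> t" using that a \<delta> by (intro cutoff_le_1) auto
      then show "ennreal (t powr (- a - 1)) * indicator {\<delta>..1} t * ennreal (cutoff b t k) \<le> ennreal (t powr (- a - 1)) * indicator {\<delta>..} t"
        by (auto simp: indicator_def ennreal_mult[symmetric] mult_left_le intro!: ennreal_leI)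
    qed
    also have "\<dots> = ennreal (\<delta> powr (- a) / a)" by (rule tail[OF \<delta>])
    also have "\<dots> \<le> ennreal ((1 / a + 1 / (b - a)) * (\<delta> powr (- a) * cutoff a \<delta> k))"
      using True a by (intro ennreal_leI) (simp add: cutoff_def distrib_right)
    finally show ?thesis .
  next
    case False
    have k0: "0 < real k" using k by simp
    have "(\<integral>\<^sup>+t. ennreal (t powr (- a - 1)) * indicator {\<delta>..1} t * ennreal (cutoff b t k) \<partial>lborel)
      \<le> (\<integral>\<^sup>+t. ennreal (real k powr b * t powr (b - a - 1)) * indicator {0..1 / real k} t
          + ennreal (t powr (- a - 1)) * indicator {1 / real k..} t \<partial>lborel)"
    proof (intro nn_integral_mono)
      fix t
      show "ennreal (t powr (- a - 1)) * indicator {\<delta>..1} t * ennreal (cutoff b t k)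
        \<le> ennreal (real k powr b * t powr (b - a - 1)) * indicator {0..1 / real k} t + ennreal (t powr (- a - 1)) * indicator {1 / real k..} t"
      proof (cases "\<delta> \<le> t")
        case t: True
        then have t0: "0 < t" using \<delta> by simp
        show ?thesis
        proof (cases "t \<le> 1 / real k")
          case True
          then have kt: "real k * t \<le> 1" using k0 by (simp add: field_simps)
          have "t powr (- a - 1) * cutoff b t k = t powr (- a - 1) * (real k powr b * t powr b)"
            using kt by (simp add: cutoff_def powr_mult)
          also have "\<dots> = real k powr b * t powr (b - a - 1)"
          proof -
            have "t powr (- a - 1) * t powr b = t powr (b - a - 1)"
              unfolding powr_add[symmetric] by (simp add: algebra_simps)
            then show ?thesis by (simp add: mult_ac)
          qed
          finally have eq: "t powr (- a - 1) * cutoff b t k = real k powr b * t powr (b - a - 1)" .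
          have "ennreal (t powr (- a - 1)) * indicator {\<delta>..1} t * ennreal (cutoff b t k) \<le> ennreal (t powr (- a - 1) * cutoff b t k)"
            by (auto simp: indicator_def ennreal_mult)
          then show ?thesis unfolding eq using True t0 by (auto intro: order_trans add_increasing2)
        next
          case False
          have "cutoff b t k \<le> 1" using t0 a by (intro cutoff_le_1) auto
          then have "ennreal (t powr (- a - 1)) * indicator {\<delta>..1} t * ennreal (cutoff b t k) \<le> ennreal (t powr (- a - 1))"
            by (auto simp: indicator_def ennreal_mult[symmetric] mult_left_le intro!: ennreal_leI)
          then show ?thesis using False by (auto intro: order_trans add_increasing)
        qed
      qed simp
    qed
    also have "\<dots> = (\<integral>\<^sup>+t. ennreal (real k powr b * t powr (b - a - 1)) * indicator {0..1 / real k} t \<partial>lborel)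
        + (\<integral>\<^sup>+t. ennreal (t powr (- a - 1)) * indicator {1 / real k..} t \<partial>lborel)"
      by (rule nn_integral_add) measurable
    also have "(\<integral>\<^sup>+t. ennreal (real k powr b * t powr (b - a - 1)) * indicator {0..1 / real k} t \<partial>lborel)
        = ennreal (real k powr b * ((1 / real k) powr (b - a) / (b - a)))"
    proof -
      have "((\<lambda>t. real k powr b * t powr (b - a - 1)) has_integral (real k powr b * ((1 / real k) powr ((b - a - 1) + 1) / ((b - a - 1) + 1)))) {0..1 / real k}"
        using a by (intro has_integral_mult_right has_integral_powr_from_0) auto
      from nn_integral_has_integral_lebesgue'[OF _ this] show ?thesis by simp
    qed
    also have "(\<integral>\<^sup>+t. ennreal (t powr (- a - 1)) * indicator {1 / real k..} t \<partial>lborel) = ennreal ((1 / real k) powr (- a) / a)"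
      using k0 by (intro tail) auto
    also have "real k powr b * ((1 / real k) powr (b - a) / (b - a)) = real k powr a / (b - a)"
      using k0 by (simp add: powr_divide powr_diff)
    also have "(1 / real k) powr (- a) / a = real k powr a / a"
      using k0 by (simp add: powr_divide powr_minus)
    also have "ennreal (real k powr a / (b - a)) + ennreal (real k powr a / a) = ennreal ((1 / a + 1 / (b - a)) * real k powr a)"
      using a by (subst ennreal_plus[symmetric]) (auto simp: algebra_simps)
    also have "real k powr a = \<delta> powr (- a) * cutoff a \<delta> k"
      using False \<delta> by (simp add: cutoff_def powr_mult powr_minus field_simps)
    finally show ?thesis .
  qed
qed

text \<open>One dyadic interval [s, 2 s] inside [\<delta>, 1] carries enough mass: there k t \<ge> 1
  / 2, so the cutoff is at least 2 powr (- b), and the rest is of order s powr (- a).\<close>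

lemma nn_integral_cutoff_lower:
  fixes a b \<delta> :: real
  assumes a: "0 < a" "0 < b" and \<delta>: "0 < \<delta>" "\<delta> \<le> 1 / 2" and k: "1 \<le> k"
  shows "ennreal (2 powr (- a - 1 - b) * (\<delta> powr (- a) * cutoff a \<delta> k))
    \<le> (\<integral>\<^sup>+t. ennreal (t powr (- a - 1)) * indicator {\<delta>..1} t * ennreal (cutoff b t k) \<partial>lborel)"
proof -
  have k0: "1 \<le> real k" using k by simp
  \<comment> \<open>The smallest admissible s with k s \<ge> 1 / 2. The assumptions \<delta> \<le> 1
    / 2 and k \<ge> 1 keep 2 s \<le> 1.\<close>
  define s where "s = max \<delta> (1 / (2 * real k))"
  have s: "0 < s" "\<delta> \<le> s" "1 / (2 * real k) \<le> s" using \<delta> by (auto simp: s_def)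
  have s1: "2 * s \<le> 1" unfolding s_def using \<delta> k0 by (auto simp: max_def field_simps)
  define v where "v = (2 * s) powr (- a - 1) * (1 / 2) powr b"
  have "2 powr (- a - 1 - b) * (\<delta> powr (- a) * cutoff a \<delta> k) \<le> v * s"
  proof -
    have "min 1 (real k * \<delta>) * s \<le> \<delta>"
    proof (cases "\<delta> \<le> 1 / (2 * real k)")
      case True
      then have "s = 1 / (2 * real k)" by (simp add: s_def)
      moreover have "min 1 (real k * \<delta>) * (1 / (2 * real k)) \<le> (real k * \<delta>) * (1 / (2 * real k))"
        by (intro mult_right_mono) auto
      ultimately show ?thesis using k0 \<delta> by simp
    next
      case False
      then have "s = \<delta>" by (simp add: s_def)
      then show ?thesis using \<delta> by (simp add: mult_left_le_one_le)
    qed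
    then have "min 1 (real k * \<delta>) \<le> \<delta> / s" using s by (simp add: field_simps)
    then have "cutoff a \<delta> k \<le> (\<delta> / s) powr a" unfolding cutoff_def using a \<delta> by (intro powr_mono2) auto
    also have "\<dots> = \<delta> powr a * s powr (- a)" using s \<delta> by (simp add: powr_divide powr_minus_divide)
    finally have "\<delta> powr (- a) * cutoff a \<delta> k \<le> \<delta> powr (- a) * (\<delta> powr a * s powr (- a))"
      by (intro mult_left_mono) auto
    also have "\<dots> = s powr (- a)" using \<delta> by (simp add: powr_minus)
    finally have "2 powr (- a - 1 - b) * (\<delta> powr (- a) * cutoff a \<delta> k) \<le> 2 powr (- a - 1 - b) * s powr (- a)"
      by (intro mult_left_mono) auto
    also have "\<dots> = v * s"
    proof -
      have "(1 / 2 :: real) powr b = 2 powr (- b)" by (simp add: powr_divide powr_minus_divide)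
      then have "v * s = (2 powr (- a - 1) * 2 powr (- b)) * (s powr (- a - 1) * s powr 1)"
        unfolding v_def using s by (simp add: powr_mult)
      also have "2 powr (- a - 1) * 2 powr (- b) = (2 :: real) powr (- a - 1 - b)" by (simp flip: powr_add)
      also have "s powr (- a - 1) * s powr 1 = s powr (- a)" by (subst powr_add[symmetric]) simp
      finally show ?thesis by simp
    qed
    finally show ?thesis .
  qed
  then have "ennreal (2 powr (- a - 1 - b) * (\<delta> powr (- a) * cutoff a \<delta> k)) \<le> ennreal (v * s)" by (rule ennreal_leI)
  also have "ennreal (v * s) = (\<integral>\<^sup>+t. ennreal v * indicator {s..2 * s} t \<partial>lborel)"
    using s by (subst nn_integral_cmult_indicator) (auto simp: ennreal_mult'[symmetric] v_def)
  also have "\<dots> \<le> (\<integral>\<^sup>+t. ennreal (t powr (- a - 1)) * indicator {\<delta>..1} t * ennreal (cutoff b t k) \<partial>lborel)"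
  proof (intro nn_integral_mono)
    fix t
    show "ennreal v * indicator {s..2 * s} t \<le> ennreal (t powr (- a - 1)) * indicator {\<delta>..1} t * ennreal (cutoff b t k)"
    proof (cases "t \<in> {s..2 * s}")
      case True
      then have t: "0 < t" "t \<in> {\<delta>..1}" using s s1 by auto
      have "1 / 2 \<le> real k * t"
      proof -
        have "1 / 2 = real k * (1 / (2 * real k))" using k0 by simp
        also have "\<dots> \<le> real k * t" using True s k0 by (intro mult_left_mono) auto
        finally show ?thesis .
      qed
      then have "(1 / 2) powr b \<le> cutoff b t k" unfolding cutoff_def using a by (intro powr_mono2) auto
      moreover have "(2 * s) powr (- a - 1) \<le> t powr (- a - 1)" using True t a by (intro powr_mono2') auto
      ultimately have "v \<le> t powr (- a - 1) * cutoff b t k" unfolding v_def by (intro mult_mono) auto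
      then show ?thesis using True t by (simp add: ennreal_mult[symmetric] ennreal_leI)
    qed simp
  qed
  finally show ?thesis .
qed

lemma cutoff_powr: "0 < p \<Longrightarrow> cutoff \<alpha> \<delta> k powr p = cutoff (\<alpha> * p) \<delta> k"
  unfolding cutoff_def by (simp add: powr_powr)

lemma cutoff_measurable [measurable]: "(\<lambda>t. cutoff \<alpha> t k) \<in> borel_measurable borel"
  unfolding cutoff_def by measurable

text \<open>The exponent - a - 1 already contains the factor 1 / t of the measure dt / t.\<close>

definition power_window :: "real \<Rightarrow> real \<Rightarrow> real \<Rightarrow> ennreal" where
  "power_window a \<delta> t = ennreal (t powr (- a - 1)) * indicator {\<delta>..1} t"

lemma power_window_measurable [measurable]: "power_window a \<delta> \<in> borel_measurable borel"
  unfolding power_window_def[abs_def] by measurable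

text \<open>Monotonicity of g supplies both measurability and boundedness, hence integrability
  against the power weight on an interval away from 0.\<close>

lemma mono_weight_integral:
  fixes g :: "real \<Rightarrow> real"
  assumes \<delta>: "0 < \<delta>" "\<delta> \<le> 1" and g: "\<And>t. t \<in> {\<delta>..1} \<Longrightarrow> 0 \<le> g t"
    and mono: "\<And>s t. \<delta> \<le> s \<Longrightarrow> s \<le> t \<Longrightarrow> t \<le> 1 \<Longrightarrow> g s \<le> g t"
  shows "set_integrable lborel {\<delta>..1} (\<lambda>t. t powr (- a - 1) * g t)"
    and "ennreal (LBINT t:{\<delta>..1}. t powr (- a - 1) * g t) = (\<integral>\<^sup>+t. power_window a \<delta> t * ennreal (g t) \<partial>lborel)"
proof -
  \<comment> \<open>Clamping the argument extends g to a function monotone on the whole line, which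
    is Borel, without changing it on the interval.\<close>
  define g' where "g' t = g (max \<delta> (min t 1))" for t
  have "mono g'" unfolding g'_def using \<delta> by (intro monoI mono) auto
  then have [measurable]: "g' \<in> borel_measurable borel" by (rule borel_measurable_mono)
  have g'_eq: "g' t = g t" if "t \<in> {\<delta>..1}" for t using that by (simp add: g'_def max_def min_def)
  have g'b: "0 \<le> g' t" "g' t \<le> g 1" for t
    unfolding g'_def using \<delta> by (auto intro!: g mono)
  define B where "B = max (\<delta> powr (- a - 1)) 1 * g 1"
  have bd: "norm (indicator {\<delta>..1} t *\<^sub>R (t powr (- a - 1) * g' t)) \<le> norm (indicator {\<delta>..1} t *\<^sub>R B)" for t
  proof (cases "t \<in> {\<delta>..1}")
    case True
    have "t powr (- a - 1) \<le> max (\<delta> powr (- a - 1)) 1"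
    proof (cases "0 \<le> - a - 1")
      case True
      then have "t powr (- a - 1) \<le> 1 powr (- a - 1)" using \<open>t \<in> _\<close> \<delta> by (intro powr_mono2) auto
      then show ?thesis by simp
    next
      case False
      then have "t powr (- a - 1) \<le> \<delta> powr (- a - 1)" using \<open>t \<in> _\<close> \<delta> by (intro powr_mono2') auto
      then show ?thesis by simp
    qed
    then have "t powr (- a - 1) * g' t \<le> B" unfolding B_def using g'b[of t] by (intro mult_mono) auto
    then show ?thesis using True g'b[of t] by simp
  qed simp
  have int': "set_integrable lborel {\<delta>..1} (\<lambda>t. t powr (- a - 1) * g' t)"
    unfolding set_integrable_def
  proof (rule Bochner_Integration.integrable_bound[where f = "\<lambda>t. indicator {\<delta>..1} t *\<^sub>R B"])
    show "integrable lborel (\<lambda>t. indicator {\<delta>..1} t *\<^sub>R B)"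
      using \<delta> by (intro integrable_scaleR_left integrable_real_indicator) auto
  qed (use bd in auto)
  have eq: "indicator {\<delta>..1} t *\<^sub>R (t powr (- a - 1) * g' t) = indicator {\<delta>..1} t *\<^sub>R (t powr (- a - 1) * g t)" for t
    by (auto simp: indicator_def g'_eq)
  show int: "set_integrable lborel {\<delta>..1} (\<lambda>t. t powr (- a - 1) * g t)"
    using int' unfolding set_integrable_def eq .
  have "(\<integral>\<^sup>+t. ennreal (indicator {\<delta>..1} t *\<^sub>R (t powr (- a - 1) * g t)) \<partial>lborel)
     = ennreal (LBINT t:{\<delta>..1}. t powr (- a - 1) * g t)"
    unfolding set_lebesgue_integral_def
    using int g unfolding set_integrable_def by (intro nn_integral_eq_integral) (auto simp: indicator_def)
  also have "(\<integral>\<^sup>+t. ennreal (indicator {\<delta>..1} t *\<^sub>R (t powr (- a - 1) * g t)) \<partial>lborel)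
     = (\<integral>\<^sup>+t. power_window a \<delta> t * ennreal (g t) \<partial>lborel)"
    using g by (intro nn_integral_cong) (auto simp: power_window_def indicator_def ennreal_mult)
  finally show "ennreal (LBINT t:{\<delta>..1}. t powr (- a - 1) * g t) = (\<integral>\<^sup>+t. power_window a \<delta> t * ennreal (g t) \<partial>lborel)" by simp
qed

section \<open>Weighted integrals of the coefficient series\<close>

context cosine_class begin

definition coeff_weight :: "nat \<Rightarrow> nat \<Rightarrow> real" where
  "coeff_weight k l = (real k * real l) powr (p - 2) * a k l powr p"

lemma coeff_weight_nonneg [simp]: "0 \<le> coeff_weight k l" by (simp add: coeff_weight_def)

lemma coeff_sum_eq: "coeff_sum \<alpha>1 \<alpha>2 \<delta>1 \<delta>2 M = (\<Sum>k=1..M. \<Sum>l=1..M. coeff_weight k l * (cutoff (\<alpha>1 * p) \<delta>1 k * cutoff (\<alpha>2 * p) \<delta>2 l))"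
  unfolding coeff_sum_def coeff_weight_def using p by (intro sum.cong refl) (simp add: powr_mult cutoff_powr mult_ac)

text \<open>For each frequency pair the dependence on t1 and t2 is a product of cutoffs, so the
  double integral factors and the one-variable bounds can be inserted term by term.\<close>

lemma nn_integral_coeff_sum:
  "(\<integral>\<^sup>+t1. power_window a1 \<delta>1 t1 * (\<integral>\<^sup>+t2. power_window a2 \<delta>2 t2 * ennreal (coeff_sum \<beta>1 \<beta>2 t1 t2 M) \<partial>lborel) \<partial>lborel)
   = (\<Sum>k=1..M. \<Sum>l=1..M. ennreal (coeff_weight k l) * ((\<integral>\<^sup>+t. power_window a1 \<delta>1 t * ennreal (cutoff (\<beta>1 * p) t k) \<partial>lborel)
        * (\<integral>\<^sup>+t. power_window a2 \<delta>2 t * ennreal (cutoff (\<beta>2 * p) t l) \<partial>lborel)))"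
proof -
  define J where "J l = (\<integral>\<^sup>+t. power_window a2 \<delta>2 t * ennreal (cutoff (\<beta>2 * p) t l) \<partial>lborel)" for l
  have W: "ennreal (coeff_sum \<beta>1 \<beta>2 t1 t2 M) = (\<Sum>k=1..M. \<Sum>l=1..M. (ennreal (coeff_weight k l) * ennreal (cutoff (\<beta>1 * p) t1 k)) * ennreal (cutoff (\<beta>2 * p) t2 l))" for t1 t2
    unfolding coeff_sum_eq by (simp add: ennreal_mult mult.assoc sum_nonneg flip: sum_ennreal)
  have inner: "(\<integral>\<^sup>+t2. power_window a2 \<delta>2 t2 * ennreal (coeff_sum \<beta>1 \<beta>2 t1 t2 M) \<partial>lborel)
     = (\<Sum>k=1..M. \<Sum>l=1..M. (ennreal (coeff_weight k l) * ennreal (cutoff (\<beta>1 * p) t1 k)) * J l)" for t1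
  proof -
    have "(\<integral>\<^sup>+t2. power_window a2 \<delta>2 t2 * ennreal (coeff_sum \<beta>1 \<beta>2 t1 t2 M) \<partial>lborel)
      = (\<integral>\<^sup>+t2. (\<Sum>k=1..M. \<Sum>l=1..M. (ennreal (coeff_weight k l) * ennreal (cutoff (\<beta>1 * p) t1 k)) * (power_window a2 \<delta>2 t2 * ennreal (cutoff (\<beta>2 * p) t2 l))) \<partial>lborel)"
      unfolding W by (simp add: sum_distrib_left mult_ac)
    also have "\<dots> = (\<Sum>k=1..M. \<Sum>l=1..M. (ennreal (coeff_weight k l) * ennreal (cutoff (\<beta>1 * p) t1 k)) * J l)"
      unfolding J_def by (simp add: nn_integral_sum nn_integral_cmult)
    finally show ?thesis .
  qed
  have "(\<integral>\<^sup>+t1. power_window a1 \<delta>1 t1 * (\<integral>\<^sup>+t2. power_window a2 \<delta>2 t2 * ennreal (coeff_sum \<beta>1 \<beta>2 t1 t2 M) \<partial>lborel) \<partial>lborel)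
    = (\<integral>\<^sup>+t1. (\<Sum>k=1..M. \<Sum>l=1..M. (ennreal (coeff_weight k l) * J l) * (power_window a1 \<delta>1 t1 * ennreal (cutoff (\<beta>1 * p) t1 k))) \<partial>lborel)"
    unfolding inner by (simp add: sum_distrib_left mult_ac)
  also have "\<dots> = (\<Sum>k=1..M. \<Sum>l=1..M. (ennreal (coeff_weight k l) * J l) * (\<integral>\<^sup>+t. power_window a1 \<delta>1 t * ennreal (cutoff (\<beta>1 * p) t k) \<partial>lborel))"
    by (simp add: nn_integral_sum nn_integral_cmult)
  finally show ?thesis unfolding J_def by (simp add: mult_ac)
qed

lemma nn_integral_coeff_sum_bounds:
  assumes \<alpha>: "0 < \<alpha>1" "\<alpha>1 < \<beta>1" "0 < \<alpha>2" "\<alpha>2 < \<beta>2" and \<delta>: "0 < \<delta>1" "\<delta>1 \<le> 1 / 2" "0 < \<delta>2" "\<delta>2 \<le> 1 / 2"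
  defines "N \<equiv> \<lambda>M. \<integral>\<^sup>+t1. power_window (\<alpha>1 * p) \<delta>1 t1 * (\<integral>\<^sup>+t2. power_window (\<alpha>2 * p) \<delta>2 t2 * ennreal (coeff_sum \<beta>1 \<beta>2 t1 t2 M) \<partial>lborel) \<partial>lborel"
  shows "N M \<le> ennreal ((1 / (\<alpha>1 * p) + 1 / (\<beta>1 * p - \<alpha>1 * p)) * (1 / (\<alpha>2 * p) + 1 / (\<beta>2 * p - \<alpha>2 * p)) *
            (\<delta>1 powr (- (\<alpha>1 * p)) * \<delta>2 powr (- (\<alpha>2 * p)) * coeff_sum \<alpha>1 \<alpha>2 \<delta>1 \<delta>2 M))" (is ?U)
    and "ennreal (2 powr (- (\<alpha>1 * p) - 1 - \<beta>1 * p) * 2 powr (- (\<alpha>2 * p) - 1 - \<beta>2 * p) *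
            (\<delta>1 powr (- (\<alpha>1 * p)) * \<delta>2 powr (- (\<alpha>2 * p)) * coeff_sum \<alpha>1 \<alpha>2 \<delta>1 \<delta>2 M)) \<le> N M" (is ?L)
proof -
  have ab: "0 < \<alpha>1 * p" "\<alpha>1 * p < \<beta>1 * p" "0 < \<alpha>2 * p" "\<alpha>2 * p < \<beta>2 * p" "0 < \<beta>1 * p" "0 < \<beta>2 * p" using \<alpha> p by auto
  have ex: "(\<Sum>k=1..M. \<Sum>l=1..M. ennreal (coeff_weight k l) * (ennreal (c1 * (d1 * cutoff (\<alpha>1 * p) \<delta>1 k)) * ennreal (c2 * (d2 * cutoff (\<alpha>2 * p) \<delta>2 l))))
    = ennreal (c1 * c2 * (d1 * d2 * coeff_sum \<alpha>1 \<alpha>2 \<delta>1 \<delta>2 M))" if "0 \<le> c1" "0 \<le> c2" "0 \<le> d1" "0 \<le> d2" for c1 c2 d1 d2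
  proof -
    have "(\<Sum>k=1..M. \<Sum>l=1..M. ennreal (coeff_weight k l) * (ennreal (c1 * (d1 * cutoff (\<alpha>1 * p) \<delta>1 k)) * ennreal (c2 * (d2 * cutoff (\<alpha>2 * p) \<delta>2 l))))
      = ennreal (\<Sum>k=1..M. \<Sum>l=1..M. coeff_weight k l * ((c1 * (d1 * cutoff (\<alpha>1 * p) \<delta>1 k)) * (c2 * (d2 * cutoff (\<alpha>2 * p) \<delta>2 l))))"
      using that by (simp add: ennreal_mult sum_nonneg flip: sum_ennreal)
    then show ?thesis unfolding coeff_sum_eq by (simp add: sum_distrib_left mult_ac)
  qed
  have cp: "0 \<le> 1 / (\<alpha>1 * p) + 1 / (\<beta>1 * p - \<alpha>1 * p)" "0 \<le> 1 / (\<alpha>2 * p) + 1 / (\<beta>2 * p - \<alpha>2 * p)"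
    using ab by (auto intro!: add_nonneg_nonneg)
  note u1 = nn_integral_cutoff_upper[OF ab(1,2) \<delta>(1), folded power_window_def]
    and u2 = nn_integral_cutoff_upper[OF ab(3,4) \<delta>(3), folded power_window_def]
    and l1 = nn_integral_cutoff_lower[OF ab(1,5) \<delta>(1,2), folded power_window_def]
    and l2 = nn_integral_cutoff_lower[OF ab(3,6) \<delta>(3,4), folded power_window_def]
  show ?U unfolding N_def nn_integral_coeff_sum ex[OF cp powr_ge_zero powr_ge_zero, symmetric]
    by (intro sum_mono mult_left_mono mult_mono u1 u2) auto
  show ?L unfolding N_def nn_integral_coeff_sum ex[OF powr_ge_zero powr_ge_zero powr_ge_zero powr_ge_zero, symmetric]
    by (intro sum_mono mult_left_mono mult_mono l1 l2) auto
qed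

lemma coeff_sum_measurable: "(\<lambda>t2. coeff_sum \<beta>1 \<beta>2 t1 t2 M) \<in> borel_measurable borel"
  unfolding coeff_sum_eq by measurable

lemma nn_integral_coeff_sum_measurable:
  "(\<lambda>t1. \<integral>\<^sup>+t2. power_window a2 \<delta>2 t2 * ennreal (coeff_sum \<beta>1 \<beta>2 t1 t2 M) \<partial>lborel) \<in> borel_measurable borel"
proof -
  have "(\<lambda>t1. \<integral>\<^sup>+t2. power_window a2 \<delta>2 t2 * ennreal (coeff_sum \<beta>1 \<beta>2 t1 t2 M) \<partial>lborel) \<in> borel_measurable lborel"
    unfolding coeff_sum_eq by measurable
  then show ?thesis by simp
qed

lemma nn_integral_coeff_sum_scale:
  assumes c: "0 \<le> c"
  shows "(\<integral>\<^sup>+t1. power_window a1 \<delta>1 t1 * (\<integral>\<^sup>+t2. power_window a2 \<delta>2 t2 * ennreal (c * coeff_sum \<beta>1 \<beta>2 t1 t2 M) \<partial>lborel) \<partial>lborel)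
    = ennreal c * (\<integral>\<^sup>+t1. power_window a1 \<delta>1 t1 * (\<integral>\<^sup>+t2. power_window a2 \<delta>2 t2 * ennreal (coeff_sum \<beta>1 \<beta>2 t1 t2 M) \<partial>lborel) \<partial>lborel)"
proof -
  note [measurable] = coeff_sum_measurable nn_integral_coeff_sum_measurable
  have "(\<integral>\<^sup>+t2. power_window a2 \<delta>2 t2 * ennreal (c * coeff_sum \<beta>1 \<beta>2 t1 t2 M) \<partial>lborel)
    = ennreal c * (\<integral>\<^sup>+t2. power_window a2 \<delta>2 t2 * ennreal (coeff_sum \<beta>1 \<beta>2 t1 t2 M) \<partial>lborel)" for t1
    using c by (subst nn_integral_cmult[symmetric]) (simp_all add: ennreal_mult' mult.left_commute)
  then show ?thesis
    by (subst nn_integral_cmult[symmetric]) (simp_all add: mult.left_commute)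
qed

text \<open>Monotone convergence in M, first inside and then outside. This asks for measurability of
  the finite sums only, and convergence to \<open>coeff_series\<close> is used only for steps inside
  the windows.\<close>

lemma nn_integral_coeff_series_le:
  assumes \<beta>: "0 < \<beta>1" "0 < \<beta>2" and \<delta>: "0 < \<delta>1" "0 < \<delta>2" and c: "0 \<le> c"
    and B: "\<And>M. (\<integral>\<^sup>+t1. power_window a1 \<delta>1 t1 * (\<integral>\<^sup>+t2. power_window a2 \<delta>2 t2 * ennreal (coeff_sum \<beta>1 \<beta>2 t1 t2 M) \<partial>lborel) \<partial>lborel) \<le> B"
  shows "(\<integral>\<^sup>+t1. power_window a1 \<delta>1 t1 * (\<integral>\<^sup>+t2. power_window a2 \<delta>2 t2 * ennreal (c * coeff_series \<beta>1 \<beta>2 t1 t2) \<partial>lborel) \<partial>lborel) \<le> ennreal c * B"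
proof -
  define I where "I M t1 = (\<integral>\<^sup>+t2. power_window a2 \<delta>2 t2 * ennreal (c * coeff_sum \<beta>1 \<beta>2 t1 t2 M) \<partial>lborel)" for M t1
  note [measurable] = coeff_sum_measurable
  have [measurable]: "I M \<in> borel_measurable borel" for M
    using nn_integral_coeff_sum_measurable[of a2 \<delta>2 \<beta>1 \<beta>2 M] c unfolding I_def[abs_def]
    by (simp add: ennreal_mult' mult.left_commute[of _ "ennreal c"] nn_integral_cmult)
  have inner: "(\<integral>\<^sup>+t2. power_window a2 \<delta>2 t2 * ennreal (c * coeff_series \<beta>1 \<beta>2 t1 t2) \<partial>lborel) = (SUP M. I M t1)" if t1: "\<delta>1 \<le> t1" for t1
  proof -
    have inc: "incseq (\<lambda>M t2. power_window a2 \<delta>2 t2 * ennreal (c * coeff_sum \<beta>1 \<beta>2 t1 t2 M))"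
      by (auto simp: incseq_def le_fun_def intro!: mult_left_mono ennreal_leI coeff_sum_mono c)
    have "power_window a2 \<delta>2 t2 * ennreal (c * coeff_series \<beta>1 \<beta>2 t1 t2) = (SUP M. power_window a2 \<delta>2 t2 * ennreal (c * coeff_sum \<beta>1 \<beta>2 t1 t2 M))" for t2
    proof (cases "\<delta>2 \<le> t2")
      case True
      have "power_window a2 \<delta>2 t2 < top" by (auto simp: power_window_def indicator_def)
      moreover have "(\<lambda>M. ennreal (c * coeff_sum \<beta>1 \<beta>2 t1 t2 M)) \<longlonglongrightarrow> ennreal (c * coeff_series \<beta>1 \<beta>2 t1 t2)"
        using t1 True \<delta> \<beta> by (intro tendsto_ennrealI tendsto_mult_left coeff_sum_tendsto_coeff_series) auto
      ultimately have "(\<lambda>M. power_window a2 \<delta>2 t2 * ennreal (c * coeff_sum \<beta>1 \<beta>2 t1 t2 M)) \<longlonglongrightarrow> power_window a2 \<delta>2 t2 * ennreal (c * coeff_series \<beta>1 \<beta>2 t1 t2)"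
        by (rule ennreal_tendsto_cmult)
      moreover have "(\<lambda>M. power_window a2 \<delta>2 t2 * ennreal (c * coeff_sum \<beta>1 \<beta>2 t1 t2 M)) \<longlonglongrightarrow> (SUP M. power_window a2 \<delta>2 t2 * ennreal (c * coeff_sum \<beta>1 \<beta>2 t1 t2 M))"
        using inc by (intro LIMSEQ_SUP) (auto simp: incseq_def le_fun_def)
      ultimately show ?thesis by (rule LIMSEQ_unique)
    qed (simp add: power_window_def)
    then show ?thesis unfolding I_def using inc
      by (simp add: nn_integral_monotone_convergence_SUP)
  qed
  have incI: "incseq (\<lambda>M t1. power_window a1 \<delta>1 t1 * I M t1)"
    unfolding I_def by (auto simp: incseq_def le_fun_def intro!: mult_left_mono nn_integral_mono ennreal_leI coeff_sum_mono c)
  have "(\<integral>\<^sup>+t1. power_window a1 \<delta>1 t1 * (\<integral>\<^sup>+t2. power_window a2 \<delta>2 t2 * ennreal (c * coeff_series \<beta>1 \<beta>2 t1 t2) \<partial>lborel) \<partial>lborel)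
    = (\<integral>\<^sup>+t1. (SUP M. power_window a1 \<delta>1 t1 * I M t1) \<partial>lborel)"
  proof (intro nn_integral_cong)
    fix t1
    show "power_window a1 \<delta>1 t1 * (\<integral>\<^sup>+t2. power_window a2 \<delta>2 t2 * ennreal (c * coeff_series \<beta>1 \<beta>2 t1 t2) \<partial>lborel) = (SUP M. power_window a1 \<delta>1 t1 * I M t1)"
    proof (cases "\<delta>1 \<le> t1")
      case True
      show ?thesis unfolding inner[OF True] by (simp add: SUP_mult_left_ennreal)
    qed (simp add: power_window_def)
  qed
  also have "\<dots> = (SUP M. \<integral>\<^sup>+t1. power_window a1 \<delta>1 t1 * I M t1 \<partial>lborel)"
    using incI by (intro nn_integral_monotone_convergence_SUP) auto
  also have "\<dots> \<le> ennreal c * B" unfolding I_def nn_integral_coeff_sum_scale[OF c] by (intro SUP_least mult_left_mono B) simp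
  finally show ?thesis .
qed

text \<open>Here g stands for the p-th power of the modulus of orders \<beta>1, \<beta>2. Its
  comparison with \<open>coeff_series\<close> is integrated as a nonnegative integral, where no
  integrability is at issue, and monotonicity identifies that integral with the iterated Lebesgue
  integral T.\<close>

lemma weighted_integral_equiv:
  fixes g :: "real \<Rightarrow> real \<Rightarrow> real"
  assumes \<alpha>: "0 < \<alpha>1" "\<alpha>1 < \<beta>1" "0 < \<alpha>2" "\<alpha>2 < \<beta>2" and \<delta>: "0 < \<delta>1" "\<delta>1 \<le> 1 / 2" "0 < \<delta>2" "\<delta>2 \<le> 1 / 2"
    and C: "0 < C"
    and g: "\<And>t1 t2. t1 \<in> {\<delta>1..1} \<Longrightarrow> t2 \<in> {\<delta>2..1} \<Longrightarrow>
      0 \<le> g t1 t2 \<and> g t1 t2 \<le> C * coeff_series \<beta>1 \<beta>2 t1 t2 \<and> coeff_series \<beta>1 \<beta>2 t1 t2 \<le> C * g t1 t2"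
    and mono: "\<And>s1 s2 t1 t2. \<delta>1 \<le> s1 \<Longrightarrow> s1 \<le> t1 \<Longrightarrow> t1 \<le> 1 \<Longrightarrow> \<delta>2 \<le> s2 \<Longrightarrow> s2 \<le> t2 \<Longrightarrow> t2 \<le> 1 \<Longrightarrow>
      g s1 s2 \<le> g t1 t2"
  defines "T \<equiv> LBINT t1:{\<delta>1..1}. t1 powr (- (\<alpha>1 * p) - 1) * (LBINT t2:{\<delta>2..1}. t2 powr (- (\<alpha>2 * p) - 1) * g t1 t2)"
    and "D \<equiv> \<delta>1 powr (- (\<alpha>1 * p)) * \<delta>2 powr (- (\<alpha>2 * p))"
  shows "0 \<le> T"
    and "T \<le> C * ((1 / (\<alpha>1 * p) + 1 / (\<beta>1 * p - \<alpha>1 * p)) * (1 / (\<alpha>2 * p) + 1 / (\<beta>2 * p - \<alpha>2 * p)) *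
      (D * coeff_series \<alpha>1 \<alpha>2 \<delta>1 \<delta>2))" (is "T \<le> C * (?U * _)")
    and "2 powr (- (\<alpha>1 * p) - 1 - \<beta>1 * p) * 2 powr (- (\<alpha>2 * p) - 1 - \<beta>2 * p) * (D * coeff_series \<alpha>1 \<alpha>2 \<delta>1 \<delta>2) \<le> C * T"
    (is "?L * _ \<le> _")
proof -
  have \<beta>: "0 < \<beta>1" "0 < \<beta>2" using \<alpha> by auto
  define Y where "Y t1 = (LBINT t2:{\<delta>2..1}. t2 powr (- (\<alpha>2 * p) - 1) * g t1 t2)" for t1
  have Yi: "set_integrable lborel {\<delta>2..1} (\<lambda>t2. t2 powr (- (\<alpha>2 * p) - 1) * g t1 t2)"
    and Y: "ennreal (Y t1) = (\<integral>\<^sup>+t2. power_window (\<alpha>2 * p) \<delta>2 t2 * ennreal (g t1 t2) \<partial>lborel)"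
    if "t1 \<in> {\<delta>1..1}" for t1
    unfolding Y_def using \<delta> that g mono by (intro mono_weight_integral; force)+
  have Y0: "0 \<le> Y t1" if "t1 \<in> {\<delta>1..1}" for t1
    unfolding Y_def set_lebesgue_integral_def using g that
    by (intro Bochner_Integration.integral_nonneg) (auto simp: indicator_def)
  have Ym: "Y s \<le> Y t" if "\<delta>1 \<le> s" "s \<le> t" "t \<le> 1" for s t
    unfolding Y_def using that by (intro set_integral_mono Yi mult_left_mono mono) auto
  have T0: "0 \<le> T"
    unfolding T_def Y_def[symmetric] set_lebesgue_integral_def[of _ "{\<delta>1..1}"] using Y0
    by (intro Bochner_Integration.integral_nonneg) (auto simp: indicator_def)
  then show "0 \<le> T" .
  have "ennreal T = (\<integral>\<^sup>+t1. power_window (\<alpha>1 * p) \<delta>1 t1 * ennreal (Y t1) \<partial>lborel)"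
    unfolding T_def Y_def[symmetric] using \<delta> Y0 Ym by (intro mono_weight_integral) auto
  also have "\<dots> = (\<integral>\<^sup>+t1. power_window (\<alpha>1 * p) \<delta>1 t1 * (\<integral>\<^sup>+t2. power_window (\<alpha>2 * p) \<delta>2 t2 * ennreal (g t1 t2) \<partial>lborel) \<partial>lborel)"
    by (intro nn_integral_cong) (auto simp: power_window_def Y indicator_def)
  finally have T: "ennreal T = (\<integral>\<^sup>+t1. power_window (\<alpha>1 * p) \<delta>1 t1 * (\<integral>\<^sup>+t2. power_window (\<alpha>2 * p) \<delta>2 t2 * ennreal (g t1 t2) \<partial>lborel) \<partial>lborel)" .
  have nest: "(\<integral>\<^sup>+t1. power_window (\<alpha>1 * p) \<delta>1 t1 * (\<integral>\<^sup>+t2. power_window (\<alpha>2 * p) \<delta>2 t2 * ennreal (u t1 t2) \<partial>lborel) \<partial>lborel)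
    \<le> (\<integral>\<^sup>+t1. power_window (\<alpha>1 * p) \<delta>1 t1 * (\<integral>\<^sup>+t2. power_window (\<alpha>2 * p) \<delta>2 t2 * ennreal (v t1 t2) \<partial>lborel) \<partial>lborel)"
    if uv: "\<And>t1 t2. t1 \<in> {\<delta>1..1} \<Longrightarrow> t2 \<in> {\<delta>2..1} \<Longrightarrow> u t1 t2 \<le> v t1 t2" for u v
  proof (rule nn_integral_mono)
    fix t1
    show "power_window (\<alpha>1 * p) \<delta>1 t1 * (\<integral>\<^sup>+t2. power_window (\<alpha>2 * p) \<delta>2 t2 * ennreal (u t1 t2) \<partial>lborel)
      \<le> power_window (\<alpha>1 * p) \<delta>1 t1 * (\<integral>\<^sup>+t2. power_window (\<alpha>2 * p) \<delta>2 t2 * ennreal (v t1 t2) \<partial>lborel)"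
    proof (cases "t1 \<in> {\<delta>1..1}")
      case True
      have "power_window (\<alpha>2 * p) \<delta>2 t2 * ennreal (u t1 t2) \<le> power_window (\<alpha>2 * p) \<delta>2 t2 * ennreal (v t1 t2)" for t2
        using uv[OF True, of t2] by (cases "t2 \<in> {\<delta>2..1}") (auto simp: power_window_def intro!: mult_left_mono ennreal_leI)
      then show ?thesis by (intro mult_left_mono[OF nn_integral_mono]) auto
    qed (simp add: power_window_def)
  qed
  have U0: "0 \<le> ?U" using \<alpha> p by (intro mult_nonneg_nonneg add_nonneg_nonneg) (auto simp: mult_right_mono)
  have W: "0 \<le> coeff_series \<alpha>1 \<alpha>2 \<delta>1 \<delta>2" "\<And>M. coeff_sum \<alpha>1 \<alpha>2 \<delta>1 \<delta>2 M \<le> coeff_series \<alpha>1 \<alpha>2 \<delta>1 \<delta>2"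
    using coeff_sum_le_coeff_series[of \<alpha>1 \<alpha>2 \<delta>1 \<delta>2] coeff_sum_le_coeff_series[of \<alpha>1 \<alpha>2 \<delta>1 \<delta>2 0] \<alpha> \<delta> by (auto simp: coeff_sum_def)
  have D0: "0 < D" using \<delta> by (simp add: D_def)
  have "ennreal T \<le> ennreal C * ennreal (?U * (D * coeff_series \<alpha>1 \<alpha>2 \<delta>1 \<delta>2))"
    unfolding T
  proof (rule order_trans[OF nest nn_integral_coeff_series_le[where c = C, OF \<beta> \<delta>(1,3)]])
    show "(\<integral>\<^sup>+t1. power_window (\<alpha>1 * p) \<delta>1 t1 * (\<integral>\<^sup>+t2. power_window (\<alpha>2 * p) \<delta>2 t2 * ennreal (coeff_sum \<beta>1 \<beta>2 t1 t2 M) \<partial>lborel) \<partial>lborel)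
      \<le> ennreal (?U * (D * coeff_series \<alpha>1 \<alpha>2 \<delta>1 \<delta>2))" for M
      using nn_integral_coeff_sum_bounds(1)[OF \<alpha> \<delta>, of M] W(2)[of M] U0 D0
      unfolding D_def by (elim order_trans) (intro ennreal_leI mult_left_mono, auto)
  qed (use g C in auto)
  then show "T \<le> C * (?U * (D * coeff_series \<alpha>1 \<alpha>2 \<delta>1 \<delta>2))"
    using C U0 D0 W(1) by (simp add: ennreal_mult'[symmetric] ennreal_le_iff)
  \<comment> \<open>The lower bound is integrated for finite sums, with 1 / C moved inside so that
    the pointwise comparison with g applies; M tends to infinity only afterwards.\<close>
  have "?L * (D * coeff_sum \<alpha>1 \<alpha>2 \<delta>1 \<delta>2 M) \<le> C * T" for M
  proof -
    have "ennreal (1 / C) * ennreal (?L * (D * coeff_sum \<alpha>1 \<alpha>2 \<delta>1 \<delta>2 M)) \<le> ennreal (1 / C) *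
      (\<integral>\<^sup>+t1. power_window (\<alpha>1 * p) \<delta>1 t1 * (\<integral>\<^sup>+t2. power_window (\<alpha>2 * p) \<delta>2 t2 * ennreal (coeff_sum \<beta>1 \<beta>2 t1 t2 M) \<partial>lborel) \<partial>lborel)"
      unfolding D_def by (intro mult_left_mono nn_integral_coeff_sum_bounds(2)[OF \<alpha> \<delta>]) simp
    also have "\<dots> \<le> ennreal T"
      unfolding T using C
    proof (subst nn_integral_coeff_sum_scale[symmetric], simp, intro nest)
      fix t1 t2 assume t: "t1 \<in> {\<delta>1..1}" "t2 \<in> {\<delta>2..1}"
      have "coeff_sum \<beta>1 \<beta>2 t1 t2 M \<le> C * g t1 t2"
        using t \<delta> g[OF t] coeff_sum_le_coeff_series[OF \<beta>, of t1 t2 M] by auto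
      then show "1 / C * coeff_sum \<beta>1 \<beta>2 t1 t2 M \<le> g t1 t2" using C by (simp add: field_simps)
    qed
    finally have "ennreal (1 / C * (?L * (D * coeff_sum \<alpha>1 \<alpha>2 \<delta>1 \<delta>2 M))) \<le> ennreal T"
      using C by (subst ennreal_mult') auto
    then have "1 / C * (?L * (D * coeff_sum \<alpha>1 \<alpha>2 \<delta>1 \<delta>2 M)) \<le> T" using T0 by (simp add: ennreal_le_iff)
    then show ?thesis using C by (simp add: field_simps)
  qed
  moreover have "(\<lambda>M. ?L * (D * coeff_sum \<alpha>1 \<alpha>2 \<delta>1 \<delta>2 M)) \<longlonglongrightarrow> ?L * (D * coeff_series \<alpha>1 \<alpha>2 \<delta>1 \<delta>2)"
    using \<alpha> \<delta> by (intro tendsto_intros coeff_sum_tendsto_coeff_series) auto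
  ultimately show "?L * (D * coeff_series \<alpha>1 \<alpha>2 \<delta>1 \<delta>2) \<le> C * T"
    using LIMSEQ_le_const2 by blast
qed

end

theorem theorem10p2:
  fixes p \<alpha>1 \<alpha>2 \<beta>1 \<beta>2 :: real
  assumes "1 < p"
    and "0 < \<alpha>1" and "\<alpha>1 < \<beta>1"
    and "0 < \<alpha>2" and "\<alpha>2 < \<beta>2"
  shows "\<exists>C>0. \<forall>f \<in> M_class p. \<forall>\<delta>1 \<in> {0<..<1/2}. \<forall>\<delta>2 \<in> {0<..<1/2}.
    (let A = mixed_modulus p \<alpha>1 \<alpha>2 f \<delta>1 \<delta>2;
         B = \<delta>1 powr \<alpha>1 * \<delta>2 powr \<alpha>2 *
             (LBINT t1:{\<delta>1..1}. (LBINT t2:{\<delta>2..1}.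
                (t1 powr (- \<alpha>1) * t2 powr (- \<alpha>2) * mixed_modulus p \<beta>1 \<beta>2 f t1 t2) powr p / t2) / t1)
             powr (1 / p)
     in inverse C * B \<le> A \<and> A \<le> C * B)"
proof -
  note p = assms(1) and \<alpha> = assms(2-5)
  have p0: "0 < p" using p by simp
  have \<beta>: "0 < \<beta>1" "0 < \<beta>2" using \<alpha> by auto
  obtain C\<^sub>\<alpha> where C\<alpha>: "C\<^sub>\<alpha> > 0" and m\<alpha>:
    "\<And>f f0 a \<delta>1 \<delta>2. f \<in> M_class p \<Longrightarrow> cosine_class p f0 a \<Longrightarrow> AE z in lborel. f z = f0 z \<Longrightarrow>
      0 < \<delta>1 \<Longrightarrow> \<delta>1 \<le> 1 \<Longrightarrow> 0 < \<delta>2 \<Longrightarrow> \<delta>2 \<le> 1 \<Longrightarrow>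
      0 \<le> mixed_modulus p \<alpha>1 \<alpha>2 f \<delta>1 \<delta>2 \<and>
      mixed_modulus p \<alpha>1 \<alpha>2 f \<delta>1 \<delta>2 powr p \<le> C\<^sub>\<alpha> * cosine_class.coeff_series p a \<alpha>1 \<alpha>2 \<delta>1 \<delta>2 \<and>
      cosine_class.coeff_series p a \<alpha>1 \<alpha>2 \<delta>1 \<delta>2 \<le> C\<^sub>\<alpha> * mixed_modulus p \<alpha>1 \<alpha>2 f \<delta>1 \<delta>2 powr p"
    and "\<And>f f0 a \<delta>1 \<delta>2 \<delta>1' \<delta>2'. f \<in> M_class p \<Longrightarrow> cosine_class p f0 a \<Longrightarrow> AE z in lborel. f z = f0 z \<Longrightarrow>
      0 < \<delta>1 \<Longrightarrow> \<delta>1 \<le> \<delta>1' \<Longrightarrow> \<delta>1' \<le> 1 \<Longrightarrow> 0 < \<delta>2 \<Longrightarrow> \<delta>2 \<le> \<delta>2' \<Longrightarrow> \<delta>2' \<le> 1 \<Longrightarrow>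
      mixed_modulus p \<alpha>1 \<alpha>2 f \<delta>1 \<delta>2 \<le> mixed_modulus p \<alpha>1 \<alpha>2 f \<delta>1' \<delta>2'"
    by (rule mixed_modulus_equiv[OF p \<alpha>(1,3)]) (rule that, assumption, blast, blast)
  obtain C\<^sub>\<beta> where C\<beta>: "C\<^sub>\<beta> > 0" and m\<beta>:
    "\<And>f f0 a \<delta>1 \<delta>2. f \<in> M_class p \<Longrightarrow> cosine_class p f0 a \<Longrightarrow> AE z in lborel. f z = f0 z \<Longrightarrow>
      0 < \<delta>1 \<Longrightarrow> \<delta>1 \<le> 1 \<Longrightarrow> 0 < \<delta>2 \<Longrightarrow> \<delta>2 \<le> 1 \<Longrightarrow>
      0 \<le> mixed_modulus p \<beta>1 \<beta>2 f \<delta>1 \<delta>2 \<and>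
      mixed_modulus p \<beta>1 \<beta>2 f \<delta>1 \<delta>2 powr p \<le> C\<^sub>\<beta> * cosine_class.coeff_series p a \<beta>1 \<beta>2 \<delta>1 \<delta>2 \<and>
      cosine_class.coeff_series p a \<beta>1 \<beta>2 \<delta>1 \<delta>2 \<le> C\<^sub>\<beta> * mixed_modulus p \<beta>1 \<beta>2 f \<delta>1 \<delta>2 powr p"
    and mono: "\<And>f f0 a \<delta>1 \<delta>2 \<delta>1' \<delta>2'. f \<in> M_class p \<Longrightarrow> cosine_class p f0 a \<Longrightarrow> AE z in lborel. f z = f0 z \<Longrightarrow>
      0 < \<delta>1 \<Longrightarrow> \<delta>1 \<le> \<delta>1' \<Longrightarrow> \<delta>1' \<le> 1 \<Longrightarrow> 0 < \<delta>2 \<Longrightarrow> \<delta>2 \<le> \<delta>2' \<Longrightarrow> \<delta>2' \<le> 1 \<Longrightarrow>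
      mixed_modulus p \<beta>1 \<beta>2 f \<delta>1 \<delta>2 \<le> mixed_modulus p \<beta>1 \<beta>2 f \<delta>1' \<delta>2'"
    by (rule mixed_modulus_equiv[OF p \<beta>]) (rule that, assumption, blast, blast)
  define U where "U = (1 / (\<alpha>1 * p) + 1 / (\<beta>1 * p - \<alpha>1 * p)) * (1 / (\<alpha>2 * p) + 1 / (\<beta>2 * p - \<alpha>2 * p))"
  define L where "L = 2 powr (- (\<alpha>1 * p) - 1 - \<beta>1 * p) * 2 powr (- (\<alpha>2 * p) - 1 - \<beta>2 * p)"
  have L0: "0 < L" by (simp add: L_def)
  have U0: "0 < U" unfolding U_def using \<alpha> p0
    by (intro mult_pos_pos add_pos_pos) (auto simp: mult_strict_right_mono)
  \<comment> \<open>The first entry comes from bounding B powr p by A powr p, the second from the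
    reverse; the constant of the theorem is the p-th root.\<close>
  define K where "K = max (C\<^sub>\<beta> * U * C\<^sub>\<alpha>) (C\<^sub>\<alpha> * C\<^sub>\<beta> / L)"
  have K0: "0 < K" using C\<alpha> C\<beta> U0 by (simp add: K_def less_max_iff_disj)
  show ?thesis unfolding Let_def
  proof (intro exI[of _ "K powr (1 / p)"] conjI ballI)
    show "0 < K powr (1 / p)" using K0 by simp
  next
    fix f and \<delta>1 \<delta>2 :: real assume f: "f \<in> M_class p" and d: "\<delta>1 \<in> {0<..<1 / 2}" "\<delta>2 \<in> {0<..<1 / 2}"
    obtain f0 a where fa: "cosine_class p f0 a" "AE z in lborel. f z = f0 z"
      using M_class_cosine_class[OF p f] by blast
    interpret cosine_class p f0 a by fact
    have \<delta>: "0 < \<delta>1" "\<delta>1 \<le> 1 / 2" "0 < \<delta>2" "\<delta>2 \<le> 1 / 2" using d by auto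
    define \<omega> where "\<omega> = mixed_modulus p \<beta>1 \<beta>2 f"
    define A where "A = mixed_modulus p \<alpha>1 \<alpha>2 f \<delta>1 \<delta>2"
    \<comment> \<open>The reciprocal of the p-th power of the factor in front of the integral,
      whence B powr p = T / D.\<close>
    define D where "D = \<delta>1 powr (- (\<alpha>1 * p)) * \<delta>2 powr (- (\<alpha>2 * p))"
    define T where "T = (LBINT t1:{\<delta>1..1}. t1 powr (- (\<alpha>1 * p) - 1) * (LBINT t2:{\<delta>2..1}. t2 powr (- (\<alpha>2 * p) - 1) * \<omega> t1 t2 powr p))"
    define B where "B = \<delta>1 powr \<alpha>1 * \<delta>2 powr \<alpha>2 * T powr (1 / p)"
    have \<omega>0: "0 \<le> \<omega> t1 t2" if "t1 \<in> {\<delta>1..1}" "t2 \<in> {\<delta>2..1}" for t1 t2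
      using m\<beta>[OF f fa, of t1 t2] that \<delta> by (simp add: \<omega>_def)
    have D0: "0 < D" using \<delta> by (simp add: D_def)
    note W = weighted_integral_equiv[OF \<alpha> \<delta> C\<beta>, of "\<lambda>t1 t2. \<omega> t1 t2 powr p", folded D_def T_def U_def L_def]
    have W': "0 \<le> T" "T \<le> C\<^sub>\<beta> * (U * (D * coeff_series \<alpha>1 \<alpha>2 \<delta>1 \<delta>2))" "L * (D * coeff_series \<alpha>1 \<alpha>2 \<delta>1 \<delta>2) \<le> C\<^sub>\<beta> * T"
    proof -
      have 1: "0 \<le> \<omega> t1 t2 powr p \<and> \<omega> t1 t2 powr p \<le> C\<^sub>\<beta> * coeff_series \<beta>1 \<beta>2 t1 t2 \<and> coeff_series \<beta>1 \<beta>2 t1 t2 \<le> C\<^sub>\<beta> * \<omega> t1 t2 powr p"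
        if "t1 \<in> {\<delta>1..1}" "t2 \<in> {\<delta>2..1}" for t1 t2
        using m\<beta>[OF f fa, of t1 t2] that \<delta> by (simp add: \<omega>_def)
      have 2: "\<omega> s1 s2 powr p \<le> \<omega> t1 t2 powr p"
        if "\<delta>1 \<le> s1" "s1 \<le> t1" "t1 \<le> 1" "\<delta>2 \<le> s2" "s2 \<le> t2" "t2 \<le> 1" for s1 s2 t1 t2
        using mono[OF f fa, of s1 t1 s2 t2] \<omega>0[of s1 s2] that \<delta> p0 unfolding \<omega>_def by (intro powr_mono2) auto
      show "0 \<le> T" "T \<le> C\<^sub>\<beta> * (U * (D * coeff_series \<alpha>1 \<alpha>2 \<delta>1 \<delta>2))" "L * (D * coeff_series \<alpha>1 \<alpha>2 \<delta>1 \<delta>2) \<le> C\<^sub>\<beta> * T"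
        using W[OF 1 2] by blast+
    qed
    have A: "0 \<le> A" "A powr p \<le> C\<^sub>\<alpha> * coeff_series \<alpha>1 \<alpha>2 \<delta>1 \<delta>2" "coeff_series \<alpha>1 \<alpha>2 \<delta>1 \<delta>2 \<le> C\<^sub>\<alpha> * A powr p"
      using m\<alpha>[OF f fa, of \<delta>1 \<delta>2] \<delta> by (simp_all add: A_def)
    have B0: "0 \<le> B" by (simp add: B_def)
    have Bp: "B powr p = T / D"
    proof -
      have "B powr p = \<delta>1 powr (\<alpha>1 * p) * \<delta>2 powr (\<alpha>2 * p) * T"
        unfolding B_def using p0 W'(1) by (simp add: powr_mult powr_powr)
      then show ?thesis unfolding D_def by (simp add: powr_minus field_simps)
    qed
    have "B powr p \<le> C\<^sub>\<beta> * U * coeff_series \<alpha>1 \<alpha>2 \<delta>1 \<delta>2"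
      unfolding Bp using W'(2) D0 by (simp add: field_simps)
    also have "\<dots> \<le> C\<^sub>\<beta> * U * (C\<^sub>\<alpha> * A powr p)" using C\<beta> U0 by (intro mult_left_mono A(3)) auto
    also have "\<dots> \<le> K * A powr p" unfolding K_def mult.assoc[symmetric] by (intro mult_right_mono) auto
    finally have BA: "B powr p \<le> K * A powr p" .
    have "A powr p \<le> C\<^sub>\<alpha> * (C\<^sub>\<beta> / L * B powr p)"
    proof -
      have "coeff_series \<alpha>1 \<alpha>2 \<delta>1 \<delta>2 \<le> C\<^sub>\<beta> / L * B powr p" unfolding Bp using W'(3) D0 L0 by (simp add: field_simps)
      then show ?thesis using A(2) C\<alpha> by (meson mult_left_mono less_imp_le order_trans)
    qed
    also have "\<dots> = C\<^sub>\<alpha> * C\<^sub>\<beta> / L * B powr p" by simp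
    also have "\<dots> \<le> K * B powr p" unfolding K_def by (intro mult_right_mono) auto
    finally have AB: "A powr p \<le> K * B powr p" .
    have root: "x \<le> K powr (1 / p) * y" if "0 \<le> x" "0 \<le> y" "x powr p \<le> K * y powr p" for x y
    proof -
      have "x = (x powr p) powr (1 / p)" using that p0 by (simp add: powr_powr)
      also have "\<dots> \<le> (K * y powr p) powr (1 / p)" using that p0 by (intro powr_mono2) auto
      also have "\<dots> = K powr (1 / p) * y" using that p0 K0 by (simp add: powr_mult powr_powr)
      finally show ?thesis .
    qed
    \<comment> \<open>Taking the p-th power of the integrand and absorbing dt / t changes t powr (-
      \<alpha>) into t powr (- (\<alpha> * p) - 1); the factor in t1 leaves the inner
      integral.\<close>
    have inner: "(LBINT t2:{\<delta>2..1}. (t1 powr (- \<alpha>1) * t2 powr (- \<alpha>2) * \<omega> t1 t2) powr p / t2) / t1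
      = t1 powr (- (\<alpha>1 * p) - 1) * (LBINT t2:{\<delta>2..1}. t2 powr (- (\<alpha>2 * p) - 1) * \<omega> t1 t2 powr p)"
      if t1: "t1 \<in> {\<delta>1..1}" for t1
    proof -
      have e: "x powr (- (c * p) - 1) = x powr (- (c * p)) / x" if "0 < x" for x c :: real
        using that by (simp add: powr_diff)
      have "(LBINT t2:{\<delta>2..1}. (t1 powr (- \<alpha>1) * t2 powr (- \<alpha>2) * \<omega> t1 t2) powr p / t2)
        = (LBINT t2:{\<delta>2..1}. t1 powr (- (\<alpha>1 * p)) * (t2 powr (- (\<alpha>2 * p) - 1) * \<omega> t1 t2 powr p))"
      proof (intro set_lebesgue_integral_cong ballI allI impI)
        fix t2 assume t2: "t2 \<in> {\<delta>2..1}"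
        show "(t1 powr (- \<alpha>1) * t2 powr (- \<alpha>2) * \<omega> t1 t2) powr p / t2
          = t1 powr (- (\<alpha>1 * p)) * (t2 powr (- (\<alpha>2 * p) - 1) * \<omega> t1 t2 powr p)"
          using t1 t2 \<delta> \<omega>0[OF t1 t2] by (simp add: e powr_mult powr_powr)
      qed simp
      then show ?thesis using t1 \<delta> by (simp add: e)
    qed
    have T: "(LBINT t1:{\<delta>1..1}. (LBINT t2:{\<delta>2..1}. (t1 powr (- \<alpha>1) * t2 powr (- \<alpha>2) * \<omega> t1 t2) powr p / t2) / t1) = T"
      unfolding T_def by (intro set_lebesgue_integral_cong ballI allI impI inner) auto
    have "inverse (K powr (1 / p)) * B \<le> A"
      using root[OF B0 A(1) BA] K0 by (simp add: field_simps)
    moreover have "A \<le> K powr (1 / p) * B" by (rule root[OF A(1) B0 AB])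
    ultimately show "inverse (K powr (1 / p)) * (\<delta>1 powr \<alpha>1 * \<delta>2 powr \<alpha>2 *
        (LBINT t1:{\<delta>1..1}. (LBINT t2:{\<delta>2..1}. (t1 powr (- \<alpha>1) * t2 powr (- \<alpha>2) * mixed_modulus p \<beta>1 \<beta>2 f t1 t2) powr p / t2) / t1) powr (1 / p))
        \<le> mixed_modulus p \<alpha>1 \<alpha>2 f \<delta>1 \<delta>2"
      "mixed_modulus p \<alpha>1 \<alpha>2 f \<delta>1 \<delta>2 \<le> K powr (1 / p) * (\<delta>1 powr \<alpha>1 * \<delta>2 powr \<alpha>2 *
        (LBINT t1:{\<delta>1..1}. (LBINT t2:{\<delta>2..1}. (t1 powr (- \<alpha>1) * t2 powr (- \<alpha>2) * mixed_modulus p \<beta>1 \<beta>2 f t1 t2) powr p / t2) / t1) powr (1 / p))"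
      unfolding A_def \<omega>_def[symmetric] T B_def by auto
  qed
qed

end
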